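(* Let $1\leq q_1,q_2\leq \infty$ and $0<r<\infty$ with $\frac{1}r =\frac 1 {q_1}+\frac 1 {q_2}$. Suppose that $a\in S^{m}_{\varrho,\delta}(n,2)$ with $0<\varrho,\delta\leq 1$, $\delta<1$, and \[ m<n(\varrho-1)\left[\max\left(\left|\frac{1}{2}-\frac{1}{q_1}\right|,\left|\frac{1}{2}-\frac{1}{q_2}\right|\right)+\frac{1}{\min(2,q_1,q_2)}\right]+\frac{n\min(\varrho-\delta,0)}{2}. \] Then the bilinear pseudodifferential operator $T_{a} (f,g)(x)= \iint a(x,\xi,\eta)\, e^{ i \langle x,\xi+\eta\rangle} \widehat{ f}(\xi) \widehat{g}(\eta)\,d \xi\, d\eta$ satisfies $\|T_a(f,g)\|_{L^r}\lesssim \|f\|_{L^{q_1}}\|g\|_{L^{q_2}}$ for $f,g\in\mathcal{S}$.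
   Context: $S^m_{\varrho,\delta}(n,2)$: functions $a\in C^\infty(\mathbb{R}^n\times\mathbb{R}^{2n})$ with $|\partial_x^\beta\partial_{\xi}^{\alpha_1}\partial_{\eta}^{\alpha_2}a(x,\xi,\eta)|\le C_{\alpha_1,\alpha_2,\beta}(1+|\xi|+|\eta|)^{m-\varrho(|\alpha_1|+|\alpha_2|)+\delta|\beta|}$ for all multi-indices. *)

theory Defs
  imports "HOL-Analysis.Analysis" "HOL-Probability.Essential_Supremum"
begin

type_synonym 'n triple = "(real^'n) \<times> (real^'n) \<times> (real^'n)"

definition ddir :: "'v::real_normed_vector \<Rightarrow> ('v \<Rightarrow> complex) \<Rightarrow> 'v \<Rightarrow> complex" where
  "ddir v F x = vector_derivative (\<lambda>t::real. F (x + t *\<^sub>R v)) (at 0)"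

fun ddirs :: "'v::real_normed_vector list \<Rightarrow> ('v \<Rightarrow> complex) \<Rightarrow> 'v \<Rightarrow> complex" where
  "ddirs [] F = F"
| "ddirs (v # vs) F = ddir v (ddirs vs F)"

definition smooth_on_dirs :: "'v::real_normed_vector set \<Rightarrow> ('v \<Rightarrow> complex) \<Rightarrow> bool" where
  "smooth_on_dirs B F \<longleftrightarrow>
     (\<forall>vs. set vs \<subseteq> B \<longrightarrow> continuous_on UNIV (ddirs vs F) \<and>
        (\<forall>v\<in>B. \<forall>x. (\<lambda>t::real. ddirs vs F (x + t *\<^sub>R v)) differentiable (at 0)))"

definition coord_dirs :: "(real^'n::finite) set" where
  "coord_dirs = {axis i 1 | i. True}"

definition x_dirs :: "'n::finite triple set" where
  "x_dirs = {(axis i 1, 0, 0) | i. True}"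
definition xi_dirs :: "'n::finite triple set" where
  "xi_dirs = {(0, axis i 1, 0) | i. True}"
definition eta_dirs :: "'n::finite triple set" where
  "eta_dirs = {(0, 0, axis i 1) | i. True}"

text \<open>The bilinear symbol class S^m_{rho,delta}(n,2).  A list of derivative directions
  encodes a multi-index; |beta| = number of x-directions, |alpha_1|+|alpha_2| = number of
  xi- and eta-directions.\<close>
definition bisymbol :: "real \<Rightarrow> real \<Rightarrow> real \<Rightarrow> ('n::finite triple \<Rightarrow> complex) \<Rightarrow> bool" where
  "bisymbol m \<rho> \<delta> a \<longleftrightarrow>
     smooth_on_dirs (x_dirs \<union> xi_dirs \<union> eta_dirs) a \<and>
     (\<forall>vs. set vs \<subseteq> x_dirs \<union> xi_dirs \<union> eta_dirs \<longrightarrow>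
        (\<exists>C. \<forall>x \<xi> \<eta>. norm (ddirs vs a (x, \<xi>, \<eta>)) \<le>
           C * (1 + norm \<xi> + norm \<eta>) powr
             (m - \<rho> * real (length (filter (\<lambda>v. v \<in> xi_dirs \<union> eta_dirs) vs))
                + \<delta> * real (length (filter (\<lambda>v. v \<in> x_dirs) vs)))))"

definition schwartz :: "(real^'n::finite \<Rightarrow> complex) \<Rightarrow> bool" where
  "schwartz f \<longleftrightarrow> smooth_on_dirs coord_dirs f \<and>
     (\<forall>vs N. set vs \<subseteq> coord_dirs \<longrightarrow>
        (\<exists>C. \<forall>x. (1 + norm x) ^ N * norm (ddirs vs f x) \<le> C))"

text \<open>Fourier transform (normalisation constants are irrelevant for the bound).\<close>
definition fourier :: "(real^'n::finite \<Rightarrow> complex) \<Rightarrow> real^'n \<Rightarrow> complex" where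
  "fourier f \<xi> = (LINT x|lborel. f x * cis (- (x \<bullet> \<xi>)))"

definition bipsido :: "('n::finite triple \<Rightarrow> complex) \<Rightarrow> (real^'n \<Rightarrow> complex) \<Rightarrow> (real^'n \<Rightarrow> complex)
    \<Rightarrow> real^'n \<Rightarrow> complex" where
  "bipsido a f g x = (LINT \<xi>|lborel. LINT \<eta>|lborel.
      a (x, \<xi>, \<eta>) * cis (x \<bullet> (\<xi> + \<eta>)) * fourier f \<xi> * fourier g \<eta>)"

definition Lnorm :: "ereal \<Rightarrow> (real^'n::finite \<Rightarrow> complex) \<Rightarrow> ennreal" where
  "Lnorm p f =
     (if p = \<infinity> then esssup lborel (\<lambda>x. ennreal (norm (f x)))
      else (let I = (\<integral>\<^sup>+ x. ennreal (norm (f x) powr real_of_ereal p) \<partial>lborel)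
            in if I = \<infinity> then \<infinity> else ennreal (enn2real I powr (1 / real_of_ereal p))))"

definition recip :: "ereal \<Rightarrow> real" where
  "recip q = (if q = \<infinity> then 0 else 1 / real_of_ereal q)"

end

theory Submission
  imports Defs "HOL-Probability.Characteristic_Functions" "HOL-Probability.Sinc_Integral"
begin

text \<open>
  The frequency variables are cut dyadically, \<open>a = \<Sum>\<^sub>j a\<^sub>j\<close> with \<open>a\<^sub>j\<close> supported where
  \<open>|\<xi>| + |\<eta>|\<close> is of order \<open>2\<^sup>j\<close>. After dilation by \<open>2\<close> to the power \<open>-j\<rho>\<close> the frequency derivatives of
  \<open>a\<^sub>j\<close> cost nothing, every \<open>x\<close>-derivative costs a factor \<open>L\<close> with exponent \<open>j max(\<delta> - \<rho>, 0)\<close>, and the frequency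
  support is a box whose side \<open>N\<close> has exponent \<open>j(1 - \<rho>)\<close>. Integration by parts in \<open>\<xi>\<close> and \<open>\<eta>\<close> then makes the
  operator almost local with respect to the unit cells of \<open>\<real>\<^sup>n\<close>. On one cell, freezing the \<open>x\<close>-dependence of
  the amplitude one coordinate at a time by Sobolev inequalities loses the factor \<open>L\<close> to the power \<open>n/2\<close>, and Plancherel's
  inequality bounds the result by frequency-localised \<open>L\<^sup>2\<close> sizes of \<open>f\<close> and \<open>g\<close>; passing from these to
  \<open>L\<^sup>q\<close> norms costs powers of \<open>N\<close>. Hoelder's and Young's inequalities sum the cells. Undoing the dilation, which the
  relation \<open>1/r = 1/q\<^sub>1 + 1/q\<^sub>2\<close> makes neutral, the \<open>j\<close>-th piece has norm of order \<open>2\<close> to the power \<open>je\<close>, and the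
  hypothesis on \<open>m\<close> gives \<open>e < 0\<close>, so the pieces are summable.
\<close>

section \<open>Directional derivatives\<close>

text \<open>Two obstacles shape the proof. Since r may be below 1, L^r has no triangle inequality;
  sums over cells and over dyadic pieces alike are therefore taken with weights that have summable
  reciprocals, and the decay of the terms has to pay for these weights. Moreover, smoothness is
  given only through iterated derivatives along coordinate directions, so derivatives are kept as
  ordered lists and never commuted.

  The exponents arise as follows. With N the side of the frequency box, one cell costs N^(n max(1/2,
  1 - 1/r)): the 1/2 comes from Cauchy-Schwarz on the box, the other value from interpolating with a
  sup bound. Each of f and g costs N^(n max(0, 1/q - 1/2)) with its own q, for passing from L^2
  sizes to L^q sizes. The sum of the three exponents is at most n times the bracket in the
  hypothesis on m, and L^(n/2) produces the term with min(\<rho> - \<delta>, 0).\<close>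

lemma has_vector_derivative_ddir:
  assumes "(\<lambda>t::real. F (x + t *\<^sub>R v)) differentiable (at 0)"
  shows "((\<lambda>t. F (x + t *\<^sub>R v)) has_vector_derivative ddir v F x) (at 0)"
  using assms by (simp add: ddir_def vector_derivative_works)

lemma ddir_eqI:
  assumes "((\<lambda>t. F (x + t *\<^sub>R v)) has_vector_derivative d) (at 0)"
  shows "ddir v F x = d"
  using assms by (simp add: ddir_def vector_derivative_at)

text \<open>\<open>ddir\<close> only records derivatives at time 0. As differentiability is assumed
  at every base point, shifting the parameter by \<open>s\<close> gives the derivative along the
  whole line, as mean value arguments need.\<close>

lemma has_vector_derivative_ddir_at:
  assumes "\<And>x. (\<lambda>t::real. F (x + t *\<^sub>R v)) differentiable (at 0)"
  shows "((\<lambda>t. F (x + t *\<^sub>R v)) has_vector_derivative ddir v F (x + s *\<^sub>R v)) (at s)"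
proof -
  have "((\<lambda>t. F ((x + s *\<^sub>R v) + t *\<^sub>R v)) has_vector_derivative ddir v F (x + s *\<^sub>R v)) (at 0)"
    by (rule has_vector_derivative_ddir) (rule assms)
  then have "((\<lambda>t. F ((x + s *\<^sub>R v) + t *\<^sub>R v)) \<circ> (\<lambda>t. t - s) has_vector_derivative 1 *\<^sub>R ddir v F (x + s *\<^sub>R v)) (at s)"
    by (intro vector_diff_chain_at) (auto intro!: derivative_eq_intros)
  moreover have "(\<lambda>t. F ((x + s *\<^sub>R v) + t *\<^sub>R v)) \<circ> (\<lambda>t. t - s) = (\<lambda>t. F (x + t *\<^sub>R v))"
    by (simp add: fun_eq_iff scaleR_left_diff_distrib)
  ultimately show ?thesis by simp
qed

text \<open>The last entry of the list acts first. Peeling it off leaves a shorter list acting on a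
  new function, which suits statements quantified over a whole class of functions.\<close>

lemma ddirs_snoc: "ddirs (vs @ [v]) F = ddirs vs (ddir v F)"
  by (induction vs) auto

lemma ddirs_append: "ddirs (us @ vs) F = ddirs us (ddirs vs F)"
  by (induction us) auto

lemma smooth_on_dirs_continuous: "smooth_on_dirs B F \<Longrightarrow> continuous_on UNIV F"
  unfolding smooth_on_dirs_def by (metis ddirs.simps(1) empty_subsetI list.set(1))

lemma smooth_on_dirs_differentiable:
  "smooth_on_dirs B F \<Longrightarrow> v \<in> B \<Longrightarrow> (\<lambda>t::real. F (x + t *\<^sub>R v)) differentiable (at 0)"
  unfolding smooth_on_dirs_def by (metis ddirs.simps(1) empty_subsetI list.set(1))

lemma smooth_on_dirs_ddirs:
  "smooth_on_dirs B F \<Longrightarrow> set us \<subseteq> B \<Longrightarrow> smooth_on_dirs B (ddirs us F)"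
  unfolding smooth_on_dirs_def by (auto simp flip: ddirs_append)

lemma smooth_on_dirs_ddir:
  "smooth_on_dirs B F \<Longrightarrow> v \<in> B \<Longrightarrow> smooth_on_dirs B (ddir v F)"
  using smooth_on_dirs_ddirs[of B F "[v]"] by simp

text \<open>Smoothness is a greatest fixed point: closure properties can be proved by exhibiting a
  class stable under one derivative.\<close>

lemma smooth_on_dirs_coinduct:
  assumes "P F"
    and *: "\<And>F. P F \<Longrightarrow> continuous_on UNIV F \<and>
      (\<forall>v\<in>B. (\<forall>x. (\<lambda>t::real. F (x + t *\<^sub>R v)) differentiable (at 0)) \<and> P (ddir v F))"
  shows "smooth_on_dirs B F"
proof -
  have "P (ddirs vs F)" if "set vs \<subseteq> B" for vs
    using that by (induction vs) (use assms in auto)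
  then show ?thesis unfolding smooth_on_dirs_def using * by blast
qed

lemma ddir_add:
  assumes "(\<lambda>t::real. F (x + t *\<^sub>R v)) differentiable (at 0)" "(\<lambda>t::real. G (x + t *\<^sub>R v)) differentiable (at 0)"
  shows "ddir v (\<lambda>z. F z + G z) x = ddir v F x + ddir v G x"
  by (rule ddir_eqI) (intro has_vector_derivative_add has_vector_derivative_ddir assms)

lemma ddir_mult:
  assumes "(\<lambda>t::real. F (x + t *\<^sub>R v)) differentiable (at 0)" "(\<lambda>t::real. G (x + t *\<^sub>R v)) differentiable (at 0)"
  shows "ddir v (\<lambda>z. F z * G z) x = F x * ddir v G x + ddir v F x * G x"
  by (rule ddir_eqI)
    (use has_vector_derivative_mult[OF has_vector_derivative_ddir[OF assms(1)] has_vector_derivative_ddir[OF assms(2)]] in simp)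

text \<open>Closing under sums and products makes the Leibniz rule a one-step coinduction.\<close>

inductive dalg :: "'v::real_normed_vector set \<Rightarrow> ('v \<Rightarrow> complex) \<Rightarrow> bool" for B where
  base: "smooth_on_dirs B F \<Longrightarrow> dalg B F"
| add: "dalg B F \<Longrightarrow> dalg B G \<Longrightarrow> dalg B (\<lambda>z. F z + G z)"
| mult: "dalg B F \<Longrightarrow> dalg B G \<Longrightarrow> dalg B (\<lambda>z. F z * G z)"

lemma dalg_smooth: "dalg B F \<Longrightarrow> smooth_on_dirs B F"
proof (erule smooth_on_dirs_coinduct)
  fix F assume "dalg B F"
  then show "continuous_on UNIV F \<and>
      (\<forall>v\<in>B. (\<forall>x. (\<lambda>t::real. F (x + t *\<^sub>R v)) differentiable (at 0)) \<and> dalg B (ddir v F))"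
  proof induction
    case (base F)
    then show ?case
      by (auto intro: smooth_on_dirs_continuous smooth_on_dirs_differentiable smooth_on_dirs_ddir dalg.base)
  next
    case (add F G)
    have eq: "ddir v (\<lambda>z. F z + G z) = (\<lambda>z. ddir v F z + ddir v G z)" if "v \<in> B" for v
      using add.IH that by (intro ext ddir_add) blast+
    have "continuous_on UNIV (\<lambda>z. F z + G z)"
      using add.IH by (intro continuous_on_add) blast+
    moreover have "(\<lambda>t::real. F (x + t *\<^sub>R v) + G (x + t *\<^sub>R v)) differentiable (at 0)" if "v \<in> B" for v x
      using add.IH that by (intro differentiable_add) blast+
    moreover have "dalg B (ddir v (\<lambda>z. F z + G z))" if "v \<in> B" for v
      unfolding eq[OF that] using add.IH that by (intro dalg.add) blast+
    ultimately show ?case by blast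
  next
    case (mult F G)
    have eq: "ddir v (\<lambda>z. F z * G z) = (\<lambda>z. F z * ddir v G z + ddir v F z * G z)" if "v \<in> B" for v
      using mult.IH that by (intro ext ddir_mult) blast+
    have "continuous_on UNIV (\<lambda>z. F z * G z)"
      using mult.IH by (intro continuous_on_mult) blast+
    moreover have "(\<lambda>t::real. F (x + t *\<^sub>R v) * G (x + t *\<^sub>R v)) differentiable (at 0)" if "v \<in> B" for v x
      using mult.IH that by (intro differentiable_mult) blast+
    moreover have "dalg B (ddir v (\<lambda>z. F z * G z))" if "v \<in> B" for v
      unfolding eq[OF that] using mult.IH mult.hyps that by (intro dalg.add dalg.mult) blast+
    ultimately show ?case by blast
  qed
qed

lemma smooth_on_dirs_add:
  "smooth_on_dirs B F \<Longrightarrow> smooth_on_dirs B G \<Longrightarrow> smooth_on_dirs B (\<lambda>z. F z + G z)"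
  by (rule dalg_smooth[OF dalg.add[OF dalg.base dalg.base]])

lemma smooth_on_dirs_mult:
  "smooth_on_dirs B F \<Longrightarrow> smooth_on_dirs B G \<Longrightarrow> smooth_on_dirs B (\<lambda>z. F z * G z)"
  by (rule dalg_smooth[OF dalg.mult[OF dalg.base dalg.base]])

lemma ddir_const [simp]: "ddir v (\<lambda>z. c) = (\<lambda>z. 0)"
  by (auto intro!: ddir_eqI)

lemma smooth_on_dirs_const: "smooth_on_dirs B (\<lambda>z. c)"
  by (rule smooth_on_dirs_coinduct[where P="\<lambda>F. \<exists>c. F = (\<lambda>z. c)"]) auto

lemma ddirs_add:
  assumes "smooth_on_dirs B F" "smooth_on_dirs B G" "set vs \<subseteq> B"
  shows "ddirs vs (\<lambda>z. F z + G z) = (\<lambda>z. ddirs vs F z + ddirs vs G z)"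
  using assms(3)
proof (induction vs)
  case (Cons v vs)
  then have "ddirs (v # vs) (\<lambda>z. F z + G z) = ddir v (\<lambda>z. ddirs vs F z + ddirs vs G z)" by simp
  also have "\<dots> = (\<lambda>z. ddir v (ddirs vs F) z + ddir v (ddirs vs G) z)"
    using Cons.prems assms(1,2)
    by (intro ext ddir_add smooth_on_dirs_differentiable[of B] smooth_on_dirs_ddirs) auto
  finally show ?case by simp
qed simp

text \<open>Near time 0 the line through \<open>z\<close> stays in \<open>U\<close>. This carries
  support information from a symbol to its derivatives.\<close>

lemma ddirs_zero_on_open:
  assumes "open U" "\<And>z. z \<in> U \<Longrightarrow> F z = 0" "z \<in> U"
  shows "ddirs vs F z = 0"
  using assms(3)
proof (induction vs arbitrary: z)
  case (Cons v vs)
  have "open ((\<lambda>t::real. z + t *\<^sub>R v) -` U)"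
    by (intro continuous_open_vimage assms(1) continuous_intros)
  then have "((\<lambda>t. ddirs vs F (z + t *\<^sub>R v)) has_vector_derivative 0) (at 0)"
    by (rule has_vector_derivative_transform_within_open[OF has_vector_derivative_const])
      (use Cons in auto)
  then show ?case by (simp add: ddir_eqI)
qed (use assms in auto)

text \<open>Chain rule for a linear map that has every direction of \<open>B\<close> as an
  eigenvector, so that composition never leaves the derivatives along \<open>B\<close>. Dilations of
  the coordinates are of this kind.\<close>

lemma ddirs_linear_scale:
  assumes F: "smooth_on_dirs B F" and L: "linear L" and k: "\<And>v. v \<in> B \<Longrightarrow> L v = k v *\<^sub>R v"
    and vs: "set vs \<subseteq> B"
  shows "ddirs vs (\<lambda>z. F (L z)) = (\<lambda>z. of_real (prod_list (map k vs)) * ddirs vs F (L z))"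
  using vs
proof (induction vs)
  case (Cons v vs)
  show ?case
  proof
    fix z
    have v: "v \<in> B" and vs: "set vs \<subseteq> B" using Cons.prems by auto
    have "((\<lambda>t. ddirs vs F (L z + t *\<^sub>R v)) has_vector_derivative ddir v (ddirs vs F) (L z)) (at (k v * 0))"
      using has_vector_derivative_ddir[OF smooth_on_dirs_differentiable[OF smooth_on_dirs_ddirs[OF F vs] v]] by simp
    then have "((\<lambda>t. ddirs vs F (L z + t *\<^sub>R v)) \<circ> (\<lambda>t. k v * t) has_vector_derivative k v *\<^sub>R ddir v (ddirs vs F) (L z)) (at 0)"
      by (intro vector_diff_chain_at) (auto intro!: derivative_eq_intros)
    then have "((\<lambda>t. of_real (prod_list (map k vs)) * ddirs vs F (L (z + t *\<^sub>R v)))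
        has_vector_derivative of_real (prod_list (map k vs)) * (k v *\<^sub>R ddir v (ddirs vs F) (L z))) (at 0)"
      by (intro derivative_intros)
        (simp add: o_def linear_add[OF L] linear_scale[OF L] k[OF v] mult.commute)
    then have "ddir v (\<lambda>z. of_real (prod_list (map k vs)) * ddirs vs F (L z)) z =
        of_real (prod_list (map k vs)) * (k v *\<^sub>R ddir v (ddirs vs F) (L z))"
      by (rule ddir_eqI)
    then show "ddirs (v # vs) (\<lambda>z. F (L z)) z = of_real (prod_list (map k (v # vs))) * ddirs (v # vs) F (L z)"
      using Cons.IH[OF vs] by (simp add: scaleR_conv_of_real mult_ac)
  qed
qed simp

lemma smooth_on_dirs_linear_scale:
  assumes F: "smooth_on_dirs B F" and L: "bounded_linear L" and k: "\<And>v. v \<in> B \<Longrightarrow> L v = k v *\<^sub>R v"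
  shows "smooth_on_dirs B (\<lambda>z. F (L z))"
  unfolding smooth_on_dirs_def
proof (intro allI impI conjI ballI)
  fix vs v z assume vs: "set vs \<subseteq> B"
  have eq: "ddirs vs (\<lambda>z. F (L z)) = (\<lambda>z. of_real (prod_list (map k vs)) * ddirs vs F (L z))"
    by (rule ddirs_linear_scale[OF F bounded_linear.linear[OF L] k vs])
  show "continuous_on UNIV (ddirs vs (\<lambda>z. F (L z)))" unfolding eq
    by (intro continuous_intros continuous_on_compose2[OF smooth_on_dirs_continuous[OF smooth_on_dirs_ddirs[OF F vs]]]
        linear_continuous_on L) auto
  assume v: "v \<in> B"
  have "(\<lambda>t. ddirs vs F (L z + t *\<^sub>R v)) differentiable (at (k v * 0))"
    using smooth_on_dirs_differentiable[OF smooth_on_dirs_ddirs[OF F vs] v] by simp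
  then have "((\<lambda>t. ddirs vs F (L z + t *\<^sub>R v)) \<circ> (\<lambda>t. k v * t)) differentiable (at 0)"
    by (intro differentiable_chain_at) auto
  then have "(\<lambda>t. ddirs vs F (L (z + t *\<^sub>R v))) differentiable (at 0)"
    by (simp add: o_def linear_add[OF bounded_linear.linear[OF L]] linear_scale[OF bounded_linear.linear[OF L]] k[OF v] mult.commute)
  then show "(\<lambda>t. ddirs vs (\<lambda>z. F (L z)) (z + t *\<^sub>R v)) differentiable (at 0)"
    unfolding eq by (intro derivative_intros)
qed

text \<open>A weighted symbol class, uniform in the index \<open>i\<close>: \<open>U\<close>
  measures the size and each derivative along \<open>v\<close> costs \<open>w v i z\<close>. The
  constant may depend on the list but not on \<open>i\<close> or \<open>z\<close>; later
  \<open>i\<close> is the dyadic index.\<close>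

definition dbd :: "'v::real_normed_vector set \<Rightarrow> ('v \<Rightarrow> 'i \<Rightarrow> 'v \<Rightarrow> real) \<Rightarrow> ('i \<Rightarrow> 'v \<Rightarrow> real)
    \<Rightarrow> ('i \<Rightarrow> 'v \<Rightarrow> complex) \<Rightarrow> bool" where
  "dbd B w U F \<longleftrightarrow> (\<forall>i. smooth_on_dirs B (F i)) \<and>
     (\<forall>vs. set vs \<subseteq> B \<longrightarrow> (\<exists>C. \<forall>i z. norm (ddirs vs (F i) z) \<le> C * (U i z * prod_list (map (\<lambda>v. w v i z) vs))))"

lemma dbd_ddir:
  assumes "dbd B w U F" "v \<in> B"
  shows "dbd B w (\<lambda>i z. U i z * w v i z) (\<lambda>i. ddir v (F i))"
  unfolding dbd_def
proof (intro allI impI conjI)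
  fix i show "smooth_on_dirs B (ddir v (F i))"
    using assms by (auto simp: dbd_def intro: smooth_on_dirs_ddir)
next
  fix vs assume "set vs \<subseteq> B"
  then have "set (vs @ [v]) \<subseteq> B" using assms by auto
  then obtain C where "\<forall>i z. norm (ddirs (vs @ [v]) (F i) z) \<le> C * (U i z * prod_list (map (\<lambda>v. w v i z) (vs @ [v])))"
    using assms(1) unfolding dbd_def by blast
  then show "\<exists>C. \<forall>i z. norm (ddirs vs (ddir v (F i)) z) \<le> C * (U i z * w v i z * prod_list (map (\<lambda>v. w v i z) vs))"
    by (intro exI[of _ C]) (simp add: ddirs_snoc mult_ac)
qed

text \<open>Leibniz rule for the weighted classes. The induction peels off the innermost derivative
  and must range over all sizes \<open>U\<close> and \<open>V\<close>, because in each of the two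
  resulting products one factor is a derivative whose size has gained a weight.\<close>

lemma dbd_mult:
  assumes "dbd B w U F" "dbd B w V G"
  shows "dbd B w (\<lambda>i z. U i z * V i z) (\<lambda>i z. F i z * G i z)"
proof -
  have sm: "smooth_on_dirs B (\<lambda>z. F i z * G i z)" if "dbd B w U F" "dbd B w V G" for F G U V i
    using that by (auto simp: dbd_def intro: smooth_on_dirs_mult)
  have "\<exists>C. \<forall>i z. norm (ddirs vs (\<lambda>z. F i z * G i z) z) \<le> C * (U i z * V i z * prod_list (map (\<lambda>v. w v i z) vs))"
    if "set vs \<subseteq> B" "dbd B w U F" "dbd B w V G" for vs F G U V
    using that
  proof (induction "length vs" arbitrary: vs F G U V)
    case 0
    obtain C where C: "\<forall>i z. norm (F i z) \<le> C * U i z"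
      using 0(3) unfolding dbd_def by (auto dest!: spec[of _ "[]"])
    obtain D where D: "\<forall>i z. norm (G i z) \<le> D * V i z"
      using 0(4) unfolding dbd_def by (auto dest!: spec[of _ "[]"])
    \<comment> \<open>No sign is assumed of \<open>U\<close> and \<open>V\<close>; that
      \<open>C * U i z\<close> is nonnegative follows from the norm below it.\<close>
    have "norm (F i z) * norm (G i z) \<le> (C * U i z) * (D * V i z)" for i z
      using C D by (intro mult_mono) (auto intro: order_trans[OF norm_ge_zero])
    then show ?case using 0 by (intro exI[of _ "C * D"]) (simp add: norm_mult mult_ac)
  next
    case (Suc n)
    then obtain us v where vs: "vs = us @ [v]" by (metis list.size(3) nat.distinct(1) rev_exhaust)
    have v: "v \<in> B" and us: "set us \<subseteq> B" "n = length us" using Suc.prems Suc.hyps vs by auto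
    have eq: "ddir v (\<lambda>z. F i z * G i z) = (\<lambda>z. F i z * ddir v (G i) z + ddir v (F i) z * G i z)" for i
      using Suc.prems v by (intro ext ddir_mult) (auto simp: dbd_def intro: smooth_on_dirs_differentiable)
    have d1: "dbd B w (\<lambda>i z. U i z * w v i z) (\<lambda>i. ddir v (F i))" 
      and d2: "dbd B w (\<lambda>i z. V i z * w v i z) (\<lambda>i. ddir v (G i))"
      using Suc.prems v by (auto intro: dbd_ddir)
    obtain C where C: "\<forall>i z. norm (ddirs us (\<lambda>z. F i z * ddir v (G i) z) z) \<le> C * (U i z * (V i z * w v i z) * prod_list (map (\<lambda>v. w v i z) us))"
      using Suc.hyps(1)[OF us(2) us(1) Suc.prems(2) d2] by blast
    obtain D where D: "\<forall>i z. norm (ddirs us (\<lambda>z. ddir v (F i) z * G i z) z) \<le> D * (U i z * w v i z * V i z * prod_list (map (\<lambda>v. w v i z) us))"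
      using Suc.hyps(1)[OF us(2) us(1) d1 Suc.prems(3)] by blast
    show ?case
    proof (intro exI[of _ "C + D"] allI)
      fix i z
      have "ddirs vs (\<lambda>z. F i z * G i z) z =
          ddirs us (\<lambda>z. F i z * ddir v (G i) z) z + ddirs us (\<lambda>z. ddir v (F i) z * G i z) z"
        unfolding vs ddirs_snoc eq
        by (subst ddirs_add[where B=B]) (use sm[OF Suc.prems(2) d2] sm[OF d1 Suc.prems(3)] us in auto)
      then have "norm (ddirs vs (\<lambda>z. F i z * G i z) z) \<le>
        C * (U i z * (V i z * w v i z) * prod_list (map (\<lambda>v. w v i z) us)) + D * (U i z * w v i z * V i z * prod_list (map (\<lambda>v. w v i z) us))"
        using norm_triangle_mono[OF C[rule_format] D[rule_format], of i z i z] by simp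
      then show "norm (ddirs vs (\<lambda>z. F i z * G i z) z) \<le> (C + D) * (U i z * V i z * prod_list (map (\<lambda>v. w v i z) vs))"
        by (simp add: vs algebra_simps)
    qed
  qed
  with assms sm show ?thesis by (auto simp: dbd_def)
qed

section \<open>Lebesgue integration on Euclidean space\<close>

lemma prod_Basis_vec: "(\<Prod>b\<in>(Basis :: (real^'n::finite) set). F b) = (\<Prod>i\<in>UNIV. F (axis i 1))"
proof -
  have "(Basis :: (real^'n) set) = range (\<lambda>i. axis i 1)" by (auto simp: Basis_vec_def)
  moreover have "inj (\<lambda>i::'n. axis i (1::real))" by (auto simp: inj_on_def axis_eq_axis)
  ultimately show ?thesis by (metis (no_types, lifting) prod.reindex_cong)
qed

lemma nn_integral_prod_vec:
  assumes "\<And>i. f i \<in> borel_measurable borel"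
  shows "(\<integral>\<^sup>+x. (\<Prod>i\<in>UNIV. f i (x $ i)) \<partial>(lborel :: (real^'n::finite) measure)) = (\<Prod>i\<in>UNIV. (\<integral>\<^sup>+t. f i t \<partial>lborel))"
proof -
  \<comment> \<open>The product measure is indexed by basis vectors, the statement by coordinates;
    \<open>THE\<close> inverts the injective map from \<open>i\<close> to
    \<open>axis i 1\<close>.\<close>
  define g where "g b = f (THE i. b = axis i (1::real))" for b :: "real^'n"
  have [simp]: "g (axis i 1) = f i" for i by (auto simp: g_def axis_eq_axis)
  have gm: "g b \<in> borel_measurable borel" for b by (simp add: g_def assms)
  show ?thesis
    using nn_integral_lborel_prod[of g, OF gm] by (simp add: prod_Basis_vec inner_axis)
qed

text \<open>\<open>lborel\<close> is the image of a product measure over \<open>Basis\<close>, and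
  there integrability and integral of a product of one-variable functions factorise.\<close>

lemma
  fixes f :: "'n::finite \<Rightarrow> real \<Rightarrow> complex"
  assumes f: "\<And>i. integrable lborel (f i)"
  shows integrable_prod_vec: "integrable (lborel :: (real^'n) measure) (\<lambda>x. \<Prod>i\<in>UNIV. f i (x $ i))"
    and integral_prod_vec: "(\<integral>x. (\<Prod>i\<in>UNIV. f i (x $ i)) \<partial>(lborel :: (real^'n) measure)) = (\<Prod>i\<in>UNIV. LINT t|lborel. f i t)"
proof -
  interpret product_sigma_finite "\<lambda>_::real^'n. lborel :: real measure" ..
  define g where "g b = f (THE i. b = axis i (1::real))" for b :: "real^'n"
  have g[simp]: "g (axis i 1) = f i" for i by (auto simp: g_def axis_eq_axis)
  have gi: "integrable lborel (g b)" for b by (simp add: g_def f)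
  have [measurable]: "f i \<in> borel_measurable borel" for i using f[of i] by simp
  let ?P = "\<Pi>\<^sub>M b\<in>(Basis :: (real^'n) set). (lborel :: real measure)"
  let ?T = "\<lambda>f. \<Sum>b\<in>(Basis :: (real^'n) set). f b *\<^sub>R b"
  have eq: "(\<Prod>i\<in>UNIV. f i (?T u $ i)) = (\<Prod>b\<in>Basis. g b (u b))" for u
  proof -
    have "?T u $ i = u (axis i 1)" for i
    proof -
      have "?T u $ i = ?T u \<bullet> axis i 1" by (simp add: inner_axis del: sum_component)
      also have "\<dots> = u (axis i 1)" by (rule inner_sum_left_Basis) (auto simp: Basis_vec_def)
      finally show ?thesis .
    qed
    then show ?thesis by (simp add: prod_Basis_vec)
  qed
  have i: "integrable ?P (\<lambda>u. \<Prod>b\<in>Basis. g b (u b))"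
    by (intro product_integrable_prod gi) simp
  show "integrable (lborel :: (real^'n) measure) (\<lambda>x. \<Prod>i\<in>UNIV. f i (x $ i))"
    by (subst lborel_eq, subst integrable_distr_eq) (use i in \<open>simp_all add: eq del: sum_component\<close>)
  have "(\<integral>x. (\<Prod>i\<in>UNIV. f i (x $ i)) \<partial>(lborel :: (real^'n) measure)) = (LINT u|?P. (\<Prod>b\<in>Basis. g b (u b)))"
    by (subst lborel_eq, subst integral_distr) (simp_all add: eq del: sum_component)
  also have "\<dots> = (\<Prod>b\<in>Basis. LINT t|lborel. g b t)"
    by (intro product_integral_prod gi) simp
  finally show "(\<integral>x. (\<Prod>i\<in>UNIV. f i (x $ i)) \<partial>(lborel :: (real^'n) measure)) = (\<Prod>i\<in>UNIV. LINT t|lborel. f i t)"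
    by (simp add: prod_Basis_vec)
qed

section \<open>Translation invariance, Fubini and integrals depending on a parameter\<close>

lemma nn_integral_lborel_shift:
  fixes F :: "'a::euclidean_space \<Rightarrow> ennreal"
  assumes [measurable]: "F \<in> borel_measurable borel"
  shows "(\<integral>\<^sup>+x. F (c + x) \<partial>lborel) = (\<integral>\<^sup>+x. F x \<partial>lborel)"
  by (subst (2) lborel_distr_plus[of c, symmetric], subst nn_integral_distr) simp_all

lemma integral_lborel_shift:
  fixes F :: "'a::euclidean_space \<Rightarrow> complex"
  assumes [measurable]: "F \<in> borel_measurable borel"
  shows "(LINT x|lborel. F (c + x)) = (LINT x|lborel. F x)"
  by (subst (2) lborel_distr_plus[of c, symmetric], subst integral_distr) simp_all

lemma integrable_lborel_shift:
  fixes F :: "'a::euclidean_space \<Rightarrow> complex"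
  assumes "integrable lborel F"
  shows "integrable lborel (\<lambda>x. F (c + x))"
proof -
  have [measurable]: "F \<in> borel_measurable borel" using assms by simp
  have "integrable (distr lborel borel ((+) c)) F" using assms by (simp add: lborel_distr_plus)
  then show ?thesis by (subst (asm) integrable_distr_eq) simp_all
qed

lemma integrable_mult_pair:
  fixes f g :: "'a::euclidean_space \<Rightarrow> real"
  assumes f: "integrable lborel f" and g: "integrable lborel g"
  shows "integrable (lborel \<Otimes>\<^sub>M lborel) (\<lambda>(x, y). f x * g y)"
proof (rule lborel_pair.Fubini_integrable)
  have [measurable]: "f \<in> borel_measurable borel" "g \<in> borel_measurable borel" using f g by auto
  show "(\<lambda>(x, y). f x * g y) \<in> borel_measurable (lborel \<Otimes>\<^sub>M lborel)" by measurable
  show "integrable lborel (\<lambda>x. LINT y|lborel. norm (case (x, y) of (x, y) \<Rightarrow> f x * g y))"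
    using f by (simp add: abs_mult)
  show "AE x in lborel. integrable lborel (\<lambda>y. case (x, y) of (x, y) \<Rightarrow> f x * g y)"
    using g by simp
qed

lemma measurable_cis[measurable]: "cis \<in> borel_measurable borel"
  by (intro borel_measurable_continuous_onI continuous_intros)

lemma measurable_cnj[measurable]: "cnj \<in> borel_measurable borel"
  by (intro borel_measurable_continuous_onI continuous_intros)

text \<open>The mean value inequality bounds the difference quotients by the same \<open>H\<close>
  that bounds the derivatives on a unit neighbourhood of \<open>t0\<close>; then dominated
  convergence applies.\<close>

lemma has_vector_derivative_integral:
  fixes F :: "real \<Rightarrow> 'a \<Rightarrow> complex"
  assumes F: "\<And>t. integrable M (F t)"
    and [measurable]: "F' t0 \<in> borel_measurable M"
    and d: "\<And>x t. \<bar>t - t0\<bar> \<le> 1 \<Longrightarrow> ((\<lambda>t. F t x) has_vector_derivative F' t x) (at t)"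
    and b: "\<And>x t. \<bar>t - t0\<bar> \<le> 1 \<Longrightarrow> norm (F' t x) \<le> H x"
    and H: "integrable M H"
  shows "((\<lambda>t. LINT x|M. F t x) has_vector_derivative (LINT x|M. F' t0 x)) (at t0)"
proof -
  let ?q = "\<lambda>h x. (F (t0 + h) x - F t0 x) /\<^sub>R h"
  have F'i: "integrable M (F' t0)"
    by (rule Bochner_Integration.integrable_bound[OF H]) (use b[of t0] in \<open>auto intro!: AE_I2 order_trans[OF _ abs_ge_self]\<close>)
  have lim: "((\<lambda>h. ?q h x) \<longlongrightarrow> F' t0 x) (at 0)" for x
  proof -
    have "((\<lambda>h. norm (F (t0 + h) x - F t0 x - h *\<^sub>R F' t0 x) / norm h) \<longlongrightarrow> 0) (at 0)"
      using d[of t0 x] unfolding has_vector_derivative_def has_derivative_at by simp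
    moreover have "eventually (\<lambda>h. norm (F (t0 + h) x - F t0 x - h *\<^sub>R F' t0 x) / norm h = norm (?q h x - F' t0 x)) (at 0)"
    proof (rule eventually_mono[OF eventually_neq_at_within])
      fix h :: real assume "h \<noteq> 0"
      then have "?q h x - F' t0 x = (F (t0 + h) x - F t0 x - h *\<^sub>R F' t0 x) /\<^sub>R h"
        by (simp add: scaleR_diff_right)
      then show "norm (F (t0 + h) x - F t0 x - h *\<^sub>R F' t0 x) / norm h = norm (?q h x - F' t0 x)"
        by (simp add: divide_inverse mult.commute)
    qed
    ultimately have "((\<lambda>h. norm (?q h x - F' t0 x)) \<longlongrightarrow> 0) (at 0)"
      by (simp add: filterlim_cong)
    then show ?thesis by (simp add: LIM_zero_cancel tendsto_norm_zero_iff)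
  qed
  have qb: "norm (?q h x) \<le> H x" if "h \<noteq> 0" "\<bar>h\<bar> \<le> 1" for h x
  proof -
    have "norm (F (t0 + h) x - F t0 x) \<le> H x * norm (t0 + h - t0)"
    proof (rule differentiable_bound[where S="{t0-1..t0+1}" and f'="\<lambda>t h. h *\<^sub>R F' t x"])
      fix t assume "t \<in> {t0 - 1..t0 + 1}"
      then have "\<bar>t - t0\<bar> \<le> 1" by auto
      from d[OF this] b[OF this] show "((\<lambda>t. F t x) has_derivative (\<lambda>h. h *\<^sub>R F' t x)) (at t within {t0-1..t0+1})"
          "onorm (\<lambda>h. h *\<^sub>R F' t x) \<le> H x"
        by (auto simp: has_vector_derivative_def onorm_scaleR_left[OF bounded_linear_ident] onorm_id[unfolded id_def] intro: has_derivative_at_withinI)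
    qed (use that in auto)
    then have "inverse \<bar>h\<bar> * norm (F (t0 + h) x - F t0 x) \<le> inverse \<bar>h\<bar> * (H x * \<bar>h\<bar>)"
      by (intro mult_left_mono) auto
    also have "inverse \<bar>h\<bar> * (H x * \<bar>h\<bar>) = H x" using that by simp
    finally show ?thesis by simp
  qed
  have "((\<lambda>h. LINT x|M. ?q h x) \<longlongrightarrow> (LINT x|M. F' t0 x)) (at 0)"
    unfolding tendsto_at_iff_sequentially
  proof (intro allI impI)
    fix X :: "nat \<Rightarrow> real" assume X: "\<forall>i. X i \<in> UNIV - {0}" "X \<longlonglongrightarrow> 0"
    have [measurable]: "F t \<in> borel_measurable M" for t using F[of t] by simp
    \<comment> \<open>The majorant is valid only for increments of size at most 1, so the first
      \<open>K\<close> terms of the sequence are dropped.\<close>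
    have "eventually (\<lambda>i. \<bar>X i\<bar> \<le> 1) sequentially"
      using order_tendstoD(2)[OF tendsto_rabs_zero[OF X(2)], of 1] by (auto elim: eventually_mono)
    then obtain K where K: "\<And>i. i \<ge> K \<Longrightarrow> \<bar>X i\<bar> \<le> 1" by (auto simp: eventually_sequentially)
    have "(\<lambda>i. LINT x|M. ?q (X (i + K)) x) \<longlonglongrightarrow> (LINT x|M. F' t0 x)"
    proof (rule integral_dominated_convergence[OF _ _ H])
      show "AE x in M. (\<lambda>i. ?q (X (i + K)) x) \<longlonglongrightarrow> F' t0 x"
        using lim X LIMSEQ_ignore_initial_segment[OF X(2), of K]
        unfolding tendsto_at_iff_sequentially by (auto simp: comp_def)
      show "AE x in M. norm (?q (X (i + K)) x) \<le> H x" for i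
        using X K[of "i + K"] qb[of "X (i + K)"] by auto
    qed auto
    then show "((\<lambda>h. LINT x|M. ?q h x) \<circ> X) \<longlonglongrightarrow> (LINT x|M. F' t0 x)"
      unfolding comp_def by (rule LIMSEQ_offset)
  qed
  moreover have "(LINT x|M. ?q h x) = ((LINT x|M. F (t0 + h) x) - (LINT x|M. F t0 x)) /\<^sub>R h" for h
    by (simp only: integral_scaleR_right Bochner_Integration.integral_diff[OF F F])
  ultimately have L: "((\<lambda>h. ((LINT x|M. F (t0 + h) x) - (LINT x|M. F t0 x)) /\<^sub>R h) \<longlongrightarrow> (LINT x|M. F' t0 x)) (at 0)"
    by (simp only:)
  let ?I = "\<lambda>t. LINT x|M. F t x" and ?D = "LINT x|M. F' t0 x"
  have "((\<lambda>h. norm ((?I (t0 + h) - ?I t0) /\<^sub>R h - ?D)) \<longlongrightarrow> 0) (at 0)"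
    using L by (intro tendsto_norm_zero) (simp add: LIM_zero)
  moreover have "eventually (\<lambda>h. norm (?I (t0 + h) - ?I t0 - h *\<^sub>R ?D) / norm h = norm ((?I (t0 + h) - ?I t0) /\<^sub>R h - ?D)) (at 0)"
  proof (rule eventually_mono[OF eventually_neq_at_within])
    fix h :: real assume "h \<noteq> 0"
    then have "(?I (t0 + h) - ?I t0) /\<^sub>R h - ?D = (?I (t0 + h) - ?I t0 - h *\<^sub>R ?D) /\<^sub>R h"
      by (simp add: scaleR_diff_right)
    then show "norm (?I (t0 + h) - ?I t0 - h *\<^sub>R ?D) / norm h = norm ((?I (t0 + h) - ?I t0) /\<^sub>R h - ?D)"
      by (simp add: divide_inverse mult.commute)
  qed
  ultimately show ?thesis
    unfolding has_vector_derivative_def has_derivative_at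
    by (simp add: filterlim_cong bounded_linear_scaleR_left)
qed

text \<open>Integration by parts without Fubini: translation invariance makes \<open>\<integral>H(\<cdot> + tv)\<close> constant in \<open>t\<close>.\<close>

lemma integral_ddir_eq_0:
  fixes H H' :: "'a::euclidean_space \<Rightarrow> complex"
  assumes H: "integrable lborel H" and [measurable]: "H' \<in> borel_measurable borel"
    and d: "\<And>x. ((\<lambda>t. H (x + t *\<^sub>R v)) has_vector_derivative H' x) (at 0)"
    and b: "\<And>x t. \<bar>t\<bar> \<le> 1 \<Longrightarrow> norm (H' (x + t *\<^sub>R v)) \<le> K x"
    and K: "integrable lborel K"
  shows "(LINT x|lborel. H' x) = 0"
proof -
  have [measurable]: "H \<in> borel_measurable borel" using H by simp
  have d': "((\<lambda>t. H (x + t *\<^sub>R v)) has_vector_derivative H' (x + t *\<^sub>R v)) (at t)" for x t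
    using d has_vector_derivative_ddir_at[of H v x t] ddir_eqI[OF d]
    by (metis differentiableI_vector)
  have "((\<lambda>t. LINT x|lborel. H (x + t *\<^sub>R v)) has_vector_derivative (LINT x|lborel. H' (x + 0 *\<^sub>R v))) (at 0)"
  proof (rule has_vector_derivative_integral[OF _ _ _ _ K])
    show "integrable lborel (\<lambda>x. H (x + t *\<^sub>R v))" for t
      using integrable_lborel_shift[OF H, of "t *\<^sub>R v"] by (simp add: add.commute)
  qed (use d' b in auto)
  moreover have "(LINT x|lborel. H (x + t *\<^sub>R v)) = (LINT x|lborel. H x)" for t
    using integral_lborel_shift[of H "t *\<^sub>R v"] by (simp add: add.commute)
  ultimately have "((\<lambda>t::real. LINT x|lborel. H x) has_vector_derivative (LINT x|lborel. H' x)) (at 0)" by simp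
  then show ?thesis using vector_derivative_unique_at has_vector_derivative_const by blast
qed

section \<open>The Fourier transform\<close>

lemma measurable_fourier[measurable]:
  assumes [measurable]: "f \<in> borel_measurable borel"
  shows "fourier f \<in> borel_measurable borel"
  unfolding fourier_def[abs_def] by measurable

lemma norm_fourier_le:
  assumes "integrable lborel f"
  shows "norm (fourier f \<xi>) \<le> (LINT x|lborel. norm (f x))"
  unfolding fourier_def
  by (rule order_trans[OF integral_norm_bound]) (simp add: norm_mult)

lemma integrable_mult_cis:
  assumes "integrable lborel f" and [measurable]: "u \<in> borel_measurable borel"
  shows "integrable lborel (\<lambda>x::'a::euclidean_space. f x * cis (u x))"
  by (rule Bochner_Integration.integrable_bound[OF assms(1)]) (use assms in \<open>auto simp: norm_mult\<close>)

text \<open>A rescaled form of the characteristic function of the standard normal law. Written with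
  \<open>normal_density\<close>, the transform is visibly nonnegative and of mass 2 pi, which the
  Plancherel argument uses.\<close>

lemma gaussian_fourier_1d:
  assumes "\<sigma> > 0"
  shows "integrable lborel (\<lambda>t. complex_of_real (exp (- (\<sigma> * t)\<^sup>2 / 2)) * cis (s * t))"
    and "(LINT t|lborel. complex_of_real (exp (- (\<sigma> * t)\<^sup>2 / 2)) * cis (s * t)) = of_real (2 * pi * normal_density 0 \<sigma> s)"
proof -
  have s1: "exp (- (\<sigma> * t)\<^sup>2 / 2) = sqrt (2 * pi) * std_normal_density (0 + \<sigma> * t)" for t
    by (simp add: normal_density_def)
  have i1: "integrable lborel (\<lambda>t. exp (- (\<sigma> * t)\<^sup>2 / 2))"
    unfolding s1 by (intro integrable_mult_right lborel_integrable_real_affine integrable_normal_density) (use assms in auto)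
  show "integrable lborel (\<lambda>t. complex_of_real (exp (- (\<sigma> * t)\<^sup>2 / 2)) * cis (s * t))"
    by (intro integrable_mult_cis integrable_of_real i1) simp
  have "complex_of_real (exp (- (s / \<sigma>)\<^sup>2 / 2)) = (LINT t|lborel. std_normal_density t *\<^sub>R iexp ((s / \<sigma>) * t))"
    using fun_cong[OF char_std_normal_distribution, of "s / \<sigma>"]
    unfolding char_def by (subst (asm) integral_density) auto
  also have "\<dots> = \<sigma> *\<^sub>R (LINT t|lborel. std_normal_density (0 + \<sigma> * t) *\<^sub>R iexp ((s / \<sigma>) * (0 + \<sigma> * t)))"
    by (subst lborel_integral_real_affine[of \<sigma> _ 0]) (use assms in auto)
  also have "\<dots> = \<sigma> *\<^sub>R (LINT t|lborel. (1 / sqrt (2 * pi)) *\<^sub>R (complex_of_real (exp (- (\<sigma> * t)\<^sup>2 / 2)) * cis (s * t)))"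
    using assms by (intro arg_cong[where f="\<lambda>x. \<sigma> *\<^sub>R x"] Bochner_Integration.integral_cong)
      (auto simp: normal_density_def cis_conv_exp scaleR_conv_of_real mult_ac)
  also have "\<dots> = (\<sigma> / sqrt (2 * pi)) *\<^sub>R (LINT t|lborel. complex_of_real (exp (- (\<sigma> * t)\<^sup>2 / 2)) * cis (s * t))"
    by simp
  finally have *: "(\<sigma> / sqrt (2 * pi)) *\<^sub>R (LINT t|lborel. complex_of_real (exp (- (\<sigma> * t)\<^sup>2 / 2)) * cis (s * t)) = complex_of_real (exp (- (s / \<sigma>)\<^sup>2 / 2))"
    by simp
  have "(LINT t|lborel. complex_of_real (exp (- (\<sigma> * t)\<^sup>2 / 2)) * cis (s * t))
      = (sqrt (2 * pi) / \<sigma>) *\<^sub>R ((\<sigma> / sqrt (2 * pi)) *\<^sub>R (LINT t|lborel. complex_of_real (exp (- (\<sigma> * t)\<^sup>2 / 2)) * cis (s * t)))"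
    using assms by simp
  also have "\<dots> = of_real (sqrt (2 * pi) / \<sigma> * exp (- (s / \<sigma>)\<^sup>2 / 2))"
    by (simp only: *) (simp add: scaleR_conv_of_real)
  also have "sqrt (2 * pi) / \<sigma> * exp (- (s / \<sigma>)\<^sup>2 / 2) = 2 * pi * normal_density 0 \<sigma> s"
  proof -
    have "2 * pi = sqrt (2 * pi) * sqrt (2 * pi)" by simp
    then show ?thesis
      using assms unfolding normal_density_def
      by (simp add: real_sqrt_mult power_divide divide_simps)
  qed
  finally show "(LINT t|lborel. complex_of_real (exp (- (\<sigma> * t)\<^sup>2 / 2)) * cis (s * t)) = of_real (2 * pi * normal_density 0 \<sigma> s)" .
qed

lemma prod_cis: "finite I \<Longrightarrow> (\<Prod>i\<in>I. cis (f i)) = cis (\<Sum>i\<in>I. f i)"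
  by (induction I rule: finite_induct) (auto simp: cis_mult)

lemma gaussian_fourier:
  fixes s :: "real^'n::finite"
  assumes "\<sigma> > 0"
  shows "integrable lborel (\<lambda>\<xi>::real^'n. complex_of_real (\<Prod>i\<in>UNIV. exp (- (\<sigma> * \<xi> $ i)\<^sup>2 / 2)) * cis (s \<bullet> \<xi>))"
    and "(LINT \<xi>|lborel. complex_of_real (\<Prod>i\<in>UNIV. exp (- (\<sigma> * \<xi> $ i)\<^sup>2 / 2)) * cis (s \<bullet> \<xi>))
      = of_real (\<Prod>i\<in>UNIV. 2 * pi * normal_density 0 \<sigma> (s $ i))"
proof -
  let ?f = "\<lambda>i t. complex_of_real (exp (- (\<sigma> * t)\<^sup>2 / 2)) * cis (s $ i * t)"
  have eq: "complex_of_real (\<Prod>i\<in>UNIV. exp (- (\<sigma> * \<xi> $ i)\<^sup>2 / 2)) * cis (s \<bullet> \<xi>) = (\<Prod>i\<in>UNIV. ?f i (\<xi> $ i))" for \<xi>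
    by (simp add: prod.distrib prod_cis inner_vec_def)
  show "integrable lborel (\<lambda>\<xi>::real^'n. complex_of_real (\<Prod>i\<in>UNIV. exp (- (\<sigma> * \<xi> $ i)\<^sup>2 / 2)) * cis (s \<bullet> \<xi>))"
    unfolding eq by (intro integrable_prod_vec gaussian_fourier_1d assms)
  show "(LINT \<xi>|lborel. complex_of_real (\<Prod>i\<in>UNIV. exp (- (\<sigma> * \<xi> $ i)\<^sup>2 / 2)) * cis (s \<bullet> \<xi>))
      = of_real (\<Prod>i\<in>UNIV. 2 * pi * normal_density 0 \<sigma> (s $ i))"
    unfolding eq
    by (subst integral_prod_vec[OF gaussian_fourier_1d(1)[OF assms]])
      (simp only: gaussian_fourier_1d(2)[OF assms] of_real_prod)
qed

text \<open>The Gaussian factor makes Fubini applicable and turns the left side into the double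
  integral of h(y) \<open>cnj\<close> h(z) \<Gamma>(z - y). This kernel is nonnegative, symmetric
  and of mass (2 pi)^n, so the bound is Schur's test.\<close>

lemma plancherel_gaussian:
  fixes h :: "real^'n::finite \<Rightarrow> complex"
  assumes h: "integrable lborel h" and s: "\<sigma> > 0"
  shows "(\<integral>\<^sup>+\<xi>. ennreal ((norm (fourier h \<xi>))\<^sup>2 * (\<Prod>i\<in>UNIV. exp (- (\<sigma> * \<xi> $ i)\<^sup>2 / 2))) \<partial>lborel)
    \<le> ennreal ((2 * pi) ^ CARD('n)) * (\<integral>\<^sup>+x. ennreal ((norm (h x))\<^sup>2) \<partial>lborel)"
proof -
  define G where "G \<xi> = (\<Prod>i\<in>UNIV. exp (- (\<sigma> * \<xi> $ i)\<^sup>2 / 2))" for \<xi> :: "real^'n"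
  define \<Gamma> where "\<Gamma> s = (\<Prod>i\<in>UNIV. 2 * pi * normal_density 0 \<sigma> (s $ i))" for s :: "real^'n"
  have [measurable]: "h \<in> borel_measurable borel" using h by simp
  have [measurable]: "G \<in> borel_measurable borel" unfolding G_def by measurable
  have [measurable]: "\<Gamma> \<in> borel_measurable borel" unfolding \<Gamma>_def by measurable
  have Gn: "G \<xi> \<ge> 0" for \<xi> by (auto simp: G_def intro!: prod_nonneg)
  have \<Gamma>n: "\<Gamma> \<xi> \<ge> 0" for \<xi> by (auto simp: \<Gamma>_def intro!: prod_nonneg)
  have G\<Gamma>: "(LINT \<xi>|lborel. complex_of_real (G \<xi>) * cis (s \<bullet> \<xi>)) = of_real (\<Gamma> s)" for s
    using gaussian_fourier(2)[OF s] by (simp add: G_def \<Gamma>_def)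
  have Gi: "integrable lborel (\<lambda>\<xi>. complex_of_real (G \<xi>))"
    using gaussian_fourier(1)[OF s, of 0] by (simp add: G_def)
  then have Gi': "integrable lborel G" by (simp add: complex_of_real_integrable_eq)
  have \<Gamma>1: "(\<integral>\<^sup>+z. ennreal (\<Gamma> z) \<partial>lborel) = ennreal ((2 * pi) ^ CARD('n))"
  proof -
    have "(\<integral>\<^sup>+z. ennreal (\<Gamma> z) \<partial>lborel) = (\<integral>\<^sup>+(z::real^'n). (\<Prod>i\<in>UNIV. ennreal (2 * pi * normal_density 0 \<sigma> (z $ i))) \<partial>lborel)"
      unfolding \<Gamma>_def by (intro nn_integral_cong prod_ennreal[symmetric]) simp
    also have "\<dots> = (\<Prod>i\<in>(UNIV::'n set). \<integral>\<^sup>+t. ennreal (2 * pi * normal_density 0 \<sigma> t) \<partial>lborel)"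
      by (rule nn_integral_prod_vec) measurable
    also have "(\<integral>\<^sup>+t. ennreal (2 * pi * normal_density 0 \<sigma> t) \<partial>lborel) = ennreal (2 * pi)"
      using s by (subst nn_integral_eq_integral) auto
    finally show ?thesis by (simp add: ennreal_power)
  qed
  have \<Gamma>s: "\<Gamma> (z - y) = \<Gamma> (y - z)" for y z
    by (simp add: \<Gamma>_def normal_density_def power2_commute)
  have sh1: "(\<integral>\<^sup>+z. ennreal (\<Gamma> (z - y)) \<partial>lborel) = ennreal ((2 * pi) ^ CARD('n))" for y
    using nn_integral_lborel_shift[of "\<lambda>z. ennreal (\<Gamma> z)" "- y"] \<Gamma>1 by simp
  \<comment> \<open>The weight of each half in the arithmetic-geometric mean inequality below; the
    two halves recombine at the end.\<close>
  define \<kappa> :: real where "\<kappa> = 1/2"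
  have \<kappa>0: "\<kappa> \<ge> 0" and \<kappa>1: "\<kappa> + \<kappa> = 1" by (auto simp: \<kappa>_def)
  define W where "W = (LINT x|lborel. norm (h x))"
  have Fb: "norm (fourier h \<xi>) \<le> W" for \<xi> unfolding W_def by (rule norm_fourier_le[OF h])
  have W0: "W \<ge> 0" unfolding W_def by simp
  have FGi: "integrable lborel (\<lambda>\<xi>. of_real (G \<xi>) * cnj (fourier h \<xi>))"
  proof (rule Bochner_Integration.integrable_bound[OF integrable_mult_right[OF Gi', of W]])
    show "AE \<xi> in lborel. norm (of_real (G \<xi>) * cnj (fourier h \<xi>)) \<le> norm (W * G \<xi>)"
      using Fb Gn W0 by (intro AE_I2) (simp add: norm_mult abs_mult mult.commute[of W] mult_left_mono)
  qed measurable
  have step1: "(LINT \<xi>|lborel. fourier h \<xi> * (of_real (G \<xi>) * cnj (fourier h \<xi>)))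
      = (LINT y|lborel. h y * (LINT \<xi>|lborel. cis (- (y \<bullet> \<xi>)) * (of_real (G \<xi>) * cnj (fourier h \<xi>))))"
  proof -
    let ?k = "\<lambda>(y, \<xi>). h y * cis (- (y \<bullet> \<xi>)) * (of_real (G \<xi>) * cnj (fourier h \<xi>))"
    have "integrable (lborel \<Otimes>\<^sub>M lborel) (\<lambda>(y, \<xi>). norm (h y) * norm (of_real (G \<xi>) * cnj (fourier h \<xi>)))"
      by (intro integrable_mult_pair) (use h FGi in auto)
    then have "integrable (lborel \<Otimes>\<^sub>M lborel) ?k"
      by (rule Bochner_Integration.integrable_bound) (auto simp: norm_mult intro!: AE_I2)
    from lborel_pair.Fubini_integral[OF this]
    have "(LINT \<xi>|lborel. LINT y|lborel. ?k (y, \<xi>)) = (LINT y|lborel. LINT \<xi>|lborel. ?k (y, \<xi>))" by simp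
    moreover have "(LINT y|lborel. ?k (y, \<xi>)) = fourier h \<xi> * (of_real (G \<xi>) * cnj (fourier h \<xi>))" for \<xi>
      by (simp only: prod.case integral_mult_left_zero fourier_def[of h \<xi>, symmetric])
    moreover have "(LINT \<xi>|lborel. ?k (y, \<xi>)) = h y * (LINT \<xi>|lborel. cis (- (y \<bullet> \<xi>)) * (of_real (G \<xi>) * cnj (fourier h \<xi>)))" for y
      by (simp only: prod.case mult.assoc integral_mult_right_zero)
    ultimately show ?thesis by (simp only:)
  qed
  \<comment> \<open>Expanding the conjugate transform produces the Fourier integral of the Gaussian
    at \<open>z - y\<close>.\<close>
  have step2: "(LINT \<xi>|lborel. cis (- (y \<bullet> \<xi>)) * (of_real (G \<xi>) * cnj (fourier h \<xi>)))
      = (LINT z|lborel. cnj (h z) * of_real (\<Gamma> (z - y)))" for y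
  proof -
    let ?k = "\<lambda>(z, \<xi>). cnj (h z) * (of_real (G \<xi>) * cis ((z - y) \<bullet> \<xi>))"
    have "integrable (lborel \<Otimes>\<^sub>M lborel) (\<lambda>(z, \<xi>). norm (h z) * G \<xi>)"
      by (intro integrable_mult_pair) (use h Gi' in auto)
    then have "integrable (lborel \<Otimes>\<^sub>M lborel) ?k"
      by (rule Bochner_Integration.integrable_bound) (auto simp: norm_mult Gn intro!: AE_I2)
    from lborel_pair.Fubini_integral[OF this]
    have "(LINT \<xi>|lborel. LINT z|lborel. ?k (z, \<xi>)) = (LINT z|lborel. cnj (h z) * of_real (\<Gamma> (z - y)))"
      by (simp add: G\<Gamma>)
    moreover have "(LINT z|lborel. ?k (z, \<xi>)) = cis (- (y \<bullet> \<xi>)) * (of_real (G \<xi>) * cnj (fourier h \<xi>))" for \<xi>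
    proof -
      have "(LINT z|lborel. ?k (z, \<xi>)) = (LINT z|lborel. (cis (- (y \<bullet> \<xi>)) * of_real (G \<xi>)) * cnj (h z * cis (- (z \<bullet> \<xi>))))"
        by (intro Bochner_Integration.integral_cong)
          (auto simp: cis_cnj cis_mult inner_diff_left algebra_simps diff_conv_add_uminus simp del: add_uminus_conv_diff)
      also have "\<dots> = (cis (- (y \<bullet> \<xi>)) * of_real (G \<xi>)) * cnj (fourier h \<xi>)"
        unfolding fourier_def by (simp only: integral_mult_right_zero Bochner_Integration.integral_cnj)
      finally show ?thesis by (simp add: mult.assoc)
    qed
    ultimately show ?thesis by simp
  qed
  have lhs: "(LINT \<xi>|lborel. fourier h \<xi> * (of_real (G \<xi>) * cnj (fourier h \<xi>))) = of_real (LINT \<xi>|lborel. (norm (fourier h \<xi>))\<^sup>2 * G \<xi>)"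
    unfolding integral_complex_of_real[symmetric]
    by (intro Bochner_Integration.integral_cong refl, simp only: of_real_mult complex_norm_square) (simp only: mult_ac)
  have I2: "integrable lborel (\<lambda>\<xi>. (norm (fourier h \<xi>))\<^sup>2 * G \<xi>)"
  proof (rule Bochner_Integration.integrable_bound[OF integrable_mult_right[OF Gi', of "W\<^sup>2"]])
    show "AE \<xi> in lborel. norm ((norm (fourier h \<xi>))\<^sup>2 * G \<xi>) \<le> norm (W\<^sup>2 * G \<xi>)"
      using Fb Gn by (intro AE_I2) (simp add: abs_mult mult_right_mono power_mono)
  qed measurable
  have "(\<integral>\<^sup>+\<xi>. ennreal ((norm (fourier h \<xi>))\<^sup>2 * G \<xi>) \<partial>lborel) = ennreal (LINT \<xi>|lborel. (norm (fourier h \<xi>))\<^sup>2 * G \<xi>)"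
    by (rule nn_integral_eq_integral[OF I2]) (simp add: Gn)
  also have "\<dots> \<le> ennreal (norm (LINT y|lborel. h y * (LINT z|lborel. cnj (h z) * of_real (\<Gamma> (z - y)))))"
    using arg_cong[OF step1[unfolded step2 lhs], of norm] by (intro ennreal_leI) simp
  also have "\<dots> \<le> (\<integral>\<^sup>+y. ennreal (norm (h y)) * (\<integral>\<^sup>+z. ennreal (norm (h z)) * ennreal (\<Gamma> (z - y)) \<partial>lborel) \<partial>lborel)"
  proof -
    have b: "ennreal (norm (LINT x|lborel. u x)) \<le> (\<integral>\<^sup>+x. ennreal (norm (u x)) \<partial>lborel)" for u :: "real^'n \<Rightarrow> complex"
    proof (cases "integrable lborel u")
      case True then show ?thesis
        by (subst nn_integral_eq_integral) (auto intro!: ennreal_leI)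
    qed (simp add: not_integrable_integral_eq)
    have "norm (h y * (LINT z|lborel. cnj (h z) * of_real (\<Gamma> (z - y)))) = norm (h y) * norm (LINT z|lborel. cnj (h z) * of_real (\<Gamma> (z - y)))" for y
      by (simp add: norm_mult)
    then show ?thesis
      by (intro order_trans[OF b] nn_integral_mono)
        (auto simp: ennreal_mult' \<Gamma>n norm_mult intro!: mult_left_mono order_trans[OF b])
  qed
  also have "\<dots> \<le> (\<integral>\<^sup>+y. (\<integral>\<^sup>+z. ennreal \<kappa> * (ennreal ((norm (h y))\<^sup>2) * ennreal (\<Gamma> (z - y))) + ennreal \<kappa> * (ennreal ((norm (h z))\<^sup>2) * ennreal (\<Gamma> (z - y))) \<partial>lborel) \<partial>lborel)"
  proof (intro nn_integral_mono, subst nn_integral_cmult[symmetric])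
    fix y
    \<comment> \<open>This decouples y and z: each half contains one of the two values only, and the
      kernel has the same mass in either variable.\<close>
    have "norm (h y) * (norm (h z) * \<Gamma> (z - y)) \<le> \<kappa> * ((norm (h y))\<^sup>2 * \<Gamma> (z - y)) + \<kappa> * ((norm (h z))\<^sup>2 * \<Gamma> (z - y))" for z
    proof -
      have "2 * (norm (h y) * norm (h z)) \<le> (norm (h y))\<^sup>2 + (norm (h z))\<^sup>2"
        using sum_squares_bound[of "norm (h y)" "norm (h z)"] by simp
      from mult_right_mono[OF this \<Gamma>n[of "z - y"]] show ?thesis by (simp add: algebra_simps \<kappa>_def)
    qed
    then show "(\<integral>\<^sup>+z. ennreal (norm (h y)) * (ennreal (norm (h z)) * ennreal (\<Gamma> (z - y))) \<partial>lborel) \<le> (\<integral>\<^sup>+z. ennreal \<kappa> * (ennreal ((norm (h y))\<^sup>2) * ennreal (\<Gamma> (z - y))) + ennreal \<kappa> * (ennreal ((norm (h z))\<^sup>2) * ennreal (\<Gamma> (z - y))) \<partial>lborel)"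
      by (intro nn_integral_mono)
        (auto simp: \<Gamma>n \<kappa>0 simp del: ennreal_plus simp flip: ennreal_mult ennreal_plus intro!: ennreal_leI)
  qed measurable
  also have "\<dots> = ennreal \<kappa> * (\<integral>\<^sup>+y. (\<integral>\<^sup>+z. ennreal ((norm (h y))\<^sup>2) * ennreal (\<Gamma> (z - y)) \<partial>lborel) \<partial>lborel)
      + ennreal \<kappa> * (\<integral>\<^sup>+y. (\<integral>\<^sup>+z. ennreal ((norm (h z))\<^sup>2) * ennreal (\<Gamma> (z - y)) \<partial>lborel) \<partial>lborel)"
    by (simp add: nn_integral_add nn_integral_cmult)
  also have "(\<integral>\<^sup>+y. (\<integral>\<^sup>+z. ennreal ((norm (h z))\<^sup>2) * ennreal (\<Gamma> (z - y)) \<partial>lborel) \<partial>lborel)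
      = (\<integral>\<^sup>+z. (\<integral>\<^sup>+y. ennreal ((norm (h z))\<^sup>2) * ennreal (\<Gamma> (y - z)) \<partial>lborel) \<partial>lborel)"
    by (subst lborel_pair.Fubini') (simp_all add: \<Gamma>s)
  also have "ennreal \<kappa> * (\<integral>\<^sup>+y. (\<integral>\<^sup>+z. ennreal ((norm (h y))\<^sup>2) * ennreal (\<Gamma> (z - y)) \<partial>lborel) \<partial>lborel)
      + ennreal \<kappa> * \<dots> = ennreal ((2 * pi) ^ CARD('n)) * (\<integral>\<^sup>+x. ennreal ((norm (h x))\<^sup>2) \<partial>lborel)"
  proof -
    have "(ennreal \<kappa> + ennreal \<kappa>) * x = x" for x
      using \<kappa>0 by (simp add: \<kappa>1 flip: ennreal_plus)
    then have half: "ennreal \<kappa> * x + ennreal \<kappa> * x = x" for x by (simp flip: distrib_right)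
    have e: "(\<integral>\<^sup>+y. (\<integral>\<^sup>+z. ennreal ((norm (h y))\<^sup>2) * ennreal (\<Gamma> (z - y)) \<partial>lborel) \<partial>lborel)
      = ennreal ((2 * pi) ^ CARD('n)) * (\<integral>\<^sup>+x. ennreal ((norm (h x))\<^sup>2) \<partial>lborel)"
      by (simp add: nn_integral_cmult sh1 nn_integral_multc mult.commute)
    show ?thesis unfolding half by (rule e)
  qed
  finally show ?thesis by (simp add: G_def)
qed

text \<open>As the parameter 1/(k+1) of the Gaussian tends to 0 the damping tends to 1 pointwise,
  and Fatou's lemma keeps the bound. The right side may be infinite.\<close>

theorem plancherel_le:
  fixes h :: "real^'n::finite \<Rightarrow> complex"
  assumes h: "integrable lborel h"
  shows "(\<integral>\<^sup>+\<xi>. ennreal ((norm (fourier h \<xi>))\<^sup>2) \<partial>lborel)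
    \<le> ennreal ((2 * pi) ^ CARD('n)) * (\<integral>\<^sup>+x. ennreal ((norm (h x))\<^sup>2) \<partial>lborel)"
proof -
  have [measurable]: "h \<in> borel_measurable borel" using h by simp
  let ?g = "\<lambda>k \<xi>. ennreal ((norm (fourier h \<xi>))\<^sup>2 * (\<Prod>i\<in>UNIV. exp (- (inverse (real (Suc k)) * \<xi> $ i)\<^sup>2 / 2)))"
  have "(\<lambda>k. ?g k \<xi>) \<longlonglongrightarrow> ennreal ((norm (fourier h \<xi>))\<^sup>2 * (\<Prod>i\<in>UNIV. exp (- (0 * \<xi> $ i)\<^sup>2 / 2)))" for \<xi> :: "real^'n"
    by (intro tendsto_intros LIMSEQ_inverse_real_of_nat) simp
  then have "(\<lambda>k. ?g k \<xi>) \<longlonglongrightarrow> ennreal ((norm (fourier h \<xi>))\<^sup>2)" for \<xi> :: "real^'n" by simp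
  then have "(\<integral>\<^sup>+\<xi>. ennreal ((norm (fourier h \<xi>))\<^sup>2) \<partial>lborel) = (\<integral>\<^sup>+\<xi>. liminf (\<lambda>k. ?g k \<xi>) \<partial>lborel)"
    by (intro nn_integral_cong lim_imp_Liminf[symmetric]) (simp_all del: of_nat_Suc)
  also have "\<dots> \<le> liminf (\<lambda>k. \<integral>\<^sup>+\<xi>. ?g k \<xi> \<partial>lborel)"
    by (rule nn_integral_liminf) measurable
  also have "\<dots> \<le> ennreal ((2 * pi) ^ CARD('n)) * (\<integral>\<^sup>+x. ennreal ((norm (h x))\<^sup>2) \<partial>lborel)"
    by (intro Liminf_le always_eventually allI plancherel_gaussian h) (simp_all del: of_nat_Suc)
  finally show ?thesis .
qed

section \<open>Local square-integrable estimates\<close>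

text \<open>The integral of a non-integrable function is 0 by convention, so the bound holds for
  every \<open>u\<close>.\<close>

lemma nn_norm_integral_le:
  fixes u :: "'a \<Rightarrow> complex"
  shows "ennreal (norm (LINT x|M. u x)) \<le> (\<integral>\<^sup>+x. ennreal (norm (u x)) \<partial>M)"
proof (cases "integrable M u")
  case True then show ?thesis
    by (subst nn_integral_eq_integral) (auto intro!: ennreal_leI)
qed (simp add: not_integrable_integral_eq)

text \<open>The derivative of |\<phi>|^2 is at most 2 |\<phi>| |\<phi>'|, split with the weight L so
  that both parts balance when a derivative costs a factor L. Comparing the value at s with all
  values on a unit interval and averaging then costs one factor L in the square.\<close>

lemma sobolev_interval:
  fixes \<phi> \<phi>' :: "real \<Rightarrow> complex"
  assumes d: "\<And>t. (\<phi> has_vector_derivative \<phi>' t) (at t)" and c: "continuous_on UNIV \<phi>'"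
    and L: "L \<ge> 1" and s: "s \<in> {c..c+1}"
  shows "ennreal ((norm (\<phi> s))\<^sup>2) \<le>
    (\<integral>\<^sup>+t. ennreal (2 * L * (norm (\<phi> t))\<^sup>2 + (norm (\<phi>' t))\<^sup>2 / L) * indicator {c..c+1} t \<partial>lborel)"
proof -
  define w where "w t = L * (norm (\<phi> t))\<^sup>2 + (norm (\<phi>' t))\<^sup>2 / L" for t
  have c\<phi>: "continuous_on UNIV \<phi>"
    using d by (meson UNIV_I continuous_at_imp_continuous_on has_vector_derivative_continuous)
  have cS: "continuous_on S \<phi>" "continuous_on S \<phi>'" for S
    using c c\<phi> by (auto intro: continuous_on_subset)
  have cw: "continuous_on S w" for S
    unfolding w_def using L by (intro continuous_intros cS) auto
  have wi: "w integrable_on {a..b}" for a b by (intro integrable_continuous_real cw)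
  have w0: "w t \<ge> 0" for t using L by (simp add: w_def)
  define g' where "g' t = 2 * (\<phi> t \<bullet> \<phi>' t)" for t
  have dg: "((\<lambda>t. (norm (\<phi> t))\<^sup>2) has_real_derivative g' t) (at t within S)" for t S
  proof -
    have "((\<lambda>t. \<phi> t \<bullet> \<phi> t) has_derivative (\<lambda>h. \<phi> t \<bullet> (h *\<^sub>R \<phi>' t) + (h *\<^sub>R \<phi>' t) \<bullet> \<phi> t)) (at t within S)"
      using d[of t] unfolding has_vector_derivative_def
      by (intro has_derivative_inner) (auto intro: has_derivative_at_withinI)
    then show ?thesis
      unfolding has_field_derivative_def g'_def power2_norm_eq_inner
      by (rule has_derivative_eq_rhs) (auto simp: fun_eq_iff inner_commute)
  qed
  have g'w: "\<bar>g' t\<bar> \<le> w t" for t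
  proof -
    have "\<bar>g' t\<bar> \<le> 2 * (norm (\<phi> t) * norm (\<phi>' t))"
      unfolding g'_def using Cauchy_Schwarz_ineq2[of "\<phi> t" "\<phi>' t"] by simp
    \<comment> \<open>Inserting \<open>sqrt L\<close> before the arithmetic-geometric mean
      inequality puts the weight L on \<phi> and 1/L on its derivative.\<close>
    also have "\<dots> = 2 * ((sqrt L * norm (\<phi> t)) * (norm (\<phi>' t) / sqrt L))" using L by simp
    also have "\<dots> \<le> (sqrt L * norm (\<phi> t))\<^sup>2 + (norm (\<phi>' t) / sqrt L)\<^sup>2"
      using sum_squares_bound[of "sqrt L * norm (\<phi> t)" "norm (\<phi>' t) / sqrt L"] by (simp only: mult.assoc)
    also have "\<dots> = w t" using L by (simp add: w_def power_mult_distrib power_divide)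
    finally show ?thesis .
  qed
  define W where "W = integral {c..c+1} w"
  have inc: "\<bar>(norm (\<phi> b))\<^sup>2 - (norm (\<phi> a))\<^sup>2\<bar> \<le> W" if "a \<le> b" "c \<le> a" "b \<le> c + 1" for a b
  proof -
    have h: "(g' has_integral ((norm (\<phi> b))\<^sup>2 - (norm (\<phi> a))\<^sup>2)) {a..b}"
      using that by (intro fundamental_theorem_of_calculus) (auto simp: has_real_derivative_iff_has_vector_derivative[symmetric] dg)
    have "norm ((norm (\<phi> b))\<^sup>2 - (norm (\<phi> a))\<^sup>2) \<le> integral {a..b} w"
      using integral_norm_bound_integral[OF _ wi, of g' a b] h g'w
      by (metis has_integral_integrable integral_unique real_norm_def)
    also have "\<dots> \<le> W" unfolding W_def using that by (intro integral_subset_le wi) (auto simp: w0)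
    finally show ?thesis by simp
  qed
  have le: "(norm (\<phi> s))\<^sup>2 \<le> (norm (\<phi> t))\<^sup>2 + W" if "t \<in> {c..c+1}" for t
    using inc[of s t] inc[of t s] s that by (cases "s \<le> t") auto
  have i2: "(\<lambda>t. (norm (\<phi> t))\<^sup>2) integrable_on {c..c+1}"
    by (intro integrable_continuous_real continuous_intros cS)
  \<comment> \<open>The interval has length 1, so integrating the constant is the averaging
    step.\<close>
  have "(norm (\<phi> s))\<^sup>2 = integral {c..c+1} (\<lambda>t. (norm (\<phi> s))\<^sup>2)" by simp
  also have "\<dots> \<le> integral {c..c+1} (\<lambda>t. (norm (\<phi> t))\<^sup>2 + W)"
    using le i2 by (intro integral_le integrable_add) auto
  also have "\<dots> = integral {c..c+1} (\<lambda>t. (norm (\<phi> t))\<^sup>2) + W"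
    using i2 by (subst integral_add) auto
  also have "\<dots> = integral {c..c+1} (\<lambda>t. (norm (\<phi> t))\<^sup>2 + w t)"
    unfolding W_def using i2 wi by (subst integral_add) auto
  \<comment> \<open>As L \<ge> 1, the term |\<phi>|^2 left by the averaging is absorbed into a
    second copy of L |\<phi>|^2.\<close>
  also have "\<dots> \<le> integral {c..c+1} (\<lambda>t. 2 * L * (norm (\<phi> t))\<^sup>2 + (norm (\<phi>' t))\<^sup>2 / L)"
  proof (rule integral_le)
    show "(\<lambda>t. 2 * L * (norm (\<phi> t))\<^sup>2 + (norm (\<phi>' t))\<^sup>2 / L) integrable_on {c..c+1}"
      using L by (intro integrable_continuous_real continuous_intros cS) auto
    show "(norm (\<phi> t))\<^sup>2 + w t \<le> 2 * L * (norm (\<phi> t))\<^sup>2 + (norm (\<phi>' t))\<^sup>2 / L" for t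
      using mult_right_mono[OF L, of "(norm (\<phi> t))\<^sup>2"] by (simp add: w_def algebra_simps)
  qed (use i2 wi in \<open>auto intro: integrable_add\<close>)
  finally have *: "(norm (\<phi> s))\<^sup>2 \<le> integral {c..c+1} (\<lambda>t. 2 * L * (norm (\<phi> t))\<^sup>2 + (norm (\<phi>' t))\<^sup>2 / L)" .
  have "(\<lambda>t. 2 * L * (norm (\<phi> t))\<^sup>2 + (norm (\<phi>' t))\<^sup>2 / L) integrable_on {c..c+1}"
    using L by (intro integrable_continuous_real continuous_intros cS) auto
  then have "(\<integral>\<^sup>+t. ennreal (2 * L * (norm (\<phi> t))\<^sup>2 + (norm (\<phi>' t))\<^sup>2 / L) * indicator {c..c+1} t \<partial>lborel)
      = ennreal (integral {c..c+1} (\<lambda>t. 2 * L * (norm (\<phi> t))\<^sup>2 + (norm (\<phi>' t))\<^sup>2 / L))"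
    using L by (intro nn_integral_has_integral_lebesgue') (auto intro: integrable_integral)
  with * show ?thesis by (simp add: ennreal_leI)
qed

section \<open>Unit cells, and merging of two points coordinate by coordinate\<close>

definition cell :: "int^'n \<Rightarrow> (real^'n::finite) set" where
  "cell k = {x. \<forall>i. \<lfloor>x $ i\<rfloor> = k $ i}"

lemma measurable_cell[measurable]: "cell k \<in> sets borel"
proof -
  have "cell k = {x \<in> space borel. \<forall>i. \<lfloor>x $ i\<rfloor> = k $ i}" by (simp add: cell_def)
  also have "\<dots> \<in> sets borel" by measurable
  finally show ?thesis .
qed

text \<open>Cells are half-open so that they partition the space; the closed intervals given here
  suffice for the Sobolev and moment estimates.\<close>

lemma mem_cellD: "x \<in> cell k \<Longrightarrow> x $ i \<in> {of_int (k $ i)..of_int (k $ i) + 1}"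
  unfolding cell_def by (auto simp: floor_eq_iff dest!: spec[of _ i])

lemma emeasure_cell_le: "emeasure lborel (cell (k :: int^'n::finite)) \<le> 1"
proof -
  let ?C = "cbox (\<chi> i. of_int (k $ i)) (\<chi> i. of_int (k $ i) + 1) :: (real^'n) set"
  have "cell k \<subseteq> ?C"
    using mem_cellD by (fastforce simp: mem_box_cart)
  then have "emeasure lborel (cell k) \<le> emeasure lborel ?C"
    by (intro emeasure_mono) auto
  also have "emeasure lborel ?C = ennreal (\<Prod>b\<in>Basis. ((\<chi> i. of_int (k $ i) + 1) - (\<chi> i. of_int (k $ i)) :: real^'n) \<bullet> b)"
    by (rule emeasure_lborel_cbox) (auto simp: Basis_vec_def inner_axis)
  also have "\<dots> = 1" by (simp add: prod_Basis_vec inner_axis)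
  finally show ?thesis .
qed

text \<open>\<open>mrg J x y\<close> agrees with \<open>x\<close> in the coordinates of \<open>J\<close> and with \<open>y\<close> in the others.\<close>

definition mrg :: "'n set \<Rightarrow> real^'n \<Rightarrow> real^'n \<Rightarrow> real^'n::finite" where
  "mrg J x y = y + (\<Sum>j\<in>J. (x $ j - y $ j) *\<^sub>R axis j 1)"

lemma mrg_empty: "mrg {} x y = y" by (simp add: mrg_def)

text \<open>Taking one more coordinate from \<open>x\<close> amounts to moving the base point along
  that axis before merging; the moved points form the one-parameter family to which the Sobolev
  inequality is applied.\<close>

lemma mrg_insert: "i \<notin> J \<Longrightarrow> mrg (insert i J) x y = mrg J x (y + (x $ i - y $ i) *\<^sub>R axis i 1)"
  by (subst mrg_def, subst sum.insert) (auto simp: mrg_def axis_def intro!: sum.cong)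

lemma mrg_shift: "i \<notin> J \<Longrightarrow> mrg J x (y + t *\<^sub>R axis i 1) = mrg J x y + t *\<^sub>R axis i 1"
  by (auto simp: mrg_def axis_def intro!: sum.cong)

lemma mrg_UNIV: "mrg UNIV x y = x"
  by (auto simp: mrg_def vec_eq_iff axis_def sum_distrib_left if_distrib cong: if_cong)

lemma measurable_vec_nth_comp[measurable (raw)]:
  fixes f :: "'a \<Rightarrow> real^'n::finite"
  shows "f \<in> borel_measurable M \<Longrightarrow> (\<lambda>x. f x $ j) \<in> borel_measurable M"
  by (rule measurable_compose[of f M borel]) (auto intro!: borel_measurable_continuous_onI continuous_intros)

lemma measurable_axis_mult[measurable (raw)]:
  "f \<in> borel_measurable M \<Longrightarrow> (\<lambda>x. f x *\<^sub>R axis j (1::real)) \<in> borel_measurable M"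
  by (intro borel_measurable_scaleR) auto

text \<open>The oscillatory integral \<open>\<Phi> S y x\<close> has amplitude frozen at \<open>y\<close>; the coordinates of \<open>y\<close> are
  set equal to those of \<open>x\<close> one at a time, each at the cost of one one-dimensional Sobolev inequality.\<close>

locale amplitude =
  fixes D :: "'n::finite list \<Rightarrow> real^'n \<Rightarrow> real^'n \<Rightarrow> complex" and H :: "real^'n \<Rightarrow> real" and \<mu> :: real
  assumes measD: "\<And>S. distinct S \<Longrightarrow> (\<lambda>p. D S (fst p) (snd p)) \<in> borel_measurable borel"
    and contD: "\<And>S \<xi>. distinct S \<Longrightarrow> continuous_on UNIV (\<lambda>y. D S y \<xi>)"
    and bndD: "\<And>S y \<xi>. distinct S \<Longrightarrow> norm (D S y \<xi>) \<le> \<mu> ^ length S * H \<xi>"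
    and H: "integrable lborel H"
    and dD: "\<And>S i y \<xi>. distinct (i # S) \<Longrightarrow>
      ((\<lambda>t. D S (y + t *\<^sub>R axis i 1) \<xi>) has_vector_derivative D (i # S) y \<xi>) (at 0)"
    and lam: "\<mu> \<ge> 1"
begin

definition "\<Phi> S y x = (LINT \<xi>|lborel. D S y \<xi> * cis (x \<bullet> \<xi>))"

lemma measD'[measurable (raw)]:
  "distinct S \<Longrightarrow> f \<in> borel_measurable M \<Longrightarrow> g \<in> borel_measurable M \<Longrightarrow> (\<lambda>p. D S (f p) (g p)) \<in> borel_measurable M"
  using measurable_compose[OF borel_measurable_Pair measD, of f M g] by simp

lemma H_nonneg: "H \<xi> \<ge> 0"
  using order_trans[OF norm_ge_zero bndD[of "[]" 0 \<xi>]] by simp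

lemma integrable_D: "distinct S \<Longrightarrow> integrable lborel (\<lambda>\<xi>. D S y \<xi> * cis (x \<bullet> \<xi>))"
  using lam H_nonneg
  by (intro Bochner_Integration.integrable_bound[OF integrable_mult_right[OF H, of "\<mu> ^ length S"]])
    (auto simp: norm_mult bndD abs_mult intro!: AE_I2)

lemma measurable_\<Phi>[measurable (raw)]:
  assumes S: "distinct S" and [measurable]: "f \<in> borel_measurable M" "g \<in> borel_measurable M"
  shows "(\<lambda>p. \<Phi> S (f p) (g p)) \<in> borel_measurable M"
proof -
  have "(\<lambda>p. \<Phi> S (fst p) (snd p)) \<in> borel_measurable (borel \<Otimes>\<^sub>M borel)"
    unfolding \<Phi>_def using S by measurable
  then have "(\<lambda>p. \<Phi> S (fst p) (snd p)) \<in> borel_measurable borel" by (simp add: borel_prod)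
  from measurable_compose[OF borel_measurable_Pair this, of f M g] show ?thesis by simp
qed

text \<open>The one-dimensional Sobolev inequality asks for a continuous derivative; dominated
  convergence with the majorant \<open>H\<close> provides it.\<close>

lemma \<Phi>_continuous:
  assumes S: "distinct S" shows "continuous_on UNIV (\<lambda>t. \<Phi> S (y + t *\<^sub>R v) x)"
  unfolding continuous_on_sequentially comp_def
proof (intro allI ballI impI)
  fix X :: "nat \<Rightarrow> real" and t assume X: "(\<forall>n. X n \<in> UNIV) \<and> X \<longlonglongrightarrow> t"
  show "(\<lambda>n. \<Phi> S (y + X n *\<^sub>R v) x) \<longlonglongrightarrow> \<Phi> S (y + t *\<^sub>R v) x"
    unfolding \<Phi>_def
  proof (rule integral_dominated_convergence[OF _ _ integrable_mult_right[OF H, of "\<mu> ^ length S"]])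
    have "(\<lambda>n. D S (y + X n *\<^sub>R v) \<xi>) \<longlonglongrightarrow> D S (y + t *\<^sub>R v) \<xi>" for \<xi>
      using X by (intro continuous_on_tendsto_compose[OF contD[OF S]] tendsto_intros) auto
    then show "AE \<xi> in lborel. (\<lambda>n. D S (y + X n *\<^sub>R v) \<xi> * cis (x \<bullet> \<xi>)) \<longlonglongrightarrow> D S (y + t *\<^sub>R v) \<xi> * cis (x \<bullet> \<xi>)"
      by (intro AE_I2 tendsto_intros)
  qed (use S in \<open>auto simp: norm_mult bndD\<close>)
qed

lemma \<Phi>_deriv:
  assumes S: "distinct (i # S)"
  shows "((\<lambda>t. \<Phi> S (y + t *\<^sub>R axis i 1) x) has_vector_derivative \<Phi> (i # S) (y + t *\<^sub>R axis i 1) x) (at t)"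
  unfolding \<Phi>_def
proof (rule has_vector_derivative_integral[OF _ _ _ _ integrable_mult_right[OF H, of "\<mu> ^ length (i # S)"],
      where F' = "\<lambda>t \<xi>. D (i # S) (y + t *\<^sub>R axis i 1) \<xi> * cis (x \<bullet> \<xi>)"])
  have "((\<lambda>t. D S (y + t *\<^sub>R axis i 1) \<xi>) has_vector_derivative D (i # S) (y + t *\<^sub>R axis i 1) \<xi>) (at t)" for t \<xi>
    using has_vector_derivative_ddir_at[of "\<lambda>y. D S y \<xi>" "axis i 1" y t] dD[OF S] ddir_eqI[OF dD[OF S]]
    by (metis differentiableI_vector)
  then show "((\<lambda>t. D S (y + t *\<^sub>R axis i 1) \<xi> * cis (x \<bullet> \<xi>)) has_vector_derivative D (i # S) (y + t *\<^sub>R axis i 1) \<xi> * cis (x \<bullet> \<xi>)) (at t)" for t \<xi>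
    by (rule has_vector_derivative_mult_left)
  show "norm (D (i # S) (y + t *\<^sub>R axis i 1) \<xi> * cis (x \<bullet> \<xi>)) \<le> \<mu> ^ length (i # S) * H \<xi>" for \<xi> t
    using bndD[OF S] by (simp add: norm_mult)
qed (use S integrable_D in auto)

text \<open>Induction on the set \<open>J\<close> of coordinates in which the amplitude still moves
  with x. The list \<open>S\<close> records directions already differentiated; being distinct, it
  never exceeds the dimension. With \<open>J\<close> empty the amplitude is fixed and Plancherel's
  inequality applies.\<close>

lemma local_L2_aux:
  assumes "finite J"
  shows "distinct S \<Longrightarrow> set S \<inter> J = {} \<Longrightarrow>
    (\<integral>\<^sup>+x. ennreal ((norm (\<Phi> S (mrg J x y) x))\<^sup>2) * indicator (cell q) x \<partial>lborel)
    \<le> ennreal ((3 * \<mu>) ^ card J * (\<mu> ^ length S)\<^sup>2 * (2 * pi) ^ CARD('n)) * (\<integral>\<^sup>+\<xi>. ennreal ((H \<xi>)\<^sup>2) \<partial>lborel)"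
  using assms
proof (induction J arbitrary: S y rule: finite_induct)
  case empty
  note S = \<open>distinct S\<close>
  have [measurable]: "H \<in> borel_measurable borel" using H by simp
  have i: "integrable lborel (\<lambda>\<xi>. cnj (D S y \<xi>))"
    using integrable_D[OF S, of y 0] by simp
  \<comment> \<open>\<open>fourier\<close> has the opposite sign in its exponent, hence the two
    conjugations.\<close>
  have eq: "norm (\<Phi> S y x) = norm (fourier (\<lambda>\<xi>. cnj (D S y \<xi>)) x)" for x
  proof -
    have "fourier (\<lambda>\<xi>. cnj (D S y \<xi>)) x = (LINT \<xi>|lborel. cnj (D S y \<xi> * cis (x \<bullet> \<xi>)))"
      unfolding fourier_def by (simp add: cis_cnj inner_commute del: Bochner_Integration.integral_cnj)
    also have "\<dots> = cnj (\<Phi> S y x)" unfolding \<Phi>_def by (rule Bochner_Integration.integral_cnj)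
    finally show ?thesis by simp
  qed
  have "(\<integral>\<^sup>+x. ennreal ((norm (\<Phi> S (mrg {} x y) x))\<^sup>2) * indicator (cell q) x \<partial>lborel)
      \<le> (\<integral>\<^sup>+x. ennreal ((norm (fourier (\<lambda>\<xi>. cnj (D S y \<xi>)) x))\<^sup>2) \<partial>lborel)"
    by (intro nn_integral_mono) (auto simp: mrg_empty eq indicator_def)
  also have "\<dots> \<le> ennreal ((2 * pi) ^ CARD('n)) * (\<integral>\<^sup>+\<xi>. ennreal ((norm (D S y \<xi>))\<^sup>2) \<partial>lborel)"
    using plancherel_le[OF i] by simp
  also have "\<dots> \<le> ennreal ((2 * pi) ^ CARD('n)) * (\<integral>\<^sup>+\<xi>. ennreal ((\<mu> ^ length S)\<^sup>2) * ennreal ((H \<xi>)\<^sup>2) \<partial>lborel)"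
    using power_mono[OF bndD[OF S] norm_ge_zero, of _ _ 2] lam
    by (intro mult_left_mono nn_integral_mono) (auto simp: power_mult_distrib simp flip: ennreal_mult intro!: ennreal_leI)
  also have "\<dots> = ennreal ((3 * \<mu>) ^ card {} * (\<mu> ^ length S)\<^sup>2 * (2 * pi) ^ CARD('n)) * (\<integral>\<^sup>+\<xi>. ennreal ((H \<xi>)\<^sup>2) \<partial>lborel)"
    by (subst nn_integral_cmult) (auto simp: ennreal_mult mult_ac)
  finally show ?case .
next
  case (insert i J)
  define I where "I = (\<integral>\<^sup>+\<xi>. ennreal ((H \<xi>)\<^sup>2) \<partial>lborel)"
  have iS: "distinct (i # S)" "set (i # S) \<inter> J = {}" "distinct S" "set S \<inter> J = {}"
    using insert by auto
  note [measurable (raw)] = measurable_\<Phi>[OF iS(1)] measurable_\<Phi>[OF iS(3)]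
  define Y where "Y t = y + (t - y $ i) *\<^sub>R axis i 1" for t
  have [measurable]: "Y \<in> borel_measurable borel" unfolding Y_def by measurable
  have mrgm[measurable (raw)]: "f \<in> borel_measurable M \<Longrightarrow> g \<in> borel_measurable M \<Longrightarrow> (\<lambda>p. mrg J (f p) (g p)) \<in> borel_measurable M" for f g M
    unfolding mrg_def
    by (intro borel_measurable_add borel_measurable_sum measurable_axis_mult borel_measurable_diff measurable_vec_nth_comp)
  have [measurable]: "{real_of_int (q $ i)..real_of_int (q $ i) + 1} \<in> sets borel" by simp
  let ?c = "real_of_int (q $ i)"
  let ?w = "\<lambda>x t. ennreal (2 * \<mu> * (norm (\<Phi> S (mrg J x (Y t)) x))\<^sup>2 + (norm (\<Phi> (i # S) (mrg J x (Y t)) x))\<^sup>2 / \<mu>)"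
  have "ennreal ((norm (\<Phi> S (mrg (insert i J) x y) x))\<^sup>2) * indicator (cell q) x
      \<le> (\<integral>\<^sup>+t. ?w x t * indicator {?c..?c+1} t * indicator (cell q) x \<partial>lborel)" for x
  proof (cases "x \<in> cell q")
    case True
    have e: "mrg J x (Y t) = (mrg J x y + (- (y $ i)) *\<^sub>R axis i 1) + t *\<^sub>R axis i 1" for t
    proof -
      have "Y t = y + (t + (- (y $ i))) *\<^sub>R axis i 1" by (simp add: Y_def)
      then show ?thesis using mrg_shift[OF insert(2), of x y "t + (- (y $ i))"]
        by (simp add: scaleR_left_diff_distrib add_ac)
    qed
    \<comment> \<open>The quantity to be bounded is the value at t = x_i of a function of t, and x_i
      lies in the unit interval of the cell.\<close>
    have "ennreal ((norm (\<Phi> S (mrg J x (Y (x $ i))) x))\<^sup>2) \<le> (\<integral>\<^sup>+t. ?w x t * indicator {?c..?c+1} t \<partial>lborel)"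
      unfolding e
      by (rule sobolev_interval[OF \<Phi>_deriv[OF iS(1)] \<Phi>_continuous[OF iS(1)] lam mem_cellD[OF True]])
    then show ?thesis using True by (simp add: mrg_insert[OF insert(2)] Y_def)
  qed simp
  then have "(\<integral>\<^sup>+x. ennreal ((norm (\<Phi> S (mrg (insert i J) x y) x))\<^sup>2) * indicator (cell q) x \<partial>lborel)
      \<le> (\<integral>\<^sup>+x. (\<integral>\<^sup>+t. ?w x t * indicator {?c..?c+1} t * indicator (cell q) x \<partial>lborel) \<partial>lborel)"
    by (intro nn_integral_mono)
  \<comment> \<open>With t outside, the i-th coordinate of the amplitude no longer depends on x, and
    the induction hypothesis applies with base point \<open>Y t\<close>.\<close>
  also have "\<dots> = (\<integral>\<^sup>+t. (\<integral>\<^sup>+x. ?w x t * indicator {?c..?c+1} t * indicator (cell q) x \<partial>lborel) \<partial>lborel)"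
    by (rule lborel_pair.Fubini') measurable
  also have "\<dots> \<le> (\<integral>\<^sup>+t. ennreal ((3 * \<mu>) ^ card (insert i J) * (\<mu> ^ length S)\<^sup>2 * (2 * pi) ^ CARD('n)) * I * indicator {?c..?c+1} t \<partial>lborel)"
  proof (intro nn_integral_mono)
    fix t
    let ?P = "ennreal ((3 * \<mu>) ^ card J * (\<mu> ^ length S)\<^sup>2 * (2 * pi) ^ CARD('n)) * I"
    have "(\<integral>\<^sup>+x. ?w x t * indicator {?c..?c+1} t * indicator (cell q) x \<partial>lborel) =
      (\<integral>\<^sup>+x. ennreal (2 * \<mu>) * (ennreal ((norm (\<Phi> S (mrg J x (Y t)) x))\<^sup>2) * indicator (cell q) x)
         + ennreal (1 / \<mu>) * (ennreal ((norm (\<Phi> (i # S) (mrg J x (Y t)) x))\<^sup>2) * indicator (cell q) x) \<partial>lborel) * indicator {?c..?c+1} t"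
    proof (cases "t \<in> {?c..?c+1}")
      case True
      have "?w x t = ennreal (2 * \<mu>) * ennreal ((norm (\<Phi> S (mrg J x (Y t)) x))\<^sup>2) + ennreal (1 / \<mu>) * ennreal ((norm (\<Phi> (i # S) (mrg J x (Y t)) x))\<^sup>2)" for x
        using lam by (simp flip: ennreal_mult ennreal_plus)
      then show ?thesis using True by (simp add: algebra_simps)
    qed simp
    also have "\<dots> = (ennreal (2 * \<mu>) * (\<integral>\<^sup>+x. ennreal ((norm (\<Phi> S (mrg J x (Y t)) x))\<^sup>2) * indicator (cell q) x \<partial>lborel)
         + ennreal (1 / \<mu>) * (\<integral>\<^sup>+x. ennreal ((norm (\<Phi> (i # S) (mrg J x (Y t)) x))\<^sup>2) * indicator (cell q) x \<partial>lborel)) * indicator {?c..?c+1} t"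
      by (subst nn_integral_add, measurable) (simp_all add: nn_integral_cmult)
    also have "\<dots> \<le> (ennreal (2 * \<mu>) * ?P + ennreal (1 / \<mu>) * (ennreal ((3 * \<mu>) ^ card J * (\<mu> ^ length (i # S))\<^sup>2 * (2 * pi) ^ CARD('n)) * I)) * indicator {?c..?c+1} t"
      unfolding I_def by (intro mult_right_mono add_mono mult_left_mono insert.IH iS) auto
    also have "\<dots> = ennreal ((3 * \<mu>) ^ card (insert i J) * (\<mu> ^ length S)\<^sup>2 * (2 * pi) ^ CARD('n)) * I * indicator {?c..?c+1} t"
    proof -
      define R where "R = (3 * \<mu>) ^ card J * (\<mu> ^ length S)\<^sup>2 * (2 * pi) ^ CARD('n)"
      have R: "R \<ge> 0" using lam by (simp add: R_def)
      \<comment> \<open>The differentiated term carries an extra \<mu>^2 against the Sobolev weight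
        1/\<mu>, so a coordinate costs 2 \<mu> + \<mu> = 3 \<mu>.\<close>
      have "ennreal (2 * \<mu>) * (ennreal R * I) + ennreal (1 / \<mu>) * (ennreal (\<mu>\<^sup>2 * R) * I) = (ennreal (2 * \<mu> * R) + ennreal (1 / \<mu> * (\<mu>\<^sup>2 * R))) * I"
      proof -
        have "ennreal (2 * \<mu> * R) = ennreal (2 * \<mu>) * ennreal R"
          "ennreal (1 / \<mu> * (\<mu>\<^sup>2 * R)) = ennreal (1 / \<mu>) * ennreal (\<mu>\<^sup>2 * R)"
          using lam R by (intro ennreal_mult; simp)+
        then show ?thesis by (simp only: distrib_right mult.assoc)
      qed
      also have "ennreal (2 * \<mu> * R) + ennreal (1 / \<mu> * (\<mu>\<^sup>2 * R)) = ennreal (3 * \<mu> * R)"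
        using lam R by (subst ennreal_plus[symmetric]) (auto simp: power2_eq_square)
      finally show ?thesis using insert(1,2)
        by (simp add: R_def power_mult_distrib mult_ac)
    qed
    finally show "(\<integral>\<^sup>+x. ?w x t * indicator {?c..?c+1} t * indicator (cell q) x \<partial>lborel)
      \<le> ennreal ((3 * \<mu>) ^ card (insert i J) * (\<mu> ^ length S)\<^sup>2 * (2 * pi) ^ CARD('n)) * I * indicator {?c..?c+1} t" .
  qed
  also have "\<dots> = ennreal ((3 * \<mu>) ^ card (insert i J) * (\<mu> ^ length S)\<^sup>2 * (2 * pi) ^ CARD('n)) * I"
    by (subst nn_integral_cmult) auto
  finally show ?case unfolding I_def .
qed

text \<open>With \<open>J = UNIV\<close> the amplitude is evaluated at x itself and the auxiliary
  base point 0 disappears. Each dimension contributes 3 \<mu> from the Sobolev step and 2 pi from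
  Plancherel.\<close>

lemma local_L2:
  "(\<integral>\<^sup>+x. ennreal ((norm (LINT \<xi>|lborel. D [] x \<xi> * cis (x \<bullet> \<xi>)))\<^sup>2) * indicator (cell q) x \<partial>lborel)
    \<le> ennreal ((6 * pi * \<mu>) ^ CARD('n)) * (\<integral>\<^sup>+\<xi>. ennreal ((H \<xi>)\<^sup>2) \<partial>lborel)"
proof -
  have "(3 * \<mu>) ^ CARD('n) * (2 * pi) ^ CARD('n) = (6 * pi * \<mu>) ^ CARD('n)"
  proof -
    have "6 * pi * \<mu> = (3 * \<mu>) * (2 * pi)" by simp
    then show ?thesis by (simp only: power_mult_distrib)
  qed
  then show ?thesis
    using local_L2_aux[of UNIV "[]" 0 q] by (simp add: mrg_UNIV \<Phi>_def)
qed

end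

section \<open>Frequency-localised symbols at unit scale\<close>

definition alld :: "'n::finite triple set" where
  "alld = x_dirs \<union> xi_dirs \<union> eta_dirs"

definition nx :: "'n::finite triple list \<Rightarrow> nat" where
  "nx vs = length (filter (\<lambda>v. v \<in> x_dirs) vs)"

definition fbox :: "real \<Rightarrow> (real^'n::finite) set" where
  "fbox N = {\<xi>. \<forall>i. \<bar>\<xi> $ i\<bar> \<le> N}"

text \<open>The normal form of a dilated dyadic piece: \<open>A\<close> is the amplitude,
  \<open>L\<close> the price of an x-derivative, frequency derivatives are free, and
  \<open>N\<close> is the half side of the frequency box. Of the \<open>CARD('n) + M\<close> orders
  controlled, \<open>CARD('n)\<close> serve the Sobolev steps on a cell and \<open>M\<close> the
  integrations by parts.\<close>

definition usym :: "nat \<Rightarrow> real \<Rightarrow> real \<Rightarrow> real \<Rightarrow> ('n::finite triple \<Rightarrow> complex) \<Rightarrow> bool" where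
  "usym M A L N b \<longleftrightarrow> smooth_on_dirs alld b \<and>
     (\<forall>vs z. set vs \<subseteq> alld \<longrightarrow> length vs \<le> CARD('n) + M \<longrightarrow> norm (ddirs vs b z) \<le> A * L ^ nx vs) \<and>
     (\<forall>x \<xi> \<eta>. \<xi> \<notin> fbox N \<or> \<eta> \<notin> fbox N \<longrightarrow> b (x, \<xi>, \<eta>) = 0)"

lemma usym_mono: "usym M A L N b \<Longrightarrow> M' \<le> M \<Longrightarrow> usym M' A L N b"
  unfolding usym_def by auto

lemma usym_smooth: "usym M A L N b \<Longrightarrow> smooth_on_dirs alld b"
  by (simp add: usym_def)

lemma usym_bound:
  assumes "usym M A L N b" shows "norm (b z) \<le> A"
proof -
  have "norm (ddirs [] b z) \<le> A * L ^ nx ([] :: 'a triple list)"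
    using assms unfolding usym_def by (metis empty_subsetI le0 list.set(1) list.size(3))
  then show ?thesis by (simp add: nx_def)
qed

lemma fbox_cbox: "fbox N = cbox (\<chi> i. - N) (\<chi> i. N)"
  by (auto simp: fbox_def mem_box_cart abs_le_iff) (metis minus_le_iff)+

lemma closed_fbox: "closed (fbox N)" by (simp add: fbox_cbox closed_cbox)

lemma measurable_fbox[measurable]: "fbox N \<in> sets borel" by (simp add: fbox_cbox)

lemma emeasure_fbox: "N \<ge> 0 \<Longrightarrow> emeasure lborel (fbox N :: (real^'n::finite) set) = ennreal ((2 * N) ^ CARD('n))"
proof -
  assume N: "N \<ge> 0"
  have "emeasure lborel (fbox N :: (real^'n) set) = ennreal (\<Prod>b\<in>Basis. ((\<chi> i. N) - (\<chi> i. - N) :: real^'n) \<bullet> b)"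
    unfolding fbox_cbox by (rule emeasure_lborel_cbox) (use N in \<open>auto simp: Basis_vec_def inner_axis\<close>)
  also have "\<dots> = ennreal ((2 * N) ^ CARD('n))" by (simp add: prod_Basis_vec inner_axis)
  finally show ?thesis .
qed

text \<open>The complement of the closed box is open, so locality of derivatives applies.\<close>

lemma usym_supp:
  assumes b: "usym M A L N b" and o: "\<xi> \<notin> fbox N \<or> \<eta> \<notin> fbox N"
  shows "ddirs vs b (x, \<xi>, \<eta>) = 0"
proof (rule ddirs_zero_on_open)
  let ?U = "(\<lambda>z. fst (snd z)) -` (- fbox N) \<union> (\<lambda>z. snd (snd z)) -` (- fbox N)"
  show "open ?U"
    by (intro open_Un open_vimage continuous_intros) (use closed_fbox in auto)
  show "(x, \<xi>, \<eta>) \<in> ?U" using o by auto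
  show "b z = 0" if "z \<in> ?U" for z
    using b that by (cases z) (auto simp: usym_def)
qed

section \<open>Measurability and the operator as an iterated oscillatory integral\<close>

definition xdir :: "'n \<Rightarrow> 'n::finite triple" where "xdir i = (axis i 1, 0, 0)"

lemma xdir_in: "xdir i \<in> x_dirs" "xdir i \<in> alld" by (auto simp: xdir_def x_dirs_def alld_def)

lemma measurable_triple[measurable (raw)]:
  fixes b :: "'n::finite triple \<Rightarrow> complex"
  assumes "smooth_on_dirs alld b" "set vs \<subseteq> alld"
    and "f \<in> borel_measurable M" "g \<in> borel_measurable M" "h \<in> borel_measurable M"
  shows "(\<lambda>p. ddirs vs b (f p, g p, h p)) \<in> borel_measurable M"
  by (rule measurable_compose[where g="ddirs vs b" and f="\<lambda>p. (f p, g p, h p)" and N=borel], intro borel_measurable_Pair assms)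
    (intro borel_measurable_continuous_onI smooth_on_dirs_continuous[of alld] smooth_on_dirs_ddirs assms)

lemma measurable_triple0[measurable (raw)]:
  fixes b :: "'n::finite triple \<Rightarrow> complex"
  assumes "smooth_on_dirs alld b"
    and "f \<in> borel_measurable M" "g \<in> borel_measurable M" "h \<in> borel_measurable M"
  shows "(\<lambda>p. b (f p, g p, h p)) \<in> borel_measurable M"
  using measurable_triple[of b "[]"] assms by simp

lemma measurable_fourier_comp[measurable (raw)]:
  assumes "f \<in> borel_measurable borel" "g \<in> borel_measurable M"
  shows "(\<lambda>x. fourier f (g x)) \<in> borel_measurable M"
  by (rule measurable_compose[OF assms(2) measurable_fourier[OF assms(1)]])

text \<open>For fixed \<xi> the inner integral becomes a linear oscillatory integral in \<eta>. No
  convergence is involved, since constant factors always move out of the integral.\<close>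

lemma bipsido_eq:
  "bipsido b f g x = (LINT \<xi>|lborel. fourier f \<xi> * cis (x \<bullet> \<xi>) * (LINT \<eta>|lborel. b (x, \<xi>, \<eta>) * fourier g \<eta> * cis (x \<bullet> \<eta>)))"
proof -
  have "(LINT \<eta>|lborel. b (x, \<xi>, \<eta>) * cis (x \<bullet> (\<xi> + \<eta>)) * fourier f \<xi> * fourier g \<eta>)
     = fourier f \<xi> * cis (x \<bullet> \<xi>) * (LINT \<eta>|lborel. b (x, \<xi>, \<eta>) * fourier g \<eta> * cis (x \<bullet> \<eta>))" for \<xi>
    unfolding Bochner_Integration.integral_mult_right_zero[symmetric]
    by (intro Bochner_Integration.integral_cong) (auto simp: inner_add_right cis_mult[symmetric])
  then show ?thesis by (simp add: bipsido_def)
qed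

lemma measurable_bipsido:
  fixes b :: "'n::finite triple \<Rightarrow> complex"
  assumes [measurable]: "smooth_on_dirs alld b" "f \<in> borel_measurable borel" "g \<in> borel_measurable borel"
  shows "bipsido b f g \<in> borel_measurable borel"
  unfolding bipsido_eq[abs_def] by measurable

text \<open>The locale is used for fixed \<xi>: \<open>D S\<close> takes the x-derivatives listed in
  \<open>S\<close>, \<open>H\<close> is A |\<open>fourier g\<close>| on the box, and \<mu> is L. A
  distinct list has at most \<open>CARD('n)\<close> entries, so \<open>usym 0\<close> controls all
  of them.\<close>

lemma inner_L2:
  fixes b :: "'n::finite triple \<Rightarrow> complex"
  assumes b: "usym 0 A L N b" and L: "L \<ge> 1" and g: "integrable lborel g"
    and sg: "(\<integral>\<^sup>+\<eta>. ennreal ((norm (fourier g \<eta>))\<^sup>2) * indicator (fbox N) \<eta> \<partial>lborel) \<le> ennreal (sg\<^sup>2)"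
  shows "(\<integral>\<^sup>+x. ennreal ((norm (LINT \<eta>|lborel. b (x, \<xi>, \<eta>) * fourier g \<eta> * cis (x \<bullet> \<eta>)))\<^sup>2) * indicator (cell q) x \<partial>lborel)
    \<le> ennreal ((6 * pi * L) ^ CARD('n) * (A\<^sup>2 * sg\<^sup>2))"
proof -
  have [measurable]: "g \<in> borel_measurable borel" using g by simp
  have sm: "smooth_on_dirs alld b" using b by (rule usym_smooth)
  have A: "A \<ge> 0" using usym_bound[OF b, of 0] norm_ge_zero order_trans by blast
  define D where "D S y \<eta> = ddirs (map xdir S) b (y, \<xi>, \<eta>) * fourier g \<eta>" for S and y \<eta> :: "real^'n"
  define H where "H \<eta> = A * (indicator (fbox N) \<eta> * norm (fourier g \<eta>))" for \<eta> :: "real^'n"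
  have sub: "set (map xdir S) \<subseteq> alld" for S :: "'n list" using xdir_in by auto
  have nxS: "nx (map xdir S) = length S" for S :: "'n list"
    unfolding nx_def using xdir_in by (induction S) auto
  have len: "length S \<le> CARD('n)" if "distinct S" for S :: "'n list"
    using distinct_card[OF that] card_mono[of "UNIV :: 'n set" "set S"] by auto
  interpret amplitude D H L
  proof
    fix S :: "'n list" assume S: "distinct S"
    show "(\<lambda>p. D S (fst p) (snd p)) \<in> borel_measurable borel"
      unfolding D_def using sm sub[of S] by (simp add: borel_prod[symmetric])
    show "continuous_on UNIV (\<lambda>y. D S y \<eta>)" for \<eta>
      unfolding D_def
      by (intro continuous_on_mult continuous_on_const continuous_on_compose2[OF smooth_on_dirs_continuous[OF smooth_on_dirs_ddirs[OF sm sub]]]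
          continuous_on_Pair continuous_on_id) auto
    show "norm (D S y \<eta>) \<le> L ^ length S * H \<eta>" for y \<eta>
    proof (cases "\<eta> \<in> fbox N")
      case True
      have "norm (ddirs (map xdir S) b (y, \<xi>, \<eta>)) \<le> A * L ^ length S"
        using b len[OF S] sub[of S] nxS[of S] unfolding usym_def by (metis add.right_neutral length_map)
      then have "norm (D S y \<eta>) \<le> A * L ^ length S * norm (fourier g \<eta>)"
        unfolding D_def norm_mult by (rule mult_right_mono) simp
      then show ?thesis using True by (simp add: H_def mult_ac)
    qed (use usym_supp[OF b, of \<xi> \<eta>] in \<open>simp add: D_def H_def\<close>)
  next
    have "emeasure lborel (fbox N :: (real^'n) set) < \<infinity>" unfolding fbox_cbox by (rule emeasure_lborel_cbox_finite)
    then have "integrable lborel (indicator (fbox N) :: real^'n \<Rightarrow> real)"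
      by (intro integrable_real_indicator) auto
    then have "integrable lborel (\<lambda>\<eta>::real^'n. (LINT x|lborel. norm (g x)) * indicator (fbox N) \<eta> :: real)" by simp
    then have "integrable lborel (\<lambda>\<eta>::real^'n. indicator (fbox N) \<eta> * norm (fourier g \<eta>))"
      by (rule Bochner_Integration.integrable_bound)
        (auto intro!: AE_I2 simp: abs_mult indicator_def norm_fourier_le[OF g])
    then show "integrable lborel H" unfolding H_def by simp
  next
    fix S :: "'n list" and i y \<eta> assume "distinct (i # S)"
    have "((\<lambda>t. ddirs (map xdir S) b ((y, \<xi>, \<eta>) + t *\<^sub>R xdir i)) has_vector_derivative ddir (xdir i) (ddirs (map xdir S) b) (y, \<xi>, \<eta>)) (at 0)"
      by (intro has_vector_derivative_ddir smooth_on_dirs_differentiable[of alld] smooth_on_dirs_ddirs sm sub xdir_in)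
    then have "((\<lambda>t. ddirs (map xdir S) b ((y, \<xi>, \<eta>) + t *\<^sub>R xdir i) * fourier g \<eta>) has_vector_derivative D (i # S) y \<eta>) (at 0)"
      unfolding D_def by (intro has_vector_derivative_mult_left) simp
    then show "((\<lambda>t. D S (y + t *\<^sub>R axis i 1) \<eta>) has_vector_derivative D (i # S) y \<eta>) (at 0)"
      unfolding D_def by (simp add: xdir_def)
  qed (rule L)
  have "(\<integral>\<^sup>+\<eta>. ennreal ((H \<eta>)\<^sup>2) \<partial>lborel) = (\<integral>\<^sup>+\<eta>. ennreal (A\<^sup>2) * (ennreal ((norm (fourier g \<eta>))\<^sup>2) * indicator (fbox N) \<eta>) \<partial>lborel)"
    by (intro nn_integral_cong) (auto simp: H_def indicator_def power_mult_distrib ennreal_mult)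
  also have "\<dots> \<le> ennreal (A\<^sup>2) * ennreal (sg\<^sup>2)"
    by (subst nn_integral_cmult) (auto intro!: mult_left_mono sg)
  finally have HH: "(\<integral>\<^sup>+\<eta>. ennreal ((H \<eta>)\<^sup>2) \<partial>lborel) \<le> ennreal (A\<^sup>2 * sg\<^sup>2)" by (simp add: ennreal_mult)
  have "(\<integral>\<^sup>+x. ennreal ((norm (LINT \<eta>|lborel. D [] x \<eta> * cis (x \<bullet> \<eta>)))\<^sup>2) * indicator (cell q) x \<partial>lborel)
    \<le> ennreal ((6 * pi * L) ^ CARD('n)) * (\<integral>\<^sup>+\<xi>. ennreal ((H \<xi>)\<^sup>2) \<partial>lborel)" by (rule local_L2)
  also have "\<dots> \<le> ennreal ((6 * pi * L) ^ CARD('n)) * ennreal (A\<^sup>2 * sg\<^sup>2)"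
    by (intro mult_left_mono HH) auto
  finally show ?thesis using L by (simp add: D_def ennreal_mult)
qed

section \<open>Square, uniform and L^r bounds on one cell\<close>

lemma nn_box_CS:
  fixes u v :: "real^'n::finite \<Rightarrow> ennreal"
  assumes [measurable]: "u \<in> borel_measurable borel" "v \<in> borel_measurable borel"
  shows "(\<integral>\<^sup>+\<xi>. u \<xi> * v \<xi> * indicator (fbox N) \<xi> \<partial>lborel)\<^sup>2
    \<le> (\<integral>\<^sup>+\<xi>. (u \<xi>)\<^sup>2 * indicator (fbox N) \<xi> \<partial>lborel) * (\<integral>\<^sup>+\<xi>. (v \<xi>)\<^sup>2 * indicator (fbox N) \<xi> \<partial>lborel)"
proof -
  have "(\<integral>\<^sup>+\<xi>. u \<xi> * v \<xi> * indicator (fbox N) \<xi> \<partial>lborel) = (\<integral>\<^sup>+\<xi>. (u \<xi> * indicator (fbox N) \<xi>) * (v \<xi> * indicator (fbox N) \<xi>) \<partial>lborel)"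
    by (intro nn_integral_cong) (auto simp: indicator_def)
  moreover have "(\<integral>\<^sup>+\<xi>. (w \<xi>)\<^sup>2 * indicator (fbox N) \<xi> \<partial>lborel) = (\<integral>\<^sup>+\<xi>. (w \<xi> * indicator (fbox N) \<xi>)\<^sup>2 \<partial>lborel)" for w :: "real^'n \<Rightarrow> ennreal"
    by (intro nn_integral_cong) (auto simp: indicator_def)
  ultimately show ?thesis
    using Cauchy_Schwarz_nn_integral[of "\<lambda>\<xi>. u \<xi> * indicator (fbox N) \<xi>" lborel "\<lambda>\<xi>. v \<xi> * indicator (fbox N) \<xi>"] by simp
qed

lemma inner_outside:
  assumes "usym M A L N b" "\<xi> \<notin> fbox N"
  shows "(LINT \<eta>|lborel. b (x, \<xi>, \<eta>) * fourier g \<eta> * cis (x \<bullet> \<eta>)) = 0"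
  using usym_supp[OF assms(1), of \<xi> _ "[]"] assms(2) by simp

text \<open>Cauchy-Schwarz in \<xi> separates f, Tonelli moves the integral over the cell inside,
  and the estimate for fixed \<xi> is uniform; integrating it over the box costs the volume
  (2N)^n.\<close>

lemma bipsido_L2:
  fixes b :: "'n::finite triple \<Rightarrow> complex"
  assumes b: "usym 0 A L N b" and L: "L \<ge> 1" and N: "N \<ge> 1" and f: "integrable lborel f" and g: "integrable lborel g"
    and sf: "(\<integral>\<^sup>+\<eta>. ennreal ((norm (fourier f \<eta>))\<^sup>2) * indicator (fbox N) \<eta> \<partial>lborel) \<le> ennreal (sf\<^sup>2)"
    and sg: "(\<integral>\<^sup>+\<eta>. ennreal ((norm (fourier g \<eta>))\<^sup>2) * indicator (fbox N) \<eta> \<partial>lborel) \<le> ennreal (sg\<^sup>2)"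
  shows "(\<integral>\<^sup>+x. ennreal ((norm (bipsido b f g x))\<^sup>2) * indicator (cell q) x \<partial>lborel)
    \<le> ennreal ((12 * pi * L * N) ^ CARD('n) * (A * sf * sg)\<^sup>2)"
proof -
  have [measurable]: "f \<in> borel_measurable borel" "g \<in> borel_measurable borel" using f g by auto
  have [measurable]: "smooth_on_dirs alld b" using b by (rule usym_smooth)
  define J where "J x \<xi> = (LINT \<eta>|lborel. b (x, \<xi>, \<eta>) * fourier g \<eta> * cis (x \<bullet> \<eta>))" for x \<xi>
  have J0: "\<xi> \<notin> fbox N \<Longrightarrow> J x \<xi> = 0" for x \<xi> unfolding J_def by (rule inner_outside[OF b])
  have [measurable]: "(\<lambda>p. J (fst p) (snd p)) \<in> borel_measurable (borel \<Otimes>\<^sub>M borel)"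
    unfolding J_def by measurable
  have [measurable]: "(\<lambda>\<xi>. J x \<xi>) \<in> borel_measurable borel" for x
    unfolding J_def by measurable
  have "ennreal ((norm (bipsido b f g x))\<^sup>2) \<le> ennreal (sf\<^sup>2) * (\<integral>\<^sup>+\<xi>. ennreal ((norm (J x \<xi>))\<^sup>2) * indicator (fbox N) \<xi> \<partial>lborel)" for x
  proof -
    have "ennreal (norm (bipsido b f g x)) \<le> (\<integral>\<^sup>+\<xi>. ennreal (norm (fourier f \<xi>)) * ennreal (norm (J x \<xi>)) * indicator (fbox N) \<xi> \<partial>lborel)"
      unfolding bipsido_eq J_def[symmetric]
      by (rule order_trans[OF nn_norm_integral_le], intro nn_integral_mono)
        (auto simp: norm_mult indicator_def ennreal_mult J0)
    then have "(ennreal (norm (bipsido b f g x)))\<^sup>2 \<le> (\<integral>\<^sup>+\<xi>. ennreal (norm (fourier f \<xi>)) * ennreal (norm (J x \<xi>)) * indicator (fbox N) \<xi> \<partial>lborel)\<^sup>2"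
      by (rule power_mono) simp
    also have "\<dots> \<le> (\<integral>\<^sup>+\<xi>. (ennreal (norm (fourier f \<xi>)))\<^sup>2 * indicator (fbox N) \<xi> \<partial>lborel) * (\<integral>\<^sup>+\<xi>. (ennreal (norm (J x \<xi>)))\<^sup>2 * indicator (fbox N) \<xi> \<partial>lborel)"
      by (rule nn_box_CS) measurable
    also have "\<dots> \<le> ennreal (sf\<^sup>2) * (\<integral>\<^sup>+\<xi>. ennreal ((norm (J x \<xi>))\<^sup>2) * indicator (fbox N) \<xi> \<partial>lborel)"
      using sf by (auto simp: ennreal_power intro!: mult_right_mono)
    finally show ?thesis by (simp add: ennreal_power)
  qed
  then have "(\<integral>\<^sup>+x. ennreal ((norm (bipsido b f g x))\<^sup>2) * indicator (cell q) x \<partial>lborel)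
     \<le> (\<integral>\<^sup>+x. ennreal (sf\<^sup>2) * (\<integral>\<^sup>+\<xi>. ennreal ((norm (J x \<xi>))\<^sup>2) * indicator (fbox N) \<xi> \<partial>lborel) * indicator (cell q) x \<partial>lborel)"
    by (intro nn_integral_mono mult_right_mono) auto
  also have "\<dots> = ennreal (sf\<^sup>2) * (\<integral>\<^sup>+x. (\<integral>\<^sup>+\<xi>. ennreal ((norm (J x \<xi>))\<^sup>2) * indicator (fbox N) \<xi> * indicator (cell q) x \<partial>lborel) \<partial>lborel)"
  proof -
    have "ennreal (sf\<^sup>2) * (\<integral>\<^sup>+\<xi>. ennreal ((norm (J x \<xi>))\<^sup>2) * indicator (fbox N) \<xi> \<partial>lborel) * indicator (cell q) x
      = ennreal (sf\<^sup>2) * (\<integral>\<^sup>+\<xi>. ennreal ((norm (J x \<xi>))\<^sup>2) * indicator (fbox N) \<xi> * indicator (cell q) x \<partial>lborel)" for x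
      by (subst nn_integral_multc, measurable) (simp only: mult.assoc)
    then show ?thesis by (simp only:) (rule nn_integral_cmult, measurable)
  qed
  also have "\<dots> = ennreal (sf\<^sup>2) * (\<integral>\<^sup>+\<xi>. (\<integral>\<^sup>+x. ennreal ((norm (J x \<xi>))\<^sup>2) * indicator (fbox N) \<xi> * indicator (cell q) x \<partial>lborel) \<partial>lborel)"
    by (subst lborel_pair.Fubini') simp_all
  also have "\<dots> \<le> ennreal (sf\<^sup>2) * (\<integral>\<^sup>+\<xi>. ennreal ((6 * pi * L) ^ CARD('n) * (A\<^sup>2 * sg\<^sup>2)) * indicator (fbox N) (\<xi>::real^'n) \<partial>lborel)"
    using inner_L2[OF b L g sg, of _ q]
    by (intro mult_left_mono nn_integral_mono) (auto simp: indicator_def J_def)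
  also have "\<dots> = ennreal (sf\<^sup>2) * (ennreal ((6 * pi * L) ^ CARD('n) * (A\<^sup>2 * sg\<^sup>2)) * ennreal ((2 * N) ^ CARD('n)))"
    using N by (subst nn_integral_cmult_indicator) (auto simp: emeasure_fbox)
  also have "\<dots> = ennreal (sf\<^sup>2 * ((6 * pi * L) ^ CARD('n) * (A\<^sup>2 * sg\<^sup>2) * (2 * N) ^ CARD('n)))"
    using L N by (simp add: ennreal_mult)
  also have "sf\<^sup>2 * ((6 * pi * L) ^ CARD('n) * (A\<^sup>2 * sg\<^sup>2) * (2 * N) ^ CARD('n)) = (12 * pi * L * N) ^ CARD('n) * (A * sf * sg)\<^sup>2"
  proof -
    have "12 * pi * L * N = (6 * pi * L) * (2 * N)" by simp
    then show ?thesis by (simp only: power_mult_distrib) (simp add: mult_ac)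
  qed
  finally show ?thesis .
qed

lemma ennreal_power2_le:
  assumes "x\<^sup>2 \<le> (ennreal c)\<^sup>2" "c \<ge> 0" shows "x \<le> ennreal c"
proof (cases x)
  case (real a)
  then have "a\<^sup>2 \<le> c\<^sup>2" using assms by (simp add: ennreal_power)
  then show ?thesis using real assms(2) power2_le_imp_le ennreal_leI by blast
next
  case top
  then show ?thesis using assms by (simp add: ennreal_power ennreal_mult_eq_top_iff power2_eq_square top_unique)
qed

text \<open>Cauchy-Schwarz on the frequency box, once for each function, passes from L^2 to L^1
  norms of the transforms; each time the root of (2N)^n is lost.\<close>

lemma bipsido_sup:
  fixes b :: "'n::finite triple \<Rightarrow> complex"
  assumes b: "usym 0 A L N b" and N: "N \<ge> 1" and f: "integrable lborel f" and g: "integrable lborel g" and s: "sf \<ge> 0" "sg \<ge> 0"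
    and sf: "(\<integral>\<^sup>+\<eta>. ennreal ((norm (fourier f \<eta>))\<^sup>2) * indicator (fbox N) \<eta> \<partial>lborel) \<le> ennreal (sf\<^sup>2)"
    and sg: "(\<integral>\<^sup>+\<eta>. ennreal ((norm (fourier g \<eta>))\<^sup>2) * indicator (fbox N) \<eta> \<partial>lborel) \<le> ennreal (sg\<^sup>2)"
  shows "norm (bipsido b f g x) \<le> A * sf * sg * (2 * N) ^ CARD('n)"
proof -
  have A: "A \<ge> 0" using usym_bound[OF b, of 0] norm_ge_zero order_trans by blast
  have sq: "ennreal (sqrt ((2 * N) ^ CARD('n))) * ennreal (sqrt ((2 * N) ^ CARD('n))) = ennreal ((2 * N) ^ CARD('n))"
    using N by (subst ennreal_mult[symmetric]) auto
  have l1: "(\<integral>\<^sup>+\<eta>. ennreal (norm (fourier h \<eta>)) * indicator (fbox N) \<eta> \<partial>lborel) \<le> ennreal (s * sqrt ((2 * N) ^ CARD('n)))"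
    if h: "integrable lborel h" and s: "s \<ge> 0" and sh: "(\<integral>\<^sup>+\<eta>. ennreal ((norm (fourier h \<eta>))\<^sup>2) * indicator (fbox N) \<eta> \<partial>lborel) \<le> ennreal (s\<^sup>2)"
    for h :: "real^'n \<Rightarrow> complex" and s
  proof -
    have [measurable]: "h \<in> borel_measurable borel" using h by simp
    have "(\<integral>\<^sup>+\<eta>. ennreal (norm (fourier h \<eta>)) * 1 * indicator (fbox N) \<eta> \<partial>lborel)\<^sup>2
      \<le> (\<integral>\<^sup>+\<eta>. (ennreal (norm (fourier h \<eta>)))\<^sup>2 * indicator (fbox N) \<eta> \<partial>lborel) * (\<integral>\<^sup>+\<eta>. 1\<^sup>2 * indicator (fbox N) (\<eta>::real^'n) \<partial>lborel)"
      by (rule nn_box_CS) measurable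
    also have "\<dots> \<le> ennreal (s\<^sup>2) * ennreal ((2 * N) ^ CARD('n))"
      using sh N by (auto simp: ennreal_power emeasure_fbox intro!: mult_right_mono)
    also have "\<dots> = (ennreal (s * sqrt ((2 * N) ^ CARD('n))))\<^sup>2"
      using s N by (simp add: ennreal_power ennreal_mult[symmetric] power_mult_distrib)
    finally show ?thesis using s N by (intro ennreal_power2_le) simp_all
  qed
  have fm[measurable]: "f \<in> borel_measurable borel" "g \<in> borel_measurable borel" using f g by auto
  define G where "G = A * (sg * sqrt ((2 * N) ^ CARD('n)))"
  have G0: "G \<ge> 0" using A s N by (simp add: G_def)
  have J: "ennreal (norm (LINT \<eta>|lborel. b (x, \<xi>, \<eta>) * fourier g \<eta> * cis (x \<bullet> \<eta>))) \<le> ennreal G * indicator (fbox N) \<xi>" for \<xi>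
  proof (cases "\<xi> \<in> fbox N")
    case True
    have "ennreal (norm (LINT \<eta>|lborel. b (x, \<xi>, \<eta>) * fourier g \<eta> * cis (x \<bullet> \<eta>)))
      \<le> (\<integral>\<^sup>+\<eta>. ennreal A * (ennreal (norm (fourier g \<eta>)) * indicator (fbox N) \<eta>) \<partial>lborel)"
    proof (rule order_trans[OF nn_norm_integral_le], intro nn_integral_mono)
      fix \<eta> show "ennreal (norm (b (x, \<xi>, \<eta>) * fourier g \<eta> * cis (x \<bullet> \<eta>))) \<le> ennreal A * (ennreal (norm (fourier g \<eta>)) * indicator (fbox N) \<eta>)"
        using usym_supp[OF b, of \<xi> \<eta> "[]" x] usym_bound[OF b] A
        by (cases "\<eta> \<in> fbox N") (auto simp: norm_mult mult_right_mono simp flip: ennreal_mult intro!: ennreal_leI)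
    qed
    also have "\<dots> \<le> ennreal A * ennreal (sg * sqrt ((2 * N) ^ CARD('n)))"
      by (subst nn_integral_cmult, measurable) (intro mult_left_mono l1 g s sg, simp)
    finally show ?thesis using True A by (simp add: G_def ennreal_mult')
  qed (use inner_outside[OF b] in simp)
  have "ennreal (norm (bipsido b f g x)) \<le> (\<integral>\<^sup>+\<xi>. ennreal G * (ennreal (norm (fourier f \<xi>)) * indicator (fbox N) \<xi>) \<partial>lborel)"
    unfolding bipsido_eq
  proof (rule order_trans[OF nn_norm_integral_le], intro nn_integral_mono)
    fix \<xi>
    let ?J = "LINT \<eta>|lborel. b (x, \<xi>, \<eta>) * fourier g \<eta> * cis (x \<bullet> \<eta>)"
    have "ennreal (norm (fourier f \<xi> * cis (x \<bullet> \<xi>) * ?J)) = ennreal (norm (fourier f \<xi>)) * ennreal (norm ?J)"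
      by (simp only: norm_mult norm_cis mult_1_right ennreal_mult norm_ge_zero)
    also have "\<dots> \<le> ennreal (norm (fourier f \<xi>)) * (ennreal G * indicator (fbox N) \<xi>)"
      by (intro mult_left_mono J) simp
    also have "\<dots> = ennreal G * (ennreal (norm (fourier f \<xi>)) * indicator (fbox N) \<xi>)"
      by (rule mult.left_commute)
    finally show "ennreal (norm (fourier f \<xi> * cis (x \<bullet> \<xi>) * ?J)) \<le> \<dots>" .
  qed
  also have "\<dots> \<le> ennreal G * ennreal (sf * sqrt ((2 * N) ^ CARD('n)))"
    by (subst nn_integral_cmult, measurable) (intro mult_left_mono l1 f s sf, simp)
  also have "\<dots> = ennreal (A * sf * sg * (2 * N) ^ CARD('n))"
  proof -
    let ?R = "(2 * N) ^ CARD('n)"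
    have "G * (sf * sqrt ?R) = A * sf * sg * (sqrt ?R * sqrt ?R)" by (simp only: G_def mult_ac)
    also have "sqrt ?R * sqrt ?R = ?R" using N by (intro real_sqrt_mult_self[THEN trans]) simp
    finally show ?thesis by (simp only: ennreal_mult'[OF G0, symmetric])
  qed
  finally show ?thesis using A s N by (simp add: ennreal_le_iff)
qed

text \<open>The cell has measure at most 1, so exponents can be lowered. A pointwise splitting at
  height B takes the place of Hoelder's inequality; the factor 2 counts the two regimes.\<close>

lemma cell_powr_mono:
  fixes u :: "real^'n::finite \<Rightarrow> real"
  assumes [measurable]: "u \<in> borel_measurable borel" and u: "\<And>x. u x \<ge> 0" and p: "0 < p" "p \<le> s" and B: "B \<ge> 0"
    and I: "(\<integral>\<^sup>+x. ennreal (u x powr s) * indicator (cell q) x \<partial>lborel) \<le> ennreal (B powr s)"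
  shows "(\<integral>\<^sup>+x. ennreal (u x powr p) * indicator (cell q) x \<partial>lborel) \<le> ennreal (2 * B powr p)"
\<comment> \<open>For B = 0 the function vanishes almost everywhere on the cell; as a splitting
  height B has to be positive.\<close>
proof (cases "B = 0")
  case True
  then have "(\<integral>\<^sup>+x. ennreal (u x powr s) * indicator (cell q) x \<partial>lborel) = 0" using I by simp
  then have "AE x in lborel. ennreal (u x powr s) * indicator (cell q) x = 0" by (subst (asm) nn_integral_0_iff_AE) auto
  then have "AE x in lborel. ennreal (u x powr p) * indicator (cell q) x = 0" by eventually_elim auto
  then have "(\<integral>\<^sup>+x. ennreal (u x powr p) * indicator (cell q) x \<partial>lborel) = 0" by (subst nn_integral_0_iff_AE) auto
  then show ?thesis by simp
next
  case False
  then have B: "B > 0" using B by simp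
  have "u x powr p \<le> B powr p + B powr (p - s) * u x powr s" for x
  proof (cases "u x \<le> B")
    case True
    then have "u x powr p \<le> B powr p" using u p by (intro powr_mono2) auto
    then show ?thesis by (simp add: add_increasing2)
  next
    case False
    then have "u x powr (p - s) \<le> B powr (p - s)" using B p by (intro powr_mono2') auto
    then have "u x powr (p - s) * u x powr s \<le> B powr (p - s) * u x powr s" by (rule mult_right_mono) simp
    then have "u x powr p \<le> B powr (p - s) * u x powr s" by (simp flip: powr_add)
    then show ?thesis by (simp add: add_increasing)
  qed
  then have "(\<integral>\<^sup>+x. ennreal (u x powr p) * indicator (cell q) x \<partial>lborel) \<le>
    (\<integral>\<^sup>+x. ennreal (B powr p) * indicator (cell q) x + ennreal (B powr (p - s)) * (ennreal (u x powr s) * indicator (cell q) x) \<partial>lborel)"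
    by (intro nn_integral_mono) (auto simp: indicator_def simp flip: ennreal_mult ennreal_plus intro!: ennreal_leI)
  also have "\<dots> = ennreal (B powr p) * emeasure lborel (cell q) + ennreal (B powr (p - s)) * (\<integral>\<^sup>+x. ennreal (u x powr s) * indicator (cell q) x \<partial>lborel)"
    by (subst nn_integral_add, measurable) (simp add: nn_integral_cmult_indicator nn_integral_cmult)
  also have "\<dots> \<le> ennreal (B powr p) * 1 + ennreal (B powr (p - s)) * ennreal (B powr s)"
    by (intro add_mono mult_left_mono I emeasure_cell_le) auto
  also have "\<dots> = ennreal (B powr p + B powr (p - s) * B powr s)"
    by (simp flip: ennreal_mult ennreal_plus)
  also have "B powr p + B powr (p - s) * B powr s = 2 * B powr p" using B by (simp flip: powr_add)
  finally show ?thesis .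
qed

text \<open>For r \<le> 2 the exponent in the L^2 bound is lowered, giving N^(n/2). For r > 2 one
  uses |u|^r \<le> U^(r-2) |u|^2 with U the uniform bound, giving N^(n(r-1)) for the r-th power,
  that is N^(n(1-1/r)) for the norm.\<close>

lemma base_estimate:
  assumes r: "r > 0"
  obtains K where "K \<ge> 0" "\<And>(b :: 'n::finite triple \<Rightarrow> complex) A L N f g sf sg q.
    usym 0 A L N b \<Longrightarrow> L \<ge> 1 \<Longrightarrow> N \<ge> 1 \<Longrightarrow> integrable lborel f \<Longrightarrow> integrable lborel g \<Longrightarrow> sf \<ge> 0 \<Longrightarrow> sg \<ge> 0 \<Longrightarrow>
    (\<integral>\<^sup>+\<eta>. ennreal ((norm (fourier f \<eta>))\<^sup>2) * indicator (fbox N) \<eta> \<partial>lborel) \<le> ennreal (sf\<^sup>2) \<Longrightarrow>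
    (\<integral>\<^sup>+\<eta>. ennreal ((norm (fourier g \<eta>))\<^sup>2) * indicator (fbox N) \<eta> \<partial>lborel) \<le> ennreal (sg\<^sup>2) \<Longrightarrow>
    (\<integral>\<^sup>+x. ennreal (norm (bipsido b f g x) powr r) * indicator (cell q) x \<partial>lborel)
      \<le> ennreal (K * (A * sf * sg * (L powr (CARD('n) / 2) * N powr (CARD('n) * max (1/2) (1 - 1/r)))) powr r)"
proof -
  define n where "n = real CARD('n)"
  define h where "h = max (1/2) (1 - 1/r)"
  define K1 where "K1 = 2 * ((12 * pi) powr (n / 2)) powr r"
  define K2 where "K2 = 2 powr (n * (r - 2)) * (12 * pi) powr n"
  have sqr: "(c powr (n / 2))\<^sup>2 = c ^ CARD('n)" if "c > 0" for c
    using that by (simp add: n_def power2_eq_square powr_realpow flip: powr_add)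
  have pw: "c ^ CARD('n) = c powr n" if "c > 0" for c
    using that by (simp add: n_def powr_realpow)
  show ?thesis
  proof (rule that[of "max K1 K2"])
    show "max K1 K2 \<ge> 0" by (simp add: K1_def le_max_iff_disj)
    fix b :: "'n triple \<Rightarrow> complex" and A L N and f g :: "real^'n \<Rightarrow> complex" and sf sg and q :: "int^'n"
    assume b: "usym 0 A L N b" and L: "L \<ge> 1" and N: "N \<ge> 1" and f: "integrable lborel f" and g: "integrable lborel g"
      and s: "sf \<ge> 0" "sg \<ge> 0"
      and sf: "(\<integral>\<^sup>+\<eta>. ennreal ((norm (fourier f \<eta>))\<^sup>2) * indicator (fbox N) \<eta> \<partial>lborel) \<le> ennreal (sf\<^sup>2)"
      and sg: "(\<integral>\<^sup>+\<eta>. ennreal ((norm (fourier g \<eta>))\<^sup>2) * indicator (fbox N) \<eta> \<partial>lborel) \<le> ennreal (sg\<^sup>2)"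
    let ?u = "\<lambda>x. norm (bipsido b f g x)"
    let ?X = "A * sf * sg * (L powr (n / 2) * N powr (n * h))"
    have A: "A \<ge> 0" using usym_bound[OF b, of 0] norm_ge_zero order_trans by blast
    have [measurable]: "bipsido b f g \<in> borel_measurable borel"
      using measurable_bipsido[OF usym_smooth[OF b]] f g by simp
    have I2: "(\<integral>\<^sup>+x. ennreal ((?u x)\<^sup>2) * indicator (cell q) x \<partial>lborel)
      \<le> ennreal ((12 * pi * L * N) ^ CARD('n) * (A * sf * sg)\<^sup>2)"
      by (rule bipsido_L2[OF b L N f g sf sg])
    have X0: "?X \<ge> 0" using A s by simp
    have "(\<integral>\<^sup>+x. ennreal (?u x powr r) * indicator (cell q) x \<partial>lborel) \<le> ennreal (max K1 K2 * ?X powr r)"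
    proof (cases "r \<le> 2")
      case True
      then have h: "h = 1/2" using r by (simp add: h_def field_simps)
      define B where "B = (12 * pi) powr (n / 2) * ?X"
      have B0: "B \<ge> 0" using X0 by (simp add: B_def)
      have "B\<^sup>2 = (12 * pi * L * N) ^ CARD('n) * (A * sf * sg)\<^sup>2"
      proof -
        have e: "((12 * pi) powr (n / 2))\<^sup>2 = (12 * pi) ^ CARD('n)" "(L powr (n / 2))\<^sup>2 = L ^ CARD('n)"
          "(N powr (n * (1 / 2)))\<^sup>2 = N ^ CARD('n)" using L N sqr[of "12 * pi"] sqr[of L] sqr[of N] by auto
        show ?thesis unfolding B_def h by (simp only: power_mult_distrib e) (simp only: mult_ac)
      qed
      then have "(\<integral>\<^sup>+x. ennreal (?u x powr 2) * indicator (cell q) x \<partial>lborel) \<le> ennreal (B powr 2)"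
        using I2 B0 by simp
      then have "(\<integral>\<^sup>+x. ennreal (?u x powr r) * indicator (cell q) x \<partial>lborel) \<le> ennreal (2 * B powr r)"
        by (intro cell_powr_mono[where s=2]) (use r True B0 in auto)
      also have "2 * B powr r = K1 * ?X powr r"
        using X0 unfolding B_def K1_def by (subst powr_mult) auto
      also have "\<dots> \<le> max K1 K2 * ?X powr r" by (intro mult_right_mono) auto
      finally show ?thesis by (simp add: ennreal_leI)
    next
      case False
      then have h: "h = 1 - 1/r" by (simp add: h_def field_simps)
      define P where "P = A * sf * sg"
      have P0: "P \<ge> 0" using A s by (simp add: P_def)
      define U where "U = P * (2 * N) ^ CARD('n)"
      have U0: "U \<ge> 0" using P0 N by (simp add: U_def)
      have uU: "?u x \<le> U" for x
        unfolding U_def P_def by (rule bipsido_sup[OF b N f g s sf sg])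
      have "?u x powr r \<le> U powr (r - 2) * (?u x)\<^sup>2" for x
      proof (cases "?u x = 0")
        case False
        then have "?u x powr r = ?u x powr (r - 2) * ?u x powr 2" by (subst powr_add[symmetric]) simp
        also have "\<dots> \<le> U powr (r - 2) * ?u x powr 2"
          using uU \<open>\<not> r \<le> 2\<close> by (intro mult_right_mono powr_mono2) auto
        finally show ?thesis by simp
      qed simp
      then have "(\<integral>\<^sup>+x. ennreal (?u x powr r) * indicator (cell q) x \<partial>lborel)
        \<le> (\<integral>\<^sup>+x. ennreal (U powr (r - 2)) * (ennreal ((?u x)\<^sup>2) * indicator (cell q) x) \<partial>lborel)"
        by (intro nn_integral_mono) (auto simp: indicator_def simp flip: ennreal_mult intro!: ennreal_leI)
      also have "\<dots> \<le> ennreal (U powr (r - 2)) * ennreal ((12 * pi * L * N) ^ CARD('n) * P\<^sup>2)"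
        by (subst nn_integral_cmult) (use I2 in \<open>auto simp: P_def intro!: mult_left_mono\<close>)
      also have "\<dots> = ennreal (U powr (r - 2) * ((12 * pi * L * N) ^ CARD('n) * P\<^sup>2))"
        using L N by (simp add: ennreal_mult)
      also have "U powr (r - 2) * ((12 * pi * L * N) ^ CARD('n) * P\<^sup>2) \<le> max K1 K2 * ?X powr r"
      proof (cases "P = 0")
        case True then show ?thesis using X0 by (simp add: K1_def le_max_iff_disj)
      next
        case False
        then have P: "P > 0" using P0 by simp
        have "U powr (r - 2) = P powr (r - 2) * ((2 powr (n * (r - 2))) * N powr (n * (r - 2)))"
          using P N unfolding U_def pw[of "2 * N", OF mult_pos_pos[of 2 N]]
          by (subst pw) (auto simp: powr_mult powr_powr)
        moreover have "(12 * pi * L * N) ^ CARD('n) = (12 * pi) powr n * L powr n * N powr n"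
          using L N by (subst pw) (auto simp: powr_mult)
        moreover have "P\<^sup>2 = P powr 2" using P by simp
        ultimately have "U powr (r - 2) * ((12 * pi * L * N) ^ CARD('n) * P\<^sup>2)
            = K2 * ((P powr (r - 2) * P powr 2) * L powr n * (N powr (n * (r - 2)) * N powr n))"
          by (simp add: K2_def mult_ac)
        also have "\<dots> = K2 * (P powr r * L powr n * N powr (n * (r - 1)))"
          by (simp add: algebra_simps flip: powr_add)
        \<comment> \<open>As L \<ge> 1 and r > 2, L^n is raised to L^(nr/2), so that both regimes
          share the factor L^(n/2) in the norm.\<close>
        also have "\<dots> \<le> K2 * (P powr r * L powr (n / 2 * r) * N powr (n * (r - 1)))"
          using L N \<open>\<not> r \<le> 2\<close> by (intro mult_left_mono mult_right_mono powr_mono) (auto simp: K2_def n_def)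
        also have "P powr r * L powr (n / 2 * r) * N powr (n * (r - 1)) = ?X powr r"
        proof -
          have ex: "n * (1 - 1/r) * r = n * (r - 1)" using r by (simp add: field_simps)
          have "?X powr r = P powr r * ((L powr (n / 2)) powr r * (N powr (n * h)) powr r)"
            using P unfolding P_def[symmetric] by (simp only: powr_mult powr_ge_zero order.strict_implies_order mult_nonneg_nonneg)
          also have "\<dots> = P powr r * L powr (n / 2 * r) * N powr (n * (r - 1))"
            by (simp only: powr_powr h ex mult.assoc[symmetric])
          finally show ?thesis by simp
        qed
        also have "K2 * ?X powr r \<le> max K1 K2 * ?X powr r" by (intro mult_right_mono) auto
        finally show ?thesis .
      qed
      finally show ?thesis by (simp add: ennreal_leI)
    qed
    then show "(\<integral>\<^sup>+x. ennreal (?u x powr r) * indicator (cell q) x \<partial>lborel)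
      \<le> ennreal (max K1 K2 * (A * sf * sg * (L powr (CARD('n) / 2) * N powr (CARD('n) * max (1/2) (1 - 1/r)))) powr r)"
      by (simp add: n_def h_def)
  qed
qed

section \<open>Off-diagonal decay\<close>

lemma usym_nonneg: "usym M A L N b \<Longrightarrow> A \<ge> 0"
  using usym_bound[of M A L N b 0] norm_ge_zero order_trans by blast

text \<open>Frequency directions do not count in \<open>nx\<close>, so \<open>A\<close> and
  \<open>L\<close> are preserved and one order of the reserve is spent.\<close>

lemma usym_ddir:
  assumes b: "usym (Suc M) A L N b" and v: "v \<in> xi_dirs \<union> eta_dirs"
  shows "usym M A L N (ddir v b)"
  unfolding usym_def
proof (intro conjI allI impI)
  have v': "v \<in> alld" "v \<notin> x_dirs" using v by (auto simp: alld_def xi_dirs_def eta_dirs_def x_dirs_def axis_eq_0_iff)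
  show "smooth_on_dirs alld (ddir v b)" using b v' by (intro smooth_on_dirs_ddir usym_smooth)
  show "ddir v b (x, \<xi>, \<eta>) = 0" if "\<xi> \<notin> fbox N \<or> \<eta> \<notin> fbox N" for x \<xi> \<eta>
    using usym_supp[OF b that, of "[v]"] by simp
  show "norm (ddirs vs (ddir v b) z) \<le> A * L ^ nx vs" if "set vs \<subseteq> alld" "length vs \<le> CARD('a) + M" for vs z
  proof -
    have "\<forall>vs z. set vs \<subseteq> alld \<longrightarrow> length vs \<le> CARD('a) + Suc M \<longrightarrow> norm (ddirs vs b z) \<le> A * L ^ nx vs"
      using b unfolding usym_def by blast
    from this[rule_format, of "vs @ [v]" z] have "norm (ddirs (vs @ [v]) b z) \<le> A * L ^ nx (vs @ [v])"
      using that v' by simp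
    then show ?thesis using v' by (simp add: ddirs_snoc nx_def)
  qed
qed

section \<open>Integration by parts in the frequency variables\<close>

lemma integrable_fbox:
  fixes u :: "real^'n::finite \<Rightarrow> complex"
  assumes "u \<in> borel_measurable borel" "\<And>\<xi>. norm (u \<xi>) \<le> C * indicator (fbox N) \<xi>"
  shows "integrable lborel u"
proof -
  have "emeasure lborel (fbox N :: (real^'n) set) < \<infinity>" unfolding fbox_cbox by (rule emeasure_lborel_cbox_finite)
  then have "integrable lborel (indicator (fbox N) :: real^'n \<Rightarrow> real)"
    by (intro integrable_real_indicator) auto
  then have "integrable lborel (\<lambda>\<xi>::real^'n. C * indicator (fbox N) \<xi> :: real)" by simp
  then show ?thesis
    by (rule Bochner_Integration.integrable_bound) (use assms in \<open>auto intro!: AE_I2 intro: order_trans[OF _ abs_ge_self]\<close>)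
qed

lemma integrable_fbox_real: "integrable lborel (\<lambda>\<xi>::real^'n::finite. C * indicator (fbox N) \<xi> :: real)"
proof -
  have "emeasure lborel (fbox N :: (real^'n) set) < \<infinity>" unfolding fbox_cbox by (rule emeasure_lborel_cbox_finite)
  then have "integrable lborel (indicator (fbox N) :: real^'n \<Rightarrow> real)"
    by (intro integrable_real_indicator) auto
  then show ?thesis by simp
qed

lemma fourier_deriv:
  fixes g :: "real^'n::finite \<Rightarrow> complex"
  assumes g: "integrable lborel g" and yg: "integrable lborel (\<lambda>y. of_real (y $ i) * g y)"
  shows "((\<lambda>t. fourier g (\<eta> + t *\<^sub>R axis i 1)) has_vector_derivative - \<i> * fourier (\<lambda>y. of_real (y $ i) * g y) \<eta>) (at 0)"
proof -
  have [measurable]: "g \<in> borel_measurable borel" using g by simp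
  let ?F' = "\<lambda>t y. - \<i> * (of_real (y $ i) * g y * cis (- (y \<bullet> (\<eta> + t *\<^sub>R axis i 1))))"
  have "((\<lambda>t. LINT y|lborel. g y * cis (- (y \<bullet> (\<eta> + t *\<^sub>R axis i 1)))) has_vector_derivative (LINT y|lborel. ?F' 0 y)) (at 0)"
  proof (rule has_vector_derivative_integral[where F'="?F'" and H="\<lambda>y. norm (of_real (y $ i) * g y)"])
    show "integrable lborel (\<lambda>y. g y * cis (- (y \<bullet> (\<eta> + t *\<^sub>R axis i 1))))" for t
      by (intro integrable_mult_cis g) measurable
    show "((\<lambda>t. g y * cis (- (y \<bullet> (\<eta> + t *\<^sub>R axis i 1)))) has_vector_derivative ?F' t y) (at t)" for t y
      unfolding cis_conv_exp
      by (auto intro!: derivative_eq_intros has_vector_derivative_real_field simp: inner_add_right inner_axis)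
    show "norm (?F' t y) \<le> norm (of_real (y $ i) * g y)" for t y by (simp add: norm_mult)
    show "integrable lborel (\<lambda>y. norm (of_real (y $ i) * g y))" using yg by (rule integrable_norm)
  qed measurable
  then show ?thesis by (simp add: fourier_def)
qed

lemma cis_deriv:
  fixes x \<eta> :: "real^'n::finite"
  shows "((\<lambda>t. cis (x \<bullet> (\<eta> + t *\<^sub>R axis i 1))) has_vector_derivative \<i> * of_real (x $ i) * cis (x \<bullet> \<eta>)) (at 0)"
proof -
  have "((\<lambda>t. cis (x \<bullet> \<eta> + t * x $ i)) has_vector_derivative x $ i *\<^sub>R (\<i> * cis (x \<bullet> \<eta> + 0 * x $ i))) (at 0)"
    unfolding has_vector_derivative_complex_iff
    by (auto intro!: derivative_eq_intros)
  moreover have "x \<bullet> (\<eta> + t *\<^sub>R axis i 1) = x \<bullet> \<eta> + t * x $ i" for t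
    by (simp add: inner_add_right inner_axis)
  moreover have "x $ i *\<^sub>R (\<i> * cis (x \<bullet> \<eta> + 0 * x $ i)) = \<i> * of_real (x $ i) * cis (x \<bullet> \<eta>)"
    by (simp add: scaleR_conv_of_real)
  ultimately show ?thesis by (simp only:)
qed

text \<open>The derivative of the full integrand along a coordinate integrates to 0. Its
  product-rule terms are a derivative of \<open>h\<close>, a first moment of \<open>g\<close> and a
  multiplication by x_i: the commutator with a coordinate is an operator with differentiated
  amplitude.\<close>

lemma amplitude_by_parts:
  fixes g :: "real^'n::finite \<Rightarrow> complex"
  assumes g: "integrable lborel g" and yg: "integrable lborel (\<lambda>y. of_real (y $ i) * g y)"
    and [measurable]: "h \<in> borel_measurable borel" "h' \<in> borel_measurable borel"
    and d: "\<And>\<eta>. ((\<lambda>t. h (\<eta> + t *\<^sub>R axis i 1)) has_vector_derivative h' \<eta>) (at 0)"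
    and b: "\<And>\<eta>. norm (h \<eta>) \<le> C * indicator (fbox N) \<eta>" "\<And>\<eta>. norm (h' \<eta>) \<le> C * indicator (fbox N) \<eta>"
  shows "of_real (x $ i) * (LINT \<eta>|lborel. h \<eta> * fourier g \<eta> * cis (x \<bullet> \<eta>)) -
      (LINT \<eta>|lborel. h \<eta> * fourier (\<lambda>y. of_real (y $ i) * g y) \<eta> * cis (x \<bullet> \<eta>))
    = \<i> * (LINT \<eta>|lborel. h' \<eta> * fourier g \<eta> * cis (x \<bullet> \<eta>))"
proof -
  let ?g1 = "\<lambda>y. of_real (y $ i) * g y"
  have [measurable]: "g \<in> borel_measurable borel" using g by simp
  have C: "C * indicator (fbox N) \<eta> \<ge> 0" for \<eta> :: "real^'n" using order_trans[OF norm_ge_zero b(1)] .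
  have bnd: "norm (k \<eta> * fourier u \<eta> * cis (x \<bullet> \<eta>)) \<le> (C * (LINT y|lborel. norm (u y))) * indicator (fbox N) \<eta>"
    if "\<And>\<eta>. norm (k \<eta>) \<le> C * indicator (fbox N) \<eta>" "integrable lborel u" for k u \<eta>
    using mult_mono[OF that(1)[of \<eta>] norm_fourier_le[OF that(2), of \<eta>] C norm_ge_zero] by (simp add: norm_mult mult_ac)
  have i1: "integrable lborel (\<lambda>\<eta>. h \<eta> * fourier g \<eta> * cis (x \<bullet> \<eta>))"
    by (rule integrable_fbox[OF _ bnd[OF b(1) g]]) measurable
  have i2: "integrable lborel (\<lambda>\<eta>. h \<eta> * fourier ?g1 \<eta> * cis (x \<bullet> \<eta>))"
    by (rule integrable_fbox[OF _ bnd[OF b(1) yg]]) measurable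
  have i3: "integrable lborel (\<lambda>\<eta>. h' \<eta> * fourier g \<eta> * cis (x \<bullet> \<eta>))"
    by (rule integrable_fbox[OF _ bnd[OF b(2) g]]) measurable
  let ?H' = "\<lambda>\<eta>. h' \<eta> * fourier g \<eta> * cis (x \<bullet> \<eta>) - \<i> * (h \<eta> * fourier ?g1 \<eta> * cis (x \<bullet> \<eta>)) + \<i> * of_real (x $ i) * (h \<eta> * fourier g \<eta> * cis (x \<bullet> \<eta>))"
  define K where "K = C * (LINT y|lborel. norm (g y)) + C * (LINT y|lborel. norm (?g1 y)) + \<bar>x $ i\<bar> * (C * (LINT y|lborel. norm (g y)))"
  have H'b: "norm (?H' \<eta>) \<le> K * indicator (fbox N) \<eta>" for \<eta>
  proof -
    have "norm (?H' \<eta>) \<le> norm (h' \<eta> * fourier g \<eta> * cis (x \<bullet> \<eta>)) + norm (h \<eta> * fourier ?g1 \<eta> * cis (x \<bullet> \<eta>)) + \<bar>x $ i\<bar> * norm (h \<eta> * fourier g \<eta> * cis (x \<bullet> \<eta>))"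
      by (rule order_trans[OF norm_triangle_ineq] add_mono order_trans[OF norm_triangle_ineq4])+ (simp_all add: norm_mult)
    also have "\<dots> \<le> K * indicator (fbox N) \<eta>"
      using bnd[OF b(2) g, of \<eta>] bnd[OF b(1) yg, of \<eta>] mult_left_mono[OF bnd[OF b(1) g, of \<eta>] abs_ge_zero[of "x $ i"]]
      by (simp add: K_def algebra_simps)
    finally show ?thesis .
  qed
  have "(LINT \<eta>|lborel. ?H' \<eta>) = 0"
  proof (rule integral_ddir_eq_0[where v="axis i 1", OF i1])
    show "((\<lambda>t. h (\<eta> + t *\<^sub>R axis i 1) * fourier g (\<eta> + t *\<^sub>R axis i 1) * cis (x \<bullet> (\<eta> + t *\<^sub>R axis i 1))) has_vector_derivative ?H' \<eta>) (at 0)" for \<eta>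
      using has_vector_derivative_mult[OF has_vector_derivative_mult[OF d[of \<eta>] fourier_deriv[OF g yg, of \<eta>]] cis_deriv[of x \<eta> i]]
      by (simp add: algebra_simps)
    \<comment> \<open>The majorant has to cover all translates by |t| \<le> 1 of a function living
      on \<open>fbox N\<close>, hence the enlargement by 1.\<close>
    show "integrable lborel (\<lambda>\<eta>::real^'n. \<bar>K\<bar> * indicator (fbox (N + 1)) \<eta> :: real)" by (rule integrable_fbox_real)
    show "norm (?H' (\<eta> + t *\<^sub>R axis i 1)) \<le> \<bar>K\<bar> * indicator (fbox (N + 1)) \<eta>" if "\<bar>t\<bar> \<le> 1" for \<eta> t
    proof (cases "\<eta> + t *\<^sub>R axis i 1 \<in> fbox N")
      case True
      have "\<eta> \<in> fbox (N + 1)"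
        unfolding fbox_def
      proof (intro CollectI allI)
        fix j
        have "\<bar>(\<eta> + t *\<^sub>R axis i 1) $ j\<bar> \<le> N" using True by (auto simp: fbox_def)
        moreover have "\<bar>(t *\<^sub>R axis i (1::real)) $ j\<bar> \<le> 1" using that by (simp add: axis_def)
        ultimately show "\<bar>\<eta> $ j\<bar> \<le> N + 1" by simp
      qed
      then show ?thesis using H'b[of "\<eta> + t *\<^sub>R axis i 1"] True by simp
    next
      case False
      then have "norm (?H' (\<eta> + t *\<^sub>R axis i 1)) \<le> 0" using H'b[of "\<eta> + t *\<^sub>R axis i 1"] by simp
      also have "0 \<le> \<bar>K\<bar> * indicator (fbox (N + 1)) \<eta>" by simp
      finally show ?thesis .
    qed
  qed measurable
  moreover have "(LINT \<eta>|lborel. ?H' \<eta>) = (LINT \<eta>|lborel. h' \<eta> * fourier g \<eta> * cis (x \<bullet> \<eta>)) - \<i> * (LINT \<eta>|lborel. h \<eta> * fourier ?g1 \<eta> * cis (x \<bullet> \<eta>))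
      + \<i> * of_real (x $ i) * (LINT \<eta>|lborel. h \<eta> * fourier g \<eta> * cis (x \<bullet> \<eta>))"
    using i1 i2 i3 by simp
  moreover have "X * a - b = \<i> * c" if h: "c - \<i> * b + \<i> * X * a = 0" for X a b c :: complex
  proof -
    have "\<i> * (c - \<i> * b + \<i> * X * a) = \<i> * c + b - X * a" by (simp add: complex_eq_iff)
    then have "\<i> * c + b - X * a = 0" unfolding h by simp
    then show ?thesis by (simp add: algebra_simps)
  qed
  ultimately show ?thesis by (simp only:)
qed

abbreviation "jint b g x \<xi> \<equiv> (LINT \<eta>|lborel. b (x, \<xi>, \<eta>) * fourier g \<eta> * cis (x \<bullet> \<eta>))"

lemma jint_integrand_bound:
  fixes b :: "'n::finite triple \<Rightarrow> complex"
  assumes b: "usym M A L N b" and g: "integrable lborel g"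
  shows "norm (b (x, \<xi>, \<eta>) * fourier g \<eta> * cis (x \<bullet> \<eta>)) \<le> A * (LINT y|lborel. norm (g y)) * indicator (fbox N) \<eta>"
  using usym_supp[OF b, of \<xi> \<eta> "[]" x] mult_mono[OF usym_bound[OF b, of "(x, \<xi>, \<eta>)"] norm_fourier_le[OF g, of \<eta>] usym_nonneg[OF b] norm_ge_zero]
  by (cases "\<eta> \<in> fbox N") (auto simp: norm_mult)

text \<open>The inner integral inherits the \<xi>-support of the symbol and is bounded uniformly in
  x, so it can serve in turn as an amplitude in \<xi>.\<close>

lemma jint_bound:
  fixes b :: "'n::finite triple \<Rightarrow> complex"
  assumes b: "usym M A L N b" and g: "integrable lborel g"
  shows "\<exists>C. \<forall>x \<xi>. norm (jint b g x \<xi>) \<le> C * indicator (fbox N) \<xi>"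
proof (intro exI allI)
  let ?W = "A * (LINT y|lborel. norm (g y))"
  have [measurable]: "g \<in> borel_measurable borel" using g by simp
  have [measurable]: "smooth_on_dirs alld b" using b by (rule usym_smooth)
  note bd = jint_integrand_bound[OF b g]
  show "norm (jint b g x \<xi>) \<le> (LINT \<eta>|lborel. ?W * indicator (fbox N) (\<eta>::real^'n)) * indicator (fbox N) \<xi>" for x \<xi>
  proof (cases "\<xi> \<in> fbox N")
    case True
    have "norm (jint b g x \<xi>) \<le> (LINT \<eta>|lborel. ?W * indicator (fbox N) (\<eta>::real^'n))"
      by (rule Bochner_Integration.integral_norm_bound_integral[OF integrable_fbox[OF _ bd] integrable_fbox_real]) (use bd in simp_all)
    then show ?thesis using True by simp
  qed (use inner_outside[OF b] in simp)
qed

text \<open>The integration by parts takes place in the inner integral for each \<xi> separately and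
  is then integrated against the transform of f.\<close>

lemma bipsido_eta_parts:
  fixes b :: "'n::finite triple \<Rightarrow> complex"
  assumes b: "usym (Suc M) A L N b" and f: "integrable lborel f"
    and g: "integrable lborel g" and yg: "integrable lborel (\<lambda>y. of_real (y $ i) * g y)"
  shows "of_real (x $ i) * bipsido b f g x - bipsido b f (\<lambda>y. of_real (y $ i) * g y) x
    = \<i> * bipsido (ddir (0, 0, axis i 1) b) f g x"
proof -
  let ?v = "(0, 0, axis i 1) :: 'n triple" and ?g1 = "\<lambda>y. of_real (y $ i) * g y"
  have v: "?v \<in> xi_dirs \<union> eta_dirs" by (auto simp: eta_dirs_def)
  note b' = usym_ddir[OF b v]
  have A: "A \<ge> 0" using usym_nonneg[OF b] .
  have [measurable]: "g \<in> borel_measurable borel" "f \<in> borel_measurable borel" using g f by auto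
  have sm[measurable]: "smooth_on_dirs alld b" "smooth_on_dirs alld (ddir ?v b)" using b b' by (auto intro: usym_smooth)
  have *: "of_real (x $ i) * jint b g x \<xi> - jint b ?g1 x \<xi> = \<i> * jint (ddir ?v b) g x \<xi>" for \<xi>
  proof (rule amplitude_by_parts[OF g yg, where C=A and N=N])
    show "((\<lambda>t. b (x, \<xi>, \<eta> + t *\<^sub>R axis i 1)) has_vector_derivative ddir ?v b (x, \<xi>, \<eta>)) (at 0)" for \<eta>
      using has_vector_derivative_ddir[OF smooth_on_dirs_differentiable[OF sm(1), of ?v], of "(x, \<xi>, \<eta>)"] v
      by (auto simp: alld_def)
    show "norm (b (x, \<xi>, \<eta>)) \<le> A * indicator (fbox N) \<eta>" for \<eta>
      using usym_bound[OF b] usym_supp[OF b, of \<xi> \<eta> "[]"] by (cases "\<eta> \<in> fbox N") auto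
    show "norm (ddir ?v b (x, \<xi>, \<eta>)) \<le> A * indicator (fbox N) \<eta>" for \<eta>
      using usym_bound[OF b'] usym_supp[OF b', of \<xi> \<eta> "[]"] by (cases "\<eta> \<in> fbox N") auto
  qed measurable
  obtain C1 where "\<forall>x \<xi>. norm (jint b g x \<xi>) \<le> C1 * indicator (fbox N) \<xi>"
    using jint_bound[OF b g] by (elim exE)
  note C1 = this[rule_format]
  obtain C2 where "\<forall>x \<xi>. norm (jint b ?g1 x \<xi>) \<le> C2 * indicator (fbox N) \<xi>"
    using jint_bound[OF b yg] by (elim exE)
  note C2 = this[rule_format]
  have int: "integrable lborel (\<lambda>\<xi>. fourier f \<xi> * cis (x \<bullet> \<xi>) * J \<xi>)"
    if [measurable]: "J \<in> borel_measurable borel" and "\<And>\<xi>. norm (J \<xi>) \<le> C * indicator (fbox N) \<xi>" for J C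
  proof (rule integrable_fbox[of _ "(LINT y|lborel. norm (f y)) * C" N])
    show "norm (fourier f \<xi> * cis (x \<bullet> \<xi>) * J \<xi>) \<le> (LINT y|lborel. norm (f y)) * C * indicator (fbox N) \<xi>" for \<xi>
    proof -
      have "norm (fourier f \<xi>) * norm (J \<xi>) \<le> (LINT y|lborel. norm (f y)) * (C * indicator (fbox N) \<xi>)"
        by (intro mult_mono norm_fourier_le[OF f] that(2)) auto
      then show ?thesis by (simp only: norm_mult norm_cis mult_1_right mult.assoc)
    qed
  qed measurable
  have i1: "integrable lborel (\<lambda>\<xi>. fourier f \<xi> * cis (x \<bullet> \<xi>) * jint b g x \<xi>)"
    by (rule int[OF _ C1]) measurable
  have i2: "integrable lborel (\<lambda>\<xi>. fourier f \<xi> * cis (x \<bullet> \<xi>) * jint b ?g1 x \<xi>)"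
    by (rule int[OF _ C2]) measurable
  have "of_real (x $ i) * bipsido b f g x - bipsido b f ?g1 x
     = (LINT \<xi>|lborel. of_real (x $ i) * (fourier f \<xi> * cis (x \<bullet> \<xi>) * jint b g x \<xi>) - fourier f \<xi> * cis (x \<bullet> \<xi>) * jint b ?g1 x \<xi>)"
    unfolding bipsido_eq using i1 i2 by (subst Bochner_Integration.integral_diff) auto
  also have "\<dots> = (LINT \<xi>|lborel. \<i> * (fourier f \<xi> * cis (x \<bullet> \<xi>) * jint (ddir ?v b) g x \<xi>))"
  proof (intro Bochner_Integration.integral_cong refl)
    fix \<xi>
    have "of_real (x $ i) * (fourier f \<xi> * cis (x \<bullet> \<xi>) * jint b g x \<xi>) - fourier f \<xi> * cis (x \<bullet> \<xi>) * jint b ?g1 x \<xi>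
      = fourier f \<xi> * cis (x \<bullet> \<xi>) * (of_real (x $ i) * jint b g x \<xi> - jint b ?g1 x \<xi>)" by (simp only: right_diff_distrib mult_ac)
    then show "of_real (x $ i) * (fourier f \<xi> * cis (x \<bullet> \<xi>) * jint b g x \<xi>) - fourier f \<xi> * cis (x \<bullet> \<xi>) * jint b ?g1 x \<xi>
      = \<i> * (fourier f \<xi> * cis (x \<bullet> \<xi>) * jint (ddir ?v b) g x \<xi>)" unfolding * by (simp only: mult_ac)
  qed
  also have "\<dots> = \<i> * bipsido (ddir ?v b) f g x" unfolding bipsido_eq by (rule integral_mult_right_zero)
  finally show ?thesis .
qed

text \<open>Here the whole inner integral plays the role of the amplitude; differentiating it under
  the integral sign replaces \<open>b\<close> by its \<xi>-derivative.\<close>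

lemma bipsido_xi_parts:
  fixes b :: "'n::finite triple \<Rightarrow> complex"
  assumes b: "usym (Suc M) A L N b" and g: "integrable lborel g"
    and f: "integrable lborel f" and yf: "integrable lborel (\<lambda>y. of_real (y $ i) * f y)"
  shows "of_real (x $ i) * bipsido b f g x - bipsido b (\<lambda>y. of_real (y $ i) * f y) g x
    = \<i> * bipsido (ddir (0, axis i 1, 0) b) f g x"
proof -
  let ?v = "(0, axis i 1, 0) :: 'n triple" and ?f1 = "\<lambda>y. of_real (y $ i) * f y"
  have v: "?v \<in> xi_dirs \<union> eta_dirs" by (auto simp: xi_dirs_def)
  note b' = usym_ddir[OF b v]
  have [measurable]: "g \<in> borel_measurable borel" "f \<in> borel_measurable borel" using g f by auto
  have sm[measurable]: "smooth_on_dirs alld b" "smooth_on_dirs alld (ddir ?v b)" using b b' by (auto intro: usym_smooth)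
  obtain C1 where "\<forall>x \<xi>. norm (jint b g x \<xi>) \<le> C1 * indicator (fbox N) \<xi>"
    using jint_bound[OF b g] by (elim exE)
  note C1 = this[rule_format]
  obtain C2 where "\<forall>x \<xi>. norm (jint (ddir ?v b) g x \<xi>) \<le> C2 * indicator (fbox N) \<xi>"
    using jint_bound[OF b' g] by (elim exE)
  note C2 = this[rule_format]
  note D1 = jint_integrand_bound[OF b g] and D2 = jint_integrand_bound[OF b' g]
  have bm: "C1 * indicator (fbox N) \<xi> \<le> max C1 C2 * indicator (fbox N) \<xi>" "C2 * indicator (fbox N) \<xi> \<le> max C1 C2 * indicator (fbox N) \<xi>" for \<xi> :: "real^'n"
    by (auto simp: indicator_def)
  have d: "((\<lambda>t. jint b g x (\<xi> + t *\<^sub>R axis i 1)) has_vector_derivative jint (ddir ?v b) g x \<xi>) (at 0)" for \<xi>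
  proof -
    let ?F' = "\<lambda>t \<eta>. ddir ?v b (x, \<xi> + t *\<^sub>R axis i 1, \<eta>) * fourier g \<eta> * cis (x \<bullet> \<eta>)"
    have "((\<lambda>t. jint b g x (\<xi> + t *\<^sub>R axis i 1)) has_vector_derivative (LINT \<eta>|lborel. ?F' 0 \<eta>)) (at 0)"
    proof (rule has_vector_derivative_integral[where F'="?F'" and H="\<lambda>\<eta>. A * (LINT y|lborel. norm (g y)) * indicator (fbox N) \<eta>"])
      show "integrable lborel (\<lambda>\<eta>. b (x, \<xi> + t *\<^sub>R axis i 1, \<eta>) * fourier g \<eta> * cis (x \<bullet> \<eta>))" for t
        by (rule integrable_fbox[OF _ D1]) measurable
      have "((\<lambda>t. b ((x, \<xi>, \<eta>) + t *\<^sub>R ?v)) has_vector_derivative ddir ?v b ((x, \<xi>, \<eta>) + t *\<^sub>R ?v)) (at t)" for t \<eta>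
        using v by (intro has_vector_derivative_ddir_at smooth_on_dirs_differentiable[OF sm(1)]) (auto simp: alld_def)
      then show "((\<lambda>t. b (x, \<xi> + t *\<^sub>R axis i 1, \<eta>) * fourier g \<eta> * cis (x \<bullet> \<eta>)) has_vector_derivative ?F' t \<eta>) (at t)" for t \<eta>
        by (intro has_vector_derivative_mult_left) simp
      show "integrable lborel (\<lambda>\<eta>::real^'n. A * (LINT y|lborel. norm (g y)) * indicator (fbox N) \<eta>)"
        by (rule integrable_fbox_real)
    qed (use D2 in simp_all)
    then show ?thesis by simp
  qed
  have comm: "(LINT \<xi>|lborel. fourier u \<xi> * cis (x \<bullet> \<xi>) * J \<xi>) = (LINT \<xi>|lborel. J \<xi> * fourier u \<xi> * cis (x \<bullet> \<xi>))" for u J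
    by (simp only: mult_ac)
  show ?thesis
    unfolding bipsido_eq comm
  proof (rule amplitude_by_parts[OF f yf _ _ d, where C="max C1 C2" and N=N])
    show "norm (jint b g x \<xi>) \<le> max C1 C2 * indicator (fbox N) \<xi>" for \<xi>
      by (rule order_trans[OF C1 bm(1)])
    show "norm (jint (ddir ?v b) g x \<xi>) \<le> max C1 C2 * indicator (fbox N) \<xi>" for \<xi>
      by (rule order_trans[OF C2 bm(2)])
  qed measurable
qed

section \<open>Bilinearity of the operator\<close>

lemma integrable_bipsido_integrand:
  fixes b :: "'n::finite triple \<Rightarrow> complex"
  assumes b: "usym M A L N b" and f: "integrable lborel f" and g: "integrable lborel g"
  shows "integrable lborel (\<lambda>\<xi>. fourier f \<xi> * cis (x \<bullet> \<xi>) * jint b g x \<xi>)"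
proof -
  have [measurable]: "g \<in> borel_measurable borel" "f \<in> borel_measurable borel" using g f by auto
  have [measurable]: "smooth_on_dirs alld b" using b by (rule usym_smooth)
  obtain C where "\<forall>x \<xi>. norm (jint b g x \<xi>) \<le> C * indicator (fbox N) \<xi>"
    using jint_bound[OF b g] by (elim exE)
  note C = this[rule_format]
  show ?thesis
  proof (rule integrable_fbox[of _ "(LINT y|lborel. norm (f y)) * C" N])
    fix \<xi>
    have "norm (fourier f \<xi>) * norm (jint b g x \<xi>) \<le> (LINT y|lborel. norm (f y)) * (C * indicator (fbox N) \<xi>)"
      by (intro mult_mono norm_fourier_le[OF f] C) auto
    then show "norm (fourier f \<xi> * cis (x \<bullet> \<xi>) * jint b g x \<xi>) \<le> (LINT y|lborel. norm (f y)) * C * indicator (fbox N) \<xi>"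
      by (simp only: norm_mult norm_cis mult_1_right mult.assoc)
  qed measurable
qed

lemma integrable_jint_integrand:
  fixes b :: "'n::finite triple \<Rightarrow> complex"
  assumes b: "usym M A L N b" and g: "integrable lborel g"
  shows "integrable lborel (\<lambda>\<eta>. b (x, \<xi>, \<eta>) * fourier g \<eta> * cis (x \<bullet> \<eta>))"
proof -
  have [measurable]: "g \<in> borel_measurable borel" using g by simp
  have [measurable]: "smooth_on_dirs alld b" using b by (rule usym_smooth)
  show ?thesis by (rule integrable_fbox[OF _ jint_integrand_bound[OF b g]]) measurable
qed

lemma fourier_lincomb:
  assumes "integrable lborel u" "integrable lborel v"
  shows "fourier (\<lambda>y. u y + c * v y) \<xi> = fourier u \<xi> + c * fourier v \<xi>"
proof -
  have m: "(\<lambda>y::real^'a. - (y \<bullet> \<xi>)) \<in> borel_measurable borel" by measurable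
  have "fourier (\<lambda>y. u y + c * v y) \<xi> = (LINT y|lborel. u y * cis (- (y \<bullet> \<xi>)) + c * (v y * cis (- (y \<bullet> \<xi>))))"
    unfolding fourier_def by (intro Bochner_Integration.integral_cong) (auto simp: algebra_simps)
  also have "\<dots> = fourier u \<xi> + c * fourier v \<xi>"
    unfolding fourier_def
    by (subst Bochner_Integration.integral_add) (auto intro!: integrable_mult_cis assms m)
  finally show ?thesis .
qed

lemma bipsido_lincomb_left:
  fixes b :: "'n::finite triple \<Rightarrow> complex"
  assumes b: "usym M A L N b" and u: "integrable lborel u" and v: "integrable lborel v" and g: "integrable lborel g"
  shows "bipsido b (\<lambda>y. u y + c * v y) g x = bipsido b u g x + c * bipsido b v g x"
proof -
  have "bipsido b (\<lambda>y. u y + c * v y) g x = (LINT \<xi>|lborel. fourier u \<xi> * cis (x \<bullet> \<xi>) * jint b g x \<xi> + c * (fourier v \<xi> * cis (x \<bullet> \<xi>) * jint b g x \<xi>))"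
    unfolding bipsido_eq fourier_lincomb[OF u v]
    by (intro Bochner_Integration.integral_cong) (auto simp: ring_distribs mult.assoc)
  also have "\<dots> = bipsido b u g x + c * bipsido b v g x"
    unfolding bipsido_eq
    by (subst Bochner_Integration.integral_add)
      (use integrable_bipsido_integrand[OF b u g] integrable_bipsido_integrand[OF b v g] in auto)
  finally show ?thesis .
qed

lemma bipsido_lincomb_right:
  fixes b :: "'n::finite triple \<Rightarrow> complex"
  assumes b: "usym M A L N b" and f: "integrable lborel f" and u: "integrable lborel u" and v: "integrable lborel v"
  shows "bipsido b f (\<lambda>y. u y + c * v y) x = bipsido b f u x + c * bipsido b f v x"
proof -
  have j: "jint b (\<lambda>y. u y + c * v y) x \<xi> = jint b u x \<xi> + c * jint b v x \<xi>" for \<xi>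
  proof -
    have "jint b (\<lambda>y. u y + c * v y) x \<xi> = (LINT \<eta>|lborel. b (x, \<xi>, \<eta>) * fourier u \<eta> * cis (x \<bullet> \<eta>) + c * (b (x, \<xi>, \<eta>) * fourier v \<eta> * cis (x \<bullet> \<eta>)))"
      unfolding fourier_lincomb[OF u v]
      by (intro Bochner_Integration.integral_cong refl) (simp only: ring_distribs mult_ac)
    also have "\<dots> = jint b u x \<xi> + c * jint b v x \<xi>"
      by (subst Bochner_Integration.integral_add)
        (use integrable_jint_integrand[OF b u] integrable_jint_integrand[OF b v] in auto)
    finally show ?thesis .
  qed
  have "bipsido b f (\<lambda>y. u y + c * v y) x = (LINT \<xi>|lborel. fourier f \<xi> * cis (x \<bullet> \<xi>) * jint b u x \<xi> + c * (fourier f \<xi> * cis (x \<bullet> \<xi>) * jint b v x \<xi>))"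
    unfolding bipsido_eq j
    by (intro Bochner_Integration.integral_cong refl) (simp only: ring_distribs mult_ac)
  also have "\<dots> = bipsido b f u x + c * bipsido b f v x"
    unfolding bipsido_eq
    by (subst Bochner_Integration.integral_add)
      (use integrable_bipsido_integrand[OF b f u] integrable_bipsido_integrand[OF b f v] in auto)
  finally show ?thesis .
qed

section \<open>Functions supported in one cell, and decay away from it\<close>

definition dom :: "(real^'n::finite \<Rightarrow> real) \<Rightarrow> int^'n \<Rightarrow> (real^'n \<Rightarrow> complex) set" where
  "dom F p = {f. f \<in> borel_measurable borel \<and> (\<forall>y. norm (f y) \<le> F y * indicator (cell p) y)}"

text \<open>\<open>s\<close> dominates the frequency-localised square norm of every function supported in the cell \<open>p\<close> and bounded by \<open>F\<close>;
  quantifying over all such functions makes the notion stable under multiplication by coordinates.\<close>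

definition locsize :: "real \<Rightarrow> (real^'n::finite \<Rightarrow> real) \<Rightarrow> int^'n \<Rightarrow> real \<Rightarrow> bool" where
  "locsize N F p s \<longleftrightarrow> 0 \<le> s \<and> (\<forall>f\<in>dom F p.
     (\<integral>\<^sup>+\<eta>. ennreal ((norm (fourier f \<eta>))\<^sup>2) * indicator (fbox N) \<eta> \<partial>lborel) \<le> ennreal (s\<^sup>2))"

lemma dom_integrable:
  assumes F: "integrable lborel F" and f: "f \<in> dom F p"
  shows "integrable lborel f"
proof (rule Bochner_Integration.integrable_bound[OF F])
  show "AE y in lborel. norm (f y) \<le> norm (F y)"
  proof (intro AE_I2)
    fix y
    have "norm (f y) \<le> F y * indicator (cell p) y" using f by (auto simp: dom_def)
    also have "\<dots> \<le> norm (F y)" by (auto simp: indicator_def)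
    finally show "norm (f y) \<le> norm (F y)" .
  qed
qed (use f in \<open>auto simp: dom_def\<close>)

text \<open>Measured from the corner of its cell a coordinate has modulus at most 1, so the centred
  moment is dominated by the same \<open>F\<close>.\<close>

lemma dom_shift:
  assumes f: "f \<in> dom F p" shows "(\<lambda>y. of_real (y $ i - of_int (p $ i)) * f y) \<in> dom F p"
proof -
  have [measurable]: "f \<in> borel_measurable borel" using f by (auto simp: dom_def)
  have "norm (of_real (y $ i - of_int (p $ i)) * f y) \<le> F y * indicator (cell p) y" for y
  proof (cases "y \<in> cell p")
    case True
    then have "\<bar>y $ i - of_int (p $ i)\<bar> \<le> 1" using mem_cellD[OF True, of i] by auto
    then have "\<bar>y $ i - of_int (p $ i)\<bar> * norm (f y) \<le> 1 * norm (f y)" by (intro mult_right_mono) auto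
    moreover have "norm (f y) \<le> F y * indicator (cell p) y" using f by (auto simp: dom_def)
    ultimately show ?thesis unfolding norm_mult norm_of_real by linarith
  next
    case False
    then have "norm (f y) \<le> 0" using f by (auto simp: dom_def dest: spec[of _ y])
    then show ?thesis using False by simp
  qed
  then show ?thesis by (simp add: dom_def)
qed

lemma dom_moment:
  assumes F: "integrable lborel F" and f: "f \<in> dom F p"
  shows "integrable lborel (\<lambda>y. of_real (y $ i) * f y)"
    and "(\<lambda>y. of_real (y $ i) * f y) = (\<lambda>y. of_real (y $ i - of_int (p $ i)) * f y + of_int (p $ i) * f y)"
proof -
  show eq: "(\<lambda>y. of_real (y $ i) * f y) = (\<lambda>y. of_real (y $ i - of_int (p $ i)) * f y + of_int (p $ i) * f y)"
    by (simp add: algebra_simps)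
  show "integrable lborel (\<lambda>y. of_real (y $ i) * f y)"
    unfolding eq using dom_integrable[OF F f] dom_integrable[OF F dom_shift[OF f]]
    by (intro Bochner_Integration.integrable_add integrable_mult_right)
qed

text \<open>\<open>T\<close> stands for the value of the operator, \<open>T1\<close> for that of the
  differentiated symbol and \<open>T2\<close> for that with a centred moment. Replacing
  \<open>X\<close> by the corner \<open>q\<close> of its cell costs one more copy of
  \<open>T\<close>, which leaves the gain |q - p|.\<close>

lemma norm_shift_step:
  fixes X p q :: real and T T1 T2 :: complex
  assumes e: "of_real X * T - (T2 + of_real p * T) = \<i> * T1" and X: "X \<in> {q..q+1}"
  shows "\<bar>q - p\<bar> * norm T \<le> norm T1 + norm T + norm T2"
proof -
  have "of_real (q - p) * T = \<i> * T1 + T2 - of_real (X - q) * T"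
    using e by (simp add: algebra_simps)
  then have "norm (of_real (q - p) * T) \<le> norm (\<i> * T1) + norm T2 + norm (of_real (X - q) * T)"
    using norm_triangle_ineq4[of "\<i> * T1 + T2" "of_real (X - q) * T"] norm_triangle_ineq[of "\<i> * T1" T2]
    by (simp only:)
  then have "norm (of_real (q - p) * T) \<le> norm T1 + norm T2 + \<bar>X - q\<bar> * norm T"
    by (simp only: norm_mult norm_of_real norm_ii mult_1_left)
  moreover have "\<bar>X - q\<bar> * norm T \<le> 1 * norm T" using X by (intro mult_right_mono) auto
  ultimately show ?thesis unfolding norm_mult norm_of_real by linarith
qed

text \<open>One coordinate distance between the output cell and the cell of g is gained, at the
  price of a derivative of the symbol or a centred moment of g. Both remain in the classes over
  which the estimates are uniform.\<close>

lemma eta_step: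
  fixes b :: "'n::finite triple \<Rightarrow> complex"
  assumes b: "usym (Suc M) A L N b" and F: "integrable lborel F" and G: "integrable lborel G"
    and f: "f \<in> dom F p" and g: "g \<in> dom G p'"
  shows "\<exists>b' g'. usym M A L N b' \<and> g' \<in> dom G p' \<and> (\<forall>x\<in>cell q. \<bar>of_int (q $ i) - of_int (p' $ i)\<bar> * norm (bipsido b f g x)
      \<le> norm (bipsido b' f g x) + norm (bipsido b f g x) + norm (bipsido b f g' x))"
proof (intro exI conjI ballI)
  show "usym M A L N (ddir (0, 0, axis i 1) b)" by (rule usym_ddir[OF b]) (auto simp: eta_dirs_def)
  show g': "(\<lambda>y. of_real (y $ i - of_int (p' $ i)) * g y) \<in> dom G p'" by (rule dom_shift[OF g])
  fix x assume x: "x \<in> cell q"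
  show "\<bar>of_int (q $ i) - of_int (p' $ i)\<bar> * norm (bipsido b f g x)
      \<le> norm (bipsido (ddir (0, 0, axis i 1) b) f g x) + norm (bipsido b f g x) + norm (bipsido b f (\<lambda>y. of_real (y $ i - of_int (p' $ i)) * g y) x)"
    using bipsido_eta_parts[OF b dom_integrable[OF F f] dom_integrable[OF G g] dom_moment(1)[OF G g], of x i]
    unfolding dom_moment(2)[OF G g] bipsido_lincomb_right[OF b dom_integrable[OF F f] dom_integrable[OF G g'] dom_integrable[OF G g]]
    by (intro norm_shift_step[OF _ mem_cellD[OF x]]) simp
qed

lemma xi_step:
  fixes b :: "'n::finite triple \<Rightarrow> complex"
  assumes b: "usym (Suc M) A L N b" and F: "integrable lborel F" and G: "integrable lborel G"
    and f: "f \<in> dom F p" and g: "g \<in> dom G p'"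
  shows "\<exists>b' f'. usym M A L N b' \<and> f' \<in> dom F p \<and> (\<forall>x\<in>cell q. \<bar>of_int (q $ i) - of_int (p $ i)\<bar> * norm (bipsido b f g x)
      \<le> norm (bipsido b' f g x) + norm (bipsido b f g x) + norm (bipsido b f' g x))"
proof (intro exI conjI ballI)
  show "usym M A L N (ddir (0, axis i 1, 0) b)" by (rule usym_ddir[OF b]) (auto simp: xi_dirs_def)
  show f': "(\<lambda>y. of_real (y $ i - of_int (p $ i)) * f y) \<in> dom F p" by (rule dom_shift[OF f])
  fix x assume x: "x \<in> cell q"
  show "\<bar>of_int (q $ i) - of_int (p $ i)\<bar> * norm (bipsido b f g x)
      \<le> norm (bipsido (ddir (0, axis i 1, 0) b) f g x) + norm (bipsido b f g x) + norm (bipsido b (\<lambda>y. of_real (y $ i - of_int (p $ i)) * f y) g x)"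
    using bipsido_xi_parts[OF b dom_integrable[OF G g] dom_integrable[OF F f] dom_moment(1)[OF F f], of x i]
    unfolding dom_moment(2)[OF F f] bipsido_lincomb_left[OF b dom_integrable[OF F f'] dom_integrable[OF F f] dom_integrable[OF G g]]
    by (intro norm_shift_step[OF _ mem_cellD[OF x]]) simp
qed

lemma add3_powr_le:
  fixes a b c r :: real
  assumes "a \<ge> 0" "b \<ge> 0" "c \<ge> 0" "r > 0"
  shows "(a + b + c) powr r \<le> 3 powr r * (a powr r + b powr r + c powr r)"
proof -
  let ?m = "max a (max b c)"
  have "(a + b + c) powr r \<le> (3 * ?m) powr r" using assms by (intro powr_mono2) auto
  also have "\<dots> = 3 powr r * ?m powr r" by (rule powr_mult)
  also have "?m powr r \<le> a powr r + b powr r + c powr r"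
    by (cases "a \<le> b"; cases "b \<le> c"; cases "a \<le> c") (auto simp: max_def)
  finally show ?thesis by simp
qed

text \<open>The bound \<open>E\<close> is assumed for the whole class of symbols and functions, so
  each of the three terms of a step is again admissible. A round costs 3 for the number of terms and
  \<open>3 powr r\<close> for the power of a sum. The abstract step covers gains in either frequency
  variable.\<close>

lemma off_diagonal_decay_induct:
  fixes b :: "'n::finite triple \<Rightarrow> complex"
  assumes r: "r > 0" and E: "E \<ge> 0" and d: "d \<ge> 0"
    and int: "\<And>f. f \<in> dom F p \<Longrightarrow> integrable lborel f" "\<And>g. g \<in> dom G p' \<Longrightarrow> integrable lborel g"
    and base: "\<And>b f g. usym 0 A L N b \<Longrightarrow> f \<in> dom F p \<Longrightarrow> g \<in> dom G p' \<Longrightarrow>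
      (\<integral>\<^sup>+x. ennreal (norm (bipsido b f g x) powr r) * indicator (cell q) x \<partial>lborel) \<le> ennreal E"
    and step: "\<And>M b f g. usym (Suc M) A L N b \<Longrightarrow> f \<in> dom F p \<Longrightarrow> g \<in> dom G p' \<Longrightarrow>
      \<exists>b' f' g'. usym M A L N b' \<and> f' \<in> dom F p \<and> g' \<in> dom G p' \<and> (\<forall>x\<in>cell q. d * norm (bipsido b f g x)
      \<le> norm (bipsido b' f g x) + norm (bipsido b f g x) + norm (bipsido b f' g' x))"
  shows "usym M A L N b \<Longrightarrow> f \<in> dom F p \<Longrightarrow> g \<in> dom G p' \<Longrightarrow>
    (\<integral>\<^sup>+x. ennreal ((d ^ M * norm (bipsido b f g x)) powr r) * indicator (cell q) x \<partial>lborel) \<le> ennreal ((3 * 3 powr r) ^ M * E)"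
proof (induction M arbitrary: b f g)
  case 0
  then show ?case using base by simp
next
  case (Suc M)
  obtain b' f' g' where b': "usym M A L N b'" and f': "f' \<in> dom F p" and g': "g' \<in> dom G p'"
    and le: "\<And>x. x \<in> cell q \<Longrightarrow> d * norm (bipsido b f g x)
      \<le> norm (bipsido b' f g x) + norm (bipsido b f g x) + norm (bipsido b f' g' x)"
    using step[OF Suc.prems] by blast
  \<comment> \<open>Where no derivative falls on the symbol it reappears unchanged, with one order
    of its reserve forgotten.\<close>
  have b: "usym M A L N b" by (rule usym_mono[OF Suc.prems(1)]) simp
  have [measurable]: "bipsido b f g \<in> borel_measurable borel" "bipsido b' f g \<in> borel_measurable borel" "bipsido b f' g' \<in> borel_measurable borel"
    using b b' Suc.prems f' g' by (auto intro!: measurable_bipsido intro: usym_smooth simp: dom_def)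
  let ?u = "\<lambda>b f g x. ennreal ((d ^ M * norm (bipsido b f g x)) powr r) * indicator (cell q) x"
  have "ennreal ((d ^ Suc M * norm (bipsido b f g x)) powr r) * indicator (cell q) x
    \<le> ennreal (3 powr r) * (?u b' f g x + ?u b f g x + ?u b f' g' x)" for x
  proof (cases "x \<in> cell q")
    case True
    have "d ^ Suc M * norm (bipsido b f g x) \<le> d ^ M * norm (bipsido b' f g x) + d ^ M * norm (bipsido b f g x) + d ^ M * norm (bipsido b f' g' x)"
      using mult_left_mono[OF le[OF True], of "d ^ M"] d by (simp add: algebra_simps)
    then have "(d ^ Suc M * norm (bipsido b f g x)) powr r \<le> (d ^ M * norm (bipsido b' f g x) + d ^ M * norm (bipsido b f g x) + d ^ M * norm (bipsido b f' g' x)) powr r"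
      using r d by (intro powr_mono2) auto
    also have "\<dots> \<le> 3 powr r * ((d ^ M * norm (bipsido b' f g x)) powr r + (d ^ M * norm (bipsido b f g x)) powr r + (d ^ M * norm (bipsido b f' g' x)) powr r)"
      using d by (intro add3_powr_le r) auto
    finally show ?thesis using True by (simp flip: ennreal_mult ennreal_plus add: ennreal_leI)
  qed simp
  then have "(\<integral>\<^sup>+x. ennreal ((d ^ Suc M * norm (bipsido b f g x)) powr r) * indicator (cell q) x \<partial>lborel)
    \<le> (\<integral>\<^sup>+x. ennreal (3 powr r) * (?u b' f g x + ?u b f g x + ?u b f' g' x) \<partial>lborel)"
    by (intro nn_integral_mono)
  also have "\<dots> = ennreal (3 powr r) * ((\<integral>\<^sup>+x. ?u b' f g x \<partial>lborel) + (\<integral>\<^sup>+x. ?u b f g x \<partial>lborel) + (\<integral>\<^sup>+x. ?u b f' g' x \<partial>lborel))"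
    by (subst nn_integral_cmult, measurable, subst nn_integral_add, measurable, subst nn_integral_add, measurable)
  also have "\<dots> \<le> ennreal (3 powr r) * (ennreal ((3 * 3 powr r) ^ M * E) + ennreal ((3 * 3 powr r) ^ M * E) + ennreal ((3 * 3 powr r) ^ M * E))"
    by (intro mult_left_mono add_mono Suc.IH b b' f' g' Suc.prems) auto
  also have "\<dots> = ennreal ((3 * 3 powr r) ^ Suc M * E)"
    using E by (simp flip: ennreal_mult ennreal_plus add: algebra_simps)
  finally show ?case .
qed

text \<open>The squares make the reciprocal summable over the lattice, and the product form makes
  that sum factorise.\<close>

definition wt :: "int^'n::finite \<Rightarrow> real" where "wt k = (\<Prod>i\<in>UNIV. (1 + of_int \<bar>k $ i\<bar>)\<^sup>2)"

lemma wt_ge_1: "wt k \<ge> 1"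
  unfolding wt_def by (intro prod_ge_1) (auto intro: one_le_power)

lemma wt_le: "(\<And>i. \<bar>k $ i\<bar> \<le> D) \<Longrightarrow> wt (k :: int^'n::finite) \<le> (1 + of_int D) ^ (2 * CARD('n))"
proof -
  assume D: "\<And>i. \<bar>k $ i\<bar> \<le> D"
  have "wt k \<le> (\<Prod>i\<in>(UNIV :: 'n set). (1 + of_int D)\<^sup>2)"
    unfolding wt_def by (intro prod_mono conjI power_mono) (auto simp: D simp flip: of_int_abs)
  then show ?thesis by (simp add: power_mult)
qed

text \<open>All integrations by parts use the one coordinate in which \<open>p - q\<close> or
  \<open>p' - q\<close> is largest, since this distance controls both weights. The power r + 1
  anticipates the summation: r of it is spent on weights, and the last one makes the sums over cells
  converge.\<close>

lemma off_diagonal_decay: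
  assumes r: "r > 0"
  shows "\<exists>M K. K \<ge> 0 \<and> (\<forall>(b :: 'n::finite triple \<Rightarrow> complex) A L N F G p p' q sF sG f g.
    usym M A L N b \<longrightarrow> L \<ge> 1 \<longrightarrow> N \<ge> 1 \<longrightarrow> integrable lborel F \<longrightarrow> integrable lborel G \<longrightarrow>
    locsize N F p sF \<longrightarrow> locsize N G p' sG \<longrightarrow> f \<in> dom F p \<longrightarrow> g \<in> dom G p' \<longrightarrow>
    (\<integral>\<^sup>+x. ennreal (norm (bipsido b f g x) powr r) * indicator (cell q) x \<partial>lborel)
      \<le> ennreal (K * (wt (p - q) * wt (p' - q)) powr (- (r + 1)) *
          (A * sF * sG * (L powr (CARD('n) / 2) * N powr (CARD('n) * max (1/2) (1 - 1/r)))) powr r))"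
proof -
  obtain K where K: "K \<ge> 0" and base: "\<And>(b :: 'n triple \<Rightarrow> complex) A L N f g sf sg q.
    usym 0 A L N b \<Longrightarrow> L \<ge> 1 \<Longrightarrow> N \<ge> 1 \<Longrightarrow> integrable lborel f \<Longrightarrow> integrable lborel g \<Longrightarrow> sf \<ge> 0 \<Longrightarrow> sg \<ge> 0 \<Longrightarrow>
    (\<integral>\<^sup>+\<eta>. ennreal ((norm (fourier f \<eta>))\<^sup>2) * indicator (fbox N) \<eta> \<partial>lborel) \<le> ennreal (sf\<^sup>2) \<Longrightarrow>
    (\<integral>\<^sup>+\<eta>. ennreal ((norm (fourier g \<eta>))\<^sup>2) * indicator (fbox N) \<eta> \<partial>lborel) \<le> ennreal (sg\<^sup>2) \<Longrightarrow>
    (\<integral>\<^sup>+x. ennreal (norm (bipsido b f g x) powr r) * indicator (cell q) x \<partial>lborel)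
      \<le> ennreal (K * (A * sf * sg * (L powr (CARD('n) / 2) * N powr (CARD('n) * max (1/2) (1 - 1/r)))) powr r)"
    using base_estimate[OF r, where 'n='n] by blast
  define n where "n = CARD('n)"
  \<comment> \<open>The weights together are at most (1 + D)^(4n) for the largest distance D, so the
    gain D^(Mr) has to match the exponent 4n(r + 1).\<close>
  define M where "M = nat \<lceil>4 * real n * (r + 1) / r\<rceil>"
  have M: "4 * real n * (r + 1) \<le> real M * r"
    using real_nat_ceiling_ge[of "4 * real n * (r + 1) / r"] unfolding M_def pos_divide_le_eq[OF r] .
  define K' where "K' = (3 * 3 powr r) ^ M * 2 powr (real M * r) * K"
  have "(1::real) \<le> (3 * 3 powr r) ^ M * 2 powr (real M * r)"
    using r by (intro mult_ge1_I one_le_power ge_one_powr_ge_zero) (auto intro: mult_ge1_I[of 3 "3 powr r", simplified] ge_one_powr_ge_zero simp: one_le_mult_iff)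
  then have KK': "K \<le> K'" using K mult_right_mono[of 1 _ K] by (simp add: K'_def)
  have K'0: "K' \<ge> 0" using KK' K by simp
  show ?thesis
  proof (intro exI[of _ M] exI[of _ K'] conjI K'0 allI impI)
    fix b :: "'n triple \<Rightarrow> complex" and A L N and F G :: "real^'n \<Rightarrow> real" and p p' q :: "int^'n" and sF sG and f g :: "real^'n \<Rightarrow> complex"
    assume b: "usym M A L N b" and L: "L \<ge> 1" and N: "N \<ge> 1" and F: "integrable lborel F" and G: "integrable lborel G"
      and sF: "locsize N F p sF" and sG: "locsize N G p' sG" and f: "f \<in> dom F p" and g: "g \<in> dom G p'"
    let ?X = "A * sF * sG * (L powr (CARD('n) / 2) * N powr (CARD('n) * max (1/2) (1 - 1/r)))"
    define E where "E = K * ?X powr r"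
    have E0: "E \<ge> 0" using K by (simp add: E_def)
    have bs: "(\<integral>\<^sup>+x. ennreal (norm (bipsido b f g x) powr r) * indicator (cell q) x \<partial>lborel) \<le> ennreal E"
      if "usym 0 A L N b" "f \<in> dom F p" "g \<in> dom G p'" for b f g
      unfolding E_def using that sF sG dom_integrable[OF F] dom_integrable[OF G]
      by (intro base L N) (auto simp: locsize_def)
    define DD where "DD = Max (range (\<lambda>i. \<bar>(p - q) $ i\<bar>) \<union> range (\<lambda>i. \<bar>(p' - q) $ i\<bar>))"
    have DD: "\<bar>(p - q) $ i\<bar> \<le> DD" "\<bar>(p' - q) $ i\<bar> \<le> DD" for i by (auto simp: DD_def intro!: Max_ge)
    have DD0: "DD \<ge> 0" using DD(1)[of undefined] by linarith
    have "DD \<in> range (\<lambda>i. \<bar>(p - q) $ i\<bar>) \<union> range (\<lambda>i. \<bar>(p' - q) $ i\<bar>)"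
      unfolding DD_def by (intro Max_in) auto
    then have ex: "\<exists>b' f' g'. usym M' A L N b' \<and> f' \<in> dom F p \<and> g' \<in> dom G p' \<and> (\<forall>x\<in>cell q. of_int DD * norm (bipsido b f g x)
      \<le> norm (bipsido b' f g x) + norm (bipsido b f g x) + norm (bipsido b f' g' x))"
      if h: "usym (Suc M') A L N b" "f \<in> dom F p" "g \<in> dom G p'" for M' b f g
    proof (elim UnE rangeE)
      fix i assume e: "DD = \<bar>(p - q) $ i\<bar>"
      then have "of_int DD = \<bar>of_int (q $ i) - of_int (p $ i) :: real\<bar>" by simp
      then show ?thesis using xi_step[OF h(1) F G h(2,3), of q i] h by metis
    next
      fix i assume e: "DD = \<bar>(p' - q) $ i\<bar>"
      then have "of_int DD = \<bar>of_int (q $ i) - of_int (p' $ i) :: real\<bar>" by simp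
      then show ?thesis using eta_step[OF h(1) F G h(2,3), of q i] h by metis
    qed
    let ?w = "wt (p - q) * wt (p' - q)"
    let ?I = "\<integral>\<^sup>+x. ennreal (norm (bipsido b f g x) powr r) * indicator (cell q) x \<partial>lborel"
    have w1: "?w \<ge> 1" using wt_ge_1[of "p - q"] wt_ge_1[of "p' - q"] by (metis mult_ge1_I)
    have w2: "?w \<le> (1 + of_int DD) ^ (4 * n)"
    proof -
      have "?w \<le> (1 + of_int DD) ^ (2 * n) * (1 + of_int DD) ^ (2 * n)"
        unfolding n_def using DD wt_ge_1[of "p - q"] wt_ge_1[of "p' - q"] DD0 by (intro mult_mono wt_le) auto
      then show ?thesis by (simp flip: power_add)
    qed
    show "?I \<le> ennreal (K' * ?w powr (- (r + 1)) * ?X powr r)"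
    proof (cases "DD = 0")
      \<comment> \<open>At distance 0 nothing is gained, but the product of the weights is 1 and the
        base estimate suffices.\<close>
      case True
      then have w: "?w = 1" using w1 w2 by simp
      have "?I \<le> ennreal E" by (rule bs[OF usym_mono[OF b] f g]) simp
      also have "E \<le> K' * ?w powr (- (r + 1)) * ?X powr r" unfolding w E_def using KK' by (simp add: mult_right_mono)
      finally show ?thesis by (simp add: ennreal_leI)
    next
      case False
      then have D1: "DD \<ge> 1" using DD0 by simp
      define D where "D = real_of_int DD"
      have D: "D \<ge> 1" using D1 by (simp add: D_def)
      have "ennreal ((D ^ M) powr r) * ?I = (\<integral>\<^sup>+x. ennreal ((D ^ M) powr r) * (ennreal (norm (bipsido b f g x) powr r) * indicator (cell q) x) \<partial>lborel)"
      proof (rule nn_integral_cmult[symmetric])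
        have [measurable]: "bipsido b f g \<in> borel_measurable borel"
          using f g by (auto intro!: measurable_bipsido usym_smooth[OF b] simp: dom_def)
        show "(\<lambda>x. ennreal (norm (bipsido b f g x) powr r) * indicator (cell q) x) \<in> borel_measurable lborel" by measurable
      qed
      also have "\<dots> = (\<integral>\<^sup>+x. ennreal ((D ^ M * norm (bipsido b f g x)) powr r) * indicator (cell q) x \<partial>lborel)"
        using D by (intro nn_integral_cong) (simp add: powr_mult ennreal_mult mult.assoc)
      also have "\<dots> \<le> ennreal ((3 * 3 powr r) ^ M * E)"
        unfolding D_def
        by (rule off_diagonal_decay_induct[OF r E0 _ dom_integrable[OF F] dom_integrable[OF G] bs ex b f g]) (use DD0 in auto)
      finally have 1: "ennreal ((D ^ M) powr r) * ?I \<le> ennreal ((3 * 3 powr r) ^ M * E)" .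
      have "?I = ennreal ((D ^ M) powr (- r)) * (ennreal ((D ^ M) powr r) * ?I)"
      proof -
        have "ennreal ((D ^ M) powr (- r)) * ennreal ((D ^ M) powr r) = 1"
          using D by (simp flip: ennreal_mult powr_add)
        then show ?thesis by (simp flip: mult.assoc)
      qed
      also have "\<dots> \<le> ennreal ((D ^ M) powr (- r)) * ennreal ((3 * 3 powr r) ^ M * E)"
        by (intro mult_left_mono 1) simp
      also have "\<dots> = ennreal ((D ^ M) powr (- r) * ((3 * 3 powr r) ^ M * E))"
        using E0 by (simp add: ennreal_mult)
      also have "(D ^ M) powr (- r) * ((3 * 3 powr r) ^ M * E) \<le> (2 powr (real M * r) * ?w powr (- (r + 1))) * ((3 * 3 powr r) ^ M * E)"
      proof (intro mult_right_mono)
        have "?w powr (r + 1) \<le> ((1 + D) ^ (4 * n)) powr (r + 1)"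
          using w1 w2 r unfolding D_def by (intro powr_mono2) auto
        also have "\<dots> = (1 + D) powr (4 * real n * (r + 1))"
          using D by (simp add: powr_powr flip: powr_realpow)
        also have "\<dots> \<le> (1 + D) powr (real M * r)" using D M by (intro powr_mono) auto
        \<comment> \<open>D is an integer distance and at least 1, so 1 + D \<le> 2 D; this is the
          origin of the factor \<open>2 powr (real M * r)\<close> in \<open>K'\<close>.\<close>
        also have "\<dots> \<le> (2 * D) powr (real M * r)" using D r by (intro powr_mono2) auto
        also have "\<dots> = 2 powr (real M * r) * (D ^ M) powr r"
          using D by (simp add: powr_mult powr_powr flip: powr_realpow)
        finally have 2: "?w powr (r + 1) \<le> 2 powr (real M * r) * (D ^ M) powr r" .
        have "(D ^ M) powr (- r) = ?w powr (- (r + 1)) * (?w powr (r + 1) * (D ^ M) powr (- r))"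
        proof -
          have "?w powr (- (r + 1)) * ?w powr (r + 1) = ?w powr 0" by (subst powr_add[symmetric]) simp
          also have "?w \<noteq> 0" using w1 by linarith
          then have "?w powr 0 = 1" by (simp only: powr_zero_eq_one if_False)
          finally show ?thesis by (simp only: mult.assoc[symmetric] mult_1_left)
        qed
        also have "\<dots> \<le> ?w powr (- (r + 1)) * (2 powr (real M * r) * (D ^ M) powr r * (D ^ M) powr (- r))"
          using 2 by (intro mult_left_mono mult_right_mono) auto
        also have "\<dots> = 2 powr (real M * r) * ?w powr (- (r + 1))"
          using D by (simp add: mult.assoc flip: powr_add)
        finally show "(D ^ M) powr (- r) \<le> 2 powr (real M * r) * ?w powr (- (r + 1))" .
      qed (use E0 in auto)
      also have "\<dots> = K' * ?w powr (- (r + 1)) * ?X powr r" by (simp add: K'_def E_def mult_ac)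
      finally show ?thesis by (simp add: ennreal_leI)
    qed
  qed
qed

section \<open>Summation over cells\<close>

definition zbox :: "nat \<Rightarrow> (int^'n::finite) set" where "zbox j = {k. \<forall>i. \<bar>k $ i\<bar> \<le> int j}"

lemma zbox_image: "zbox j = (\<lambda>f. \<chi> i. f i) ` (PiE UNIV (\<lambda>_::'n::finite. {- int j..int j}))"
proof (intro set_eqI iffI)
  fix k :: "int^'n" assume "k \<in> zbox j"
  then have "k = (\<chi> i. (\<lambda>i. k $ i) i)" "(\<lambda>i. k $ i) \<in> PiE UNIV (\<lambda>_. {- int j..int j})"
    by (auto simp: zbox_def abs_le_iff) (metis minus_le_iff)+
  then show "k \<in> (\<lambda>f. \<chi> i. f i) ` (PiE UNIV (\<lambda>_::'n. {- int j..int j}))" by blast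
next
  fix k :: "int^'n" assume "k \<in> (\<lambda>f. \<chi> i. f i) ` (PiE UNIV (\<lambda>_::'n. {- int j..int j}))"
  then obtain f where f: "k = (\<chi> i. f i)" "f \<in> PiE UNIV (\<lambda>_. {- int j..int j})" by blast
  have "f i \<in> {- int j..int j}" for i using f(2) by auto
  then show "k \<in> zbox j" unfolding zbox_def f(1) by (simp add: abs_le_iff minus_le_iff)
qed

lemma finite_zbox: "finite (zbox j)"
  unfolding zbox_image by (intro finite_imageI finite_PiE) auto

text \<open>The correction 2/(j + 1) makes the induction telescope: each new pair of terms is at
  most the drop of the correction.\<close>

lemma sum_inverse_square: "(\<Sum>m\<in>{- int j..int j}. 1 / (1 + of_int \<bar>m\<bar>)\<^sup>2) \<le> (4 - 2 / (real j + 1) :: real)"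
proof (induction j)
  case (Suc j)
  have "{- int (Suc j)..int (Suc j)} = insert (int (Suc j)) (insert (- int (Suc j)) {- int j..int j})" by auto
  then have "(\<Sum>m\<in>{- int (Suc j)..int (Suc j)}. 1 / (1 + of_int \<bar>m\<bar>)\<^sup>2) = 2 / (real j + 2)\<^sup>2 + (\<Sum>m\<in>{- int j..int j}. 1 / (1 + of_int \<bar>m\<bar>)\<^sup>2 :: real)"
    by (simp add: add_ac)
  moreover have "2 / (real j + 2)\<^sup>2 \<le> 2 / (real j + 1) - 2 / (real (Suc j) + 1)"
  proof -
    have "2 / (real j + 1) - 2 / (real (Suc j) + 1) = 2 / ((real j + 1) * (real j + 2))" by (simp add: field_simps)
    moreover have "2 / (real j + 2)\<^sup>2 \<le> 2 / ((real j + 1) * (real j + 2))"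
      unfolding power2_eq_square by (intro divide_left_mono mult_right_mono) auto
    ultimately show ?thesis by simp
  qed
  ultimately show ?case using Suc by simp
qed simp

text \<open>Every finite set of lattice points lies in a cube, where the sum of the product is a
  product of one-dimensional sums, each at most 4.\<close>

lemma sum_inverse_wt:
  assumes "finite Z" shows "(\<Sum>k\<in>Z. 1 / wt (k :: int^'n::finite)) \<le> 4 ^ CARD('n)"
proof -
  have "\<exists>j. Z \<subseteq> zbox j"
    using assms
  proof (induction Z rule: finite_induct)
    case (insert k Z)
    then obtain j where j: "Z \<subseteq> zbox j" by blast
    define j' where "j' = max j (nat (Max (range (\<lambda>i. \<bar>k $ i\<bar>))))"
    have "\<bar>k $ i\<bar> \<le> Max (range (\<lambda>i. \<bar>k $ i\<bar>))" for i by (intro Max_ge) auto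
    then have le: "\<bar>k $ i\<bar> \<le> int (nat (Max (range (\<lambda>i. \<bar>k $ i\<bar>))))" for i using order_trans int_nat_eq by (metis abs_ge_zero)
    have "int (nat (Max (range (\<lambda>i. \<bar>k $ i\<bar>)))) \<le> int j'"
      unfolding j'_def by (intro of_nat_mono max.cobounded2)
    then have "\<bar>k $ i\<bar> \<le> int j'" for i by (rule order_trans[OF le])
    then have "k \<in> zbox j'" by (auto simp: zbox_def)
    moreover have "zbox j \<subseteq> zbox j'" by (auto simp: zbox_def j'_def intro: order_trans)
    ultimately show ?case using j by (intro exI[of _ j']) auto
  qed auto
  then obtain j where "Z \<subseteq> zbox j" by blast
  then have "(\<Sum>k\<in>Z. 1 / wt k) \<le> (\<Sum>k\<in>(zbox j :: (int^'n) set). 1 / wt k)"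
    by (intro sum_mono2 finite_zbox) (auto intro: order_trans[OF _ wt_ge_1])
  also have "\<dots> = (\<Sum>f\<in>PiE UNIV (\<lambda>_::'n. {- int j..int j}). \<Prod>i\<in>UNIV. 1 / (1 + of_int \<bar>f i\<bar>)\<^sup>2)"
    unfolding zbox_image
    by (subst sum.reindex) (auto simp: inj_on_def vec_eq_iff wt_def prod_dividef fun_eq_iff)
  also have "\<dots> = (\<Prod>i\<in>(UNIV::'n set). \<Sum>m\<in>{- int j..int j}. 1 / (1 + of_int \<bar>m\<bar>)\<^sup>2)"
    by (subst prod_sum_PiE) auto
  also have "\<dots> \<le> (\<Prod>i\<in>(UNIV::'n set). 4)"
    by (intro prod_mono conjI sum_nonneg order_trans[OF sum_inverse_square]) auto
  finally show ?thesis by simp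
qed

lemma sum_inverse_wt_shift:
  assumes "finite Z" shows "(\<Sum>k\<in>Z. 1 / wt (k - c :: int^'n::finite)) \<le> 4 ^ CARD('n)"
    and "(\<Sum>k\<in>Z. 1 / wt (c - k :: int^'n::finite)) \<le> 4 ^ CARD('n)"
proof -
  have "(\<Sum>k\<in>Z. 1 / wt (k - c)) = (\<Sum>k\<in>(\<lambda>k. k - c) ` Z. 1 / wt k)"
    by (subst sum.reindex) (auto simp: inj_on_def)
  then show "(\<Sum>k\<in>Z. 1 / wt (k - c :: int^'n::finite)) \<le> 4 ^ CARD('n)" using sum_inverse_wt[of "(\<lambda>k. k - c) ` Z"] assms by simp
  have "(\<Sum>k\<in>Z. 1 / wt (c - k)) = (\<Sum>k\<in>(\<lambda>k. c - k) ` Z. 1 / wt k)"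
    by (subst sum.reindex) (auto simp: inj_on_def)
  then show "(\<Sum>k\<in>Z. 1 / wt (c - k :: int^'n::finite)) \<le> 4 ^ CARD('n)" using sum_inverse_wt[of "(\<lambda>k. c - k) ` Z"] assms by simp
qed

text \<open>Replaces the triangle inequality of \<open>L\<^sup>r\<close>, which fails for \<open>r < 1\<close>.\<close>

lemma weighted_sum_powr:
  fixes t w :: "'i \<Rightarrow> real"
  assumes I: "finite I" and r: "r > 0" and w: "\<And>i. i \<in> I \<Longrightarrow> w i > 0" and t: "\<And>i. i \<in> I \<Longrightarrow> t i \<ge> 0"
    and S: "(\<Sum>i\<in>I. 1 / w i) \<le> S"
  shows "(\<Sum>i\<in>I. t i) powr r \<le> S powr r * (\<Sum>i\<in>I. (w i * t i) powr r)"
proof -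
  define Y where "Y = (\<Sum>i\<in>I. (w i * t i) powr r)"
  have Y0: "Y \<ge> 0" unfolding Y_def by (intro sum_nonneg) simp
  have S0: "S \<ge> 0" by (rule order_trans[OF _ S]) (auto intro!: sum_nonneg less_imp_le[OF w])
  have "t i \<le> 1 / w i * Y powr (1 / r)" if "i \<in> I" for i
  proof -
    have "(w i * t i) powr r \<le> Y" unfolding Y_def by (rule member_le_sum) (use that I in auto)
    then have "((w i * t i) powr r) powr (1 / r) \<le> Y powr (1 / r)" using r by (intro powr_mono2) auto
    moreover have "((w i * t i) powr r) powr (1 / r) = w i * t i" using r w[OF that] t[OF that] by (simp add: powr_powr)
    ultimately have "w i * t i \<le> Y powr (1 / r)" by simp
    then show ?thesis using w[OF that] by (simp add: field_simps)
  qed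
  then have "(\<Sum>i\<in>I. t i) \<le> (\<Sum>i\<in>I. 1 / w i) * Y powr (1 / r)"
    unfolding sum_distrib_right by (intro sum_mono)
  also have "\<dots> \<le> S * Y powr (1 / r)" by (intro mult_right_mono S) simp
  finally have "(\<Sum>i\<in>I. t i) powr r \<le> (S * Y powr (1 / r)) powr r"
    using r t by (intro powr_mono2) (auto intro: sum_nonneg)
  also have "\<dots> = S powr r * Y" using r Y0 by (simp add: powr_mult powr_powr)
  finally show ?thesis unfolding Y_def .
qed

section \<open>Truncation to finitely many cells\<close>

definition cells :: "nat \<Rightarrow> (real^'n::finite) set" where "cells j = (\<Union>k\<in>zbox j. cell k)"

lemma measurable_cells[measurable]: "cells j \<in> sets borel"
  unfolding cells_def by (intro sets.finite_UN finite_zbox) measurable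

lemma indicator_cells: "(indicator (cells j) x :: real) = (\<Sum>k\<in>zbox j. indicator (cell k) x)"
proof -
  have "cell k \<inter> cell k' = {}" if "k \<noteq> k'" for k k' :: "int^'a"
    using that by (auto simp: cell_def vec_eq_iff)
  then have "disjoint_family_on cell (zbox j :: (int^'a) set)" by (simp add: disjoint_family_on_def)
  then show ?thesis unfolding cells_def by (simp add: indicator_UN_disjoint[OF finite_zbox])
qed

lemma eventually_cells: "eventually (\<lambda>j. x \<in> cells j) sequentially"
proof -
  define k :: "int^'a" where "k = (\<chi> i. \<lfloor>x $ i\<rfloor>)"
  define J where "J = nat (Max (range (\<lambda>i. \<bar>k $ i\<bar>)))"
  have "\<bar>k $ i\<bar> \<le> int J" for i
  proof -
    have "\<bar>k $ i\<bar> \<le> Max (range (\<lambda>i. \<bar>k $ i\<bar>))" by (intro Max_ge) auto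
    then show ?thesis unfolding J_def by linarith
  qed
  then have "k \<in> zbox j" if "j \<ge> J" for j
    using that order_trans[OF \<open>\<And>i. \<bar>k $ i\<bar> \<le> int J\<close>, of "int j"] by (simp add: zbox_def)
  moreover have "x \<in> cell k" by (simp add: k_def cell_def)
  ultimately show ?thesis unfolding eventually_sequentially cells_def by blast
qed

text \<open>The truncation turns the decomposition into cell pieces into a finite sum, to which
  bilinearity applies; Fatou's lemma removes it at the end.\<close>

definition trunc :: "nat \<Rightarrow> (real^'n::finite \<Rightarrow> complex) \<Rightarrow> real^'n \<Rightarrow> complex" where
  "trunc j f y = f y * indicator (cells j) y"

lemma trunc_measurable[measurable (raw)]: "f \<in> borel_measurable borel \<Longrightarrow> trunc j f \<in> borel_measurable borel"
  unfolding trunc_def[abs_def] by (intro borel_measurable_times borel_measurable_indicator measurable_cells)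

lemma norm_trunc_le: "norm (trunc j f y) \<le> norm (f y)"
  by (simp add: trunc_def norm_mult indicator_def)

lemma trunc_integrable: "integrable lborel f \<Longrightarrow> integrable lborel (trunc j f)"
  by (rule Bochner_Integration.integrable_bound[of _ f]) (auto intro!: AE_I2 norm_trunc_le trunc_measurable)

lemma trunc_tendsto: "(\<lambda>j. trunc j f y) \<longlonglongrightarrow> f y"
proof (rule tendsto_eventually)
  show "eventually (\<lambda>j. trunc j f y = f y) sequentially"
    using eventually_cells[of y] by eventually_elim (simp add: trunc_def)
qed

lemma fourier_trunc_tendsto:
  assumes f: "integrable lborel f"
  shows "(\<lambda>j. fourier (trunc j f) \<xi>) \<longlonglongrightarrow> fourier f \<xi>"
  unfolding fourier_def
proof (rule integral_dominated_convergence[where w="\<lambda>y. norm (f y)"])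
  have [measurable]: "f \<in> borel_measurable borel" using f by simp
  show "(\<lambda>y. f y * cis (- (y \<bullet> \<xi>))) \<in> borel_measurable lborel" by measurable
  show "(\<lambda>y. trunc j f y * cis (- (y \<bullet> \<xi>))) \<in> borel_measurable lborel" for j by measurable
  show "AE y in lborel. (\<lambda>j. trunc j f y * cis (- (y \<bullet> \<xi>))) \<longlonglongrightarrow> f y * cis (- (y \<bullet> \<xi>))"
    by (intro AE_I2 tendsto_mult trunc_tendsto tendsto_const)
qed (use f in \<open>auto simp: norm_mult norm_trunc_le\<close>)

lemma norm_fourier_trunc_le:
  assumes f: "integrable lborel f"
  shows "norm (fourier (trunc j f) \<xi>) \<le> (LINT y|lborel. norm (f y))"
  using f norm_trunc_le
  by (intro order_trans[OF norm_fourier_le[OF trunc_integrable[OF f]]] Bochner_Integration.integral_mono integrable_norm trunc_integrable)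

text \<open>Dominated convergence in \<eta> and then in \<xi>: the transforms of the truncations
  converge pointwise and are bounded by the L^1 norms, while the symbol confines both integrals to
  the box.\<close>

lemma bipsido_trunc_tendsto:
  fixes b :: "'n::finite triple \<Rightarrow> complex"
  assumes b: "usym M A L N b" and f: "integrable lborel f" and g: "integrable lborel g"
  shows "(\<lambda>j. bipsido b (trunc j f) (trunc j g) x) \<longlonglongrightarrow> bipsido b f g x"
proof -
  have [measurable]: "g \<in> borel_measurable borel" "f \<in> borel_measurable borel" using g f by auto
  have [measurable]: "smooth_on_dirs alld b" using b by (rule usym_smooth)
  define Wf where "Wf = (LINT y|lborel. norm (f y))"
  define Wg where "Wg = (LINT y|lborel. norm (g y))"
  have A: "A \<ge> 0" using b by (rule usym_nonneg)
  have Wg0: "Wg \<ge> 0" by (simp add: Wg_def)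
  have bd: "norm (b (x, \<xi>, \<eta>) * fourier (trunc j g) \<eta> * cis (x \<bullet> \<eta>)) \<le> A * Wg * indicator (fbox N) \<eta>" for \<xi> \<eta> j
  proof (cases "\<eta> \<in> fbox N")
    case True
    have "norm (b (x, \<xi>, \<eta>)) * norm (fourier (trunc j g) \<eta>) \<le> A * Wg"
      unfolding Wg_def by (intro mult_mono usym_bound[OF b] norm_fourier_trunc_le g A) auto
    then show ?thesis using True by (simp add: norm_mult)
  qed (use usym_supp[OF b, of \<xi> \<eta> "[]" x] in simp)
  have j: "(\<lambda>j. jint b (trunc j g) x \<xi>) \<longlonglongrightarrow> jint b g x \<xi>" for \<xi>
  proof (rule integral_dominated_convergence[where w="\<lambda>\<eta>. A * Wg * indicator (fbox N) \<eta>"])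
    show "AE \<eta> in lborel. (\<lambda>j. b (x, \<xi>, \<eta>) * fourier (trunc j g) \<eta> * cis (x \<bullet> \<eta>)) \<longlonglongrightarrow> b (x, \<xi>, \<eta>) * fourier g \<eta> * cis (x \<bullet> \<eta>)"
      by (intro AE_I2 tendsto_mult fourier_trunc_tendsto g tendsto_const)
    show "integrable lborel (\<lambda>\<eta>::real^'n. A * Wg * indicator (fbox N) \<eta>)" by (rule integrable_fbox_real)
  qed (use bd in simp_all)
  define R where "R = (LINT \<eta>|lborel. A * Wg * indicator (fbox N) (\<eta>::real^'n))"
  have jb: "norm (jint b (trunc j g) x \<xi>) \<le> R * indicator (fbox N) \<xi>" for j \<xi>
  proof (cases "\<xi> \<in> fbox N")
    case True
    have "norm (jint b (trunc j g) x \<xi>) \<le> R"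
      unfolding R_def
      by (rule Bochner_Integration.integral_norm_bound_integral[OF integrable_fbox[OF _ bd] integrable_fbox_real]) (use bd in simp_all)
    then show ?thesis using True by simp
  qed (use inner_outside[OF b] in simp)
  show ?thesis
    unfolding bipsido_eq
  proof (rule integral_dominated_convergence[where w="\<lambda>\<xi>. Wf * R * indicator (fbox N) \<xi>"])
    show "AE \<xi> in lborel. (\<lambda>j. fourier (trunc j f) \<xi> * cis (x \<bullet> \<xi>) * jint b (trunc j g) x \<xi>) \<longlonglongrightarrow> fourier f \<xi> * cis (x \<bullet> \<xi>) * jint b g x \<xi>"
      by (intro AE_I2 tendsto_mult fourier_trunc_tendsto f j tendsto_const)
    show "integrable lborel (\<lambda>\<xi>::real^'n. Wf * R * indicator (fbox N) \<xi>)" by (rule integrable_fbox_real)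
    show "AE \<xi> in lborel. norm (fourier (trunc j f) \<xi> * cis (x \<bullet> \<xi>) * jint b (trunc j g) x \<xi>) \<le> Wf * R * indicator (fbox N) \<xi>" for j
    proof (intro AE_I2)
      fix \<xi>
      have "norm (fourier (trunc j f) \<xi>) * norm (jint b (trunc j g) x \<xi>) \<le> Wf * (R * indicator (fbox N) \<xi>)"
        unfolding Wf_def by (intro mult_mono norm_fourier_trunc_le f jb) auto
      then show "norm (fourier (trunc j f) \<xi> * cis (x \<bullet> \<xi>) * jint b (trunc j g) x \<xi>) \<le> Wf * R * indicator (fbox N) \<xi>"
        by (simp only: norm_mult norm_cis mult_1_right mult.assoc)
    qed
  qed measurable
qed

definition piece :: "int^'n \<Rightarrow> (real^'n::finite \<Rightarrow> complex) \<Rightarrow> real^'n \<Rightarrow> complex" where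
  "piece p f y = f y * indicator (cell p) y"

lemma piece_dom: "f \<in> borel_measurable borel \<Longrightarrow> piece p f \<in> dom (\<lambda>y. norm (f y)) p"
  by (auto simp: dom_def piece_def[abs_def] norm_mult indicator_def)

lemma piece_integrable: "integrable lborel f \<Longrightarrow> integrable lborel (piece p f)"
  by (rule dom_integrable[OF integrable_norm piece_dom]) auto

lemma trunc_eq: "trunc j f y = (\<Sum>p\<in>zbox j. piece p f y)"
proof -
  have "(indicator (cells j) y :: complex) = of_real (indicator (cells j) y)" by (simp add: indicator_def)
  also have "\<dots> = (\<Sum>p\<in>zbox j. of_real (indicator (cell p) y))" by (simp only: indicator_cells of_real_sum)
  also have "\<dots> = (\<Sum>p\<in>zbox j. indicator (cell p) y)" by (intro sum.cong) (auto simp: indicator_def)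
  finally show ?thesis by (simp add: trunc_def piece_def sum_distrib_left)
qed

lemma bipsido_zero: "bipsido b (\<lambda>y. 0) g x = 0" "bipsido b f (\<lambda>y. 0) x = 0"
  by (simp_all add: bipsido_eq fourier_def)

lemma bipsido_sum_left:
  fixes b :: "'n::finite triple \<Rightarrow> complex"
  assumes b: "usym M A L N b" and g: "integrable lborel g" and "finite Z" "\<And>p. p \<in> Z \<Longrightarrow> integrable lborel (u p)"
  shows "bipsido b (\<lambda>y. \<Sum>p\<in>Z. u p y) g x = (\<Sum>p\<in>Z. bipsido b (u p) g x)"
  using assms(3,4)
proof (induction Z rule: finite_induct)
  case (insert p Z)
  then show ?case
    using bipsido_lincomb_left[OF b, of "u p" "\<lambda>y. \<Sum>p\<in>Z. u p y" g 1 x] g by simp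
qed (simp add: bipsido_zero)

lemma bipsido_sum_right:
  fixes b :: "'n::finite triple \<Rightarrow> complex"
  assumes b: "usym M A L N b" and f: "integrable lborel f" and "finite Z" "\<And>p. p \<in> Z \<Longrightarrow> integrable lborel (u p)"
  shows "bipsido b f (\<lambda>y. \<Sum>p\<in>Z. u p y) x = (\<Sum>p\<in>Z. bipsido b f (u p) x)"
  using assms(3,4)
proof (induction Z rule: finite_induct)
  case (insert p Z)
  then show ?case
    using bipsido_lincomb_right[OF b f, of "u p" "\<lambda>y. \<Sum>p\<in>Z. u p y" 1 x] by simp
qed (simp add: bipsido_zero)

lemma bipsido_trunc_eq:
  fixes b :: "'n::finite triple \<Rightarrow> complex"
  assumes b: "usym M A L N b" and f: "integrable lborel f" and g: "integrable lborel g"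
  shows "bipsido b (trunc j f) (trunc j g) x = (\<Sum>(p, p')\<in>zbox j \<times> zbox j. bipsido b (piece p f) (piece p' g) x)"
proof -
  have e: "trunc j h = (\<lambda>y. \<Sum>p\<in>zbox j. piece p h y)" for h :: "real^'n \<Rightarrow> complex" by (intro ext trunc_eq)
  have "bipsido b (trunc j f) (trunc j g) x = (\<Sum>p\<in>zbox j. bipsido b (piece p f) (trunc j g) x)"
    unfolding e[of f] by (intro bipsido_sum_left[OF b] finite_zbox piece_integrable f trunc_integrable g)
  also have "\<dots> = (\<Sum>p\<in>zbox j. \<Sum>p'\<in>zbox j. bipsido b (piece p f) (piece p' g) x)"
    unfolding e[of g] by (intro sum.cong refl bipsido_sum_right[OF b] finite_zbox piece_integrable f g)
  finally show ?thesis by (simp add: sum.cartesian_product)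
qed

text \<open>The r-th power of a product of sizes is assumed to be below a sum of \<theta>1 at p and
  \<theta>2 at p' in order to decouple the input cells: in each summand the reciprocal weights can
  be summed freely over the other input cell and over the output cell.\<close>

lemma cells_estimate:
  assumes r: "r > 0"
  shows "\<exists>M K. K \<ge> 0 \<and> (\<forall>(b :: 'n::finite triple \<Rightarrow> complex) A L N f g sf sg \<theta>1 \<theta>2 V.
    usym M A L N b \<longrightarrow> L \<ge> 1 \<longrightarrow> N \<ge> 1 \<longrightarrow> integrable lborel f \<longrightarrow> integrable lborel g \<longrightarrow>
    (\<forall>p. locsize N (\<lambda>y. norm (f y)) p (sf p)) \<longrightarrow> (\<forall>p. locsize N (\<lambda>y. norm (g y)) p (sg p)) \<longrightarrow>
    (\<forall>p p'. (sf p * sg p') powr r \<le> \<theta>1 p + \<theta>2 p') \<longrightarrow> (\<forall>p. \<theta>1 p \<ge> 0) \<longrightarrow> (\<forall>p. \<theta>2 p \<ge> 0) \<longrightarrow>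
    (\<forall>Z. finite Z \<longrightarrow> (\<Sum>p\<in>Z. \<theta>1 p) + (\<Sum>p\<in>Z. \<theta>2 p) \<le> V) \<longrightarrow>
    (\<integral>\<^sup>+x. ennreal (norm (bipsido b f g x) powr r) \<partial>lborel)
      \<le> ennreal (K * (A * (L powr (CARD('n) / 2) * N powr (CARD('n) * max (1/2) (1 - 1/r)))) powr r * V))"
proof -
  obtain M K0 where K0: "K0 \<ge> 0" and dec: "\<And>(b :: 'n triple \<Rightarrow> complex) A L N F G p p' q sF sG f g.
    usym M A L N b \<Longrightarrow> L \<ge> 1 \<Longrightarrow> N \<ge> 1 \<Longrightarrow> integrable lborel F \<Longrightarrow> integrable lborel G \<Longrightarrow>
    locsize N F p sF \<Longrightarrow> locsize N G p' sG \<Longrightarrow> f \<in> dom F p \<Longrightarrow> g \<in> dom G p' \<Longrightarrow>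
    (\<integral>\<^sup>+x. ennreal (norm (bipsido b f g x) powr r) * indicator (cell q) x \<partial>lborel)
      \<le> ennreal (K0 * (wt (p - q) * wt (p' - q)) powr (- (r + 1)) *
          (A * sF * sG * (L powr (CARD('n) / 2) * N powr (CARD('n) * max (1/2) (1 - 1/r)))) powr r)"
    using off_diagonal_decay[OF r, where 'n='n] by blast
  define S where "S = (4::real) ^ CARD('n)"
  have S0: "S \<ge> 0" by (simp add: S_def)
  \<comment> \<open>\<open>(S * S) powr r\<close> stems from the weighted sum over pairs of input
    cells, the last \<open>S * S\<close> from summing the remaining reciprocal weights.\<close>
  define K where "K = (S * S) powr r * K0 * (S * S)"
  have K: "K \<ge> 0" using K0 S0 by (simp add: K_def)
  show ?thesis
  proof (intro exI[of _ M] exI[of _ K] conjI K allI impI)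
    fix b :: "'n triple \<Rightarrow> complex" and A L N and f g :: "real^'n \<Rightarrow> complex" and sf sg \<theta>1 \<theta>2 :: "int^'n \<Rightarrow> real" and V
    assume b: "usym M A L N b" and L: "L \<ge> 1" and N: "N \<ge> 1" and f: "integrable lborel f" and g: "integrable lborel g"
      and sf: "\<forall>p. locsize N (\<lambda>y. norm (f y)) p (sf p)" and sg: "\<forall>p. locsize N (\<lambda>y. norm (g y)) p (sg p)"
      and \<theta>: "\<forall>p p'. (sf p * sg p') powr r \<le> \<theta>1 p + \<theta>2 p'" and t1: "\<forall>p. \<theta>1 p \<ge> 0" and t2: "\<forall>p. \<theta>2 p \<ge> 0"
      and V: "\<forall>Z. finite Z \<longrightarrow> (\<Sum>p\<in>Z. \<theta>1 p) + (\<Sum>p\<in>Z. \<theta>2 p) \<le> V"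
    have [measurable]: "g \<in> borel_measurable borel" "f \<in> borel_measurable borel" using g f by auto
    have sm[measurable]: "smooth_on_dirs alld b" using b by (rule usym_smooth)
    have A: "A \<ge> 0" using b by (rule usym_nonneg)
    define Q where "Q = (A * (L powr (CARD('n) / 2) * N powr (CARD('n) * max (1/2) (1 - 1/r)))) powr r"
    have Q0: "Q \<ge> 0" by (simp add: Q_def)
    have V0: "V \<ge> 0" using V[rule_format, of "{}"] by simp
    have m[measurable]: "bipsido b u v \<in> borel_measurable borel" if "u \<in> borel_measurable borel" "v \<in> borel_measurable borel" for u v
      using that by (intro measurable_bipsido sm)
    have pm[measurable]: "piece p h \<in> borel_measurable borel" if "h \<in> borel_measurable borel" for h p
      using piece_dom[OF that, of p] by (simp add: dom_def)
    let ?w = "\<lambda>p p' q. wt (p - q) * wt (p' - q)"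
    have w0: "?w p p' q > 0" for p p' q :: "int^'n"
      using wt_ge_1[of "p - q"] wt_ge_1[of "p' - q"] by (intro mult_pos_pos) linarith+
    have tile: "(\<integral>\<^sup>+x. ennreal (norm (bipsido b (trunc j f) (trunc j g) x) powr r) * indicator (cell q) x \<partial>lborel)
      \<le> ennreal (\<Sum>(p, p')\<in>zbox j \<times> zbox j. (S * S) powr r * K0 * Q * ((\<theta>1 p + \<theta>2 p') / ?w p p' q))" for j q
    proof -
      let ?T = "\<lambda>p p' x. norm (bipsido b (piece p f) (piece p' g) x)"
      have Ssum: "(\<Sum>(p, p')\<in>zbox j \<times> zbox j. 1 / ?w p p' q) \<le> S * S"
      proof -
        have "(\<Sum>(p, p')\<in>zbox j \<times> zbox j. 1 / ?w p p' q) = (\<Sum>p\<in>zbox j. 1 / wt (p - q)) * (\<Sum>p'\<in>zbox j. 1 / wt (p' - q))"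
          by (simp add: sum_product sum.cartesian_product)
        also have "\<dots> \<le> S * S"
          unfolding S_def
          by (intro mult_mono sum_inverse_wt_shift finite_zbox sum_nonneg) (auto intro: order_trans[OF _ wt_ge_1])
        finally show ?thesis .
      qed
      have "norm (bipsido b (trunc j f) (trunc j g) x) powr r
        \<le> (S * S) powr r * (\<Sum>(p, p')\<in>zbox j \<times> zbox j. (?w p p' q * ?T p p' x) powr r)" for x
      proof -
        have "norm (bipsido b (trunc j f) (trunc j g) x) \<le> (\<Sum>(p, p')\<in>zbox j \<times> zbox j. ?T p p' x)"
          unfolding bipsido_trunc_eq[OF b f g] by (rule order_trans[OF norm_sum]) (simp add: case_prod_unfold)
        then have "norm (bipsido b (trunc j f) (trunc j g) x) powr r \<le> (\<Sum>(p, p')\<in>zbox j \<times> zbox j. ?T p p' x) powr r"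
          using r by (intro powr_mono2) auto
        \<comment> \<open>The reciprocal weights have total at most \<open>S * S\<close> over all
          pairs, so this substitute for the triangle inequality is uniform in q and j.\<close>
        also have "\<dots> \<le> (S * S) powr r * (\<Sum>(p, p')\<in>zbox j \<times> zbox j. (?w p p' q * ?T p p' x) powr r)"
          using weighted_sum_powr[OF finite_cartesian_product[OF finite_zbox finite_zbox] r,
              where w = "\<lambda>(p, p'). ?w p p' q" and t = "\<lambda>(p, p'). ?T p p' x" and S = "S * S"] Ssum w0
          by (simp add: case_prod_unfold)
        finally show ?thesis .
      qed
      then have "(\<integral>\<^sup>+x. ennreal (norm (bipsido b (trunc j f) (trunc j g) x) powr r) * indicator (cell q) x \<partial>lborel)
        \<le> (\<integral>\<^sup>+x. (\<Sum>(p, p')\<in>zbox j \<times> zbox j. ennreal ((S * S) powr r * (?w p p' q) powr r) * (ennreal (?T p p' x powr r) * indicator (cell q) x)) \<partial>lborel)"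
      proof (intro nn_integral_mono)
        fix x
        assume le: "\<And>x. norm (bipsido b (trunc j f) (trunc j g) x) powr r
          \<le> (S * S) powr r * (\<Sum>(p, p')\<in>zbox j \<times> zbox j. (?w p p' q * ?T p p' x) powr r)"
        have "ennreal (norm (bipsido b (trunc j f) (trunc j g) x) powr r) \<le> ennreal (\<Sum>(p, p')\<in>zbox j \<times> zbox j. ((S * S) powr r * (?w p p' q) powr r) * ?T p p' x powr r)"
          using le[of x] by (intro ennreal_leI) (simp add: sum_distrib_left case_prod_unfold powr_mult mult.assoc)
        also have "\<dots> = (\<Sum>(p, p')\<in>zbox j \<times> zbox j. ennreal (((S * S) powr r * (?w p p' q) powr r) * ?T p p' x powr r))"
          by (subst sum_ennreal[symmetric]) (auto simp: case_prod_unfold)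
        also have "\<dots> = (\<Sum>(p, p')\<in>zbox j \<times> zbox j. ennreal ((S * S) powr r * (?w p p' q) powr r) * ennreal (?T p p' x powr r))"
          by (simp add: ennreal_mult)
        finally show "ennreal (norm (bipsido b (trunc j f) (trunc j g) x) powr r) * indicator (cell q) x
          \<le> (\<Sum>(p, p')\<in>zbox j \<times> zbox j. ennreal ((S * S) powr r * (?w p p' q) powr r) * (ennreal (?T p p' x powr r) * indicator (cell q) x))"
          by (auto simp: indicator_def)
      qed
      also have "\<dots> = (\<Sum>(p, p')\<in>zbox j \<times> zbox j. ennreal ((S * S) powr r * (?w p p' q) powr r) * (\<integral>\<^sup>+x. ennreal (?T p p' x powr r) * indicator (cell q) x \<partial>lborel))"
        unfolding case_prod_unfold
        by (subst nn_integral_sum, measurable) (intro sum.cong refl nn_integral_cmult, measurable)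
      also have "\<dots> \<le> (\<Sum>(p, p')\<in>zbox j \<times> zbox j. ennreal ((S * S) powr r * K0 * Q * ((\<theta>1 p + \<theta>2 p') / ?w p p' q)))"
      proof (intro sum_mono, clarify)
        fix p p' :: "int^'n"
        let ?X = "A * sf p * sg p' * (L powr (CARD('n) / 2) * N powr (CARD('n) * max (1/2) (1 - 1/r)))"
        have s: "sf p \<ge> 0" "sg p' \<ge> 0" using sf sg by (auto simp: locsize_def)
        have X: "?X powr r = Q * (sf p * sg p') powr r"
        proof -
          have "?X = (A * (L powr (CARD('n) / 2) * N powr (CARD('n) * max (1/2) (1 - 1/r)))) * (sf p * sg p')" by (simp only: mult_ac)
          then show ?thesis unfolding Q_def by (simp only: powr_mult)
        qed
        have "(\<integral>\<^sup>+x. ennreal (?T p p' x powr r) * indicator (cell q) x \<partial>lborel) \<le> ennreal (K0 * ?w p p' q powr (- (r + 1)) * ?X powr r)"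
          by (rule dec[OF b L N integrable_norm[OF f] integrable_norm[OF g] sf[rule_format] sg[rule_format] piece_dom piece_dom]) measurable
        then have "ennreal ((S * S) powr r * (?w p p' q) powr r) * (\<integral>\<^sup>+x. ennreal (?T p p' x powr r) * indicator (cell q) x \<partial>lborel)
          \<le> ennreal ((S * S) powr r * (?w p p' q) powr r) * ennreal (K0 * ?w p p' q powr (- (r + 1)) * ?X powr r)"
          by (rule mult_left_mono) simp
        also have "\<dots> = ennreal ((S * S) powr r * K0 * Q * ((?w p p' q powr r * ?w p p' q powr (- (r + 1))) * (sf p * sg p') powr r))"
          unfolding X using K0 Q0 by (subst ennreal_mult[symmetric]) (simp_all add: mult_ac)
        \<comment> \<open>Decay of order r + 1 against the power r spent on the weight leaves
          exactly one reciprocal weight.\<close>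
        also have "?w p p' q powr r * ?w p p' q powr (- (r + 1)) = 1 / ?w p p' q"
        proof -
          have "?w p p' q powr r * ?w p p' q powr (- (r + 1)) = ?w p p' q powr (- 1)" by (subst powr_add[symmetric]) simp
          then show ?thesis using w0[of p q p'] by (simp add: powr_minus_divide)
        qed
        also have "ennreal ((S * S) powr r * K0 * Q * (1 / ?w p p' q * (sf p * sg p') powr r)) \<le> ennreal ((S * S) powr r * K0 * Q * ((\<theta>1 p + \<theta>2 p') / ?w p p' q))"
          using \<theta>[rule_format, of p p'] w0[of p q p'] K0 Q0 by (intro ennreal_leI mult_left_mono) (auto simp: divide_right_mono)
        finally show "ennreal ((S * S) powr r * (?w p p' q) powr r) * (\<integral>\<^sup>+x. ennreal (?T p p' x powr r) * indicator (cell q) x \<partial>lborel)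
          \<le> ennreal ((S * S) powr r * K0 * Q * ((\<theta>1 p + \<theta>2 p') / ?w p p' q))" .
      qed
      also have "\<dots> = ennreal (\<Sum>(p, p')\<in>zbox j \<times> zbox j. (S * S) powr r * K0 * Q * ((\<theta>1 p + \<theta>2 p') / ?w p p' q))"
        unfolding case_prod_unfold
        using K0 Q0 t1 t2 w0 by (intro sum_ennreal mult_nonneg_nonneg divide_nonneg_nonneg add_nonneg_nonneg) (auto intro: order_trans[OF zero_le_one wt_ge_1])
      finally show ?thesis .
    qed
    \<comment> \<open>The output is cut to the same cells as the inputs, so only finitely many q
      occur.\<close>
    have total: "(\<integral>\<^sup>+x. ennreal (norm (bipsido b (trunc j f) (trunc j g) x) powr r) * indicator (cells j) x \<partial>lborel) \<le> ennreal (K * Q * V)" for j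
    proof -
      let ?u = "\<lambda>x. ennreal (norm (bipsido b (trunc j f) (trunc j g) x) powr r)"
      have "(\<integral>\<^sup>+x. ?u x * indicator (cells j) x \<partial>lborel) \<le> (\<integral>\<^sup>+x. (\<Sum>q\<in>zbox j. ?u x * indicator (cell q) x) \<partial>lborel)"
      proof (intro nn_integral_mono)
        fix x
        show "?u x * indicator (cells j) x \<le> (\<Sum>q\<in>zbox j. ?u x * indicator (cell q) x)"
        proof (cases "x \<in> cells j")
          case True
          then obtain q where q: "q \<in> zbox j" "x \<in> cell q" by (auto simp: cells_def)
          then have "?u x * indicator (cell q) x \<le> (\<Sum>q\<in>zbox j. ?u x * indicator (cell q) x)"
            by (intro member_le_sum finite_zbox) auto
          then show ?thesis using q True by simp
        qed simp
      qed
      also have "\<dots> = (\<Sum>q\<in>zbox j. \<integral>\<^sup>+x. ?u x * indicator (cell q) x \<partial>lborel)"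
        by (rule nn_integral_sum) measurable
      also have "\<dots> \<le> (\<Sum>q\<in>zbox j. ennreal (\<Sum>(p, p')\<in>zbox j \<times> zbox j. (S * S) powr r * K0 * Q * ((\<theta>1 p + \<theta>2 p') / ?w p p' q)))"
        by (intro sum_mono tile)
      also have "\<dots> = ennreal (\<Sum>q\<in>zbox j. \<Sum>(p, p')\<in>zbox j \<times> zbox j. (S * S) powr r * K0 * Q * ((\<theta>1 p + \<theta>2 p') / ?w p p' q))"
        using K0 Q0 t1 t2 w0 unfolding case_prod_unfold
        by (intro sum_ennreal sum_nonneg mult_nonneg_nonneg divide_nonneg_nonneg add_nonneg_nonneg) (auto intro: order_trans[OF zero_le_one wt_ge_1])
      also have "(\<Sum>q\<in>zbox j. \<Sum>(p, p')\<in>zbox j \<times> zbox j. (S * S) powr r * K0 * Q * ((\<theta>1 p + \<theta>2 p') / ?w p p' q)) \<le> K * Q * V"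
      proof -
        let ?Z = "zbox j :: (int^'n) set"
        have iw: "1 / wt k \<ge> 0" for k :: "int^'n" using wt_ge_1[of k] by simp
        \<comment> \<open>\<theta>1 does not involve p', so p' is summed first against its own
          weight, and then q against the other one.\<close>
        have a: "(\<Sum>q\<in>?Z. \<Sum>p\<in>?Z. \<Sum>p'\<in>?Z. \<theta>1 p / ?w p p' q) \<le> S * S * (\<Sum>p\<in>?Z. \<theta>1 p)"
        proof -
          have "(\<Sum>q\<in>?Z. \<Sum>p\<in>?Z. \<Sum>p'\<in>?Z. \<theta>1 p / ?w p p' q) = (\<Sum>q\<in>?Z. \<Sum>p\<in>?Z. \<theta>1 p * (1 / wt (p - q)) * (\<Sum>p'\<in>?Z. 1 / wt (p' - q)))"
            by (simp add: sum_distrib_left)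
          also have "\<dots> \<le> (\<Sum>q\<in>?Z. \<Sum>p\<in>?Z. \<theta>1 p * (1 / wt (p - q)) * S)"
            unfolding S_def using t1 iw by (intro sum_mono mult_left_mono sum_inverse_wt_shift finite_zbox mult_nonneg_nonneg) auto
          also have "\<dots> = (\<Sum>p\<in>?Z. \<theta>1 p * S * (\<Sum>q\<in>?Z. 1 / wt (p - q)))"
            by (subst sum.swap) (simp add: sum_distrib_left mult_ac)
          also have "\<dots> \<le> (\<Sum>p\<in>?Z. \<theta>1 p * S * S)"
            unfolding S_def using t1 by (intro sum_mono mult_left_mono sum_inverse_wt_shift finite_zbox mult_nonneg_nonneg) auto
          finally show ?thesis by (simp add: sum_distrib_left mult_ac)
        qed
        have b: "(\<Sum>q\<in>?Z. \<Sum>p\<in>?Z. \<Sum>p'\<in>?Z. \<theta>2 p' / ?w p p' q) \<le> S * S * (\<Sum>p\<in>?Z. \<theta>2 p)"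
        proof -
          have "(\<Sum>q\<in>?Z. \<Sum>p\<in>?Z. \<Sum>p'\<in>?Z. \<theta>2 p' / ?w p p' q) = (\<Sum>q\<in>?Z. \<Sum>p'\<in>?Z. \<theta>2 p' * (1 / wt (p' - q)) * (\<Sum>p\<in>?Z. 1 / wt (p - q)))"
            by (rule sum.cong[OF refl], subst sum.swap) (simp add: sum_distrib_left mult_ac)
          also have "\<dots> \<le> (\<Sum>q\<in>?Z. \<Sum>p\<in>?Z. \<theta>2 p * (1 / wt (p - q)) * S)"
            unfolding S_def using t2 iw by (intro sum_mono mult_left_mono sum_inverse_wt_shift finite_zbox mult_nonneg_nonneg) auto
          also have "\<dots> = (\<Sum>p\<in>?Z. \<theta>2 p * S * (\<Sum>q\<in>?Z. 1 / wt (p - q)))"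
            by (subst sum.swap) (simp add: sum_distrib_left mult_ac)
          also have "\<dots> \<le> (\<Sum>p\<in>?Z. \<theta>2 p * S * S)"
            unfolding S_def using t2 by (intro sum_mono mult_left_mono sum_inverse_wt_shift finite_zbox mult_nonneg_nonneg) auto
          finally show ?thesis by (simp add: sum_distrib_left mult_ac)
        qed
        have "(\<Sum>q\<in>?Z. \<Sum>(p, p')\<in>?Z \<times> ?Z. (S * S) powr r * K0 * Q * ((\<theta>1 p + \<theta>2 p') / ?w p p' q))
          = (S * S) powr r * K0 * Q * ((\<Sum>q\<in>?Z. \<Sum>p\<in>?Z. \<Sum>p'\<in>?Z. \<theta>1 p / ?w p p' q) + (\<Sum>q\<in>?Z. \<Sum>p\<in>?Z. \<Sum>p'\<in>?Z. \<theta>2 p' / ?w p p' q))"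
          by (simp add: sum.cartesian_product[symmetric] add_divide_distrib sum.distrib distrib_left sum_distrib_left)
        also have "\<dots> \<le> (S * S) powr r * K0 * Q * (S * S * V)"
        proof (intro mult_left_mono)
          have "S * S * (\<Sum>p\<in>?Z. \<theta>1 p) + S * S * (\<Sum>p\<in>?Z. \<theta>2 p) \<le> S * S * V"
            unfolding distrib_left[symmetric] using V finite_zbox S0 by (intro mult_left_mono) auto
          with a b show "(\<Sum>q\<in>?Z. \<Sum>p\<in>?Z. \<Sum>p'\<in>?Z. \<theta>1 p / ?w p p' q) + (\<Sum>q\<in>?Z. \<Sum>p\<in>?Z. \<Sum>p'\<in>?Z. \<theta>2 p' / ?w p p' q) \<le> S * S * V" by linarith
        qed (use K0 Q0 in auto)
        finally show ?thesis by (simp add: K_def mult_ac)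
      qed
      finally show ?thesis by (simp add: ennreal_leI)
    qed
    have lim: "(\<lambda>j. ennreal (norm (bipsido b (trunc j f) (trunc j g) x) powr r) * indicator (cells j) x) \<longlonglongrightarrow> ennreal (norm (bipsido b f g x) powr r)" for x
    proof -
      have "(\<lambda>j. ennreal (norm (bipsido b (trunc j f) (trunc j g) x) powr r)) \<longlonglongrightarrow> ennreal (norm (bipsido b f g x) powr r)"
        using r by (intro tendsto_ennrealI tendsto_powr' tendsto_norm bipsido_trunc_tendsto[OF b f g] tendsto_const) auto
      then show ?thesis
        by (rule Lim_transform_eventually) (use eventually_cells[of x] in eventually_elim, simp)
    qed
    \<comment> \<open>The bound is independent of j, so Fatou's lemma removes the truncation of
      inputs and output at once.\<close>
    have "(\<integral>\<^sup>+x. ennreal (norm (bipsido b f g x) powr r) \<partial>lborel)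
      = (\<integral>\<^sup>+x. liminf (\<lambda>j. ennreal (norm (bipsido b (trunc j f) (trunc j g) x) powr r) * indicator (cells j) x) \<partial>lborel)"
      using lim by (intro nn_integral_cong lim_imp_Liminf[symmetric]) auto
    also have "\<dots> \<le> liminf (\<lambda>j. \<integral>\<^sup>+x. ennreal (norm (bipsido b (trunc j f) (trunc j g) x) powr r) * indicator (cells j) x \<partial>lborel)"
      by (rule nn_integral_liminf) measurable
    also have "\<dots> \<le> ennreal (K * Q * V)"
      by (intro Liminf_le always_eventually allI total) simp
    finally show "(\<integral>\<^sup>+x. ennreal (norm (bipsido b f g x) powr r) \<partial>lborel)
      \<le> ennreal (K * (A * (L powr (CARD('n) / 2) * N powr (CARD('n) * max (1/2) (1 - 1/r)))) powr r * V)"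
      unfolding Q_def .
  qed
qed

section \<open>Local sizes from Lebesgue norms\<close>

lemma fourier_box_le:
  fixes g :: "real^'n::finite \<Rightarrow> complex"
  assumes g: "integrable lborel g" and I: "(\<integral>\<^sup>+y. ennreal ((norm (g y))\<^sup>2) \<partial>lborel) \<le> ennreal B" and B: "B \<ge> 0"
  shows "(\<integral>\<^sup>+\<eta>. ennreal ((norm (fourier g \<eta>))\<^sup>2) * indicator (fbox N) \<eta> \<partial>lborel) \<le> ennreal ((2 * pi) ^ CARD('n) * B)"
proof -
  have "(\<integral>\<^sup>+\<eta>. ennreal ((norm (fourier g \<eta>))\<^sup>2) * indicator (fbox N) \<eta> \<partial>lborel) \<le> (\<integral>\<^sup>+\<eta>. ennreal ((norm (fourier g \<eta>))\<^sup>2) \<partial>lborel)"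
    by (intro nn_integral_mono) (auto simp: indicator_def)
  also have "\<dots> \<le> ennreal ((2 * pi) ^ CARD('n)) * ennreal B"
    by (rule order_trans[OF plancherel_le[OF g]]) (intro mult_left_mono I, simp)
  finally show ?thesis using B by (simp add: ennreal_mult)
qed

text \<open>On a cell, of measure at most 1, a sup bound is an L^2 bound. The constant is the one
  belonging to finite q, so that both cases can be used together.\<close>

lemma locsize_Linf:
  fixes f :: "real^'n::finite \<Rightarrow> complex"
  assumes f: "integrable lborel f" and S: "S \<ge> 0" "AE y in lborel. norm (f y) \<le> S"
  shows "locsize N (\<lambda>y. norm (f y)) p (sqrt (2 * (2 * pi) ^ CARD('n) + 2 * 2 ^ CARD('n)) * S)"
  unfolding locsize_def
proof (intro conjI ballI)
  let ?C = "2 * (2 * pi) ^ CARD('n) + 2 * 2 ^ CARD('n) :: real"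
  have C: "?C \<ge> 0" by simp
  show "0 \<le> sqrt ?C * S" using S by simp
  fix g assume g: "g \<in> dom (\<lambda>y. norm (f y)) p"
  have gi: "integrable lborel g" by (rule dom_integrable[OF integrable_norm[OF f] g])
  have "(\<integral>\<^sup>+y. ennreal ((norm (g y))\<^sup>2) \<partial>lborel) \<le> (\<integral>\<^sup>+y. ennreal (S\<^sup>2) * indicator (cell p) y \<partial>lborel)"
  proof (rule nn_integral_mono_AE, use S(2) in eventually_elim)
    fix y assume le: "norm (f y) \<le> S"
    have "norm (g y) \<le> norm (f y) * indicator (cell p) y" using g by (auto simp: dom_def)
    then have "norm (g y) \<le> S * indicator (cell p) y" using le by (cases "y \<in> cell p") auto
    then have "(norm (g y))\<^sup>2 \<le> (S * indicator (cell p) y)\<^sup>2" by (intro power_mono) auto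
    then show "ennreal ((norm (g y))\<^sup>2) \<le> ennreal (S\<^sup>2) * indicator (cell p) y"
      by (cases "y \<in> cell p") (auto intro: ennreal_leI)
  qed
  also have "\<dots> \<le> ennreal (S\<^sup>2) * 1"
    by (subst nn_integral_cmult_indicator, measurable) (intro mult_left_mono emeasure_cell_le, simp)
  finally have "(\<integral>\<^sup>+y. ennreal ((norm (g y))\<^sup>2) \<partial>lborel) \<le> ennreal (S\<^sup>2)" by simp
  from fourier_box_le[OF gi this, of N] have "(\<integral>\<^sup>+\<eta>. ennreal ((norm (fourier g \<eta>))\<^sup>2) * indicator (fbox N) \<eta> \<partial>lborel) \<le> ennreal ((2 * pi) ^ CARD('n) * S\<^sup>2)" by simp
  also have "(2 * pi) ^ CARD('n) * S\<^sup>2 \<le> (sqrt ?C * S)\<^sup>2"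
    unfolding power_mult_distrib real_sqrt_pow2[OF C] by (intro mult_right_mono) auto
  finally show "(\<integral>\<^sup>+\<eta>. ennreal ((norm (fourier g \<eta>))\<^sup>2) * indicator (fbox N) \<eta> \<partial>lborel) \<le> ennreal ((sqrt ?C * S)\<^sup>2)"
    by (simp add: ennreal_leI)
qed

text \<open>For \<open>q < 2\<close> the function is split at the height where the \<open>L\<^sup>2\<close> bound of the low part and
  the \<open>L\<^sup>1\<close> bound of the high part balance.\<close>

lemma locsize_Lq:
  fixes f :: "real^'n::finite \<Rightarrow> complex"
  assumes f: "integrable lborel f" and q: "q \<ge> 1" and y: "y \<ge> 0" and N: "N \<ge> 1"
    and I: "(\<integral>\<^sup>+x. ennreal (norm (f x) powr q) * indicator (cell p) x \<partial>lborel) \<le> ennreal (y powr q)"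
  shows "locsize N (\<lambda>y. norm (f y)) p (sqrt (2 * (2 * pi) ^ CARD('n) + 2 * 2 ^ CARD('n)) * N powr (CARD('n) * max 0 (1/q - 1/2)) * y)"
  unfolding locsize_def
proof (intro conjI ballI)
  \<comment> \<open>Twice the Plancherel constant for the low part plus twice the volume factor of
    the frequency box for the high part; the twos come from the square of a sum.\<close>
  let ?C = "2 * (2 * pi) ^ CARD('n) + 2 * 2 ^ CARD('n) :: real"
  define n where "n = real CARD('n)"
  let ?s = "sqrt ?C * N powr (CARD('n) * max 0 (1/q - 1/2)) * y"
  have C: "?C \<ge> 0" by simp
  show "0 \<le> ?s" using y by simp
  have [measurable]: "f \<in> borel_measurable borel" using f by simp
  fix g assume g: "g \<in> dom (\<lambda>y. norm (f y)) p"
  have gi: "integrable lborel g" by (rule dom_integrable[OF integrable_norm[OF f] g])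
  have [measurable]: "g \<in> borel_measurable borel" using gi by simp
  have gf: "norm (g x) \<le> norm (f x) * indicator (cell p) x" for x using g by (auto simp: dom_def)
  have gq: "norm (g x) powr q \<le> norm (f x) powr q * indicator (cell p) x" for x
  proof (cases "x \<in> cell p")
    case True then show ?thesis using gf[of x] q by (auto intro: powr_mono2)
  next
    case False then show ?thesis using gf[of x] by simp
  qed
  have Ig: "(\<integral>\<^sup>+x. ennreal (norm (g x) powr q) \<partial>lborel) \<le> ennreal (y powr q)"
  proof (rule order_trans[OF nn_integral_mono I])
    show "ennreal (norm (g x) powr q) \<le> ennreal (norm (f x) powr q) * indicator (cell p) x" for x
      using gq[of x] by (cases "x \<in> cell p") (auto intro: ennreal_leI)
  qed
  show "(\<integral>\<^sup>+\<eta>. ennreal ((norm (fourier g \<eta>))\<^sup>2) * indicator (fbox N) \<eta> \<partial>lborel) \<le> ennreal (?s\<^sup>2)"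
  \<comment> \<open>For q \<ge> 2 the exponent is lowered to 2 on the cell and no power of N is
    lost.\<close>
  proof (cases "q \<ge> 2")
    case True
    have "(\<integral>\<^sup>+x. ennreal (norm (f x) powr 2) * indicator (cell p) x \<partial>lborel) \<le> ennreal (2 * y powr 2)"
      by (rule cell_powr_mono[OF _ _ _ True y I]) auto
    moreover have "(\<integral>\<^sup>+x. ennreal ((norm (g x))\<^sup>2) \<partial>lborel) \<le> (\<integral>\<^sup>+x. ennreal (norm (f x) powr 2) * indicator (cell p) x \<partial>lborel)"
    proof (intro nn_integral_mono)
      fix x
      have "(norm (g x))\<^sup>2 \<le> (norm (f x) * indicator (cell p) x)\<^sup>2" by (intro power_mono gf) simp
      then show "ennreal ((norm (g x))\<^sup>2) \<le> ennreal (norm (f x) powr 2) * indicator (cell p) x"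
        by (cases "x \<in> cell p") (auto intro: ennreal_leI)
    qed
    ultimately have "(\<integral>\<^sup>+x. ennreal ((norm (g x))\<^sup>2) \<partial>lborel) \<le> ennreal (2 * y\<^sup>2)" using y by simp
    from fourier_box_le[OF gi this, of N]
    have "(\<integral>\<^sup>+\<eta>. ennreal ((norm (fourier g \<eta>))\<^sup>2) * indicator (fbox N) \<eta> \<partial>lborel) \<le> ennreal ((2 * pi) ^ CARD('n) * (2 * y\<^sup>2))" by simp
    also have "(2 * pi) ^ CARD('n) * (2 * y\<^sup>2) \<le> ?s\<^sup>2"
    proof -
      have "max 0 (1/q - 1/2) = 0" using True by (simp add: field_simps)
      then have "?s\<^sup>2 = ?C * y\<^sup>2" using N by (simp add: power_mult_distrib)
      then show ?thesis by (simp add: distrib_right)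
    qed
    finally show ?thesis by (simp add: ennreal_leI)
  next
    case False
    show ?thesis
    proof (cases "y = 0")
      case True
      then have "(\<integral>\<^sup>+x. ennreal (norm (g x) powr q) \<partial>lborel) = 0" using Ig by simp
      then have "AE x in lborel. ennreal (norm (g x) powr q) = 0" by (subst (asm) nn_integral_0_iff_AE) auto
      then have "AE x in lborel. ennreal ((norm (g x))\<^sup>2) = 0" by eventually_elim auto
      then have "(\<integral>\<^sup>+x. ennreal ((norm (g x))\<^sup>2) \<partial>lborel) = 0" by (subst nn_integral_0_iff_AE) auto
      then show ?thesis using fourier_box_le[OF gi, of 0 N] True by simp
    next
      case yn: False
      then have y: "y > 0" using y by simp
      \<comment> \<open>With this height both l^(2-q) y^q and N^n (l^(1-q) y^q)^2 equal N^(n(2/q -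
        1)) y^2.\<close>
      define l where "l = N powr (n / q) * y"
      have l: "l > 0" using y N by (simp add: l_def)
      define lo where "lo x = (if norm (g x) \<le> l then g x else 0)" for x
      define hi where "hi x = (if norm (g x) \<le> l then 0 else g x)" for x
      have [measurable]: "lo \<in> borel_measurable borel" "hi \<in> borel_measurable borel"
        unfolding lo_def[abs_def] hi_def[abs_def] by measurable
      have lo: "integrable lborel lo" and hi: "integrable lborel hi"
        by (rule Bochner_Integration.integrable_bound[OF gi]; auto simp: lo_def hi_def intro!: AE_I2)+
      have g_eq: "g = (\<lambda>x. lo x + 1 * hi x)" by (auto simp: lo_def hi_def)
      have lo2: "(\<integral>\<^sup>+x. ennreal ((norm (lo x))\<^sup>2) \<partial>lborel) \<le> ennreal (l powr (2 - q) * y powr q)"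
      proof -
        have "(norm (lo x))\<^sup>2 \<le> l powr (2 - q) * norm (g x) powr q" for x
        proof (cases "norm (g x) \<le> l \<and> g x \<noteq> 0")
          case True
          then have "(norm (g x))\<^sup>2 = norm (g x) powr (2 - q) * norm (g x) powr q" by (simp flip: powr_add)
          also have "\<dots> \<le> l powr (2 - q) * norm (g x) powr q"
            using True False by (intro mult_right_mono powr_mono2) auto
          finally show ?thesis using True by (simp add: lo_def)
        qed (auto simp: lo_def)
        then have "(\<integral>\<^sup>+x. ennreal ((norm (lo x))\<^sup>2) \<partial>lborel) \<le> (\<integral>\<^sup>+x. ennreal (l powr (2 - q)) * ennreal (norm (g x) powr q) \<partial>lborel)"
          by (intro nn_integral_mono) (auto simp flip: ennreal_mult intro!: ennreal_leI)
        also have "\<dots> \<le> ennreal (l powr (2 - q)) * ennreal (y powr q)"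
          by (subst nn_integral_cmult, measurable) (intro mult_left_mono Ig, simp)
        finally show ?thesis by (simp add: ennreal_mult)
      qed
      have hi1: "norm (fourier hi \<eta>) \<le> l powr (1 - q) * y powr q" for \<eta>
      proof -
        have "norm (hi x) \<le> l powr (1 - q) * norm (g x) powr q" for x
        proof (cases "norm (g x) \<le> l")
          case False
          then have gx: "norm (g x) > 0" using l by linarith
          then have "norm (g x) = norm (g x) powr (1 - q) * norm (g x) powr q" by (simp flip: powr_add)
          also have "\<dots> \<le> l powr (1 - q) * norm (g x) powr q"
            using False q l by (intro mult_right_mono powr_mono2') auto
          finally show ?thesis using False by (simp add: hi_def)
        qed (auto simp: hi_def)
        then have "(\<integral>\<^sup>+x. ennreal (norm (hi x)) \<partial>lborel) \<le> (\<integral>\<^sup>+x. ennreal (l powr (1 - q)) * ennreal (norm (g x) powr q) \<partial>lborel)"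
          by (intro nn_integral_mono) (auto simp flip: ennreal_mult intro!: ennreal_leI)
        also have "\<dots> \<le> ennreal (l powr (1 - q)) * ennreal (y powr q)"
          by (subst nn_integral_cmult, measurable) (intro mult_left_mono Ig, simp)
        finally have "ennreal (LINT x|lborel. norm (hi x)) \<le> ennreal (l powr (1 - q) * y powr q)"
          using hi by (subst (asm) nn_integral_eq_integral) (auto simp: ennreal_mult)
        then have "(LINT x|lborel. norm (hi x)) \<le> l powr (1 - q) * y powr q" by (subst (asm) ennreal_le_iff) auto
        then show ?thesis using norm_fourier_le[OF hi, of \<eta>] by simp
      qed
      have e1: "l powr (2 - q) * y powr q = N powr (n * (2/q - 1)) * y\<^sup>2"
      proof -
        have "l powr (2 - q) * y powr q = N powr (n / q * (2 - q)) * (y powr (2 - q) * y powr q)"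
          by (simp add: l_def powr_mult powr_powr)
        also have "y powr (2 - q) * y powr q = y\<^sup>2" using y by (simp flip: powr_add)
        also have "n / q * (2 - q) = n * (2/q - 1)" using q by (simp add: field_simps)
        finally show ?thesis .
      qed
      have e2: "(2 * N) ^ CARD('n) * (l powr (1 - q) * y powr q)\<^sup>2 = 2 ^ CARD('n) * (N powr (n * (2/q - 1)) * y\<^sup>2)"
      proof -
        have "l powr (1 - q) * y powr q = N powr (n / q * (1 - q)) * (y powr (1 - q) * y powr q)"
          by (simp add: l_def powr_mult powr_powr)
        also have "y powr (1 - q) * y powr q = y" using y by (simp flip: powr_add)
        finally have "(l powr (1 - q) * y powr q)\<^sup>2 = (N powr (n / q * (1 - q)))\<^sup>2 * y\<^sup>2" by (simp add: power_mult_distrib)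
        also have "(N powr (n / q * (1 - q)))\<^sup>2 = N powr (2 * (n / q * (1 - q)))"
          by (simp add: power2_eq_square flip: powr_add)
        finally have "(2 * N) ^ CARD('n) * (l powr (1 - q) * y powr q)\<^sup>2 = 2 ^ CARD('n) * ((N powr n * N powr (2 * (n / q * (1 - q)))) * y\<^sup>2)"
          using N by (simp add: power_mult_distrib n_def powr_realpow mult_ac)
        also have "N powr n * N powr (2 * (n / q * (1 - q))) = N powr (n * (2/q - 1))"
          using q by (simp add: field_simps flip: powr_add)
        finally show ?thesis .
      qed
      let ?E = "N powr (n * (2/q - 1)) * y\<^sup>2"
      have g2: "(norm (fourier g \<eta>))\<^sup>2 \<le> 2 * (norm (fourier lo \<eta>))\<^sup>2 + 2 * (norm (fourier hi \<eta>))\<^sup>2" for \<eta>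
      proof -
        have "fourier g \<eta> = fourier lo \<eta> + fourier hi \<eta>"
          using fourier_lincomb[OF lo hi, of 1 \<eta>] g_eq by simp
        then have "(norm (fourier g \<eta>))\<^sup>2 \<le> (norm (fourier lo \<eta>) + norm (fourier hi \<eta>))\<^sup>2"
          by (intro power_mono) (auto intro: norm_triangle_ineq)
        also have "\<dots> \<le> 2 * (norm (fourier lo \<eta>))\<^sup>2 + 2 * (norm (fourier hi \<eta>))\<^sup>2"
          using sum_squares_bound[of "norm (fourier lo \<eta>)" "norm (fourier hi \<eta>)"] by (simp add: power2_sum)
        finally show ?thesis .
      qed
      define w :: real where "w = 2"
      have w: "w \<ge> 0" by (simp add: w_def)
      have "(norm (fourier g \<eta>))\<^sup>2 \<le> w * (norm (fourier lo \<eta>))\<^sup>2 + w * (l powr (1 - q) * y powr q)\<^sup>2" for \<eta>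
        using g2[of \<eta>] power_mono[OF hi1[of \<eta>] norm_ge_zero, of 2] unfolding w_def by linarith
      then have "(\<integral>\<^sup>+\<eta>. ennreal ((norm (fourier g \<eta>))\<^sup>2) * indicator (fbox N) \<eta> \<partial>lborel)
        \<le> (\<integral>\<^sup>+\<eta>. ennreal w * (ennreal ((norm (fourier lo \<eta>))\<^sup>2) * indicator (fbox N) \<eta>) + ennreal (w * (l powr (1 - q) * y powr q)\<^sup>2) * indicator (fbox N) \<eta> \<partial>lborel)"
        by (intro nn_integral_mono) (auto simp: indicator_def w simp flip: ennreal_mult ennreal_plus intro!: ennreal_leI)
      also have "\<dots> = ennreal w * (\<integral>\<^sup>+\<eta>. ennreal ((norm (fourier lo \<eta>))\<^sup>2) * indicator (fbox N) \<eta> \<partial>lborel) + ennreal (w * (l powr (1 - q) * y powr q)\<^sup>2) * emeasure lborel (fbox N :: (real^'n) set)"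
        by (subst nn_integral_add, measurable) (subst nn_integral_cmult, measurable, simp add: nn_integral_cmult_indicator)
      also have "\<dots> \<le> ennreal w * ennreal ((2 * pi) ^ CARD('n) * ?E) + ennreal (w * (l powr (1 - q) * y powr q)\<^sup>2) * ennreal ((2 * N) ^ CARD('n))"
        using fourier_box_le[OF lo lo2, of N] N
        by (intro add_mono mult_left_mono) (auto simp: e1 emeasure_fbox)
      also have "\<dots> = ennreal (w * ((2 * pi) ^ CARD('n) * ?E) + w * (2 ^ CARD('n) * ?E))"
      proof -
        have "ennreal (w * (l powr (1 - q) * y powr q)\<^sup>2) * ennreal ((2 * N) ^ CARD('n)) = ennreal (w * (2 ^ CARD('n) * ?E))"
        proof -
          have "w * (l powr (1 - q) * y powr q)\<^sup>2 * (2 * N) ^ CARD('n) = w * (2 ^ CARD('n) * ?E)"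
            unfolding e2[symmetric] by (simp only: mult_ac)
          then show ?thesis using w N by (subst ennreal_mult[symmetric]) simp_all
        qed
        moreover have "ennreal w * ennreal ((2 * pi) ^ CARD('n) * ?E) = ennreal (w * ((2 * pi) ^ CARD('n) * ?E))"
          using w by (subst ennreal_mult[symmetric]) simp_all
        ultimately show ?thesis using w by (simp only:) (subst ennreal_plus[symmetric], simp_all)
      qed
      also have "w * ((2 * pi) ^ CARD('n) * ?E) + w * (2 ^ CARD('n) * ?E) = ?s\<^sup>2"
      proof -
        have "max 0 (1/q - 1/2) = 1/q - 1/2" using False q by (simp add: field_simps)
        then have "(N powr (CARD('n) * max 0 (1/q - 1/2)))\<^sup>2 = N powr (n * (2/q - 1))"
          by (simp add: power2_eq_square n_def algebra_simps flip: powr_add)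
        then have "?s\<^sup>2 = ?C * ?E"
          unfolding power_mult_distrib real_sqrt_pow2[OF C] by simp
        then show ?thesis by (simp only: w_def distrib_right mult.assoc)
      qed
      finally show ?thesis .
    qed
  qed
qed

text \<open>The ball of radius \<open>X\<close> in the nonnegative part of l^q, encoded by finite
  partial sums so that no series has to converge.\<close>

definition lq :: "ereal \<Rightarrow> ('i \<Rightarrow> real) \<Rightarrow> real \<Rightarrow> bool" where
  "lq q y X \<longleftrightarrow> (\<forall>p. 0 \<le> y p) \<and> (if q = \<infinity> then \<forall>p. y p \<le> X
     else \<forall>Z. finite Z \<longrightarrow> (\<Sum>p\<in>Z. y p powr real_of_ereal q) \<le> X powr real_of_ereal q)"

lemma sum_cells_nn_le:
  fixes u :: "real^'n::finite \<Rightarrow> ennreal"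
  assumes [measurable]: "u \<in> borel_measurable borel" and Z: "finite Z"
  shows "(\<Sum>p\<in>Z. \<integral>\<^sup>+x. u x * indicator (cell p) x \<partial>lborel) \<le> (\<integral>\<^sup>+x. u x \<partial>lborel)"
proof -
  have "(\<Sum>p\<in>Z. \<integral>\<^sup>+x. u x * indicator (cell p) x \<partial>lborel) = (\<integral>\<^sup>+x. (\<Sum>p\<in>Z. u x * indicator (cell p) x) \<partial>lborel)"
    by (rule nn_integral_sum[symmetric]) measurable
  also have "\<dots> \<le> (\<integral>\<^sup>+x. u x \<partial>lborel)"
  proof (intro nn_integral_mono)
    fix x :: "real^'n"
    define k :: "int^'n" where "k = (\<chi> i. \<lfloor>x $ i\<rfloor>)"
    have k: "x \<in> cell p \<longleftrightarrow> p = k" for p by (auto simp: cell_def k_def vec_eq_iff)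
    have "(\<Sum>p\<in>Z. u x * indicator (cell p) x) = (\<Sum>p\<in>Z. if p = k then u x else 0)"
      by (intro sum.cong refl) (simp add: indicator_def k)
    also have "\<dots> \<le> u x" using Z by simp
    finally show "(\<Sum>p\<in>Z. u x * indicator (cell p) x) \<le> u x" .
  qed
  finally show ?thesis .
qed

text \<open>For finite q, \<open>y p\<close> is the L^q norm of f on the cell p, and disjointness of
  the cells bounds its l^q norm. For infinite q the constant family \<open>X\<close> serves.\<close>

lemma Lnorm_local_sizes:
  fixes f :: "real^'n::finite \<Rightarrow> complex"
  assumes f: "integrable lborel f" and q: "1 \<le> q" and N: "N \<ge> 1" and X: "Lnorm q f = ennreal X" "X \<ge> 0"
  shows "\<exists>y. lq q y X \<and> (\<forall>p. locsize N (\<lambda>y. norm (f y)) p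
    (sqrt (2 * (2 * pi) ^ CARD('n) + 2 * 2 ^ CARD('n)) * N powr (CARD('n) * max 0 (recip q - 1/2)) * y p))"
proof (cases "q = \<infinity>")
  case True
  have [measurable]: "f \<in> borel_measurable borel" using f by simp
  have "AE y in lborel. ennreal (norm (f y)) \<le> ennreal X"
    using esssup_AE[of "\<lambda>y. ennreal (norm (f y))" lborel] X(1) True by (simp add: Lnorm_def)
  then have "AE y in lborel. norm (f y) \<le> X" using X(2) by simp
  from locsize_Linf[OF f X(2) this, of N] show ?thesis
    using True N X(2) by (intro exI[of _ "\<lambda>p. X"]) (auto simp: lq_def recip_def max_def)
next
  case False
  then obtain s where s: "q = ereal s" "s \<ge> 1" using q by (cases q) auto
  have [measurable]: "f \<in> borel_measurable borel" using f by simp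
  let ?u = "\<lambda>x. ennreal (norm (f x) powr s)"
  define I where "I = (\<integral>\<^sup>+x. ?u x \<partial>lborel)"
  have Ifin: "I \<noteq> \<infinity>" and XI: "X = enn2real I powr (1 / s)"
    using X s by (auto simp: Lnorm_def I_def Let_def split: if_splits)
  then have XI: "X powr s = enn2real I" using s by (simp add: powr_powr)
  define J where "J p = (\<integral>\<^sup>+x. ?u x * indicator (cell p) x \<partial>lborel)" for p
  have JI: "(\<Sum>p\<in>Z. J p) \<le> I" if "finite Z" for Z
    unfolding J_def I_def by (intro sum_cells_nn_le that) measurable
  have Jfin: "J p < \<infinity>" for p
    using JI[of "{p}"] Ifin by (simp add: le_less_trans less_top)
  define y where "y p = enn2real (J p) powr (1 / s)" for p
  have yJ: "ennreal (y p powr s) = J p" for p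
    using s Jfin[of p] by (simp add: y_def powr_powr)
  have "lq q y X"
    unfolding lq_def using False
  proof (simp add: y_def, intro allI impI)
    fix Z :: "(int^'n) set" assume Z: "finite Z"
    have "ennreal (\<Sum>p\<in>Z. y p powr s) = (\<Sum>p\<in>Z. J p)" by (simp add: yJ flip: sum_ennreal)
    also have "\<dots> \<le> I" by (rule JI[OF Z])
    also have "I = ennreal (X powr s)" using Ifin by (simp add: XI less_top)
    finally have "(\<Sum>p\<in>Z. y p powr s) \<le> X powr s" by (subst (asm) ennreal_le_iff) auto
    then show "(\<Sum>p\<in>Z. (enn2real (J p) powr (1 / s)) powr real_of_ereal q) \<le> X powr real_of_ereal q" by (simp add: y_def s)
  qed
  moreover have "locsize N (\<lambda>y. norm (f y)) p
    (sqrt (2 * (2 * pi) ^ CARD('n) + 2 * 2 ^ CARD('n)) * N powr (CARD('n) * max 0 (1/s - 1/2)) * y p)" for p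
    by (rule locsize_Lq[OF f s(2) _ N]) (simp_all add: yJ, simp_all add: y_def J_def)
  ultimately show ?thesis using False s by (intro exI[of _ y]) (simp add: recip_def)
qed

text \<open>Discrete Hoelder inequality in additive form. For finite exponents s and t, Young's
  inequality with s/r and t/r is applied after normalising by X and Y; if one exponent is infinite,
  its family is bounded by the supremum and the other carries the whole sum.\<close>

lemma Young_lq:
  fixes y z :: "'i \<Rightarrow> real"
  assumes q: "1 \<le> q1" "1 \<le> q2" and r: "r > 0" "1 / r = recip q1 + recip q2"
    and y: "lq q1 y X" "X \<ge> 0" and z: "lq q2 z Y" "Y \<ge> 0"
  shows "\<exists>\<theta>1 \<theta>2. (\<forall>p p'. (y p * z p') powr r \<le> \<theta>1 p + \<theta>2 p') \<and> (\<forall>p. \<theta>1 p \<ge> 0) \<and> (\<forall>p. \<theta>2 p \<ge> 0) \<and>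
    (\<forall>Z. finite Z \<longrightarrow> (\<Sum>p\<in>Z. \<theta>1 p) + (\<Sum>p\<in>Z. \<theta>2 p) \<le> (X * Y) powr r)"
proof -
  have y0: "y p \<ge> 0" and z0: "z p \<ge> 0" for p using y z by (auto simp: lq_def)
  consider "q1 = \<infinity>" | "q1 \<noteq> \<infinity>" "q2 = \<infinity>" | "q1 \<noteq> \<infinity>" "q2 \<noteq> \<infinity>" by blast
  then show ?thesis
  proof cases
    case 1
    \<comment> \<open>Two infinite exponents would give 1/r = 0.\<close>
    have q2: "q2 \<noteq> \<infinity>" using 1 r by (auto simp: recip_def)
    then obtain s where s: "q2 = ereal s" "s \<ge> 1" using q by (cases q2) auto
    have rs: "r = s" using 1 r s by (simp add: recip_def)
    show ?thesis
    proof (rule exI[of _ "\<lambda>p. 0"], rule exI[of _ "\<lambda>p. X powr r * z p powr r"], intro conjI allI impI)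
      show "(y p * z p') powr r \<le> 0 + X powr r * z p' powr r" for p p'
      proof -
        have "y p \<le> X" using y 1 by (simp add: lq_def)
        then have "(y p * z p') powr r \<le> (X * z p') powr r" using y0 z0 r by (intro powr_mono2 mult_right_mono) auto
        then show ?thesis by (simp add: powr_mult)
      qed
      fix Z :: "'i set" assume "finite Z"
      then have "(\<Sum>p\<in>Z. z p powr s) \<le> Y powr s" using z q2 s by (simp add: lq_def)
      then have "X powr r * (\<Sum>p\<in>Z. z p powr r) \<le> X powr r * Y powr r" unfolding rs by (rule mult_left_mono) simp
      then show "(\<Sum>p\<in>Z. 0) + (\<Sum>p\<in>Z. X powr r * z p powr r) \<le> (X * Y) powr r" by (simp add: powr_mult sum_distrib_left)
    qed auto
  next
    case 2
    then obtain s where s: "q1 = ereal s" "s \<ge> 1" using q by (cases q1) auto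
    have rs: "r = s" using 2 r s by (simp add: recip_def)
    show ?thesis
    proof (rule exI[of _ "\<lambda>p. y p powr r * Y powr r"], rule exI[of _ "\<lambda>p. 0"], intro conjI allI impI)
      show "(y p * z p') powr r \<le> y p powr r * Y powr r + 0" for p p'
      proof -
        have "z p' \<le> Y" using z 2 by (simp add: lq_def)
        then have "(y p * z p') powr r \<le> (y p * Y) powr r" using y0 z0 r by (intro powr_mono2 mult_left_mono) auto
        then show ?thesis by (simp add: powr_mult)
      qed
      fix Z :: "'i set" assume "finite Z"
      then have "(\<Sum>p\<in>Z. y p powr s) \<le> X powr s" using y 2 s by (simp add: lq_def)
      then have "(\<Sum>p\<in>Z. y p powr r) * Y powr r \<le> X powr r * Y powr r" unfolding rs by (rule mult_right_mono) simp
      then show "(\<Sum>p\<in>Z. y p powr r * Y powr r) + (\<Sum>p\<in>Z. 0) \<le> (X * Y) powr r" by (simp add: powr_mult sum_distrib_right)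
    qed auto
  next
    case 3
    obtain s t where s: "q1 = ereal s" "s \<ge> 1" and t: "q2 = ereal t" "t \<ge> 1" using q 3 by (cases q1; cases q2) auto
    have rst: "1 / r = 1 / s + 1 / t" using r s t by (simp add: recip_def)
    have ys: "(\<Sum>p\<in>Z. y p powr s) \<le> X powr s" if "finite Z" for Z using y 3 s that by (simp add: lq_def)
    have zt: "(\<Sum>p\<in>Z. z p powr t) \<le> Y powr t" if "finite Z" for Z using z 3 t that by (simp add: lq_def)
    show ?thesis
    \<comment> \<open>The normalisation needs positive X and Y; if one of them vanishes, so does
      every product.\<close>
    proof (cases "X = 0 \<or> Y = 0")
      case True
      have "y p * z p' = 0" for p p'
        using True ys[of "{p}"] zt[of "{p'}"] by auto
      then show ?thesis by (intro exI[of _ "\<lambda>p. 0"]) auto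
    next
      case False
      then have XY: "X > 0" "Y > 0" using y z by auto
      have rs: "1 / (s / r) + 1 / (t / r) = 1"
      proof -
        have "1 / (s / r) + 1 / (t / r) = r * (1 / s + 1 / t)" by (simp add: distrib_left)
        also have "\<dots> = r * (1 / r)" by (simp only: rst)
        finally show ?thesis using r(1) by simp
      qed
      have "r < s" "r < t"
      proof -
        have "1 / s < 1 / r" "1 / t < 1 / r" using rst s t by auto
        then show "r < s" "r < t" using r(1) s(2) t(2) by (auto simp: field_simps)
      qed
      then have sr: "s / r > 1" "t / r > 1" using r by auto
      define \<theta>1 where "\<theta>1 p = (X * Y) powr r * (r / s * (y p / X) powr s)" for p
      define \<theta>2 where "\<theta>2 p = (X * Y) powr r * (r / t * (z p / Y) powr t)" for p
      show ?thesis
      proof (rule exI[of _ \<theta>1], rule exI[of _ \<theta>2], intro conjI allI impI)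
        show "\<theta>1 p \<ge> 0" "\<theta>2 p \<ge> 0" for p using r s t by (auto simp: \<theta>1_def \<theta>2_def)
        fix p p'
        have "(y p / X) powr r * (z p' / Y) powr r \<le> ((y p / X) powr r) powr (s / r) / (s / r) + ((z p' / Y) powr r) powr (t / r) / (t / r)"
          by (rule Youngs_inequality[OF sr rs]) auto
        also have "\<dots> = r / s * (y p / X) powr s + r / t * (z p' / Y) powr t"
          using r(1) by (simp add: powr_powr mult.commute)
        finally have "(X * Y) powr r * ((y p / X) powr r * (z p' / Y) powr r) \<le> \<theta>1 p + \<theta>2 p'"
          unfolding \<theta>1_def \<theta>2_def distrib_left[symmetric] by (rule mult_left_mono) simp
        moreover have "(y p * z p') powr r = (X * Y) powr r * ((y p / X) powr r * (z p' / Y) powr r)"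
          using XY by (simp flip: powr_mult)
        ultimately show "(y p * z p') powr r \<le> \<theta>1 p + \<theta>2 p'" by simp
      next
        fix Z :: "'i set" assume Z: "finite Z"
        have a: "(\<Sum>p\<in>Z. (y p / X) powr s) \<le> 1"
          using ys[OF Z] XY y0 by (simp add: powr_divide flip: sum_divide_distrib)
        have b: "(\<Sum>p\<in>Z. (z p / Y) powr t) \<le> 1"
          using zt[OF Z] XY z0 by (simp add: powr_divide flip: sum_divide_distrib)
        have "(\<Sum>p\<in>Z. \<theta>1 p) + (\<Sum>p\<in>Z. \<theta>2 p) = (X * Y) powr r * (r / s * (\<Sum>p\<in>Z. (y p / X) powr s) + r / t * (\<Sum>p\<in>Z. (z p / Y) powr t))"
          by (simp add: \<theta>1_def \<theta>2_def sum_distrib_left distrib_left)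
        also have "\<dots> \<le> (X * Y) powr r * (r / s * 1 + r / t * 1)"
          using a b r s t by (intro mult_left_mono add_mono) auto
        \<comment> \<open>The two shares add up to 1, so no constant is lost.\<close>
        also have "r / s * 1 + r / t * 1 = 1" using rs by simp
        finally show "(\<Sum>p\<in>Z. \<theta>1 p) + (\<Sum>p\<in>Z. \<theta>2 p) \<le> (X * Y) powr r" by simp
      qed
    qed
  qed
qed

text \<open>All losses at unit scale are collected: A and L^(n/2) from the symbol, and three powers
  of N, one from the cell estimate and one each from the local sizes of f and g.\<close>

lemma unit_estimate:
  fixes q1 q2 :: ereal
  assumes q: "1 \<le> q1" "1 \<le> q2" and r: "r > 0" "1 / r = recip q1 + recip q2"
  shows "\<exists>M K. K \<ge> 0 \<and> (\<forall>(b :: 'n::finite triple \<Rightarrow> complex) A L N f g X Y.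
    usym M A L N b \<longrightarrow> L \<ge> 1 \<longrightarrow> N \<ge> 1 \<longrightarrow> integrable lborel f \<longrightarrow> integrable lborel g \<longrightarrow>
    Lnorm q1 f = ennreal X \<longrightarrow> Lnorm q2 g = ennreal Y \<longrightarrow> X \<ge> 0 \<longrightarrow> Y \<ge> 0 \<longrightarrow>
    (\<integral>\<^sup>+x. ennreal (norm (bipsido b f g x) powr r) \<partial>lborel)
      \<le> ennreal (K * (A * L powr (CARD('n) / 2) * N powr (CARD('n) * (max (1/2) (1 - 1/r) + max 0 (recip q1 - 1/2) + max 0 (recip q2 - 1/2))) * (X * Y)) powr r))"
proof -
  obtain M K0 where K0: "K0 \<ge> 0" and est: "\<And>(b :: 'n triple \<Rightarrow> complex) A L N f g sf sg \<theta>1 \<theta>2 V.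
    usym M A L N b \<Longrightarrow> L \<ge> 1 \<Longrightarrow> N \<ge> 1 \<Longrightarrow> integrable lborel f \<Longrightarrow> integrable lborel g \<Longrightarrow>
    (\<forall>p. locsize N (\<lambda>y. norm (f y)) p (sf p)) \<Longrightarrow> (\<forall>p. locsize N (\<lambda>y. norm (g y)) p (sg p)) \<Longrightarrow>
    (\<forall>p p'. (sf p * sg p') powr r \<le> \<theta>1 p + \<theta>2 p') \<Longrightarrow> (\<forall>p. \<theta>1 p \<ge> 0) \<Longrightarrow> (\<forall>p. \<theta>2 p \<ge> 0) \<Longrightarrow>
    (\<forall>Z. finite Z \<longrightarrow> (\<Sum>p\<in>Z. \<theta>1 p) + (\<Sum>p\<in>Z. \<theta>2 p) \<le> V) \<Longrightarrow>
    (\<integral>\<^sup>+x. ennreal (norm (bipsido b f g x) powr r) \<partial>lborel)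
      \<le> ennreal (K0 * (A * (L powr (CARD('n) / 2) * N powr (CARD('n) * max (1/2) (1 - 1/r)))) powr r * V)"
    using cells_estimate[OF r(1), where 'n='n] by blast
  define C where "C = sqrt (2 * (2 * pi) ^ CARD('n) + 2 * 2 ^ CARD('n))"
  define K where "K = K0 * (C * C) powr r"
  have K: "K \<ge> 0" using K0 by (simp add: K_def)
  show ?thesis
  proof (intro exI[of _ M] exI[of _ K] conjI K allI impI)
    fix b :: "'n triple \<Rightarrow> complex" and A L N and f g :: "real^'n \<Rightarrow> complex" and X Y
    assume b: "usym M A L N b" and L: "L \<ge> 1" and N: "N \<ge> 1" and f: "integrable lborel f" and g: "integrable lborel g"
      and X: "Lnorm q1 f = ennreal X" and Y: "Lnorm q2 g = ennreal Y" and X0: "X \<ge> 0" and Y0: "Y \<ge> 0"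
    let ?n = "real CARD('n)"
    define e1 where "e1 = N powr (?n * max 0 (recip q1 - 1/2))"
    define e2 where "e2 = N powr (?n * max 0 (recip q2 - 1/2))"
    obtain y where y: "lq q1 y X" and sf: "\<forall>p. locsize N (\<lambda>y. norm (f y)) p (C * e1 * y p)"
      using Lnorm_local_sizes[OF f q(1) N X X0] unfolding C_def e1_def by blast
    obtain z where z: "lq q2 z Y" and sg: "\<forall>p. locsize N (\<lambda>y. norm (g y)) p (C * e2 * z p)"
      using Lnorm_local_sizes[OF g q(2) N Y Y0] unfolding C_def e2_def by blast
    obtain \<theta>1 \<theta>2 where \<theta>: "\<forall>p p'. (y p * z p') powr r \<le> \<theta>1 p + \<theta>2 p'" "\<forall>p. \<theta>1 p \<ge> 0" "\<forall>p. \<theta>2 p \<ge> 0"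
      "\<forall>Z. finite Z \<longrightarrow> (\<Sum>p\<in>Z. \<theta>1 p) + (\<Sum>p\<in>Z. \<theta>2 p) \<le> (X * Y) powr r"
      using Young_lq[OF q r y X0 z Y0] by blast
    define c where "c = (C * C * (e1 * e2)) powr r"
    have c0: "c \<ge> 0" by (simp add: c_def)
    have h1: "\<forall>p p'. (C * e1 * y p * (C * e2 * z p')) powr r \<le> c * \<theta>1 p + c * \<theta>2 p'"
    proof (intro allI)
      fix p p'
      have "C * e1 * y p * (C * e2 * z p') = (C * C * (e1 * e2)) * (y p * z p')" by (simp only: mult_ac)
      then have "(C * e1 * y p * (C * e2 * z p')) powr r = c * (y p * z p') powr r" unfolding c_def by (simp only: powr_mult)
      also have "\<dots> \<le> c * (\<theta>1 p + \<theta>2 p')" using \<theta>(1) c0 by (intro mult_left_mono) auto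
      finally show "(C * e1 * y p * (C * e2 * z p')) powr r \<le> c * \<theta>1 p + c * \<theta>2 p'" by (simp only: distrib_left)
    qed
    have h2: "\<forall>Z. finite Z \<longrightarrow> (\<Sum>p\<in>Z. c * \<theta>1 p) + (\<Sum>p\<in>Z. c * \<theta>2 p) \<le> c * (X * Y) powr r"
      unfolding sum_distrib_left[symmetric] distrib_left[symmetric] using \<theta>(4) c0 by (auto intro: mult_left_mono)
    have "(\<integral>\<^sup>+x. ennreal (norm (bipsido b f g x) powr r) \<partial>lborel)
      \<le> ennreal (K0 * (A * (L powr (?n / 2) * N powr (?n * max (1/2) (1 - 1/r)))) powr r * (c * (X * Y) powr r))"
      by (rule est[OF b L N f g sf sg h1 _ _ h2]) (use \<theta> c0 in auto)
    also have "K0 * (A * (L powr (?n / 2) * N powr (?n * max (1/2) (1 - 1/r)))) powr r * (c * (X * Y) powr r)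
      = K * (A * L powr (?n / 2) * N powr (?n * (max (1/2) (1 - 1/r) + max 0 (recip q1 - 1/2) + max 0 (recip q2 - 1/2))) * (X * Y)) powr r"
    proof -
      have "N powr (?n * (max (1/2) (1 - 1/r) + max 0 (recip q1 - 1/2) + max 0 (recip q2 - 1/2))) = N powr (?n * max (1/2) (1 - 1/r)) * e1 * e2"
        unfolding e1_def e2_def by (simp only: distrib_left powr_add)
      then have "K * (A * L powr (?n / 2) * N powr (?n * (max (1/2) (1 - 1/r) + max 0 (recip q1 - 1/2) + max 0 (recip q2 - 1/2))) * (X * Y)) powr r
        = K0 * ((C * C) powr r * (A * L powr (?n / 2) * (N powr (?n * max (1/2) (1 - 1/r)) * e1 * e2) * (X * Y)) powr r)"
        by (simp only: K_def mult.assoc)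
      also have "\<dots> = K0 * ((A * (L powr (?n / 2) * N powr (?n * max (1/2) (1 - 1/r)))) powr r * (c * (X * Y) powr r))"
        unfolding c_def by (simp only: powr_mult[symmetric] mult_ac)
      finally show ?thesis by (simp only: mult.assoc)
    qed
    finally show "(\<integral>\<^sup>+x. ennreal (norm (bipsido b f g x) powr r) \<partial>lborel)
      \<le> ennreal (K * (A * L powr (?n / 2) * N powr (?n * (max (1/2) (1 - 1/r) + max 0 (recip q1 - 1/2) + max 0 (recip q2 - 1/2))) * (X * Y)) powr r)" .
  qed
qed

section \<open>A smooth cutoff function\<close>

text \<open>The negative powers of t are carried along so that the family is closed under
  differentiation up to linear combinations.\<close>

definition hexp :: "nat \<Rightarrow> real \<Rightarrow> real" where
  "hexp k t = (if t > 0 then inverse t ^ k * exp (- inverse t) else 0)"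

lemma hexp_tendsto_right: "(hexp k \<longlongrightarrow> 0) (at_right 0)"
proof -
  have "((\<lambda>t::real. inverse t ^ k / exp (inverse t)) \<longlongrightarrow> 0) (at_right 0)"
    by (rule filterlim_compose[OF tendsto_power_div_exp_0 filterlim_inverse_at_top_right])
  moreover have "eventually (\<lambda>t::real. inverse t ^ k / exp (inverse t) = hexp k t) (at_right 0)"
    by (rule eventually_at_right_less[THEN eventually_mono]) (simp add: hexp_def exp_minus field_simps)
  ultimately show ?thesis by (simp add: filterlim_cong)
qed

text \<open>At 0 the right difference quotient of \<open>hexp k\<close> is
  \<open>hexp (k + 1)\<close>, which tends to 0 because the exponential beats every power; the left
  one is 0.\<close>

lemma hexp_deriv: "(hexp k has_real_derivative hexp (k + 2) t - real k * hexp (k + 1) t) (at t)"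
proof -
  consider "t > 0" | "t < 0" | "t = 0" by linarith
  then show ?thesis
  proof cases
    case 1
    have "((\<lambda>t. inverse t ^ k * exp (- inverse t)) has_real_derivative hexp (k + 2) t - real k * hexp (k + 1) t) (at t)"
    proof -
      have p: "((\<lambda>t. inverse t ^ k) has_real_derivative real k * (- (inverse t * inverse t) * inverse t ^ (k - Suc 0))) (at t)"
        using 1 by (intro DERIV_power) (auto intro!: derivative_eq_intros)
      have e: "((\<lambda>t. exp (- inverse t)) has_real_derivative exp (- inverse t) * (inverse t * inverse t)) (at t)"
        using 1 by (auto intro!: derivative_eq_intros)
      have "real k * (- (inverse t * inverse t) * inverse t ^ (k - Suc 0)) * exp (- inverse t) + exp (- inverse t) * (inverse t * inverse t) * inverse t ^ k
        = hexp (k + 2) t - real k * hexp (k + 1) t"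
        using 1 by (cases k) (simp_all add: hexp_def algebra_simps)
      with DERIV_mult[OF p e] show ?thesis by simp
    qed
    then show ?thesis
      by (rule has_field_derivative_transform_within_open[where S="{0<..}"]) (use 1 in \<open>auto simp: hexp_def\<close>)
  next
    case 2
    have "((\<lambda>t. 0) has_real_derivative 0) (at t)" by simp
    then have "(hexp k has_real_derivative 0) (at t)"
      by (rule has_field_derivative_transform_within_open[where S="{..<0}"]) (use 2 in \<open>auto simp: hexp_def\<close>)
    then show ?thesis using 2 by (simp add: hexp_def)
  next
    case 3
    have "((\<lambda>y. (hexp k y - hexp k 0) / (y - 0)) \<longlongrightarrow> 0) (at 0)"
    proof (rule filterlim_split_at)
      have "eventually (\<lambda>y. hexp (k + 1) y = (hexp k y - hexp k 0) / (y - 0)) (at_right 0)"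
        by (rule eventually_at_right_less[THEN eventually_mono]) (simp add: hexp_def field_simps)
      then show "((\<lambda>y. (hexp k y - hexp k 0) / (y - 0)) \<longlongrightarrow> 0) (at_right 0)"
        using hexp_tendsto_right[of "k + 1"] by (rule Lim_transform_eventually[rotated])
      have "eventually (\<lambda>y. 0 = (hexp k y - hexp k 0) / (y - 0)) (at_left 0)"
        by (rule eventually_at_left_real[of "-1", THEN eventually_mono]) (auto simp: hexp_def)
      then show "((\<lambda>y. (hexp k y - hexp k 0) / (y - 0)) \<longlongrightarrow> 0) (at_left 0)"
        by (rule Lim_transform_eventually[OF tendsto_const])
    qed
    then show ?thesis unfolding 3 has_field_derivative_iff by (simp add: hexp_def)
  qed
qed

text \<open>The denominator of a smooth step: \<open>hexp 0 t / hden t\<close> rises from 0 for t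
  \<le> 0 to 1 for t \<ge> 1.\<close>

definition hden :: "real \<Rightarrow> real" where "hden t = hexp 0 t + hexp 0 (1 - t)"

lemma hden_pos: "hden t > 0"
  unfolding hden_def hexp_def by (auto intro: add_pos_pos)

text \<open>A class containing the smooth step and closed under derivatives, so that derivatives of
  all orders come at once. Affine arguments are included because differentiating \<open>hden\<close>
  brings in the reflected point 1 - t.\<close>

inductive dcl :: "(real \<Rightarrow> real) \<Rightarrow> bool" where
  "dcl (\<lambda>t. c)"
| "dcl (\<lambda>t. hexp k (\<alpha> * t + \<beta>))"
| "dcl (\<lambda>t. inverse (hden (\<alpha> * t + \<beta>)))"
| "dcl f \<Longrightarrow> dcl g \<Longrightarrow> dcl (\<lambda>t. f t + g t)"
| "dcl f \<Longrightarrow> dcl g \<Longrightarrow> dcl (\<lambda>t. f t * g t)"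

lemma hexp_deriv_affine:
  "((\<lambda>t. hexp k (\<alpha> * t + \<beta>)) has_real_derivative (hexp (k + 2) (\<alpha> * t + \<beta>) + (- real k) * hexp (k + 1) (\<alpha> * t + \<beta>)) * \<alpha>) (at t)"
proof -
  have "((\<lambda>t. \<alpha> * t + \<beta>) has_real_derivative \<alpha>) (at t)" by (auto intro!: derivative_eq_intros)
  then show ?thesis
    using DERIV_chain2[where f="hexp k" and g="\<lambda>t. \<alpha> * t + \<beta>" and x=t and s=UNIV, OF hexp_deriv] by simp
qed

lemma hden_deriv_affine:
  "((\<lambda>t. hden (\<alpha> * t + \<beta>)) has_real_derivative (hexp 2 (\<alpha> * t + \<beta>) + (- 1) * hexp 2 ((- \<alpha>) * t + (1 - \<beta>))) * \<alpha>) (at t)"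
proof -
  have e: "1 - (\<alpha> * t + \<beta>) = (- \<alpha>) * t + (1 - \<beta>)" for t by simp
  show ?thesis
    unfolding hden_def e
    by (rule derivative_eq_intros hexp_deriv_affine refl)+ (simp add: algebra_simps numeral_2_eq_2)
qed

lemma dcl_deriv: "dcl f \<Longrightarrow> \<exists>f'. dcl f' \<and> (\<forall>t. (f has_real_derivative f' t) (at t))"
proof (induction rule: dcl.induct)
  case (1 c)
  show ?case by (rule exI[of _ "\<lambda>t. 0"]) (auto intro: dcl.intros)
next
  case (2 k \<alpha> \<beta>)
  have "dcl (\<lambda>t. (hexp (k + 2) (\<alpha> * t + \<beta>) + (- real k) * hexp (k + 1) (\<alpha> * t + \<beta>)) * \<alpha>)" by (intro dcl.intros)
  then show ?case using hexp_deriv_affine[of k \<alpha> \<beta>] by (metis (no_types, lifting))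
next
  case (3 \<alpha> \<beta>)
  let ?d = "\<lambda>t. (hexp 2 (\<alpha> * t + \<beta>) + (- 1) * hexp 2 ((- \<alpha>) * t + (1 - \<beta>))) * \<alpha>"
  let ?f = "\<lambda>t. (- 1) * ((inverse (hden (\<alpha> * t + \<beta>)) * ?d t) * inverse (hden (\<alpha> * t + \<beta>)))"
  have "dcl ?f" by (intro dcl.intros)
  moreover have "((\<lambda>t. inverse (hden (\<alpha> * t + \<beta>))) has_real_derivative ?f t) (at t)" for t
    using DERIV_inverse'[OF hden_deriv_affine[of \<alpha> \<beta> t]] hden_pos[of "\<alpha> * t + \<beta>"] by simp
  ultimately show ?case by (intro exI[of _ ?f]) blast
next
  case (4 f g)
  then obtain f' g' where "dcl f'" "dcl g'" "\<And>t. (f has_real_derivative f' t) (at t)" "\<And>t. (g has_real_derivative g' t) (at t)" by blast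
  then show ?case by (intro exI[of _ "\<lambda>t. f' t + g' t"]) (auto intro: dcl.intros DERIV_add)
next
  case (5 f g)
  then obtain f' g' where *: "dcl f'" "dcl g'" "\<And>t. (f has_real_derivative f' t) (at t)" "\<And>t. (g has_real_derivative g' t) (at t)" by blast
  have "dcl (\<lambda>t. f' t * g t + g' t * f t)" using * 5 by (intro dcl.intros)
  then show ?case using * by (intro exI[of _ "\<lambda>t. f' t * g t + g' t * f t"]) (auto intro: DERIV_mult)
qed

lemma dcl_iterated:
  assumes "dcl f"
  shows "dcl ((deriv ^^ n) f)" and "((deriv ^^ n) f has_real_derivative (deriv ^^ Suc n) f t) (at t)"
proof -
  have d: "dcl (deriv f) \<and> (\<forall>t. (f has_real_derivative deriv f t) (at t))" if df: "dcl f" for f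
  proof -
    obtain f' where f': "dcl f'" "\<And>t. (f has_real_derivative f' t) (at t)" using dcl_deriv[OF df] by blast
    then have "deriv f = f'" by (intro ext DERIV_imp_deriv)
    then show ?thesis using f' by simp
  qed
  have *: "dcl ((deriv ^^ n) f)" for n using assms d by (induction n) auto
  show "dcl ((deriv ^^ n) f)" by (rule *)
  show "((deriv ^^ n) f has_real_derivative (deriv ^^ Suc n) f t) (at t)" using d[OF *[of n]] by simp
qed

text \<open>A product of a rising and a falling smooth step, equal to 1 on [-1, 1] and to 0 outside
  (-2, 2). The coefficients \<open>(-1) * t\<close> and \<open>1 * t\<close> are spelled out to
  match the rules of \<open>dcl\<close>.\<close>

definition cut :: "real \<Rightarrow> real" where
  "cut t = (hexp 0 ((-1) * t + 2) * inverse (hden ((-1) * t + 2))) * (hexp 0 (1 * t + 2) * inverse (hden (1 * t + 2)))"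

lemma dcl_cut: "dcl cut"
  unfolding cut_def[abs_def] by (intro dcl.intros)

lemma cut_1: "\<bar>t\<bar> \<le> 1 \<Longrightarrow> cut t = 1"
proof -
  assume "\<bar>t\<bar> \<le> 1"
  then have "hden ((-1) * t + 2) = hexp 0 ((-1) * t + 2)" "hden (1 * t + 2) = hexp 0 (1 * t + 2)"
    by (auto simp: hden_def hexp_def)
  then show ?thesis unfolding cut_def using hden_pos by (metis less_numeral_extra(3) mult_1 right_inverse)
qed

lemma cut_0: "\<bar>t\<bar> \<ge> 2 \<Longrightarrow> cut t = 0"
  by (auto simp: cut_def hexp_def abs_if split: if_splits)

lemma cut_range: "\<bar>cut t\<bar> \<le> 1"
proof -
  have *: "0 \<le> hexp 0 s * inverse (hden s)" "hexp 0 s * inverse (hden s) \<le> 1" for s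
    using hden_pos[of s] by (auto simp: hden_def hexp_def divide_simps)
  have "cut t \<le> 1 * 1" unfolding cut_def by (intro mult_mono *) auto
  moreover have "cut t \<ge> 0" unfolding cut_def by (intro mult_nonneg_nonneg[OF *(1) *(1)])
  ultimately show ?thesis by simp
qed

abbreviation "dcut n \<equiv> (deriv ^^ n) cut"

lemma dcut_zero: "\<bar>t\<bar> > 2 \<Longrightarrow> dcut n t = 0"
proof (induction n arbitrary: t)
  case 0 then show ?case by (simp add: cut_0)
next
  case (Suc n)
  have o: "open {t::real. \<bar>t\<bar> > 2}" by (intro open_Collect_less continuous_intros)
  have "(dcut n has_real_derivative 0) (at t)"
    by (rule has_field_derivative_transform_within_open[OF DERIV_const[of 0] o]) (use Suc in auto)
  then show ?case by (auto dest: DERIV_imp_deriv)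
qed

text \<open>Each derivative is continuous and vanishes outside [-2, 2], so compactness bounds
  it.\<close>

lemma dcut_bounded: "\<exists>B. \<forall>t. \<bar>dcut n t\<bar> \<le> B"
proof -
  have "continuous_on {-2..2} (dcut n)"
    using dcl_iterated(2)[OF dcl_cut] by (meson DERIV_isCont continuous_at_imp_continuous_on)
  then have "bounded (dcut n ` {-2..2})" by (intro compact_imp_bounded compact_continuous_image) auto
  then obtain B where "\<forall>s\<in>dcut n ` {-2..2}. norm s \<le> B" unfolding bounded_iff by blast
  then have B: "\<bar>dcut n t\<bar> \<le> B" if "t \<in> {-2..2}" for t using that by simp
  have "\<bar>dcut n t\<bar> \<le> max B 0" for t
    using B[of t] dcut_zero[of t n] by (cases "\<bar>t\<bar> \<le> 2") (auto simp: le_max_iff_disj abs_le_iff)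
  then show ?thesis by blast
qed

section \<open>Dyadic pieces of a symbol\<close>

text \<open>As \<open>l\<close> is linear, a derivative along \<open>v\<close> only produces the
  constant \<open>c * l v\<close> and one more derivative of the one-variable cutoff.\<close>

lemma cut_ddirs:
  fixes l :: "'v::real_normed_vector \<Rightarrow> real"
  assumes l: "bounded_linear l"
  shows "ddirs vs (\<lambda>z. of_real (cut (c * l z))) = (\<lambda>z. of_real (prod_list (map (\<lambda>v. c * l v) vs) * dcut (length vs) (c * l z)))"
    and "(\<lambda>t::real. ddirs vs (\<lambda>z. of_real (cut (c * l z)) :: complex) (z + t *\<^sub>R v)) differentiable (at 0)"
proof -
  have d: "((\<lambda>t. of_real (p * dcut n (c * l (z + t *\<^sub>R v))) :: complex) has_vector_derivative of_real (p * (dcut (Suc n) (c * l z) * (c * l v)))) (at 0)" for p n z v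
  proof -
    have e: "c * l (z + t *\<^sub>R v) = (c * l v) * t + c * l z" for t
      using bounded_linear.linear[OF l] by (simp add: linear_add linear_scale algebra_simps)
    have "((\<lambda>t. dcut n ((c * l v) * t + c * l z)) has_real_derivative dcut (Suc n) (c * l z) * (c * l v)) (at 0)"
    proof -
      have "((\<lambda>t. (c * l v) * t + c * l z) has_real_derivative c * l v) (at 0)" by (auto intro!: derivative_eq_intros)
      then show ?thesis
        using DERIV_chain2[where f="dcut n" and g="\<lambda>t. (c * l v) * t + c * l z" and x=0 and s=UNIV, OF dcl_iterated(2)[OF dcl_cut]] by simp
    qed
    then have "((\<lambda>t. p * dcut n ((c * l v) * t + c * l z)) has_real_derivative p * (dcut (Suc n) (c * l z) * (c * l v))) (at 0)"
      by (rule DERIV_cmult)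
    then show ?thesis unfolding e
      by (intro has_vector_derivative_of_real) (simp only: has_real_derivative_iff_has_vector_derivative)
  qed
  show eq: "ddirs vs (\<lambda>z. of_real (cut (c * l z))) = (\<lambda>z. of_real (prod_list (map (\<lambda>v. c * l v) vs) * dcut (length vs) (c * l z)))" for vs
  proof (induction vs)
    case (Cons v vs)
    show ?case
    proof
      fix z
      show "ddirs (v # vs) (\<lambda>z. of_real (cut (c * l z))) z = of_real (prod_list (map (\<lambda>v. c * l v) (v # vs)) * dcut (length (v # vs)) (c * l z))"
        unfolding ddirs.simps Cons
        by (subst ddir_eqI[OF d]) (simp add: mult_ac)
    qed
  qed simp
  show "(\<lambda>t::real. ddirs vs (\<lambda>z. of_real (cut (c * l z)) :: complex) (z + t *\<^sub>R v)) differentiable (at 0)"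
    unfolding eq using d by (rule differentiableI_vector)
qed

lemma cut_smooth:
  assumes l: "bounded_linear l"
  shows "smooth_on_dirs B (\<lambda>z. of_real (cut (c * l z)) :: complex)"
  unfolding smooth_on_dirs_def
proof (intro allI impI conjI ballI)
  fix vs
  have "continuous_on UNIV (dcut n)" for n
    using dcl_iterated(2)[OF dcl_cut] by (meson DERIV_isCont continuous_at_imp_continuous_on)
  then have "continuous_on UNIV (\<lambda>z. dcut n (c * l z))" for n
    by (rule continuous_on_compose2) (auto intro!: linear_continuous_on bounded_linear_const_mult l)
  then show "continuous_on UNIV (ddirs vs (\<lambda>z. of_real (cut (c * l z)) :: complex))"
    unfolding cut_ddirs(1)[OF l] by (intro continuous_on_of_real continuous_on_mult_left)
qed (rule cut_ddirs(2)[OF l])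

text \<open>Weights of a cutoff at frequency scale 2^j: frequency derivatives gain 2^(-j), and 1
  suffices for x-derivatives since the cutoffs do not depend on x.\<close>

definition "wR v j z = (if v \<in> x_dirs then 1 else (1/2) ^ j :: real)"

lemma wR_nonneg: "wR v j z \<ge> 0" by (simp add: wR_def)

lemma dbd_cut:
  fixes l :: "'n::finite triple \<Rightarrow> real"
  assumes l: "bounded_linear l" and lv: "\<And>v. v \<in> alld \<Longrightarrow> \<bar>l v\<bar> \<le> 1" and lx: "\<And>v. v \<in> x_dirs \<Longrightarrow> l v = 0"
  shows "dbd alld wR (\<lambda>j z. 1) (\<lambda>j z. of_real (cut ((1/2) ^ j * l z)))"
  unfolding dbd_def
proof (intro conjI allI impI cut_smooth l)
  fix vs :: "'n triple list" assume vs: "set vs \<subseteq> alld"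
  obtain B where B: "\<And>t. \<bar>dcut (length vs) t\<bar> \<le> B" using dcut_bounded by blast
  have p: "\<bar>prod_list (map (\<lambda>v. (1/2) ^ j * l v) vs)\<bar> \<le> prod_list (map (\<lambda>v. wR v j z) vs)" for j z
    using vs
  proof (induction vs)
    case (Cons v vs)
    have "\<bar>(1/2) ^ j * l v\<bar> \<le> wR v j z"
      using lv[of v] lx[of v] Cons.prems by (auto simp: wR_def abs_mult mult_left_le)
    then show ?case using Cons by (auto simp: abs_mult wR_nonneg intro!: mult_mono)
  qed simp
  show "\<exists>C. \<forall>j z. norm (ddirs vs (\<lambda>z. of_real (cut ((1/2) ^ j * l z))) z) \<le> C * (1 * prod_list (map (\<lambda>v. wR v j z) vs))"
  proof (intro exI[of _ B] allI)
    fix j z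
    have "norm (ddirs vs (\<lambda>z. of_real (cut ((1/2) ^ j * l z))) z) = \<bar>prod_list (map (\<lambda>v. (1/2) ^ j * l v) vs)\<bar> * \<bar>dcut (length vs) ((1/2) ^ j * l z)\<bar>"
      unfolding cut_ddirs(1)[OF l] norm_of_real abs_mult ..
    also have "\<dots> \<le> prod_list (map (\<lambda>v. wR v j z) vs) * B"
      by (intro mult_mono p B) (auto intro: order_trans[OF abs_ge_zero p])
    finally show "norm (ddirs vs (\<lambda>z. of_real (cut ((1/2) ^ j * l z))) z) \<le> B * (1 * prod_list (map (\<lambda>v. wR v j z) vs))"
      by (simp add: mult.commute)
  qed
qed

lemma dbd_prod:
  assumes "finite I" "\<And>i. i \<in> I \<Longrightarrow> dbd B w (\<lambda>j z. 1) (F i)" "dbd B w (\<lambda>j z. 1) (\<lambda>j z. 1)"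
  shows "dbd B w (\<lambda>j z. 1) (\<lambda>j z. \<Prod>i\<in>I. F i j z)"
  using assms
proof (induction I rule: finite_induct)
  case (insert i I)
  then have "dbd B w (\<lambda>j z. 1 * 1) (\<lambda>j z. F i j z * (\<Prod>i\<in>I. F i j z))" by (intro dbd_mult) auto
  then show ?case using insert by simp
qed simp

text \<open>Cutting each frequency coordinate separately reduces all bounds to one variable. The
  function is 1 where all frequency coordinates are at most 2^j in modulus and 0 where one of them
  exceeds twice that.\<close>

definition Psi :: "nat \<Rightarrow> 'n::finite triple \<Rightarrow> complex" where
  "Psi j z = (\<Prod>i\<in>UNIV. of_real (cut ((1/2) ^ j * (fst (snd z) $ i)))) * (\<Prod>i\<in>UNIV. of_real (cut ((1/2) ^ j * (snd (snd z) $ i))))"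

text \<open>Differences of consecutive cutoffs, so that partial sums telescope to
  \<open>Psi\<close>. The subtraction is written as a product with - 1 to fall under the closure
  rules for sums and products.\<close>

definition Chi :: "nat \<Rightarrow> 'n::finite triple \<Rightarrow> complex" where
  "Chi j z = (case j of 0 \<Rightarrow> Psi 0 z | Suc k \<Rightarrow> Psi (Suc k) z + (- 1) * Psi k z)"

lemma sum_Chi: "(\<Sum>j\<le>J. Chi j z) = Psi J z"
  by (induction J) (auto simp: Chi_def)

lemma dbd_const1:
  assumes "\<And>v i z. v \<in> B \<Longrightarrow> w v i z \<ge> 0"
  shows "dbd B w (\<lambda>i z. 1) (\<lambda>i z. c)"
  unfolding dbd_def
proof (intro conjI allI impI)
  show "smooth_on_dirs B (\<lambda>z. c)" by (rule smooth_on_dirs_const)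
  fix vs assume vs: "set vs \<subseteq> B"
  have z: "ddirs us (\<lambda>z. 0) = (\<lambda>z. 0)" for us :: "'a list" by (induction us) auto
  show "\<exists>C. \<forall>i z. norm (ddirs vs (\<lambda>z. c) z) \<le> C * (1 * prod_list (map (\<lambda>v. w v i z) vs))"
  proof (cases vs rule: rev_cases)
    case (snoc us v)
    then show ?thesis by (intro exI[of _ 0]) (simp add: ddirs_snoc z)
  qed (auto intro: exI[of _ "norm c"])
qed

lemma alld_axis_component:
  assumes "v \<in> alld" shows "\<bar>fst (snd v) $ i\<bar> \<le> 1" "\<bar>snd (snd v) $ i\<bar> \<le> 1"
  using assms by (auto simp: alld_def x_dirs_def xi_dirs_def eta_dirs_def axis_def)

lemma dbd_Psi: "dbd alld wR (\<lambda>j z. 1) (Psi :: nat \<Rightarrow> 'n::finite triple \<Rightarrow> complex)"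
proof -
  have one: "dbd alld wR (\<lambda>j z. 1) (\<lambda>j z. 1)" by (rule dbd_const1) (simp add: wR_def)
  have c1: "dbd alld wR (\<lambda>j z. 1) (\<lambda>j z. of_real (cut ((1/2) ^ j * (fst (snd z) $ i))))" for i :: 'n
    by (rule dbd_cut)
      (auto intro!: bounded_linear_compose[OF bounded_linear_vec_nth] bounded_linear_compose[OF bounded_linear_fst] bounded_linear_snd alld_axis_component simp: x_dirs_def)
  have c2: "dbd alld wR (\<lambda>j z. 1) (\<lambda>j z. of_real (cut ((1/2) ^ j * (snd (snd z) $ i))))" for i :: 'n
    by (rule dbd_cut)
      (auto intro!: bounded_linear_compose[OF bounded_linear_vec_nth] bounded_linear_compose[OF bounded_linear_snd] bounded_linear_snd alld_axis_component simp: x_dirs_def)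
  have "dbd alld wR (\<lambda>j z. 1 * 1) (\<lambda>j z. (\<Prod>i\<in>UNIV. of_real (cut ((1/2) ^ j * (fst (snd z) $ (i::'n))))) * (\<Prod>i\<in>UNIV. of_real (cut ((1/2) ^ j * (snd (snd z) $ (i::'n))))))"
    by (intro dbd_mult dbd_prod one c1 c2 finite)
  then show ?thesis by (simp add: Psi_def[abs_def])
qed

lemma Psi_1: "\<xi> \<in> fbox (2 ^ j) \<Longrightarrow> \<eta> \<in> fbox (2 ^ j) \<Longrightarrow> Psi j (x, \<xi>, \<eta>) = 1"
proof -
  assume "\<xi> \<in> fbox (2 ^ j)" "\<eta> \<in> fbox (2 ^ j)"
  then have "\<bar>(1/2) ^ j * (\<xi> $ i)\<bar> \<le> 1" "\<bar>(1/2) ^ j * (\<eta> $ i)\<bar> \<le> 1" for i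
    by (auto simp: fbox_def abs_mult power_one_over divide_simps)
  then show ?thesis by (simp add: Psi_def cut_1)
qed

lemma Psi_0: "\<xi> \<notin> fbox (2 * 2 ^ j) \<or> \<eta> \<notin> fbox (2 * 2 ^ j) \<Longrightarrow> Psi j (x, \<xi>, \<eta>) = 0"
proof -
  assume "\<xi> \<notin> fbox (2 * 2 ^ j) \<or> \<eta> \<notin> fbox (2 * 2 ^ j)"
  then obtain i where "\<bar>\<xi> $ i\<bar> > 2 * 2 ^ j \<or> \<bar>\<eta> $ i\<bar> > 2 * 2 ^ j" by (auto simp: fbox_def not_le)
  then have "\<bar>(1/2) ^ j * (\<xi> $ i)\<bar> \<ge> 2 \<or> \<bar>(1/2) ^ j * (\<eta> $ i)\<bar> \<ge> 2"
    by (auto simp: abs_mult power_one_over divide_simps)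
  then have "cut ((1/2) ^ j * (\<xi> $ i)) = 0 \<or> cut ((1/2) ^ j * (\<eta> $ i)) = 0" using cut_0 by blast
  then show ?thesis unfolding Psi_def fst_conv snd_conv mult_eq_0_iff prod_zero_iff[OF finite] by fastforce
qed

lemma norm_Psi_le: "norm (Psi j z) \<le> 1"
proof -
  have "norm (\<Prod>i\<in>UNIV. of_real (cut (f i)) :: complex) \<le> 1" for f :: "'a \<Rightarrow> real"
    unfolding prod_norm[symmetric] by (intro prod_le_1) (auto simp: cut_range)
  then show ?thesis unfolding Psi_def norm_mult by (intro mult_le_one) auto
qed

lemma fbox_mono: "M \<le> N \<Longrightarrow> fbox M \<subseteq> fbox N"
  unfolding fbox_def by (auto intro: order_trans)

text \<open>For j = 0 the inner condition is dropped, because nothing is subtracted from the first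
  cutoff.\<close>

definition shell :: "nat \<Rightarrow> 'n::finite triple set" where
  "shell j = {(x, \<xi>, \<eta>). \<xi> \<in> fbox (2 * 2 ^ j) \<and> \<eta> \<in> fbox (2 * 2 ^ j) \<and>
     (j = 0 \<or> (\<exists>i. \<bar>\<xi> $ i\<bar> \<ge> 2 ^ j / 2 \<or> \<bar>\<eta> $ i\<bar> \<ge> 2 ^ j / 2))}"

text \<open>The complement of the shell is covered by two open sets: beyond the outer box both
  cutoffs vanish, and inside the inner box, for j > 0, both equal 1 and cancel.\<close>

lemma ddirs_Chi_outside:
  assumes "z \<notin> shell j" shows "ddirs vs (Chi j) z = 0"
proof -
  define U1 where "U1 = {z :: 'a triple. \<exists>i. \<bar>fst (snd z) $ i\<bar> > 2 * 2 ^ j \<or> \<bar>snd (snd z) $ i\<bar> > 2 * 2 ^ j}"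
  define U2 where "U2 = (if j = 0 then {} else {z :: 'a triple. \<forall>i. \<bar>fst (snd z) $ i\<bar> < 2 ^ j / 2 \<and> \<bar>snd (snd z) $ i\<bar> < 2 ^ j / 2})"
  have o1: "open U1" unfolding U1_def
    by (intro open_Collect_ex open_Collect_disj open_Collect_less continuous_intros)
  have "open {z :: 'a triple. \<forall>i. \<bar>fst (snd z) $ i\<bar> < 2 ^ j / 2 \<and> \<bar>snd (snd z) $ i\<bar> < 2 ^ j / 2}"
  proof -
    have "{z :: 'a triple. \<forall>i. \<bar>fst (snd z) $ i\<bar> < 2 ^ j / 2 \<and> \<bar>snd (snd z) $ i\<bar> < 2 ^ j / 2}
      = (\<Inter>i. {z. \<bar>fst (snd z) $ i\<bar> < 2 ^ j / 2 \<and> \<bar>snd (snd z) $ i\<bar> < 2 ^ j / 2})" by auto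
    also have "open \<dots>"
      by (intro open_INT open_Collect_conj open_Collect_less continuous_intros ballI finite)
    finally show ?thesis .
  qed
  then have o2: "open U2" by (simp add: U2_def)
  have z1: "Chi j z = 0" if zU: "z \<in> U1" for z
  proof -
    obtain x \<xi> \<eta> where z: "z = (x, \<xi>, \<eta>)" by (metis prod.exhaust)
    have a: "\<xi> \<notin> fbox (2 * 2 ^ j) \<or> \<eta> \<notin> fbox (2 * 2 ^ j)" using zU unfolding U1_def fbox_def z by (auto simp: not_le)
    have "Psi j z = 0" unfolding z by (rule Psi_0[OF a])
    moreover have "Psi k z = 0" if "j = Suc k" for k
    proof -
      have "fbox (2 * 2 ^ k) \<subseteq> (fbox (2 * 2 ^ j) :: (real^'a) set)" unfolding that by (intro fbox_mono) simp
      then show ?thesis unfolding z using a by (intro Psi_0) auto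
    qed
    ultimately show ?thesis by (cases j) (auto simp: Chi_def)
  qed
  have z2: "Chi j z = 0" if zU: "z \<in> U2" for z
  proof -
    obtain x \<xi> \<eta> where z: "z = (x, \<xi>, \<eta>)" by (metis prod.exhaust)
    obtain k where j: "j = Suc k" using zU by (cases j) (auto simp: U2_def)
    have "\<xi> \<in> fbox (2 ^ k)" "\<eta> \<in> fbox (2 ^ k)" using zU unfolding U2_def fbox_def z j by (auto intro: less_imp_le)
    moreover have "fbox (2 ^ k) \<subseteq> (fbox (2 ^ j) :: (real^'a) set)" unfolding j by (intro fbox_mono) simp
    ultimately have "Psi j (x, \<xi>, \<eta>) = 1" "Psi k (x, \<xi>, \<eta>) = 1" by (auto intro!: Psi_1)
    then show ?thesis by (simp add: j Chi_def z)
  qed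
  have "z \<in> U1 \<union> U2"
  proof (cases z)
    case (fields x \<xi> \<eta>)
    then show ?thesis using assms by (auto simp: shell_def U1_def U2_def fbox_def not_le)
  qed
  then show ?thesis using z1 z2 o1 o2 by (intro ddirs_zero_on_open[of "U1 \<union> U2"]) auto
qed

text \<open>The subtracted cutoff has its weights at scale j - 1; passing to scale j costs at most a
  factor 2 per derivative.\<close>

lemma Chi_bound:
  assumes vs: "set vs \<subseteq> alld"
  shows "\<exists>C\<ge>0. \<forall>j (z :: 'n::finite triple). norm (ddirs vs (Chi j) z) \<le> C * prod_list (map (\<lambda>v. wR v j z) vs)"
proof -
  have m: "dbd alld wR (\<lambda>j z. 1) (\<lambda>j (z::'n triple). (- 1) * Psi j z)"
    using dbd_mult[OF dbd_const1[where c="- 1", OF wR_nonneg] dbd_Psi[where 'n='n]] by simp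
  obtain C where C: "\<And>j (z::'n triple). norm (ddirs vs (Psi j) z) \<le> C * (1 * prod_list (map (\<lambda>v. wR v j z) vs))"
    using dbd_Psi[where 'n='n] vs unfolding dbd_def by blast
  obtain D where D: "\<And>j (z::'n triple). norm (ddirs vs (\<lambda>z. (- 1) * Psi j z) z) \<le> D * (1 * prod_list (map (\<lambda>v. wR v j z) vs))"
    using m vs unfolding dbd_def by blast
  have p0: "prod_list (map (\<lambda>v. wR v j z) us) \<ge> 0" for j and z :: "'n triple" and us :: "'n triple list"
    by (induction us) (auto simp: wR_nonneg)
  have half: "prod_list (map (\<lambda>v. wR v k z) us) \<le> 2 ^ length us * prod_list (map (\<lambda>v. wR v (Suc k) z) us)" for k and z :: "'n triple" and us :: "'n triple list"
  proof (induction us)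
    case (Cons v us)
    have "wR v k z \<le> 2 * wR v (Suc k) z" by (simp add: wR_def)
    then have "wR v k z * prod_list (map (\<lambda>v. wR v k z) us) \<le> (2 * wR v (Suc k) z) * (2 ^ length us * prod_list (map (\<lambda>v. wR v (Suc k) z) us))"
      by (rule mult_mono[OF _ Cons]) (simp_all add: wR_nonneg p0)
    then show ?case by (simp add: mult_ac)
  qed simp
  show ?thesis
  proof (intro exI[of _ "\<bar>C\<bar> + \<bar>D\<bar> * 2 ^ length vs"] conjI allI)
    fix j and z :: "'n triple"
    let ?p = "\<lambda>j. prod_list (map (\<lambda>v. wR v j z) vs)"
    have Cp: "norm (ddirs vs (Psi j) z) \<le> \<bar>C\<bar> * ?p j" for j
      using C[of j z] mult_right_mono[OF abs_ge_self[of C] p0[of j z vs]] by simp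
    have Dp: "norm (ddirs vs (\<lambda>z. (- 1) * Psi j z) z) \<le> \<bar>D\<bar> * ?p j" for j
      using D[of j z] mult_right_mono[OF abs_ge_self[of D] p0[of j z vs]] by simp
    show "norm (ddirs vs (Chi j) z) \<le> (\<bar>C\<bar> + \<bar>D\<bar> * 2 ^ length vs) * ?p j"
    proof (cases j)
      case 0
      have "Chi 0 = (Psi 0 :: 'n triple \<Rightarrow> complex)" by (simp add: Chi_def fun_eq_iff)
      then have "norm (ddirs vs (Chi j) z) \<le> \<bar>C\<bar> * ?p j" using Cp[of 0] 0 by simp
      also have "\<dots> \<le> (\<bar>C\<bar> + \<bar>D\<bar> * 2 ^ length vs) * ?p j" using p0[of j z vs] by (intro mult_right_mono) auto
      finally show ?thesis .
    next
      case (Suc k)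
      have e: "Chi j = (\<lambda>z::'n triple. Psi (Suc k) z + (- 1) * Psi k z)" by (simp add: Chi_def fun_eq_iff Suc)
      have "ddirs vs (Chi j) z = ddirs vs (Psi (Suc k)) z + ddirs vs (\<lambda>z. (- 1) * Psi k z) z"
        unfolding e using dbd_Psi[where 'n='n] m vs by (subst ddirs_add[of alld]) (auto simp: dbd_def)
      then have "norm (ddirs vs (Chi j) z) \<le> \<bar>C\<bar> * ?p j + \<bar>D\<bar> * ?p k"
        using norm_triangle_mono[OF Cp[of "Suc k"] Dp[of k]] Suc by simp
      also have "\<dots> \<le> \<bar>C\<bar> * ?p j + \<bar>D\<bar> * (2 ^ length vs * ?p j)"
        using half[of k z vs] Suc by (intro add_left_mono mult_left_mono) auto
      finally show ?thesis by (simp add: algebra_simps)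
    qed
  qed simp
qed

lemma smooth_Chi: "smooth_on_dirs alld (Chi j :: 'n::finite triple \<Rightarrow> complex)"
proof (cases j)
  case 0
  have "Chi 0 = (Psi 0 :: 'n triple \<Rightarrow> complex)" by (simp add: Chi_def fun_eq_iff)
  then show ?thesis using dbd_Psi[where 'n='n] 0 by (simp add: dbd_def)
next
  case (Suc k)
  have e: "Chi j = (\<lambda>z::'n triple. Psi (Suc k) z + (- 1) * Psi k z)" by (simp add: Chi_def fun_eq_iff Suc)
  show ?thesis unfolding e using dbd_Psi[where 'n='n]
    by (intro smooth_on_dirs_add smooth_on_dirs_mult smooth_on_dirs_const) (auto simp: dbd_def)
qed

section \<open>The symbol on a dyadic shell\<close>

definition jw :: "'n::finite triple \<Rightarrow> real" where "jw z = 1 + norm (fst (snd z)) + norm (snd (snd z))"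

lemma jw_ge_1: "jw z \<ge> 1" by (simp add: jw_def)

text \<open>\<open>jw\<close> is comparable to 2^j on the shell, with constants depending on the
  dimension alone, so its powers of either sign can be traded for powers of 2^j.\<close>

lemma jw_shell:
  fixes z :: "'n::finite triple"
  assumes "z \<in> shell j"
  shows "jw z \<le> (1 + 4 * real CARD('n)) * 2 ^ j" and "2 ^ j / 2 \<le> jw z"
proof -
  obtain x \<xi> \<eta> where z: "z = (x, \<xi>, \<eta>)" by (metis prod.exhaust)
  have n: "norm v \<le> real CARD('n) * (2 * 2 ^ j)" if "v \<in> fbox (2 * 2 ^ j)" for v :: "real^'n"
  proof -
    have "norm v \<le> (\<Sum>i\<in>UNIV. \<bar>v $ i\<bar>)" by (rule norm_le_l1_cart)
    also have "\<dots> \<le> (\<Sum>i\<in>(UNIV::'n set). 2 * 2 ^ j)" using that by (intro sum_mono) (auto simp: fbox_def)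
    finally show ?thesis by simp
  qed
  have "jw z \<le> 1 + 4 * real CARD('n) * 2 ^ j"
    using n[of \<xi>] n[of \<eta>] assms by (auto simp: jw_def z shell_def)
  also have "\<dots> \<le> (1 + 4 * real CARD('n)) * 2 ^ j" by (simp add: distrib_right)
  finally show "jw z \<le> (1 + 4 * real CARD('n)) * 2 ^ j" .
  show "2 ^ j / 2 \<le> jw z"
  proof (cases "j = 0")
    case False
    then obtain i where "2 ^ j / 2 \<le> \<bar>\<xi> $ i\<bar> \<or> 2 ^ j / 2 \<le> \<bar>\<eta> $ i\<bar>" using assms by (auto simp: shell_def z)
    moreover have "\<bar>\<xi> $ i\<bar> \<le> jw z" "\<bar>\<eta> $ i\<bar> \<le> jw z"
      using component_le_norm_cart[of \<xi> i] component_le_norm_cart[of \<eta> i] norm_ge_zero[of \<xi>] norm_ge_zero[of \<eta>]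
      unfolding jw_def z fst_conv snd_conv by linarith+
    ultimately show ?thesis by linarith
  qed (use jw_ge_1[of z] in simp)
qed

definition nz :: "'n::finite triple list \<Rightarrow> nat" where
  "nz vs = length (filter (\<lambda>v. v \<in> xi_dirs \<union> eta_dirs) vs)"

lemma x_z_disjoint: "v \<in> alld \<Longrightarrow> (v \<in> xi_dirs \<union> eta_dirs) = (v \<notin> x_dirs)"
  by (auto simp: alld_def x_dirs_def xi_dirs_def eta_dirs_def axis_eq_0_iff)

lemma prod_list_xz:
  fixes A B :: real
  assumes "set vs \<subseteq> alld"
  shows "prod_list (map (\<lambda>v. if v \<in> x_dirs then A else B) vs) = A ^ nx vs * B ^ nz vs"
  using assms
proof (induction vs)
  case (Cons v vs)
  then show ?case using x_z_disjoint[of v] by (auto simp: nx_def nz_def)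
qed (simp add: nx_def nz_def)

text \<open>The cutoff is placed in a weighted class with the same weights as the symbol and with
  size the indicator of the shell. One product estimate then covers a piece, and \<open>jw\<close>
  is traded for 2^j.\<close>

lemma symbol_piece_bound:
  fixes a :: "'n::finite triple \<Rightarrow> complex"
  assumes a: "bisymbol m \<rho> \<delta> a" and \<rho>: "0 < \<rho>" "\<rho> \<le> 1" and \<delta>: "0 < \<delta>" and vs: "set vs \<subseteq> alld"
  shows "\<exists>C\<ge>0. \<forall>j z. norm (ddirs vs (\<lambda>z. a z * Chi j z) z) \<le> C * (2 ^ j) powr (m - \<rho> * nz vs + \<delta> * nx vs)"
proof -
  define wa where "wa v (j::nat) z = (if v \<in> x_dirs then jw z powr \<delta> else jw z powr (- \<rho>))" for v z :: "'n triple" and j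
  have waprod: "prod_list (map (\<lambda>v. wa v j z) us) = jw z powr (\<delta> * nx us - \<rho> * nz us)" if "set us \<subseteq> alld" for us j z
  proof -
    have "prod_list (map (\<lambda>v. wa v j z) us) = (jw z powr \<delta>) ^ nx us * (jw z powr (- \<rho>)) ^ nz us"
      unfolding wa_def by (rule prod_list_xz[OF that])
    also have "\<dots> = jw z powr (\<delta> * nx us) * jw z powr (- \<rho> * nz us)"
      using jw_ge_1[of z] by (simp add: powr_powr flip: powr_realpow)
    finally show ?thesis by (simp flip: powr_add)
  qed
  have da: "dbd alld wa (\<lambda>j z. jw z powr m) (\<lambda>j. a)"
    unfolding dbd_def
  proof (intro conjI allI impI)
    show "smooth_on_dirs alld a" using a by (simp add: bisymbol_def alld_def)
    fix us :: "'n triple list" assume us: "set us \<subseteq> alld"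
    then obtain C where C: "\<And>x \<xi> \<eta>. norm (ddirs us a (x, \<xi>, \<eta>)) \<le> C * (1 + norm \<xi> + norm \<eta>) powr (m - \<rho> * real (nz us) + \<delta> * real (nx us))"
      using a unfolding bisymbol_def alld_def nz_def nx_def by blast
    show "\<exists>C. \<forall>(j::nat) z. norm (ddirs us a z) \<le> C * (jw z powr m * prod_list (map (\<lambda>v. wa v j z) us))"
    proof (intro exI[of _ C] allI)
      fix j z
      have "norm (ddirs us a z) \<le> C * jw z powr (m - \<rho> * real (nz us) + \<delta> * real (nx us))"
        using C[of "fst z" "fst (snd z)" "snd (snd z)"] by (simp add: jw_def)
      also have "m - \<rho> * real (nz us) + \<delta> * real (nx us) = m + (\<delta> * nx us - \<rho> * nz us)" by simp
      finally show "norm (ddirs us a z) \<le> C * (jw z powr m * prod_list (map (\<lambda>v. wa v j z) us))"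
        by (simp only: waprod[OF us] powr_add)
    qed
  qed
  define c0 where "c0 = 1 + 4 * real CARD('n)"
  have c0: "c0 \<ge> 2" using zero_less_card_finite[where 'a='n] unfolding c0_def by linarith
  have dc: "dbd alld wa (\<lambda>j z. indicator (shell j) z) Chi"
    unfolding dbd_def
  proof (intro conjI allI impI smooth_Chi)
    fix us :: "'n triple list" assume us: "set us \<subseteq> alld"
    obtain C where C: "C \<ge> 0" "\<And>j z. norm (ddirs us (Chi j) z) \<le> C * prod_list (map (\<lambda>v. wR v j z) us)"
      using Chi_bound[OF us] by blast
    show "\<exists>C. \<forall>j z. norm (ddirs us (Chi j) z) \<le> C * (indicator (shell j) z * prod_list (map (\<lambda>v. wa v j z) us))"
    proof (intro exI[of _ "C * c0 ^ length us"] allI)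
      fix j z
      show "norm (ddirs us (Chi j) z) \<le> C * c0 ^ length us * (indicator (shell j) z * prod_list (map (\<lambda>v. wa v j z) us))"
      proof (cases "z \<in> shell j")
        case True
        have w: "wR v j z \<le> c0 * wa v j z" for v
        proof (cases "v \<in> x_dirs")
          case v: True
          have "1 \<le> c0 * jw z powr \<delta>"
            using c0 ge_one_powr_ge_zero[OF jw_ge_1[of z], of \<delta>] \<delta> mult_mono[of 1 c0 1 "jw z powr \<delta>"] by simp
          then show ?thesis using v by (simp add: wR_def wa_def)
        next
          case v: False
          \<comment> \<open>Here \<rho> \<le> 1 enters: the gain 2^(-j) from a derivative of the
            cutoff is, up to \<open>c0\<close>, as good as the gain
            \<open>jw z powr (- \<rho>)\<close> from a derivative of the symbol.\<close>
          have "jw z powr \<rho> \<le> jw z powr 1" using jw_ge_1[of z] \<rho> by (intro powr_mono) auto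
          then have "jw z powr \<rho> \<le> c0 * 2 ^ j" using jw_shell(1)[OF True] jw_ge_1[of z] by (simp add: c0_def)
          then have "(1/2) ^ j * jw z powr \<rho> \<le> c0" by (simp add: power_one_over field_simps)
          then have "(1/2) ^ j \<le> c0 * jw z powr (- \<rho>)"
            using jw_ge_1[of z] by (simp add: powr_minus field_simps)
          then show ?thesis using v by (simp add: wR_def wa_def)
        qed
        have "prod_list (map (\<lambda>v. wR v j z) us) \<le> c0 ^ length us * prod_list (map (\<lambda>v. wa v j z) us)" for us
        proof (induction us)
          case (Cons v us)
          have p0: "prod_list (map (\<lambda>v. wR v j z) us) \<ge> 0" by (induction us) (auto simp: wR_nonneg)
          have wa0: "wa v j z \<ge> 0" by (simp add: wa_def)
          have "wR v j z * prod_list (map (\<lambda>v. wR v j z) us) \<le> (c0 * wa v j z) * (c0 ^ length us * prod_list (map (\<lambda>v. wa v j z) us))"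
            by (rule mult_mono[OF w Cons]) (use p0 wa0 c0 in simp_all)
          then show ?case by (simp add: mult_ac)
        qed simp
        from mult_left_mono[OF this C(1)] C(2)[of j z] show ?thesis using True by (simp add: mult.assoc) (meson order_trans)
      qed (simp add: ddirs_Chi_outside)
    qed
  qed
  have "dbd alld wa (\<lambda>j z. jw z powr m * indicator (shell j) z) (\<lambda>j z. a z * Chi j z)"
    by (rule dbd_mult[OF da dc])
  then obtain C where C: "\<And>j z. norm (ddirs vs (\<lambda>z. a z * Chi j z) z) \<le> C * (jw z powr m * indicator (shell j) z * prod_list (map (\<lambda>v. wa v j z) vs))"
    using vs unfolding dbd_def by blast
  define e where "e = m - \<rho> * nz vs + \<delta> * nx vs"
  show ?thesis
  proof (intro exI[of _ "\<bar>C\<bar> * c0 powr \<bar>e\<bar>"] conjI allI)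
    fix j z
    show "norm (ddirs vs (\<lambda>z. a z * Chi j z) z) \<le> \<bar>C\<bar> * c0 powr \<bar>e\<bar> * (2 ^ j) powr (m - \<rho> * nz vs + \<delta> * nx vs)"
    proof (cases "z \<in> shell j")
      case True
      have "norm (ddirs vs (\<lambda>z. a z * Chi j z) z) \<le> C * (jw z powr m * jw z powr (\<delta> * nx vs - \<rho> * nz vs))"
        using C[of j z] True by (simp add: waprod[OF vs])
      also have "jw z powr m * jw z powr (\<delta> * nx vs - \<rho> * nz vs) = jw z powr e"
        by (subst powr_add[symmetric]) (simp add: e_def algebra_simps)
      \<comment> \<open>The exponent may have either sign: the upper bound on \<open>jw\<close>
        serves e \<ge> 0, the lower one e < 0.\<close>
      also have "C * jw z powr e \<le> \<bar>C\<bar> * (c0 powr \<bar>e\<bar> * (2 ^ j) powr e)"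
      proof (intro mult_mono)
        show "jw z powr e \<le> c0 powr \<bar>e\<bar> * (2 ^ j) powr e"
        proof (cases "e \<ge> 0")
          case True
          then have "jw z powr e \<le> (c0 * 2 ^ j) powr e"
            using jw_shell(1)[OF \<open>z \<in> shell j\<close>] jw_ge_1[of z] unfolding c0_def by (intro powr_mono2) auto
          then show ?thesis using True by (simp add: powr_mult)
        next
          case False
          then have "jw z powr e \<le> (2 ^ j / 2) powr e"
            using jw_shell(2)[OF \<open>z \<in> shell j\<close>] by (intro powr_mono2') auto
          also have "\<dots> = 2 powr (- e) * (2 ^ j) powr e" by (simp add: powr_divide powr_minus field_simps)
          also have "\<dots> \<le> c0 powr \<bar>e\<bar> * (2 ^ j) powr e"
            using False c0 by (intro mult_right_mono) (auto intro!: powr_mono2)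
          finally show ?thesis .
        qed
      qed auto
      finally show ?thesis by (simp add: e_def mult.assoc)
    next
      case False
      then show ?thesis using C[of j z] by simp
    qed
  qed simp
qed

section \<open>Anisotropic dilation\<close>

text \<open>Space and frequencies are scaled inversely to each other, which preserves the pairing in
  the phase.\<close>

definition dil :: "real \<Rightarrow> 'n::finite triple \<Rightarrow> 'n triple" where
  "dil c z = (c *\<^sub>R fst z, (1 / c) *\<^sub>R fst (snd z), (1 / c) *\<^sub>R snd (snd z))"

lemma dil_bounded_linear: "bounded_linear (dil c)"
  unfolding dil_def[abs_def]
  by (intro bounded_linear_Pair bounded_linear_scaleR_right[THEN bounded_linear_compose] bounded_linear_fst bounded_linear_snd
      bounded_linear_compose[OF bounded_linear_fst] bounded_linear_compose[OF bounded_linear_snd])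

lemma dil_dirs: "v \<in> alld \<Longrightarrow> dil c v = (if v \<in> x_dirs then c else 1 / c) *\<^sub>R v"
  by (auto simp: dil_def alld_def x_dirs_def xi_dirs_def eta_dirs_def axis_eq_0_iff)

lemma finite_alld: "finite (alld :: 'n::finite triple set)"
  by (simp add: alld_def x_dirs_def xi_dirs_def eta_dirs_def full_SetCompr_eq)

text \<open>With c = 2^(-j\<rho>) the dilation charges 1/c for a frequency derivative, exactly what
  the symbol gains. An x-derivative leaves 2^(j(\<delta> - \<rho>)), which is at most L, and the box
  of half side 2 times 2^j shrinks to 2 times 2^(j(1 - \<rho>)).\<close>

lemma usym_pieces:
  fixes a :: "'n::finite triple \<Rightarrow> complex"
  assumes a: "bisymbol m \<rho> \<delta> a" and \<rho>: "0 < \<rho>" "\<rho> \<le> 1" and \<delta>: "0 < \<delta>"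
  shows "\<exists>C\<ge>0. \<forall>j. usym M (C * (2 ^ j) powr m) ((2 ^ j) powr (max (\<delta> - \<rho>) 0)) (2 * (2 ^ j) powr (1 - \<rho>))
    (\<lambda>z. a (dil ((2 ^ j) powr (- \<rho>)) z) * Chi j (dil ((2 ^ j) powr (- \<rho>)) z))"
proof -
  let ?V = "{vs :: 'n triple list. set vs \<subseteq> alld \<and> length vs \<le> CARD('n) + M}"
  have fin: "finite ?V" by (rule finite_lists_length_le[OF finite_alld])
  have "\<forall>vs\<in>?V. \<exists>C\<ge>0. \<forall>j z. norm (ddirs vs (\<lambda>z. a z * Chi j z) z) \<le> C * (2 ^ j) powr (m - \<rho> * nz vs + \<delta> * nx vs)"
    using symbol_piece_bound[OF a \<rho> \<delta>] by blast
  then have "\<exists>Cf. \<forall>vs\<in>?V. 0 \<le> Cf vs \<and> (\<forall>j z. norm (ddirs vs (\<lambda>z. a z * Chi j z) z) \<le> Cf vs * (2 ^ j) powr (m - \<rho> * nz vs + \<delta> * nx vs))"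
    by (rule bchoice)
  then obtain Cf where Cf': "\<forall>vs\<in>?V. 0 \<le> Cf vs \<and> (\<forall>j z. norm (ddirs vs (\<lambda>z. a z * Chi j z) z) \<le> Cf vs * (2 ^ j) powr (m - \<rho> * nz vs + \<delta> * nx vs))"
    by (elim exE)
  have Cf0: "\<And>vs. vs \<in> ?V \<Longrightarrow> Cf vs \<ge> 0" using Cf' by simp
  have Cf: "norm (ddirs vs (\<lambda>z. a z * Chi j z) z) \<le> Cf vs * (2 ^ j) powr (m - \<rho> * nz vs + \<delta> * nx vs)" if "vs \<in> ?V" for vs j z
    using bspec[OF Cf' that] by blast
  \<comment> \<open>One constant serves all derivatives, since only finitely many lists of bounded
    length over finitely many directions occur.\<close>
  define C where "C = (\<Sum>vs\<in>?V. Cf vs)"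
  have C0: "C \<ge> 0" unfolding C_def by (intro sum_nonneg Cf0)
  have CC: "Cf vs \<le> C" if "vs \<in> ?V" for vs unfolding C_def using Cf0 fin that by (intro member_le_sum) auto
  have sma: "smooth_on_dirs alld (\<lambda>z. a z * Chi j z)" for j
    using a by (intro smooth_on_dirs_mult smooth_Chi) (simp add: bisymbol_def alld_def)
  show ?thesis
  proof (intro exI[of _ C] conjI C0 allI)
    fix j
    define R where "R = (2::real) ^ j"
    have R: "R \<ge> 1" by (simp add: R_def)
    define c where "c = R powr (- \<rho>)"
    have c: "c > 0" using R by (simp add: c_def)
    have ic: "1 / c = R powr \<rho>" unfolding c_def powr_minus by (simp add: divide_inverse)
    have "usym M (C * R powr m) (R powr (max (\<delta> - \<rho>) 0)) (2 * R powr (1 - \<rho>)) (\<lambda>z. a (dil c z) * Chi j (dil c z))"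
      unfolding usym_def
    proof (intro conjI allI impI)
      show "smooth_on_dirs alld (\<lambda>z. a (dil c z) * Chi j (dil c z))"
        using smooth_on_dirs_linear_scale[OF sma[of j] dil_bounded_linear[of c] dil_dirs] by simp
    next
      fix vs :: "'n triple list" and z assume vs: "set vs \<subseteq> alld" "length vs \<le> CARD('n) + M"
      then have V: "vs \<in> ?V" by simp
      have "ddirs vs (\<lambda>z. a (dil c z) * Chi j (dil c z)) z
        = of_real (c ^ nx vs * (1 / c) ^ nz vs) * ddirs vs (\<lambda>z. a z * Chi j z) (dil c z)"
        using ddirs_linear_scale[OF sma[of j] bounded_linear.linear[OF dil_bounded_linear[of c]] dil_dirs vs(1)]
        unfolding prod_list_xz[OF vs(1)] by simp
      then have "norm (ddirs vs (\<lambda>z. a (dil c z) * Chi j (dil c z)) z)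
        = (c ^ nx vs * (1 / c) ^ nz vs) * norm (ddirs vs (\<lambda>z. a z * Chi j z) (dil c z))"
        using c by (simp add: norm_mult norm_power norm_divide)
      also have "\<dots> \<le> (c ^ nx vs * (1 / c) ^ nz vs) * (C * R powr (m - \<rho> * nz vs + \<delta> * nx vs))"
        unfolding R_def using c Cf[OF V, of j "dil c z"] CC[OF V] order_trans[OF Cf[OF V, of j "dil c z"] mult_right_mono[OF CC[OF V]]]
        by (intro mult_left_mono) auto
      also have "c ^ nx vs * (1 / c) ^ nz vs = R powr (\<rho> * nz vs - \<rho> * nx vs)"
      proof -
        have "c ^ nx vs * (1 / c) ^ nz vs = R powr (- \<rho> * nx vs) * R powr (\<rho> * nz vs)"
          unfolding ic unfolding c_def using R by (simp add: powr_powr flip: powr_realpow)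
        then show ?thesis by (simp flip: powr_add)
      qed
      also have "R powr (\<rho> * nz vs - \<rho> * nx vs) * (C * R powr (m - \<rho> * nz vs + \<delta> * nx vs)) = C * R powr (m + (\<delta> - \<rho>) * nx vs)"
        by (simp add: algebra_simps flip: powr_add)
      \<comment> \<open>The maximum with 0 keeps the price of an x-derivative at least 1, as the
        unit estimate requires of \<open>L\<close>.\<close>
      also have "\<dots> \<le> C * R powr (m + max (\<delta> - \<rho>) 0 * nx vs)"
        using R C0 by (intro mult_left_mono powr_mono add_left_mono mult_right_mono) auto
      also have "\<dots> = C * R powr m * (R powr (max (\<delta> - \<rho>) 0)) ^ nx vs"
        using R by (simp add: powr_add powr_powr flip: powr_realpow)
      finally show "norm (ddirs vs (\<lambda>z. a (dil c z) * Chi j (dil c z)) z) \<le> C * R powr m * (R powr (max (\<delta> - \<rho>) 0)) ^ nx vs" .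
    next
      fix x \<xi> \<eta> :: "real^'n" assume o: "\<xi> \<notin> fbox (2 * R powr (1 - \<rho>)) \<or> \<eta> \<notin> fbox (2 * R powr (1 - \<rho>))"
      have box: "v \<in> fbox (2 * R powr (1 - \<rho>))" if "(1 / c) *\<^sub>R v \<in> fbox (2 * 2 ^ j)" for v :: "real^'n"
        unfolding fbox_def
      proof (intro CollectI allI)
        fix i
        have "\<bar>(1 / c) * (v $ i)\<bar> \<le> 2 * R" using that by (auto simp: fbox_def R_def)
        then have "\<bar>v $ i\<bar> \<le> 2 * R * c" using c by (simp add: abs_mult divide_simps mult.commute)
        also have "2 * R * c = 2 * (R powr 1 * R powr (- \<rho>))" using R by (simp add: c_def)
        also have "R powr 1 * R powr (- \<rho>) = R powr (1 - \<rho>)" by (subst powr_add[symmetric]) simp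
        finally show "\<bar>v $ i\<bar> \<le> 2 * R powr (1 - \<rho>)" .
      qed
      have "dil c (x, \<xi>, \<eta>) \<notin> shell j"
        using o box by (auto simp: dil_def shell_def)
      then have "Chi j (dil c (x, \<xi>, \<eta>)) = 0" using ddirs_Chi_outside[of _ j "[]"] by simp
      then show "a (dil c (x, \<xi>, \<eta>)) * Chi j (dil c (x, \<xi>, \<eta>)) = 0" by simp
    qed
    then show "usym M (C * (2 ^ j) powr m) ((2 ^ j) powr (max (\<delta> - \<rho>) 0)) (2 * (2 ^ j) powr (1 - \<rho>))
      (\<lambda>z. a (dil ((2 ^ j) powr (- \<rho>)) z) * Chi j (dil ((2 ^ j) powr (- \<rho>)) z))"
      by (simp only: c_def R_def)
  qed
qed

section \<open>Scaling of integrals, of the operator and of Lebesgue norms\<close>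

lemma lborel_scale:
  assumes "c > 0"
  shows "lborel = density (distr lborel borel (\<lambda>x::real^'n::finite. c *\<^sub>R x)) (\<lambda>_. ennreal (c ^ CARD('n)))"
  using lborel_affine[of c "0 :: real^'n"] assms by simp

lemma nn_integral_scale:
  fixes F :: "real^'n::finite \<Rightarrow> ennreal"
  assumes [measurable]: "F \<in> borel_measurable borel" and c: "c > 0"
  shows "(\<integral>\<^sup>+x. F x \<partial>lborel) = ennreal (c ^ CARD('n)) * (\<integral>\<^sup>+x. F (c *\<^sub>R x) \<partial>lborel)"
  by (subst lborel_scale[OF c]) (simp add: nn_integral_density nn_integral_distr nn_integral_cmult)

lemma integral_scale:
  fixes F :: "real^'n::finite \<Rightarrow> complex"
  assumes [measurable]: "F \<in> borel_measurable borel" and c: "c > 0"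
  shows "(LINT x|lborel. F x) = of_real (c ^ CARD('n)) * (LINT x|lborel. F (c *\<^sub>R x))"
proof -
  have "(LINT x|lborel. F x) = (LINT x|density (distr lborel borel (\<lambda>x::real^'n. c *\<^sub>R x)) (\<lambda>_. ennreal (c ^ CARD('n))). F x)"
    by (subst lborel_scale[OF c]) simp
  also have "\<dots> = (LINT x|distr lborel borel (\<lambda>x::real^'n. c *\<^sub>R x). (c ^ CARD('n)) *\<^sub>R F x)"
    using c by (intro integral_density) auto
  also have "\<dots> = of_real (c ^ CARD('n)) * (LINT x|lborel. F (c *\<^sub>R x))"
    by (subst integral_distr) (auto simp: scaleR_conv_of_real)
  finally show ?thesis .
qed

lemma AE_scale:
  fixes P :: "real^'n::finite \<Rightarrow> bool"
  assumes [measurable]: "Measurable.pred borel P" and c: "c > 0"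
  shows "(AE x in lborel. P x) \<longleftrightarrow> (AE x in lborel. P (c *\<^sub>R x))"
  using c by (subst lborel_scale[OF c]) (simp add: AE_density AE_distr_iff)

lemma fourier_scale:
  fixes f :: "real^'n::finite \<Rightarrow> complex"
  assumes [measurable]: "f \<in> borel_measurable borel" and c: "c > 0"
  shows "of_real (c ^ CARD('n)) * fourier (\<lambda>y. f (c *\<^sub>R y)) \<xi> = fourier f ((1 / c) *\<^sub>R \<xi>)"
  unfolding fourier_def using c
  by (subst (2) integral_scale[OF _ c]) auto

text \<open>Substituting in each frequency integral gives a factor c^n, which cancels the c^(-n) in
  the transform of the dilated function; the phase is unchanged.\<close>

lemma bipsido_scale:
  fixes b :: "'n::finite triple \<Rightarrow> complex"
  assumes sm: "smooth_on_dirs alld b" and f[measurable]: "f \<in> borel_measurable borel" and g[measurable]: "g \<in> borel_measurable borel" and c: "c > 0"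
  shows "bipsido (\<lambda>z. b (dil c z)) (\<lambda>y. f (c *\<^sub>R y)) (\<lambda>y. g (c *\<^sub>R y)) x = bipsido b f g (c *\<^sub>R x)"
proof -
  note [measurable] = sm
  define k where "k = complex_of_real (c ^ CARD('n))"
  have k: "k \<noteq> 0" using c by (simp add: k_def)
  have ff: "fourier (\<lambda>y. f (c *\<^sub>R y)) \<xi> = fourier f ((1 / c) *\<^sub>R \<xi>) / k" for \<xi>
    using fourier_scale[OF f c, of \<xi>] k by (simp add: k_def field_simps)
  have fg: "fourier (\<lambda>y. g (c *\<^sub>R y)) \<xi> = fourier g ((1 / c) *\<^sub>R \<xi>) / k" for \<xi>
    using fourier_scale[OF g c, of \<xi>] k by (simp add: k_def field_simps)
  have ck: "of_real (c ^ CARD('n)) = k" by (simp add: k_def)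
  have cc: "(1 / c) *\<^sub>R c *\<^sub>R v = v" "c *\<^sub>R (1 / c) *\<^sub>R v = v" for v :: "real^'n" using c by auto
  have sc: "(LINT \<xi>|lborel. F ((1 / c) *\<^sub>R \<xi>)) = k * (LINT \<xi>|lborel. F \<xi>)"
    if [measurable]: "F \<in> borel_measurable borel" for F :: "real^'n \<Rightarrow> complex"
  proof -
    have "(\<lambda>\<xi>. F ((1 / c) *\<^sub>R \<xi>)) \<in> borel_measurable borel" by measurable
    from integral_scale[OF this c] show ?thesis unfolding ck cc .
  qed
  let ?x = "c *\<^sub>R x"
  have i: "x \<bullet> v = ?x \<bullet> ((1 / c) *\<^sub>R v)" for v using c by simp
  have j: "(LINT \<eta>|lborel. b (dil c (x, \<xi>, \<eta>)) * fourier (\<lambda>y. g (c *\<^sub>R y)) \<eta> * cis (x \<bullet> \<eta>)) = jint b g ?x ((1 / c) *\<^sub>R \<xi>)" for \<xi>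
  proof -
    have "(LINT \<eta>|lborel. b (dil c (x, \<xi>, \<eta>)) * fourier (\<lambda>y. g (c *\<^sub>R y)) \<eta> * cis (x \<bullet> \<eta>))
      = (LINT \<eta>|lborel. (\<lambda>\<eta>. (1 / k) * (b (?x, (1 / c) *\<^sub>R \<xi>, \<eta>) * fourier g \<eta> * cis (?x \<bullet> \<eta>))) ((1 / c) *\<^sub>R \<eta>))"
      unfolding fg by (intro Bochner_Integration.integral_cong refl) (simp only: dil_def fst_conv snd_conv i, simp)
    also have "\<dots> = k * (LINT \<eta>|lborel. (1 / k) * (b (?x, (1 / c) *\<^sub>R \<xi>, \<eta>) * fourier g \<eta> * cis (?x \<bullet> \<eta>)))"
      by (rule sc) measurable
    also have "\<dots> = jint b g ?x ((1 / c) *\<^sub>R \<xi>)" unfolding Bochner_Integration.integral_mult_right_zero using k by simp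
    finally show ?thesis .
  qed
  have "bipsido (\<lambda>z. b (dil c z)) (\<lambda>y. f (c *\<^sub>R y)) (\<lambda>y. g (c *\<^sub>R y)) x
    = (LINT \<xi>|lborel. (\<lambda>\<xi>. (1 / k) * (fourier f \<xi> * cis (?x \<bullet> \<xi>) * jint b g ?x \<xi>)) ((1 / c) *\<^sub>R \<xi>))"
    unfolding bipsido_eq j ff by (intro Bochner_Integration.integral_cong refl) (simp only: i, simp)
  also have "\<dots> = k * (LINT \<xi>|lborel. (1 / k) * (fourier f \<xi> * cis (?x \<bullet> \<xi>) * jint b g ?x \<xi>))"
    by (rule sc) measurable
  also have "\<dots> = bipsido b f g ?x" unfolding bipsido_eq Bochner_Integration.integral_mult_right_zero using k by simp
  finally show ?thesis .
qed

lemma Lnorm_scale: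
  fixes f :: "real^'n::finite \<Rightarrow> complex"
  assumes [measurable]: "f \<in> borel_measurable borel" and c: "c > 0" and q: "1 \<le> q" and X: "Lnorm q f = ennreal X" "X \<ge> 0"
  shows "Lnorm q (\<lambda>y. f (c *\<^sub>R y)) = ennreal (c powr (- CARD('n) * recip q) * X)"
proof (cases "q = \<infinity>")
  case True
  have "esssup lborel (\<lambda>x. ennreal (norm (f (c *\<^sub>R x)))) = esssup lborel (\<lambda>x. ennreal (norm (f x)))"
    by (subst (1 2) esssup_eq_AE) (use AE_scale[OF _ c, of "\<lambda>x. ennreal (norm (f x)) \<le> z" for z] in auto)
  then show ?thesis using True X c by (simp add: Lnorm_def recip_def)
next
  case False
  then obtain s where s: "q = ereal s" "s \<ge> 1" using q by (cases q) auto
  define I where "I = (\<integral>\<^sup>+x. ennreal (norm (f x) powr s) \<partial>lborel)"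
  define J where "J = (\<integral>\<^sup>+x. ennreal (norm (f (c *\<^sub>R x)) powr s) \<partial>lborel)"
  have IJ: "I = ennreal (c ^ CARD('n)) * J" unfolding I_def J_def
    by (rule nn_integral_scale[OF _ c]) measurable
  have I: "I \<noteq> \<infinity>" and X': "X = enn2real I powr (1 / s)"
    using X s by (auto simp: Lnorm_def I_def Let_def split: if_splits)
  have J: "J \<noteq> \<infinity>" using IJ I c by (auto simp: ennreal_mult_eq_top_iff)
  have e: "enn2real I = c ^ CARD('n) * enn2real J" using c by (simp add: IJ enn2real_mult)
  have "enn2real J = c powr (- real CARD('n)) * enn2real I"
    using c by (simp add: e powr_minus powr_realpow)
  then have "enn2real J powr (1 / s) = c powr (- CARD('n) * recip q) * X"
    using s by (simp add: X' powr_mult powr_powr recip_def)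
  then show ?thesis using J s False by (simp add: Lnorm_def Let_def flip: J_def)
qed

section \<open>Schwartz functions\<close>

text \<open>An integrable majorant in product form. Its integral factorises, and its reciprocal is
  the Fourier multiplier of the product of the operators 1 - d_i^2 over all coordinates.\<close>

definition decay :: "real^'n::finite \<Rightarrow> real" where
  "decay x = (\<Prod>i\<in>UNIV. 1 / (1 + (x $ i)\<^sup>2))"

lemma decay_nonneg [simp]: "0 \<le> decay x"
  unfolding decay_def by (intro prod_nonneg) simp

lemma decay_le_1: "decay x \<le> 1"
  unfolding decay_def by (intro prod_le_1) (auto simp: field_simps add_pos_nonneg)

lemma measurable_decay [measurable]: "decay \<in> borel_measurable (borel :: (real^'n::finite) measure)"
  unfolding decay_def[abs_def] by measurable

lemma integrable_decay: "integrable lborel (decay :: real^'n::finite \<Rightarrow> real)"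
proof (rule integrableI_nonneg)
  have 1: "integrable lborel (\<lambda>t::real. 1 / (1 + t\<^sup>2))"
    using integrable_inverse_1_plus_square by (simp add: set_integrable_def inverse_eq_divide)
  have "(\<integral>\<^sup>+x. ennreal (decay x) \<partial>(lborel :: (real^'n) measure)) = (\<integral>\<^sup>+x. (\<Prod>i\<in>UNIV. ennreal (1 / (1 + (x $ i)\<^sup>2))) \<partial>(lborel :: (real^'n) measure))"
    by (simp add: decay_def prod_ennreal)
  also have "\<dots> = (\<Prod>i\<in>(UNIV::'n set). (\<integral>\<^sup>+t. ennreal (1 / (1 + t\<^sup>2)) \<partial>lborel))"
    by (rule nn_integral_prod_vec) measurable
  also have "\<dots> = ennreal ((LINT t|lborel. 1 / (1 + t\<^sup>2)) ^ CARD('n))"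
    by (subst nn_integral_eq_integral[OF 1]) (auto simp: ennreal_power)
  finally show "(\<integral>\<^sup>+x. ennreal (decay x) \<partial>(lborel :: (real^'n) measure)) < \<infinity>" by simp
qed auto

text \<open>The 3 comes from 1 + a^2 \<le> 3 (1 + (a + t)^2) for |t| \<le> 1, by completing the
  square 2 a + 3 t. Unit shifts have to be dominated when integrating by parts.\<close>

lemma decay_shift:
  assumes "\<bar>t\<bar> \<le> 1"
  shows "decay (x + t *\<^sub>R axis i 1) \<le> 3 * decay x"
proof -
  let ?y = "x + t *\<^sub>R axis i (1::real)"
  have yi: "?y $ i = x $ i + t" by (simp add: axis_def)
  have d: "decay z = 1 / (1 + (z $ i)\<^sup>2) * (\<Prod>j\<in>UNIV - {i}. 1 / (1 + (z $ j)\<^sup>2))" for z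
    unfolding decay_def by (rule prod.remove) auto
  have eq: "(\<Prod>j\<in>UNIV - {i}. 1 / (1 + (?y $ j)\<^sup>2)) = (\<Prod>j\<in>UNIV - {i}. 1 / (1 + (x $ j)\<^sup>2))"
    by (rule prod.cong) (auto simp: axis_def)
  have "t\<^sup>2 \<le> 1" using assms by (simp add: abs_square_le_1)
  then have "1 + (x $ i)\<^sup>2 \<le> 3 * (1 + (x $ i + t)\<^sup>2)"
    using zero_le_power2[of "2 * (x $ i) + 3 * t"] by (simp add: power2_eq_square algebra_simps)
  then have "1 / (1 + (x $ i + t)\<^sup>2) \<le> 3 * (1 / (1 + (x $ i)\<^sup>2))"
    by (simp add: field_simps add_pos_nonneg)
  then have "1 / (1 + (x $ i + t)\<^sup>2) * (\<Prod>j\<in>UNIV - {i}. 1 / (1 + (x $ j)\<^sup>2))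
      \<le> 3 * (1 / (1 + (x $ i)\<^sup>2)) * (\<Prod>j\<in>UNIV - {i}. 1 / (1 + (x $ j)\<^sup>2))"
    by (rule mult_right_mono) (intro prod_nonneg, simp)
  then show ?thesis unfolding d[of ?y] d[of x] eq yi by (simp only: mult.assoc)
qed

lemma decay_lower: "1 \<le> (1 + norm x) ^ (2 * CARD('n)) * decay (x :: real^'n::finite)"
proof -
  have pos: "(\<Prod>i\<in>UNIV. 1 + (x $ i)\<^sup>2) > 0" by (intro prod_pos) (simp add: add_pos_nonneg)
  have "(\<Prod>i\<in>UNIV. 1 + (x $ i)\<^sup>2) \<le> (\<Prod>i\<in>(UNIV::'n set). (1 + norm x)\<^sup>2)"
  proof (rule prod_mono)
    fix i
    have "\<bar>x $ i\<bar>\<^sup>2 \<le> (norm x)\<^sup>2" by (intro power_mono component_le_norm_cart) simp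
    also have "\<dots> \<le> (1 + norm x)\<^sup>2 - 1" by (simp add: power2_eq_square algebra_simps)
    finally show "0 \<le> 1 + (x $ i)\<^sup>2 \<and> 1 + (x $ i)\<^sup>2 \<le> (1 + norm x)\<^sup>2" by simp
  qed
  also have "\<dots> = (1 + norm x) ^ (2 * CARD('n))" by (simp add: power_mult)
  finally show ?thesis using pos by (simp add: decay_def prod_dividef field_simps)
qed

lemma schwartz_decay:
  fixes f :: "real^'n::finite \<Rightarrow> complex"
  assumes "schwartz f" "set vs \<subseteq> coord_dirs"
  shows "\<exists>C\<ge>0. \<forall>x. norm (ddirs vs f x) \<le> C * decay x"
proof -
  obtain C where C: "\<And>x. (1 + norm x) ^ (2 * CARD('n)) * norm (ddirs vs f x) \<le> C"
    using assms unfolding schwartz_def by blast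
  have "C \<ge> 0" using order_trans[OF _ C[of 0]] by simp
  moreover have "norm (ddirs vs f x) \<le> C * decay x" for x
  proof -
    have "norm (ddirs vs f x) * 1 \<le> norm (ddirs vs f x) * ((1 + norm x) ^ (2 * CARD('n)) * decay x)"
      by (intro mult_left_mono decay_lower) simp
    also have "\<dots> = ((1 + norm x) ^ (2 * CARD('n)) * norm (ddirs vs f x)) * decay x" by (simp add: mult_ac)
    also have "\<dots> \<le> C * decay x" by (intro mult_right_mono C) simp
    finally show ?thesis by simp
  qed
  ultimately show ?thesis by blast
qed

lemma schwartz_measurable: "schwartz f \<Longrightarrow> f \<in> borel_measurable borel"
  by (auto simp: schwartz_def intro!: borel_measurable_continuous_onI smooth_on_dirs_continuous)

lemma integrable_le_decay:
  fixes f :: "real^'n::finite \<Rightarrow> complex"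
  assumes "f \<in> borel_measurable borel" "\<And>x. norm (f x) \<le> C * decay x"
  shows "integrable lborel f"
proof (rule Bochner_Integration.integrable_bound)
  show "integrable lborel (\<lambda>x::real^'n. C * decay x)" by (simp add: integrable_decay)
qed (use assms in \<open>auto intro!: AE_I2 intro: order_trans[OF _ abs_ge_self]\<close>)

lemma schwartz_integrable:
  assumes "schwartz f"
  shows "integrable lborel f"
  using schwartz_decay[OF assms, of "[]"] integrable_le_decay[OF schwartz_measurable[OF assms]] by auto

lemma schwartz_Lnorm:
  fixes f :: "real^'n::finite \<Rightarrow> complex"
  assumes f: "schwartz f" and q: "1 \<le> q"
  shows "\<exists>X\<ge>0. Lnorm q f = ennreal X"
proof -
  note [measurable] = schwartz_measurable[OF f]
  obtain C where C: "C \<ge> 0" "\<And>x. norm (f x) \<le> C * decay x"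
    using schwartz_decay[OF f, of "[]"] by auto
  show ?thesis
  proof (cases "q = \<infinity>")
    case True
    have "norm (f x) \<le> C" for x
      using C(2)[of x] mult_left_mono[OF decay_le_1 C(1), of x] by simp
    then have "esssup lborel (\<lambda>x. ennreal (norm (f x))) \<le> ennreal C"
      by (intro esssup_I AE_I2) (auto intro: ennreal_leI)
    then have "Lnorm q f \<le> ennreal C" using True by (simp add: Lnorm_def)
    then show ?thesis by (cases "Lnorm q f") (auto simp: top_unique)
  next
    case False
    define p where "p = real_of_ereal q"
    have p: "p \<ge> 1" using q False unfolding p_def by (cases q) auto
    have "norm (f x) powr p \<le> C powr p * decay x" for x
    proof -
      have "norm (f x) powr p \<le> (C * decay x) powr p" using p by (intro powr_mono2 C) auto
      also have "\<dots> = C powr p * decay x powr p" using C(1) by (simp add: powr_mult)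
      also have "\<dots> \<le> C powr p * decay x powr 1"
        using p decay_le_1[of x] by (intro mult_left_mono powr_mono') auto
      finally show ?thesis by (simp add: powr_one)
    qed
    then have "(\<integral>\<^sup>+x. ennreal (norm (f x) powr p) \<partial>lborel) \<le> (\<integral>\<^sup>+x. ennreal (C powr p * decay x) \<partial>(lborel :: (real^'n) measure))"
      by (auto intro!: nn_integral_mono ennreal_leI)
    also have "\<dots> = ennreal (LINT x|(lborel :: (real^'n) measure). C powr p * decay x)"
      by (intro nn_integral_eq_integral) (auto simp: integrable_decay)
    also have "\<dots> < \<infinity>" by simp
    finally show ?thesis using False
      by (auto simp: Lnorm_def Let_def p_def[symmetric] intro!: exI[of _ "enn2real _ powr _"])
  qed
qed

lemma schwartz_ddir:
  assumes f: "schwartz f" and v: "v \<in> coord_dirs"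
  shows "schwartz (ddir v f)"
  unfolding schwartz_def
proof (intro conjI allI impI)
  show "smooth_on_dirs coord_dirs (ddir v f)" using f v by (auto simp: schwartz_def intro: smooth_on_dirs_ddir)
  show "\<exists>C. \<forall>x. (1 + norm x) ^ N * norm (ddirs vs (ddir v f) x) \<le> C" if "set vs \<subseteq> coord_dirs" for vs N
  proof -
    have "set (vs @ [v]) \<subseteq> coord_dirs" using that v by simp
    then show ?thesis using f unfolding schwartz_def ddirs_snoc[symmetric] by blast
  qed
qed

lemma schwartz_lincomb:
  assumes f: "schwartz f" and g: "schwartz g"
  shows "schwartz (\<lambda>y. f y + c * g y)"
proof -
  have sf: "smooth_on_dirs coord_dirs f" and sg: "smooth_on_dirs coord_dirs g" using f g by (auto simp: schwartz_def)
  have scg: "smooth_on_dirs coord_dirs (\<lambda>y. c * g y)" using sg by (intro smooth_on_dirs_mult smooth_on_dirs_const)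
  have dcg: "ddirs vs (\<lambda>y. c * g y) = (\<lambda>y. c * ddirs vs g y)" if "set vs \<subseteq> coord_dirs" for vs
    using that
  proof (induction vs)
    case (Cons v vs)
    have "(\<lambda>t::real. ddirs vs g (x + t *\<^sub>R v)) differentiable (at 0)" for x
      using Cons.prems sg by (intro smooth_on_dirs_differentiable[of coord_dirs] smooth_on_dirs_ddirs) auto
    then show ?case using Cons by (intro ext) (simp add: ddir_mult)
  qed simp
  show ?thesis unfolding schwartz_def
  proof (intro conjI allI impI)
    show "smooth_on_dirs coord_dirs (\<lambda>y. f y + c * g y)" by (rule smooth_on_dirs_add[OF sf scg])
    show "\<exists>C. \<forall>x. (1 + norm x) ^ N * norm (ddirs vs (\<lambda>y. f y + c * g y) x) \<le> C" if vs: "set vs \<subseteq> coord_dirs" for vs N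
    proof -
      have "\<exists>C. \<forall>x. (1 + norm x) ^ N * norm (ddirs vs f x) \<le> C" "\<exists>C. \<forall>x. (1 + norm x) ^ N * norm (ddirs vs g x) \<le> C"
        using f g vs unfolding schwartz_def by auto
      then obtain C D where C: "\<And>x. (1 + norm x) ^ N * norm (ddirs vs f x) \<le> C" and D: "\<And>x. (1 + norm x) ^ N * norm (ddirs vs g x) \<le> D"
        by (elim exE) auto
      have "(1 + norm x) ^ N * norm (ddirs vs (\<lambda>y. f y + c * g y) x) \<le> C + norm c * D" for x
      proof -
        have "ddirs vs (\<lambda>y. f y + c * g y) x = ddirs vs f x + c * ddirs vs g x"
          by (simp add: ddirs_add[OF sf scg vs] dcg[OF vs])
        also have "norm \<dots> \<le> norm (ddirs vs f x) + norm c * norm (ddirs vs g x)"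
          by (rule order_trans[OF norm_triangle_ineq]) (simp add: norm_mult)
        finally have "(1 + norm x) ^ N * norm (ddirs vs (\<lambda>y. f y + c * g y) x) \<le> (1 + norm x) ^ N * (norm (ddirs vs f x) + norm c * norm (ddirs vs g x))"
          by (intro mult_left_mono) auto
        also have "\<dots> = (1 + norm x) ^ N * norm (ddirs vs f x) + norm c * ((1 + norm x) ^ N * norm (ddirs vs g x))" by (simp add: algebra_simps)
        also have "\<dots> \<le> C + norm c * D" by (intro add_mono mult_left_mono C D) auto
        finally show ?thesis .
      qed
      then show ?thesis by blast
    qed
  qed
qed

lemma fourier_ddir:
  fixes f :: "real^'n::finite \<Rightarrow> complex"
  assumes f: "schwartz f"
  shows "fourier (ddir (axis i 1) f) \<xi> = \<i> * of_real (\<xi> $ i) * fourier f \<xi>"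
proof -
  let ?v = "axis i 1 :: real^'n"
  have v: "?v \<in> coord_dirs" by (auto simp: coord_dirs_def)
  have sf: "smooth_on_dirs coord_dirs f" using f by (simp add: schwartz_def)
  have df: "schwartz (ddir ?v f)" by (rule schwartz_ddir[OF f v])
  note [measurable] = schwartz_measurable[OF f] schwartz_measurable[OF df]
  obtain C0 where C0: "C0 \<ge> 0" "\<And>x. norm (f x) \<le> C0 * decay x" using schwartz_decay[OF f, of "[]"] by auto
  obtain C1 where C1: "C1 \<ge> 0" "\<And>x. norm (ddir ?v f x) \<le> C1 * decay x" using schwartz_decay[OF df, of "[]"] by auto
  have fe: "fourier u \<xi> = (LINT y|lborel. u y * cis ((- \<xi>) \<bullet> y))" for u by (simp add: fourier_def inner_commute)
  have i0: "integrable lborel (\<lambda>y. f y * cis ((- \<xi>) \<bullet> y))" by (intro integrable_mult_cis schwartz_integrable f) measurable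
  have i1: "integrable lborel (\<lambda>y. ddir ?v f y * cis ((- \<xi>) \<bullet> y))" by (intro integrable_mult_cis schwartz_integrable df) measurable
  let ?H' = "\<lambda>y. ddir ?v f y * cis ((- \<xi>) \<bullet> y) - \<i> * of_real (\<xi> $ i) * (f y * cis ((- \<xi>) \<bullet> y))"
  have b: "norm (?H' y) \<le> (C1 + \<bar>\<xi> $ i\<bar> * C0) * decay y" for y
  proof -
    have "norm (?H' y) \<le> norm (ddir ?v f y) + \<bar>\<xi> $ i\<bar> * norm (f y)"
      by (rule order_trans[OF norm_triangle_ineq4]) (simp add: norm_mult)
    also have "\<dots> \<le> C1 * decay y + \<bar>\<xi> $ i\<bar> * (C0 * decay y)" by (intro add_mono mult_left_mono C0 C1) auto
    finally show ?thesis by (simp add: algebra_simps)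
  qed
  have "(LINT y|lborel. ?H' y) = 0"
  proof (rule integral_ddir_eq_0[where v="?v" and H="\<lambda>y. f y * cis ((- \<xi>) \<bullet> y)"])
    show "integrable lborel (\<lambda>y. f y * cis ((- \<xi>) \<bullet> y))" by (rule i0)
    show "((\<lambda>t. f (y + t *\<^sub>R ?v) * cis ((- \<xi>) \<bullet> (y + t *\<^sub>R ?v))) has_vector_derivative ?H' y) (at 0)" for y
      using has_vector_derivative_mult[OF has_vector_derivative_ddir[OF smooth_on_dirs_differentiable[OF sf v]] cis_deriv[of "- \<xi>" y i], of y]
      by (simp add: algebra_simps)
    show "norm (?H' (y + t *\<^sub>R ?v)) \<le> (C1 + \<bar>\<xi> $ i\<bar> * C0) * (3 * decay y)" if "\<bar>t\<bar> \<le> 1" for y t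
      by (rule order_trans[OF b]) (intro mult_left_mono decay_shift that, use C0 C1 in auto)
    show "integrable lborel (\<lambda>y::real^'n. (C1 + \<bar>\<xi> $ i\<bar> * C0) * (3 * decay y))" by (simp add: integrable_decay)
  qed measurable
  moreover have "(LINT y|lborel. ?H' y) = fourier (ddir ?v f) \<xi> - \<i> * of_real (\<xi> $ i) * fourier f \<xi>"
    unfolding fe using i0 i1 by simp
  ultimately show ?thesis by simp
qed

text \<open>Applying 1 - d_i^2 once for each coordinate yields a Schwartz function whose transform
  is that of f divided by \<open>decay\<close>. Being the transform of an integrable function it is
  bounded, so that of f is dominated by a multiple of \<open>decay\<close>.\<close>

lemma schwartz_fourier_integrable:
  fixes f :: "real^'n::finite \<Rightarrow> complex"
  assumes f: "schwartz f"
  shows "integrable lborel (fourier f)"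
proof -
  have "\<exists>h. schwartz h \<and> (\<forall>\<xi>. fourier h \<xi> = of_real (\<Prod>i\<in>S. 1 + (\<xi> $ i)\<^sup>2) * fourier f \<xi>)" for S :: "'n set"
  proof (induction S rule: infinite_finite_induct)
    case (insert i S)
    then obtain h where h: "schwartz h" "\<And>\<xi>. fourier h \<xi> = of_real (\<Prod>i\<in>S. 1 + (\<xi> $ i)\<^sup>2) * fourier f \<xi>" by blast
    let ?v = "axis i 1 :: real^'n"
    have v: "?v \<in> coord_dirs" by (auto simp: coord_dirs_def)
    have d1: "schwartz (ddir ?v h)" by (rule schwartz_ddir[OF h(1) v])
    have d2: "schwartz (ddir ?v (ddir ?v h))" by (rule schwartz_ddir[OF d1 v])
    have "fourier (\<lambda>y. h y + (- 1) * ddir ?v (ddir ?v h) y) \<xi> = of_real (\<Prod>i\<in>insert i S. 1 + (\<xi> $ i)\<^sup>2) * fourier f \<xi>" for \<xi>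
    proof -
      have "fourier (\<lambda>y. h y + (- 1) * ddir ?v (ddir ?v h) y) \<xi> = fourier h \<xi> + (- 1) * (\<i> * of_real (\<xi> $ i) * (\<i> * of_real (\<xi> $ i) * fourier h \<xi>))"
        by (simp only: fourier_lincomb[OF schwartz_integrable[OF h(1)] schwartz_integrable[OF d2]] fourier_ddir[OF d1] fourier_ddir[OF h(1)])
      also have "\<dots> = of_real (1 + (\<xi> $ i)\<^sup>2) * fourier h \<xi>"
        by (simp add: power2_eq_square algebra_simps complex_eq_iff)
      finally show ?thesis using insert.hyps h(2)[of \<xi>] by simp
    qed
    then show ?case using schwartz_lincomb[OF h(1) d2] by blast
  qed (auto intro!: exI[of _ f] f)
  then obtain h where h: "schwartz h" "\<And>\<xi>. fourier h \<xi> = of_real (\<Prod>i\<in>UNIV. 1 + (\<xi> $ i)\<^sup>2) * fourier f \<xi>" by blast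
  define W where "W = (LINT x|lborel. norm (h x))"
  have bd: "norm (fourier f \<xi>) \<le> W * decay \<xi>" for \<xi>
  proof -
    define p where "p = (\<Prod>i\<in>UNIV. 1 + (\<xi> $ i)\<^sup>2)"
    have pos: "p > 0" unfolding p_def by (intro prod_pos) (simp add: add_pos_nonneg)
    have "norm (fourier h \<xi>) = p * norm (fourier f \<xi>)"
      using pos unfolding h(2) p_def[symmetric] by (simp only: norm_mult norm_of_real abs_of_pos)
    moreover have "decay \<xi> = 1 / p" by (simp add: decay_def prod_dividef p_def)
    ultimately have "norm (fourier f \<xi>) = norm (fourier h \<xi>) * decay \<xi>" using pos by (simp add: field_simps)
    also have "\<dots> \<le> W * decay \<xi>" unfolding W_def by (intro mult_right_mono norm_fourier_le schwartz_integrable h) simp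
    finally show ?thesis .
  qed
  note [measurable] = schwartz_measurable[OF f]
  show ?thesis by (rule integrable_le_decay[OF _ bd]) measurable
qed

section \<open>Absolute convergence for bounded symbols\<close>

lemma integrable_symbol_slice:
  assumes [measurable]: "smooth_on_dirs alld b" and b: "\<And>z. norm (b z) \<le> B"
    and f: "f \<in> borel_measurable borel" and g: "g \<in> borel_measurable borel" and G: "integrable lborel (fourier g)"
  shows "integrable lborel (\<lambda>\<eta>. b (x, \<xi>, \<eta>) * cis (x \<bullet> (\<xi> + \<eta>)) * fourier f \<xi> * fourier g \<eta>)"
proof (rule Bochner_Integration.integrable_bound)
  note [measurable] = f g
  show "integrable lborel (\<lambda>\<eta>. B * norm (fourier f \<xi>) * norm (fourier g \<eta>))" using G by simp
  have "norm (b (x, \<xi>, \<eta>) * cis (x \<bullet> (\<xi> + \<eta>)) * fourier f \<xi> * fourier g \<eta>) \<le> B * norm (fourier f \<xi>) * norm (fourier g \<eta>)" for \<eta>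
    using b[of "(x, \<xi>, \<eta>)"] by (simp add: norm_mult mult_right_mono)
  then show "AE \<eta> in lborel. norm (b (x, \<xi>, \<eta>) * cis (x \<bullet> (\<xi> + \<eta>)) * fourier f \<xi> * fourier g \<eta>) \<le> norm (B * norm (fourier f \<xi>) * norm (fourier g \<eta>))"
    by (intro AE_I2) (auto intro: order_trans[OF _ abs_ge_self])
  show "(\<lambda>\<eta>. b (x, \<xi>, \<eta>) * cis (x \<bullet> (\<xi> + \<eta>)) * fourier f \<xi> * fourier g \<eta>) \<in> borel_measurable lborel" by measurable
qed

lemma norm_symbol_slice_integral:
  assumes sm: "smooth_on_dirs alld b" and b: "\<And>z. norm (b z) \<le> B"
    and f: "f \<in> borel_measurable borel" and g: "g \<in> borel_measurable borel" and G: "integrable lborel (fourier g)"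
  shows "norm (LINT \<eta>|lborel. b (x, \<xi>, \<eta>) * cis (x \<bullet> (\<xi> + \<eta>)) * fourier f \<xi> * fourier g \<eta>)
    \<le> B * norm (fourier f \<xi>) * (LINT \<eta>|lborel. norm (fourier g \<eta>))"
proof -
  have "norm (LINT \<eta>|lborel. b (x, \<xi>, \<eta>) * cis (x \<bullet> (\<xi> + \<eta>)) * fourier f \<xi> * fourier g \<eta>)
    \<le> (LINT \<eta>|lborel. B * norm (fourier f \<xi>) * norm (fourier g \<eta>))"
  proof (rule Bochner_Integration.integral_norm_bound_integral)
    show "integrable lborel (\<lambda>\<eta>. b (x, \<xi>, \<eta>) * cis (x \<bullet> (\<xi> + \<eta>)) * fourier f \<xi> * fourier g \<eta>)"
      by (rule integrable_symbol_slice[OF sm b f g G])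
    show "integrable lborel (\<lambda>\<eta>. B * norm (fourier f \<xi>) * norm (fourier g \<eta>))" using G by simp
    show "norm (b (x, \<xi>, \<eta>) * cis (x \<bullet> (\<xi> + \<eta>)) * fourier f \<xi> * fourier g \<eta>) \<le> B * norm (fourier f \<xi>) * norm (fourier g \<eta>)" for \<eta>
      using b[of "(x, \<xi>, \<eta>)"] by (simp add: norm_mult mult_right_mono)
  qed
  then show ?thesis by simp
qed

lemma integrable_symbol_outer:
  assumes sm[measurable]: "smooth_on_dirs alld b" and b: "\<And>z. norm (b z) \<le> B"
    and f: "f \<in> borel_measurable borel" and g: "g \<in> borel_measurable borel"
    and F: "integrable lborel (fourier f)" and G: "integrable lborel (fourier g)"
  shows "integrable lborel (\<lambda>\<xi>. LINT \<eta>|lborel. b (x, \<xi>, \<eta>) * cis (x \<bullet> (\<xi> + \<eta>)) * fourier f \<xi> * fourier g \<eta>)"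
proof (rule Bochner_Integration.integrable_bound)
  note [measurable] = f g
  show "integrable lborel (\<lambda>\<xi>. B * norm (fourier f \<xi>) * (LINT \<eta>|lborel. norm (fourier g \<eta>)))" using F by simp
  show "AE \<xi> in lborel. norm (LINT \<eta>|lborel. b (x, \<xi>, \<eta>) * cis (x \<bullet> (\<xi> + \<eta>)) * fourier f \<xi> * fourier g \<eta>)
      \<le> norm (B * norm (fourier f \<xi>) * (LINT \<eta>|lborel. norm (fourier g \<eta>)))"
    by (intro AE_I2 order_trans[OF norm_symbol_slice_integral[OF sm b f g G]]) (simp only: real_norm_def abs_ge_self)
  show "(\<lambda>\<xi>. LINT \<eta>|lborel. b (x, \<xi>, \<eta>) * cis (x \<bullet> (\<xi> + \<eta>)) * fourier f \<xi> * fourier g \<eta>) \<in> borel_measurable lborel" by measurable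
qed

text \<open>A finite sum of symbols passes through both integrals by absolute convergence: the
  symbols are bounded and the two transforms integrable.\<close>

lemma bipsido_sum:
  fixes b :: "'i \<Rightarrow> 'n::finite triple \<Rightarrow> complex"
  assumes sm: "\<And>i. i \<in> I \<Longrightarrow> smooth_on_dirs alld (b i)" and b: "\<And>i z. i \<in> I \<Longrightarrow> norm (b i z) \<le> B"
    and f: "f \<in> borel_measurable borel" and g: "g \<in> borel_measurable borel"
    and F: "integrable lborel (fourier f)" and G: "integrable lborel (fourier g)"
  shows "bipsido (\<lambda>z. \<Sum>i\<in>I. b i z) f g x = (\<Sum>i\<in>I. bipsido (b i) f g x)"
proof -
  have "bipsido (\<lambda>z. \<Sum>i\<in>I. b i z) f g x = (LINT \<xi>|lborel. LINT \<eta>|lborel. (\<Sum>i\<in>I. b i (x, \<xi>, \<eta>) * cis (x \<bullet> (\<xi> + \<eta>)) * fourier f \<xi> * fourier g \<eta>))"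
    by (simp add: bipsido_def sum_distrib_right)
  also have "\<dots> = (LINT \<xi>|lborel. (\<Sum>i\<in>I. LINT \<eta>|lborel. b i (x, \<xi>, \<eta>) * cis (x \<bullet> (\<xi> + \<eta>)) * fourier f \<xi> * fourier g \<eta>))"
    by (intro Bochner_Integration.integral_cong refl Bochner_Integration.integral_sum integrable_symbol_slice[OF sm b f g G])
  also have "\<dots> = (\<Sum>i\<in>I. bipsido (b i) f g x)"
    unfolding bipsido_def by (intro Bochner_Integration.integral_sum integrable_symbol_outer[OF sm b f g F G])
  finally show ?thesis .
qed

text \<open>Dominated convergence, in the inner and then in the outer integral, from pointwise
  convergence of symbols under one uniform bound.\<close>

lemma bipsido_tendsto:
  fixes b :: "nat \<Rightarrow> 'n::finite triple \<Rightarrow> complex"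
  assumes sm[measurable]: "\<And>j. smooth_on_dirs alld (b j)" and b: "\<And>j z. norm (b j z) \<le> B"
    and sma[measurable]: "smooth_on_dirs alld a" and lim: "\<And>z. (\<lambda>j. b j z) \<longlonglongrightarrow> a z"
    and f[measurable]: "f \<in> borel_measurable borel" and g[measurable]: "g \<in> borel_measurable borel"
    and F: "integrable lborel (fourier f)" and G: "integrable lborel (fourier g)"
  shows "(\<lambda>j. bipsido (b j) f g x) \<longlonglongrightarrow> bipsido a f g x"
  unfolding bipsido_def
proof (rule integral_dominated_convergence)
  show "integrable lborel (\<lambda>\<xi>. B * norm (fourier f \<xi>) * (LINT \<eta>|lborel. norm (fourier g \<eta>)))" using F by simp
  show "AE \<xi> in lborel. norm (LINT \<eta>|lborel. b j (x, \<xi>, \<eta>) * cis (x \<bullet> (\<xi> + \<eta>)) * fourier f \<xi> * fourier g \<eta>)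
      \<le> B * norm (fourier f \<xi>) * (LINT \<eta>|lborel. norm (fourier g \<eta>))" for j
    by (intro AE_I2 norm_symbol_slice_integral[OF sm b f g G])
  show "AE \<xi> in lborel. (\<lambda>j. LINT \<eta>|lborel. b j (x, \<xi>, \<eta>) * cis (x \<bullet> (\<xi> + \<eta>)) * fourier f \<xi> * fourier g \<eta>)
      \<longlonglongrightarrow> (LINT \<eta>|lborel. a (x, \<xi>, \<eta>) * cis (x \<bullet> (\<xi> + \<eta>)) * fourier f \<xi> * fourier g \<eta>)"
  proof (rule AE_I2)
    fix \<xi>
    show "(\<lambda>j. LINT \<eta>|lborel. b j (x, \<xi>, \<eta>) * cis (x \<bullet> (\<xi> + \<eta>)) * fourier f \<xi> * fourier g \<eta>)
      \<longlonglongrightarrow> (LINT \<eta>|lborel. a (x, \<xi>, \<eta>) * cis (x \<bullet> (\<xi> + \<eta>)) * fourier f \<xi> * fourier g \<eta>)"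
    proof (rule integral_dominated_convergence)
      show "integrable lborel (\<lambda>\<eta>. B * norm (fourier f \<xi>) * norm (fourier g \<eta>))" using G by simp
      show "AE \<eta> in lborel. norm (b j (x, \<xi>, \<eta>) * cis (x \<bullet> (\<xi> + \<eta>)) * fourier f \<xi> * fourier g \<eta>) \<le> B * norm (fourier f \<xi>) * norm (fourier g \<eta>)" for j
        using b by (auto simp: norm_mult intro!: mult_right_mono)
      show "AE \<eta> in lborel. (\<lambda>j. b j (x, \<xi>, \<eta>) * cis (x \<bullet> (\<xi> + \<eta>)) * fourier f \<xi> * fourier g \<eta>)
        \<longlonglongrightarrow> a (x, \<xi>, \<eta>) * cis (x \<bullet> (\<xi> + \<eta>)) * fourier f \<xi> * fourier g \<eta>"
        by (intro AE_I2 tendsto_mult tendsto_const lim)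
    qed measurable
  qed
qed measurable

section \<open>Summing the dyadic pieces\<close>

text \<open>The piece is dilated to unit scale, estimated there and dilated back. The exponent
  \<open>e\<close> adds m from the amplitude, n/2 times the exponent of L and n H times that of
  N.\<close>

lemma piece_estimate:
  fixes q1 q2 :: ereal and a :: "'n::finite triple \<Rightarrow> complex" and H e :: real
  assumes q: "1 \<le> q1" "1 \<le> q2" and r: "r > 0" "1 / r = recip q1 + recip q2"
    and a: "bisymbol m \<rho> \<delta> a" and \<rho>: "0 < \<rho>" "\<rho> \<le> 1" and \<delta>: "0 < \<delta>"
    and H: "H = max (1/2) (1 - 1/r) + max 0 (recip q1 - 1/2) + max 0 (recip q2 - 1/2)"
    and e: "e = m + CARD('n) / 2 * max (\<delta> - \<rho>) 0 + (1 - \<rho>) * (CARD('n) * H)"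
  shows "\<exists>K\<ge>0. \<forall>j f g X Y. integrable lborel f \<longrightarrow> integrable lborel g \<longrightarrow>
    Lnorm q1 f = ennreal X \<longrightarrow> Lnorm q2 g = ennreal Y \<longrightarrow> X \<ge> 0 \<longrightarrow> Y \<ge> 0 \<longrightarrow>
    (\<integral>\<^sup>+x. ennreal (norm (bipsido (\<lambda>z. a z * Chi j z) f g x) powr r) \<partial>lborel)
      \<le> ennreal (K * ((2 powr e) ^ j * (X * Y)) powr r)"
proof -
  obtain M K where K: "K \<ge> 0" and est_all: "\<forall>(b :: 'n triple \<Rightarrow> complex) A L N f g X Y.
    usym M A L N b \<longrightarrow> L \<ge> 1 \<longrightarrow> N \<ge> 1 \<longrightarrow> integrable lborel f \<longrightarrow> integrable lborel g \<longrightarrow>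
    Lnorm q1 f = ennreal X \<longrightarrow> Lnorm q2 g = ennreal Y \<longrightarrow> X \<ge> 0 \<longrightarrow> Y \<ge> 0 \<longrightarrow>
    (\<integral>\<^sup>+x. ennreal (norm (bipsido b f g x) powr r) \<partial>lborel)
      \<le> ennreal (K * (A * L powr (CARD('n) / 2) * N powr (CARD('n) * H) * (X * Y)) powr r)"
    using unit_estimate[OF q r, where 'n='n] unfolding H[symmetric] by (elim exE conjE) (rule that)
  note est = est_all[rule_format]
  obtain C where C: "C \<ge> 0" and us: "\<And>j. usym M (C * (2 ^ j) powr m) ((2 ^ j) powr (max (\<delta> - \<rho>) 0)) (2 * (2 ^ j) powr (1 - \<rho>))
    (\<lambda>z. a (dil ((2 ^ j) powr (- \<rho>)) z) * Chi j (dil ((2 ^ j) powr (- \<rho>)) z))"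
    using usym_pieces[OF a \<rho> \<delta>, of M] by blast
  have sa: "smooth_on_dirs alld a" using a by (simp add: bisymbol_def alld_def)
  show ?thesis
  proof (rule exI[of _ "K * (C * 2 powr (CARD('n) * H)) powr r"], intro conjI allI impI)
    show "K * (C * 2 powr (CARD('n) * H)) powr r \<ge> 0" using K by simp
    fix j :: nat and f g :: "real^'n \<Rightarrow> complex" and X Y :: real
    assume fg: "integrable lborel f" "integrable lborel g" "Lnorm q1 f = ennreal X" "Lnorm q2 g = ennreal Y" and XY: "X \<ge> 0" "Y \<ge> 0"
    have fm[measurable]: "f \<in> borel_measurable borel" and gm[measurable]: "g \<in> borel_measurable borel" using fg(1,2) by auto
    define R :: real where "R = 2 ^ j"
    have R: "R \<ge> 1" by (simp add: R_def)
    define c where "c = R powr (- \<rho>)"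
    have c: "c > 0" using R by (simp add: c_def)
    let ?b = "\<lambda>z. a z * Chi j z"
    have sb: "smooth_on_dirs alld ?b" by (intro smooth_on_dirs_mult sa smooth_Chi)
    have ic: "integrable lborel (\<lambda>y. u (c *\<^sub>R y))" if u: "integrable lborel u" for u :: "real^'n \<Rightarrow> complex"
    proof -
      have [measurable]: "u \<in> borel_measurable borel" using u by simp
      have "ennreal (c ^ CARD('n)) * (\<integral>\<^sup>+x. ennreal (norm (u (c *\<^sub>R x))) \<partial>lborel) < \<infinity>"
        using u nn_integral_scale[of "\<lambda>x. ennreal (norm (u x))" c] c by (simp add: integrable_iff_bounded)
      then have "(\<integral>\<^sup>+x. ennreal (norm (u (c *\<^sub>R x))) \<partial>lborel) < \<infinity>"
        using c by (auto simp: ennreal_mult_less_top)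
      then show ?thesis by (simp add: integrable_iff_bounded)
    qed
    define u v where "u = recip q1" and "v = recip q2"
    define X' Y' where "X' = c powr (- CARD('n) * u) * X" and "Y' = c powr (- CARD('n) * v) * Y"
    have X'Y': "X' \<ge> 0" "Y' \<ge> 0" using XY by (auto simp: X'_def Y'_def)
    have N: "2 * R powr (1 - \<rho>) \<ge> 1" using ge_one_powr_ge_zero[of R "1 - \<rho>"] R \<rho> by simp
    have L: "R powr (max (\<delta> - \<rho>) 0) \<ge> 1" by (rule ge_one_powr_ge_zero) (use R in auto)
    define Q where "Q = C * R powr m * (R powr (max (\<delta> - \<rho>) 0)) powr (CARD('n) / 2) * (2 * R powr (1 - \<rho>)) powr (CARD('n) * H) * (X' * Y')"
    have "(\<integral>\<^sup>+x. ennreal (norm (bipsido ?b f g x) powr r) \<partial>lborel)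
      = ennreal (c ^ CARD('n)) * (\<integral>\<^sup>+x. ennreal (norm (bipsido ?b f g (c *\<^sub>R x)) powr r) \<partial>lborel)"
      using measurable_bipsido[OF sb fm gm] by (intro nn_integral_scale c) measurable
    also have "\<dots> = ennreal (c ^ CARD('n)) * (\<integral>\<^sup>+x. ennreal (norm (bipsido (\<lambda>z. ?b (dil c z)) (\<lambda>y. f (c *\<^sub>R y)) (\<lambda>y. g (c *\<^sub>R y)) x) powr r) \<partial>lborel)"
      by (simp only: bipsido_scale[OF sb fm gm c])
    also have "\<dots> \<le> ennreal (c ^ CARD('n)) * ennreal (K * Q powr r)"
      unfolding Q_def
    proof (intro mult_left_mono est)
      show "usym M (C * R powr m) (R powr max (\<delta> - \<rho>) 0) (2 * R powr (1 - \<rho>)) (\<lambda>z. ?b (dil c z))"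
        using us[of j] by (simp only: R_def c_def)
      show "Lnorm q1 (\<lambda>y. f (c *\<^sub>R y)) = ennreal X'" unfolding X'_def u_def by (rule Lnorm_scale[OF fm c q(1) fg(3) XY(1)])
      show "Lnorm q2 (\<lambda>y. g (c *\<^sub>R y)) = ennreal Y'" unfolding Y'_def v_def by (rule Lnorm_scale[OF gm c q(2) fg(4) XY(2)])
    qed (use ic fg N L X'Y' in auto)
    also have "\<dots> = ennreal (K * (C * 2 powr (CARD('n) * H)) powr r * ((2 powr e) ^ j * (X * Y)) powr r)"
    proof -
      \<comment> \<open>The relation between r, q1 and q2 enters here: the scaling factors of the
        two norms, raised to the power r, give c^(-n) and cancel the Jacobian c^n.\<close>
      have ruv: "r * (u + v) = 1" using r by (simp add: u_def v_def field_simps)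
      have Re: "(2 powr e) ^ j = R powr e" by (simp add: R_def powr_power powr_realpow[symmetric] powr_powr mult.commute)
      have "Q = (C * 2 powr (CARD('n) * H)) * (R powr e * (X * Y)) * c powr (- (CARD('n) * (u + v)))"
      proof -
        have "R powr e = R powr m * (R powr (max (\<delta> - \<rho>) 0)) powr (CARD('n) / 2) * (R powr (1 - \<rho>)) powr (CARD('n) * H)"
          by (simp add: e powr_add powr_powr mult_ac)
        moreover have "c powr (- (CARD('n) * (u + v))) = c powr (- CARD('n) * u) * c powr (- CARD('n) * v)"
          by (simp add: powr_add[symmetric] algebra_simps)
        ultimately show ?thesis by (simp add: Q_def X'_def Y'_def powr_mult mult_ac)
      qed
      then have "Q powr r = (C * 2 powr (CARD('n) * H)) powr r * (R powr e * (X * Y)) powr r * c powr (- (CARD('n) * (r * (u + v))))"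
        using C XY by (simp add: powr_mult powr_powr mult_ac)
      also have "\<dots> = (C * 2 powr (CARD('n) * H)) powr r * (R powr e * (X * Y)) powr r / c ^ CARD('n)"
        unfolding ruv using c by (simp add: powr_minus powr_realpow divide_inverse)
      finally have "c ^ CARD('n) * (K * Q powr r) = K * (C * 2 powr (CARD('n) * H)) powr r * (R powr e * (X * Y)) powr r"
        using c by simp
      then show ?thesis using c K unfolding Re by (simp add: ennreal_mult'[symmetric])
    qed
    finally show "(\<integral>\<^sup>+x. ennreal (norm (bipsido ?b f g x) powr r) \<partial>lborel)
      \<le> ennreal (K * (C * 2 powr (CARD('n) * H)) powr r * ((2 powr e) ^ j * (X * Y)) powr r)" .
  qed
qed

text \<open>Half of the decay 2^(je) pays for the weights \<beta>^j that replace the triangle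
  inequality; the other half leaves a geometric series of ratio \<gamma>. The bound is thus
  independent of \<open>J\<close>.\<close>

lemma partial_sum_estimate:
  fixes q1 q2 :: ereal and a :: "'n::finite triple \<Rightarrow> complex" and H e :: real
  assumes q: "1 \<le> q1" "1 \<le> q2" and r: "r > 0" "1 / r = recip q1 + recip q2"
    and a: "bisymbol m \<rho> \<delta> a" and \<rho>: "0 < \<rho>" "\<rho> \<le> 1" and \<delta>: "0 < \<delta>"
    and H: "H = max (1/2) (1 - 1/r) + max 0 (recip q1 - 1/2) + max 0 (recip q2 - 1/2)"
    and e: "e = m + CARD('n) / 2 * max (\<delta> - \<rho>) 0 + (1 - \<rho>) * (CARD('n) * H)" and e0: "e < 0"
  shows "\<exists>K\<ge>0. \<forall>J f g X Y. integrable lborel f \<longrightarrow> integrable lborel g \<longrightarrow>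
    Lnorm q1 f = ennreal X \<longrightarrow> Lnorm q2 g = ennreal Y \<longrightarrow> X \<ge> 0 \<longrightarrow> Y \<ge> 0 \<longrightarrow>
    (\<integral>\<^sup>+x. ennreal (norm (\<Sum>j\<le>J. bipsido (\<lambda>z. a z * Chi j z) f g x) powr r) \<partial>lborel) \<le> ennreal (K * (X * Y) powr r)"
proof -
  obtain K where K: "K \<ge> 0" and piece_all: "\<forall>j (f :: real^'n \<Rightarrow> complex) g X Y. integrable lborel f \<longrightarrow> integrable lborel g \<longrightarrow>
    Lnorm q1 f = ennreal X \<longrightarrow> Lnorm q2 g = ennreal Y \<longrightarrow> X \<ge> 0 \<longrightarrow> Y \<ge> 0 \<longrightarrow>
    (\<integral>\<^sup>+x. ennreal (norm (bipsido (\<lambda>z. a z * Chi j z) f g x) powr r) \<partial>lborel) \<le> ennreal (K * ((2 powr e) ^ j * (X * Y)) powr r)"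
    using piece_estimate[OF q r a \<rho> \<delta> H e] by (elim exE conjE) (rule that)
  note piece = piece_all[rule_format]
  define \<beta> where "\<beta> = 2 powr (- e / 2)"
  define \<gamma> where "\<gamma> = (2 powr (e / 2)) powr r"
  have \<beta>: "\<beta> > 1" using e0 by (simp add: \<beta>_def)
  have \<gamma>: "0 \<le> \<gamma>" "\<gamma> < 1" using e0 r powr_less_one[of 2 "e / 2 * r"] mult_neg_pos[of "e / 2" r]
    by (auto simp: \<gamma>_def powr_powr powr_less_one)
  have geo: "(\<Sum>j\<le>J. x ^ j) \<le> 1 / (1 - x)" if "0 \<le> x" "x < 1" for x :: real and J :: nat
  proof -
    have "(1 - x) * (\<Sum>j\<le>J. x ^ j) \<le> 1" using that sum_gp_basic[of x J] by simp
    then show ?thesis using that by (simp add: field_simps)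
  qed
  define S where "S = 1 / (1 - 1 / \<beta>)"
  have S0: "S \<ge> 0" using \<beta> by (simp add: S_def)
  have S: "(\<Sum>j\<le>J. 1 / \<beta> ^ j) \<le> S" for J
    using geo[of "1 / \<beta>" J] \<beta> by (simp add: S_def power_one_over)
  have sa: "smooth_on_dirs alld a" using a by (simp add: bisymbol_def alld_def)
  show ?thesis
  proof (rule exI[of _ "S powr r * (K * (1 / (1 - \<gamma>)))"], intro conjI allI impI)
    show "S powr r * (K * (1 / (1 - \<gamma>))) \<ge> 0" using K \<gamma> by simp
    fix J :: nat and f g :: "real^'n \<Rightarrow> complex" and X Y :: real
    assume fg: "integrable lborel f" "integrable lborel g" "Lnorm q1 f = ennreal X" "Lnorm q2 g = ennreal Y" and XY: "X \<ge> 0" "Y \<ge> 0"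
    have fm[measurable]: "f \<in> borel_measurable borel" and gm[measurable]: "g \<in> borel_measurable borel" using fg(1,2) by auto
    define T where "T = (\<lambda>j. bipsido (\<lambda>z. a z * Chi j z) f g)"
    have [measurable]: "T j \<in> borel_measurable borel" for j
      unfolding T_def by (intro measurable_bipsido smooth_on_dirs_mult sa smooth_Chi fm gm)
    have pw: "ennreal (norm (\<Sum>j\<le>J. T j x) powr r) \<le> ennreal (S powr r) * (\<Sum>j\<le>J. ennreal ((\<beta> ^ j) powr r) * ennreal (norm (T j x) powr r))" for x
    proof -
      have "norm (\<Sum>j\<le>J. T j x) powr r \<le> (\<Sum>j\<le>J. norm (T j x)) powr r"
        using r by (intro powr_mono2 norm_sum) auto
      also have "\<dots> \<le> S powr r * (\<Sum>j\<le>J. (\<beta> ^ j * norm (T j x)) powr r)"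
        using \<beta> r S by (intro weighted_sum_powr) auto
      also have "\<dots> = S powr r * (\<Sum>j\<le>J. (\<beta> ^ j) powr r * norm (T j x) powr r)"
        using \<beta> by (simp add: powr_mult)
      finally have "ennreal (norm (\<Sum>j\<le>J. T j x) powr r) \<le> ennreal (S powr r * (\<Sum>j\<le>J. (\<beta> ^ j) powr r * norm (T j x) powr r))"
        by (rule ennreal_leI)
      also have "\<dots> = ennreal (S powr r) * (\<Sum>j\<le>J. ennreal ((\<beta> ^ j) powr r) * ennreal (norm (T j x) powr r))"
        by (simp add: ennreal_mult sum_nonneg flip: sum_ennreal)
      finally show ?thesis .
    qed
    have "(\<integral>\<^sup>+x. ennreal (norm (\<Sum>j\<le>J. T j x) powr r) \<partial>lborel)
        \<le> (\<integral>\<^sup>+x. ennreal (S powr r) * (\<Sum>j\<le>J. ennreal ((\<beta> ^ j) powr r) * ennreal (norm (T j x) powr r)) \<partial>lborel)"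
      by (intro nn_integral_mono pw)
    also have "\<dots> = ennreal (S powr r) * (\<Sum>j\<le>J. ennreal ((\<beta> ^ j) powr r) * (\<integral>\<^sup>+x. ennreal (norm (T j x) powr r) \<partial>lborel))"
      by (simp add: nn_integral_cmult nn_integral_sum)
    also have "\<dots> \<le> ennreal (S powr r) * (\<Sum>j\<le>J. ennreal ((\<beta> ^ j) powr r) * ennreal (K * ((2 powr e) ^ j * (X * Y)) powr r))"
      unfolding T_def by (intro mult_left_mono sum_mono piece fg XY) auto
    also have "\<dots> = ennreal (S powr r * (\<Sum>j\<le>J. (\<beta> ^ j) powr r * (K * ((2 powr e) ^ j * (X * Y)) powr r)))"
      using K by (simp add: ennreal_mult sum_nonneg flip: sum_ennreal)
    also have "\<dots> \<le> ennreal (S powr r * (K * (1 / (1 - \<gamma>))) * (X * Y) powr r)"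
    proof (rule ennreal_leI)
      have "(\<beta> ^ j) powr r * (K * ((2 powr e) ^ j * (X * Y)) powr r) = K * (X * Y) powr r * \<gamma> ^ j" for j
      proof -
        have "\<beta> * 2 powr e = 2 powr (e / 2)" by (simp add: \<beta>_def flip: powr_add)
        then have "\<beta> ^ j * (2 powr e) ^ j = (2 powr (e / 2)) ^ j" by (simp flip: power_mult_distrib)
        moreover have "((2 powr (e / 2)) ^ j) powr r = \<gamma> ^ j"
          by (simp add: \<gamma>_def powr_power powr_powr mult_ac)
        ultimately have "(\<beta> ^ j) powr r * ((2 powr e) ^ j) powr r = \<gamma> ^ j"
          using \<beta> by (simp flip: powr_mult)
        moreover have "((2 powr e) ^ j * (X * Y)) powr r = ((2 powr e) ^ j) powr r * (X * Y) powr r"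
          using XY by (intro powr_mult)
        ultimately show ?thesis by (simp add: mult_ac)
      qed
      then have "S powr r * (\<Sum>j\<le>J. (\<beta> ^ j) powr r * (K * ((2 powr e) ^ j * (X * Y)) powr r)) = S powr r * (K * (X * Y) powr r * (\<Sum>j\<le>J. \<gamma> ^ j))"
        by (simp only: sum_distrib_left)
      also have "\<dots> \<le> S powr r * (K * (X * Y) powr r * (1 / (1 - \<gamma>)))"
        using K \<gamma> by (intro mult_left_mono geo) auto
      finally show "S powr r * (\<Sum>j\<le>J. (\<beta> ^ j) powr r * (K * ((2 powr e) ^ j * (X * Y)) powr r)) \<le> S powr r * (K * (1 / (1 - \<gamma>))) * (X * Y) powr r"
        by (simp add: mult_ac)
    qed
    finally show "(\<integral>\<^sup>+x. ennreal (norm (\<Sum>j\<le>J. bipsido (\<lambda>z. a z * Chi j z) f g x) powr r) \<partial>lborel) \<le> ennreal (S powr r * (K * (1 / (1 - \<gamma>))) * (X * Y) powr r)"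
      unfolding T_def .
  qed
qed

section \<open>Passage to the full symbol and comparison of exponents\<close>

lemma Psi_tendsto_1: "(\<lambda>j. Psi j z) \<longlonglongrightarrow> 1"
proof (rule tendsto_eventually)
  obtain x \<xi> \<eta> where z: "z = (x, \<xi>, \<eta>)" by (cases z)
  obtain k where k: "norm \<xi> + norm \<eta> < 2 ^ k" using real_arch_pow[of 2 "norm \<xi> + norm \<eta>"] by auto
  show "\<forall>\<^sub>F j in sequentially. Psi j z = 1"
  proof (rule eventually_sequentiallyI)
    fix j assume "k \<le> j"
    then have "(2::real) ^ k \<le> 2 ^ j" by simp
    then have *: "norm \<xi> \<le> 2 ^ j" "norm \<eta> \<le> 2 ^ j" using k norm_ge_zero[of \<xi>] norm_ge_zero[of \<eta>] by linarith+
    show "Psi j z = 1" unfolding z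
      by (rule Psi_1; unfold fbox_def; intro CollectI allI order_trans[OF component_le_norm_cart] *)
  qed
qed

text \<open>The estimate without derivatives, where a nonpositive power of a number at least 1 is at
  most 1. The bound feeds the dominated convergence of the partial sums.\<close>

lemma bisymbol_bounded:
  fixes a :: "'n::finite triple \<Rightarrow> complex"
  assumes a: "bisymbol m \<rho> \<delta> a" and m: "m \<le> 0"
  shows "\<exists>B. \<forall>z. norm (a z) \<le> B"
proof -
  have "\<exists>C. \<forall>x \<xi> \<eta>. norm (a (x, \<xi>, \<eta>)) \<le> C * (1 + norm \<xi> + norm \<eta>) powr m"
    using a[unfolded bisymbol_def, THEN conjunct2, rule_format, of "[]"] by simp
  then obtain C where C: "\<And>x \<xi> \<eta>. norm (a (x, \<xi>, \<eta>)) \<le> C * (1 + norm \<xi> + norm \<eta>) powr m" by blast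
  have "norm (a z) \<le> \<bar>C\<bar>" for z
  proof -
    obtain x \<xi> \<eta> where z: "z = (x, \<xi>, \<eta>)" by (cases z)
    have "(1 + norm \<xi> + norm \<eta>) powr m \<le> (1 + norm \<xi> + norm \<eta>) powr 0" using m by (intro powr_mono) auto
    also have "\<dots> = 1"
    proof -
      have "1 + norm \<xi> + norm \<eta> > 0" using norm_ge_zero[of \<xi>] norm_ge_zero[of \<eta>] by linarith
      then show ?thesis by simp
    qed
    finally have "\<bar>C\<bar> * (1 + norm \<xi> + norm \<eta>) powr m \<le> \<bar>C\<bar> * 1" by (intro mult_left_mono) auto
    moreover have "norm (a z) \<le> \<bar>C\<bar> * (1 + norm \<xi> + norm \<eta>) powr m"
      unfolding z by (rule order_trans[OF C]) (intro mult_right_mono, auto)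
    ultimately show ?thesis by simp
  qed
  then show ?thesis by blast
qed

text \<open>Let u and v be the two reciprocals and w = 1 / min(2, q1, q2). Then w \<ge> 1/2 and u
  and v lie between 0 and w, which turns the claim into a piecewise linear inequality in u, v,
  w.\<close>

lemma exponent_comparison:
  fixes q1 q2 :: ereal
  assumes q: "1 \<le> q1" "1 \<le> q2" and s: "s = recip q1 + recip q2"
  shows "max (1/2) (1 - s) + max 0 (recip q1 - 1/2) + max 0 (recip q2 - 1/2)
    \<le> max \<bar>1/2 - recip q1\<bar> \<bar>1/2 - recip q2\<bar> + 1 / real_of_ereal (min 2 (min q1 q2))"
proof -
  define t where "t = real_of_ereal (min 2 (min q1 q2))"
  have fin: "ereal t = min 2 (min q1 q2)"
    using q unfolding t_def by (cases q1; cases q2) (auto simp: min_def)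
  have "1 \<le> ereal t" "ereal t \<le> 2" "ereal t \<le> q1" "ereal t \<le> q2" unfolding fin using q by (auto simp: min_def)
  then have t: "1 \<le> t" "t \<le> 2" and tq: "ereal t \<le> q1" "ereal t \<le> q2" by auto
  have rec: "0 \<le> recip p \<and> recip p \<le> 1 / t" if "ereal t \<le> p" for p
    using that t by (cases p) (auto simp: recip_def frac_le)
  have "1 / 2 \<le> 1 / t" using t by (simp add: field_simps)
  moreover have "max (1/2) (1 - (u + v)) + max 0 (u - 1/2) + max 0 (v - 1/2) \<le> max \<bar>1/2 - u\<bar> \<bar>1/2 - v\<bar> + w"
    if "1/2 \<le> w" "0 \<le> u" "u \<le> w" "0 \<le> v" "v \<le> w" for u v w :: real
    using that by (auto simp: max_def abs_if)
  ultimately show ?thesis using rec[OF tq(1)] rec[OF tq(2)] unfolding s t_def[symmetric] by blast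
qed

theorem theorem5p18:
  fixes q1 q2 :: ereal and r m \<rho> \<delta> :: real
    and a :: "'n::finite triple \<Rightarrow> complex"
  assumes "1 \<le> q1" "q1 \<le> \<infinity>" "1 \<le> q2" "q2 \<le> \<infinity>"
    and "0 < r" and "1 / r = recip q1 + recip q2"
    and "bisymbol m \<rho> \<delta> a"
    and "0 < \<rho>" "\<rho> \<le> 1" "0 < \<delta>" "\<delta> < 1"
    and "m < real CARD('n) * (\<rho> - 1) *
               (max \<bar>1/2 - recip q1\<bar> \<bar>1/2 - recip q2\<bar>
                + 1 / real_of_ereal (min 2 (min q1 q2)))
             + real CARD('n) * min (\<rho> - \<delta>) 0 / 2"
  shows "\<exists>C. \<forall>f g. schwartz f \<longrightarrow> schwartz g \<longrightarrow>
           Lnorm (ereal r) (bipsido a f g) \<le> ennreal C * Lnorm q1 f * Lnorm q2 g"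
proof -
  note q = assms(1,3) and r = assms(5,6) and a = assms(7) and \<rho> = assms(8,9) and \<delta> = assms(10)
  define n where "n = real CARD('n)"
  define F where "F = max \<bar>1/2 - recip q1\<bar> \<bar>1/2 - recip q2\<bar> + 1 / real_of_ereal (min 2 (min q1 q2))"
  define H where "H = max (1/2) (1 - 1/r) + max 0 (recip q1 - 1/2) + max 0 (recip q2 - 1/2)"
  define e where "e = m + CARD('n) / 2 * max (\<delta> - \<rho>) 0 + (1 - \<rho>) * (CARD('n) * H)"
  have HF: "H \<le> F" unfolding H_def F_def by (rule exponent_comparison[OF q r(2)])
  have H0: "0 \<le> H" unfolding H_def by simp
  have m: "m < n * (\<rho> - 1) * F + n * min (\<rho> - \<delta>) 0 / 2" using assms(12) by (simp add: n_def F_def)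
  have n: "n \<ge> 0" by (simp add: n_def)
  \<comment> \<open>The hypothesis contains the minimum, the exponent of L the maximum; with this
    identity and H \<le> F the assumption on m gives e < 0.\<close>
  have mm: "min (\<rho> - \<delta>) 0 = - max (\<delta> - \<rho>) 0" by (simp add: min_def max_def)
  have "(1 - \<rho>) * (n * H) \<le> (1 - \<rho>) * (n * F)" using HF \<rho> n by (intro mult_left_mono) auto
  then have e0: "e < 0" using m unfolding e_def n_def[symmetric] mm by (simp add: algebra_simps)
  \<comment> \<open>Both terms bounding m are nonpositive, so m \<le> 0 and the symbol is bounded;
    the limit of the partial sums relies on this.\<close>
  have "0 \<le> (1 - \<rho>) * (n * F)" "0 \<le> n * max (\<delta> - \<rho>) 0" using HF H0 \<rho> n by auto
  then have m0: "m \<le> 0" using m unfolding mm by (simp add: algebra_simps)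
  obtain B where B: "\<And>z. norm (a z) \<le> B" using bisymbol_bounded[OF a m0] by blast
  have B0: "B \<ge> 0" using order_trans[OF norm_ge_zero B] .
  have sa: "smooth_on_dirs alld a" using a by (simp add: bisymbol_def alld_def)
  obtain K where K: "K \<ge> 0" and part_all: "\<forall>J (f :: real^'n \<Rightarrow> complex) g X Y. integrable lborel f \<longrightarrow> integrable lborel g \<longrightarrow>
    Lnorm q1 f = ennreal X \<longrightarrow> Lnorm q2 g = ennreal Y \<longrightarrow> X \<ge> 0 \<longrightarrow> Y \<ge> 0 \<longrightarrow>
    (\<integral>\<^sup>+x. ennreal (norm (\<Sum>j\<le>J. bipsido (\<lambda>z. a z * Chi j z) f g x) powr r) \<partial>lborel) \<le> ennreal (K * (X * Y) powr r)"
    using partial_sum_estimate[OF q r a \<rho> \<delta> H_def e_def e0] by (elim exE conjE) (rule that)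
  note part = part_all[rule_format]
  show ?thesis
  proof (intro exI[of _ "K powr (1 / r)"] allI impI)
    fix f g :: "real^'n \<Rightarrow> complex"
    assume f: "schwartz f" and g: "schwartz g"
    obtain X where X: "X \<ge> 0" "Lnorm q1 f = ennreal X" using schwartz_Lnorm[OF f q(1)] by blast
    obtain Y where Y: "Y \<ge> 0" "Lnorm q2 g = ennreal Y" using schwartz_Lnorm[OF g q(2)] by blast
    note fm = schwartz_measurable[OF f] and gm = schwartz_measurable[OF g]
    note fF = schwartz_fourier_integrable[OF f] and gF = schwartz_fourier_integrable[OF g]
    have sC: "smooth_on_dirs alld (\<lambda>z. a z * Chi j z)" for j by (intro smooth_on_dirs_mult sa smooth_Chi)
    have bC: "norm (a z * Chi j z) \<le> B * 2" for j z
    proof -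
      have "norm (Chi j z) \<le> 2"
        using norm_Psi_le[of j z] norm_Psi_le[of "j - 1" z] norm_triangle_ineq4[of "Psi j z" "Psi (j - 1) z"]
        by (cases j) (auto simp: Chi_def)
      then show ?thesis unfolding norm_mult by (intro mult_mono B B0) auto
    qed
    define T where "T = (\<lambda>J x. \<Sum>j\<le>J. bipsido (\<lambda>z. a z * Chi j z) f g x)"
    have [measurable]: "T J \<in> borel_measurable borel" for J
      unfolding T_def using measurable_bipsido[OF sC fm gm] by measurable
    \<comment> \<open>By telescoping, the partial sums are the operators with the symbols
      \<open>a\<close> times \<open>Psi J\<close>.\<close>
    have T: "T J x = bipsido (\<lambda>z. a z * Psi J z) f g x" for J x
      unfolding T_def by (simp add: bipsido_sum[OF sC bC fm gm fF gF, symmetric] sum_Chi flip: sum_distrib_left)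
    have sP: "smooth_on_dirs alld (\<lambda>z. a z * Psi J z)" for J
      using dbd_Psi[where 'n='n] by (intro smooth_on_dirs_mult sa) (simp add: dbd_def)
    have bP: "norm (a z * Psi J z) \<le> B" for J z
      using mult_mono[OF B norm_Psi_le B0 norm_ge_zero, of z J z] by (simp add: norm_mult)
    have lim: "(\<lambda>J. T J x) \<longlonglongrightarrow> bipsido a f g x" for x
      unfolding T
    proof (rule bipsido_tendsto[OF sP bP sa _ fm gm fF gF])
      show "(\<lambda>J. a z * Psi J z) \<longlonglongrightarrow> a z" for z
        using tendsto_mult[OF tendsto_const Psi_tendsto_1, of "a z" z] by simp
    qed
    \<comment> \<open>The partial sums converge pointwise with a bound uniform in \<open>J\<close>,
      so Fatou's lemma gives the estimate for every r > 0.\<close>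
    have "(\<integral>\<^sup>+x. ennreal (norm (bipsido a f g x) powr r) \<partial>lborel) = (\<integral>\<^sup>+x. liminf (\<lambda>J. ennreal (norm (T J x) powr r)) \<partial>lborel)"
    proof (rule nn_integral_cong)
      fix x
      have "(\<lambda>J. ennreal (norm (T J x) powr r)) \<longlonglongrightarrow> ennreal (norm (bipsido a f g x) powr r)"
        using r by (intro tendsto_ennrealI tendsto_powr' tendsto_norm lim tendsto_const) auto
      then show "ennreal (norm (bipsido a f g x) powr r) = liminf (\<lambda>J. ennreal (norm (T J x) powr r))"
        by (intro lim_imp_Liminf[symmetric]) auto
    qed
    also have "\<dots> \<le> liminf (\<lambda>J. \<integral>\<^sup>+x. ennreal (norm (T J x) powr r) \<partial>lborel)"
      by (intro nn_integral_liminf) measurable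
    also have "\<dots> \<le> liminf (\<lambda>J::nat. ennreal (K * (X * Y) powr r))"
      unfolding T_def by (intro Liminf_mono always_eventually allI part schwartz_integrable f g X Y)
    also have "\<dots> = ennreal (K * (X * Y) powr r)" by (simp add: Liminf_const)
    finally have est: "(\<integral>\<^sup>+x. ennreal (norm (bipsido a f g x) powr r) \<partial>lborel) \<le> ennreal (K * (X * Y) powr r)" .
    define I where "I = (\<integral>\<^sup>+x. ennreal (norm (bipsido a f g x) powr r) \<partial>lborel)"
    have I: "I \<noteq> \<infinity>" "enn2real I \<le> K * (X * Y) powr r"
      using est K enn2real_mono[OF est] unfolding I_def by (auto simp: top_unique)
    have "Lnorm (ereal r) (bipsido a f g) = ennreal (enn2real I powr (1 / r))"
      using I(1) by (simp add: Lnorm_def I_def Let_def)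
    also have "\<dots> \<le> ennreal ((K * (X * Y) powr r) powr (1 / r))"
      using r(1) I(2) by (intro ennreal_leI powr_mono2) auto
    also have "(K * (X * Y) powr r) powr (1 / r) = K powr (1 / r) * (X * Y)"
      using K X Y r(1) by (simp add: powr_mult powr_powr)
    also have "ennreal \<dots> = ennreal (K powr (1 / r)) * Lnorm q1 f * Lnorm q2 g"
      using X Y by (simp add: ennreal_mult mult.assoc)
    finally show "Lnorm (ereal r) (bipsido a f g) \<le> ennreal (K powr (1 / r)) * Lnorm q1 f * Lnorm q2 g" .
  qed
qed

end
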